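(* Let $n$ be a positive integer and let $S_1, S_2, \dots, S_m \subseteq \{1,\dots,n\}$ with $m \le \operatorname{poly}(n)$. Let $p \in [0,1]$ and $\varepsilon \in [1/\operatorname{poly}(\log n), 1]$ be given parameters such that for every $i \in \{1,\dots,m\}$ we have $|S_i| \ge \Omega\!\left(\frac{\log n}{p\varepsilon^2}\right)$. (Randomly including each element of $\{1,\dots,n\}$ in a set $T$ independently with probability $p$ would give, with high probability, a set $T$ such that $|S_i \cap T| \in [(1-\varepsilon)p|S_i|, (1+\varepsilon)p|S_i|]$ for every $i$.) Then there is a deterministic parallel algorithm that computes a set $T \subseteq \{1,\dots,n\}$ such that for every $i \in \{1,\dots,m\}$, \[ (1-\varepsilon)\, p\, |S_i| \;\le\; |S_i \cap T| \;\le\; (1+\varepsilon)\, p\, |S_i|, \] using depth $\operatorname{poly}(\log n)$ and work $\tilde{O}\big(\sum_{i=1}^m |S_i| + n\big)$.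
   Context: Parallel algorithms are measured in the work/depth (PRAM) model: the work of an algorithm is the total number of operations it performs, and its depth is the length of the longest chain of operations in which each operation depends on the result of the previous one. The notation $\tilde{O}(\cdot)$ hides factors polylogarithmic in $n$. The phrases "$m \le \operatorname{poly}(n)$", "$\varepsilon \ge 1/\operatorname{poly}(\log n)$" mean bounded by a fixed polynomial in $n$ (resp. at least the inverse of a fixed polynomial in $\log n$), and $\Omega(\cdot)$ in the hypothesis on $|S_i|$ hides a sufficiently large absolute constant; the constants in the work and depth bounds may depend on these fixed polynomials.
   Formalization: The constant in Ω(log n/(pε²)) may depend on the polynomial bounding m (an absolute one makes the claim false); log n is read as max(1, log₂ n), since at n=1 the size condition would be void and the claim false; the parenthetical remark on random sampling is not included. *)

theory Defs
  imports Complex_Main "HOL-Computational_Algebra.Polynomial"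
begin

text \<open>
  A work/depth model in the PRAM style: a structured language with fork-join parallel loops over
  a shared memory.  Memory cells and thread-local variables hold integer words; the word bound
  \<open>B\<close> is a parameter of the semantics, and a computation that produces a word of absolute
  value above \<open>B\<close> has no execution.  Division by zero yields 0 as usual in HOL.
\<close>

datatype binop = Add | Sub | Mult | Div | Mod | Less | Eq

datatype aexp =
    Const int
  | Var string
  | Read string aexp  \<comment> \<open>\<open>Read a e\<close> is the cell with index \<open>e\<close> of the array named \<open>a\<close>\<close>
  | Op binop aexp aexp

datatype com =
    Skip
  | Assign string aexp
  | Store string aexp aexp  \<comment> \<open>array, index, value\<close>
  | Seq com com
  | If aexp com com
  | While aexp com
  | ParFor string aexp com  \<comment> \<open>\<open>ParFor x e c\<close> runs \<open>c\<close> for \<open>x = 0, \<dots>, e - 1\<close> in parallel\<close>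

type_synonym addr = "string \<times> int"
type_synonym locals = "string \<Rightarrow> int"
type_synonym memory = "addr \<Rightarrow> int"

primrec binop_val :: "binop \<Rightarrow> int \<Rightarrow> int \<Rightarrow> int" where
  "binop_val Add x y = x + y"
| "binop_val Sub x y = x - y"
| "binop_val Mult x y = x * y"
| "binop_val Div x y = x div y"
| "binop_val Mod x y = x mod y"
| "binop_val Less x y = (if x < y then 1 else 0)"
| "binop_val Eq x y = (if x = y then 1 else 0)"

primrec aval :: "aexp \<Rightarrow> locals \<Rightarrow> memory \<Rightarrow> int" where
  "aval (Const c) l M = c"
| "aval (Var x) l M = l x"
| "aval (Read a e) l M = M (a, aval e l M)"
| "aval (Op f e1 e2) l M = binop_val f (aval e1 l M) (aval e2 l M)"

text \<open>Every value arising in the evaluation is a word.\<close>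

primrec fits :: "int \<Rightarrow> aexp \<Rightarrow> locals \<Rightarrow> memory \<Rightarrow> bool" where
  "fits B (Const c) l M \<longleftrightarrow> \<bar>c\<bar> \<le> B"
| "fits B (Var x) l M \<longleftrightarrow> \<bar>l x\<bar> \<le> B"
| "fits B (Read a e) l M \<longleftrightarrow> fits B e l M \<and> \<bar>aval (Read a e) l M\<bar> \<le> B"
| "fits B (Op f e1 e2) l M \<longleftrightarrow>
     fits B e1 l M \<and> fits B e2 l M \<and> \<bar>aval (Op f e1 e2) l M\<bar> \<le> B"

primrec reads :: "aexp \<Rightarrow> locals \<Rightarrow> memory \<Rightarrow> addr set" where
  "reads (Const c) l M = {}"
| "reads (Var x) l M = {}"
| "reads (Read a e) l M = insert (a, aval e l M) (reads e l M)"
| "reads (Op f e1 e2) l M = reads e1 l M \<union> reads e2 l M"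

primrec cost :: "aexp \<Rightarrow> nat" where
  "cost (Const c) = 1"
| "cost (Var x) = 1"
| "cost (Read a e) = 1 + cost e"
| "cost (Op f e1 e2) = 1 + cost e1 + cost e2"

text \<open>
  \<open>exec B c l M l' M' R W w d\<close>: started with local variables \<open>l\<close> and memory \<open>M\<close>, the program
  \<open>c\<close> terminates with \<open>l'\<close> and \<open>M'\<close>, having read the cells \<open>R\<close> and written the cells \<open>W\<close>,
  using work \<open>w\<close> and depth \<open>d\<close>.  All operations of one thread, including those within an
  expression, are taken to depend on each other, so that depths add up everywhere except across
  the iterations of a parallel loop.

  Each iteration of a parallel loop runs on its own copy of the local variables, which is
  discarded at the end.  Concurrent reads are allowed, but a cell written by one iteration must
  not be accessed by another one (otherwise there is no execution); hence the result does not
  depend on how the iterations are scheduled.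
\<close>

inductive exec :: "int \<Rightarrow> com \<Rightarrow> locals \<Rightarrow> memory \<Rightarrow> locals \<Rightarrow> memory
    \<Rightarrow> addr set \<Rightarrow> addr set \<Rightarrow> nat \<Rightarrow> nat \<Rightarrow> bool" for B :: int where
  Skip: "exec B Skip l M l M {} {} 1 1"
| Assign: "fits B e l M \<Longrightarrow>
    exec B (Assign x e) l M (l(x := aval e l M)) M (reads e l M) {} (1 + cost e) (1 + cost e)"
| Store: "fits B e1 l M \<Longrightarrow> fits B e2 l M \<Longrightarrow>
    exec B (Store a e1 e2) l M l (M((a, aval e1 l M) := aval e2 l M))
      (reads e1 l M \<union> reads e2 l M) {(a, aval e1 l M)}
      (1 + cost e1 + cost e2) (1 + cost e1 + cost e2)"
| Seq: "exec B c1 l M l1 M1 R1 W1 w1 d1 \<Longrightarrow> exec B c2 l1 M1 l2 M2 R2 W2 w2 d2 \<Longrightarrow>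
    exec B (Seq c1 c2) l M l2 M2 (R1 \<union> R2) (W1 \<union> W2) (w1 + w2) (d1 + d2)"
| If: "fits B e l M \<Longrightarrow>
    exec B (if aval e l M \<noteq> 0 then c1 else c2) l M l' M' R W w d \<Longrightarrow>
    exec B (If e c1 c2) l M l' M' (reads e l M \<union> R) W (1 + cost e + w) (1 + cost e + d)"
| WhileFalse: "fits B e l M \<Longrightarrow> aval e l M = 0 \<Longrightarrow>
    exec B (While e c) l M l M (reads e l M) {} (1 + cost e) (1 + cost e)"
| WhileTrue: "fits B e l M \<Longrightarrow> aval e l M \<noteq> 0 \<Longrightarrow>
    exec B c l M l1 M1 R1 W1 w1 d1 \<Longrightarrow> exec B (While e c) l1 M1 l2 M2 R2 W2 w2 d2 \<Longrightarrow>
    exec B (While e c) l M l2 M2 (reads e l M \<union> R1 \<union> R2) (W1 \<union> W2)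
      (1 + cost e + w1 + w2) (1 + cost e + d1 + d2)"
| ParFor: "fits B e l M \<Longrightarrow> k = nat (aval e l M) \<Longrightarrow>
    (\<And>i. i < k \<Longrightarrow> exec B c (l(x := int i)) M (ls i) (Ms i) (Rs i) (Ws i) (ws i) (ds i)) \<Longrightarrow>
    (\<And>i j. i < k \<Longrightarrow> j < k \<Longrightarrow> i \<noteq> j \<Longrightarrow> Ws i \<inter> (Rs j \<union> Ws j) = {}) \<Longrightarrow>
    (\<And>i a. i < k \<Longrightarrow> a \<in> Ws i \<Longrightarrow> M' a = Ms i a) \<Longrightarrow>
    (\<And>a. a \<notin> (\<Union>i<k. Ws i) \<Longrightarrow> M' a = M a) \<Longrightarrow>
    exec B (ParFor x e c) l M l M' (reads e l M \<union> (\<Union>i<k. Rs i)) (\<Union>i<k. Ws i)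
      (1 + cost e + (\<Sum>i<k. 1 + ws i)) (1 + cost e + Max (insert 0 ((\<lambda>i. 1 + ds i) ` {..<k})))"

lemma exec_deterministic:
  assumes "exec B c l M l1 M1 R1 W1 w1 d1" and "exec B c l M l2 M2 R2 W2 w2 d2"
  shows "l1 = l2 \<and> M1 = M2 \<and> R1 = R2 \<and> W1 = W2 \<and> w1 = w2 \<and> d1 = d2"
  using assms
proof (induction arbitrary: l2 M2 R2 W2 w2 d2)
  case (ParFor e l M k c x ls Ms Rs Ws ws ds M')
  from ParFor.prems show ?case
  proof cases
    case (ParFor k' ls' Ms' Rs' Ws' ws' ds')
    note P = this
    have k: "k' = k" using P ParFor.hyps by simp
    have eq: "ls i = ls' i \<and> Ms i = Ms' i \<and> Rs i = Rs' i \<and> Ws i = Ws' i \<and> ws i = ws' i \<and> ds i = ds' i"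
      if "i < k" for i
      using ParFor.IH[OF that, of "ls' i" "Ms' i" "Rs' i" "Ws' i" "ws' i" "ds' i"] P(8)[of i] that k by blast
    have U: "(\<Union>i<k. Ws i) = (\<Union>i<k. Ws' i)" "(\<Union>i<k. Rs i) = (\<Union>i<k. Rs' i)"
      "(\<Sum>i<k. 1 + ws i) = (\<Sum>i<k. 1 + ws' i)" "(\<lambda>i. 1 + ds i) ` {..<k} = (\<lambda>i. 1 + ds' i) ` {..<k}"
      using eq by (auto intro!: sum.cong image_cong)
    have "M' = M2"
    proof
      fix a
      show "M' a = M2 a"
      proof (cases "\<exists>i<k. a \<in> Ws i")
        case True
        then obtain i where "i < k" "a \<in> Ws i" by blast
        then show ?thesis using ParFor.hyps(5)[of i a] P(10)[of i a] eq[of i] k by simp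
      next
        case False
        then have "a \<notin> (\<Union>i<k. Ws i)" by blast
        then show ?thesis using ParFor.hyps(6)[of a] P(11)[of a] U(1) k by simp
      qed
    qed
    then show ?thesis using P k U by simp
  qed
next
  case (Skip l M)
  then show ?case by cases auto
next
  case (Assign e l M x)
  from Assign.prems show ?case by cases auto
next
  case (Store e1 l M e2 a)
  from Store.prems show ?case by cases auto
next
  case (Seq c1 l M l1 M1 R1 W1 w1 d1 c2 l2 M2 R2 W2 w2 d2)
  from Seq.prems show ?case by cases (use Seq.IH in blast)
next
  case (If e l M c1 c2 l' M' R W w d)
  from If.prems show ?case by cases (use If.IH in blast)
next
  case (WhileFalse e l M c)
  from WhileFalse.prems show ?case by cases (use WhileFalse.hyps in auto)
next
  case (WhileTrue e l M c l1 M1 R1 W1 w1 d1 l2 M2 R2 W2 w2 d2)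
  from WhileTrue.prems show ?case by cases (use WhileTrue.hyps WhileTrue.IH in blast)+
qed

text \<open>The base-2 logarithm, except that it is 1 instead of 0 at \<open>n = 1\<close>.\<close>

definition Log :: "nat \<Rightarrow> real" where
  "Log n = max 1 (log 2 (real n))"

text \<open>
  The family is given by lists of the elements of its members, in any order: their
  concatenation is in the array \<open>elem\<close>, and the \<open>i\<close>th member (counting from 0) occupies the
  positions from \<open>start[i]\<close> to \<open>start[i+1] - 1\<close>.  All other cells are initially 0.
\<close>

definition lists_family :: "nat list list \<Rightarrow> nat \<Rightarrow> (nat \<Rightarrow> nat set) \<Rightarrow> bool" where
  "lists_family xss m S \<longleftrightarrow> length xss = m \<and>
     (\<forall>i\<in>{1..m}. distinct (xss ! (i - 1)) \<and> set (xss ! (i - 1)) = S i)"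

definition input_memory :: "nat list list \<Rightarrow> memory" where
  "input_memory xss = (\<lambda>(a, k).
     if a = ''start'' \<and> 0 \<le> k \<and> k \<le> int (length xss) then
       int (length (concat (take (nat k) xss)))
     else if a = ''elem'' \<and> 0 \<le> k \<and> k < int (length (concat xss)) then
       int (concat xss ! nat k)
     else 0)"

text \<open>
  The real parameters are given in fixed-point representation, rounded down to a multiple of
  \<open>1 / (n + 1) ^ prec\<close>, that is, to \<open>O(log n)\<close> bits.
\<close>

definition input_locals :: "nat \<Rightarrow> nat \<Rightarrow> nat \<Rightarrow> real \<Rightarrow> real \<Rightarrow> locals" where
  "input_locals prec n m p \<epsilon> = (\<lambda>_. 0)(
     ''n'' := int n,
     ''m'' := int m,
     ''p'' := \<lfloor>p * (real n + 1) ^ prec\<rfloor>,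
     ''eps'' := \<lfloor>\<epsilon> * (real n + 1) ^ prec\<rfloor>)"

definition output_set :: "nat \<Rightarrow> memory \<Rightarrow> nat set" where
  "output_set n M = {j \<in> {1..n}. M (''T'', int j) = 1}"

end

theory Submission
  imports Defs
begin

text \<open>
  Every element \<open>j\<close> carries a fractional value \<open>x j\<close>, initially \<open>p\<close>.  In each round all values in the
  open interval \<open>(0, 1)\<close> move by \<open>\<sigma> j * \<delta> j\<close>, where \<open>\<sigma> j\<close> is a sign and the step \<open>\<delta> j\<close> is, up to
  constant factors, \<open>x j\<close> times \<open>\<epsilon> / log n\<close>; when every value is \<open>0\<close> or \<open>1\<close>, the set \<open>T\<close> is read off.

  For \<open>\<lambda>\<close> of order \<open>log n / (\<epsilon> p |S i|)\<close> put \<open>X = (\<Sum>j\<in>S i. x j)\<close> and \<open>Q = (\<Sum>j\<in>S i. (x j)\<^sup>2)\<close>.  Both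
  potentials \<open>exp (\<plusminus>\<lambda> X - 4 \<lambda>\<^sup>2 Q)\<close> are supermartingales, since the growth of \<open>Q\<close> pays for the quadratic
  variation of \<open>X\<close>, and to second order this only involves products of two signs.  So the signs need only
  be pairwise independent, and \<open>\<sigma> j\<close> can be the product of the \<open>r k\<close> over the one-bits \<open>k\<close> of \<open>j\<close>.  The
  logarithmically many \<open>r k\<close> are fixed one after the other by conditional expectations: once \<open>r 0, \<dots>, r (k - 1)\<close>
  are fixed, the expectation depends only on signed sums over the classes of elements of \<open>S i\<close> that agree in
  all bits from \<open>k\<close> on, and there are at most \<open>|S i|\<close> nonempty classes.

  A further potential, concave in the values that still move and with a weight that grows geometrically in
  the number of rounds, is decreased in expectation as well.  It forces every value to be absorbed after
  polylogarithmically many rounds.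
\<close>

section \<open>Reasoning about the parallel machine\<close>

text \<open>Two obstacles shape the proof. Pairwise independence alone does not give Chernoff
  bounds; small steps do, because the exponential may then be replaced by a quadratic polynomial in
  the signs, whose expectation involves only pairs. And words have O(log n) bits, so neither
  exponentials nor real numbers can be stored. The values are therefore integers
  \<open>y * c\<^sup>2\<close> on dyadic levels, with no rounding during the walk. The exponential
  potentials are never evaluated: an integer \<open>\<kappa> i\<close>, multiplied in each round by
  the quadratic bound and rounded up, dominates them. The scale \<open>2 ^ (20 * K)\<close> makes
  all accumulated rounding errors smaller than the initial potential. Origin of the constants: with
  \<open>\<bar>SL i\<bar>\<close> in the role of 1/\<lambda>, a potential that grows by at most a
  factor exp K confines the sum to a deviation of \<open>K * \<bar>SL i\<bar>\<close>, at most
  \<epsilon>/10 of its mean, plus the compensator \<open>4 * Q / \<bar>SL i\<bar>\<close>, at most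
  \<epsilon>/10 of its current value. Together this stays within \<epsilon>/4; rounding the initial
  value \<open>p\<close> down costs another factor 1 - \<epsilon>/8.\<close>

definition setarr :: "memory \<Rightarrow> string \<Rightarrow> (int \<Rightarrow> int) \<Rightarrow> memory" where
  "setarr M a f = (\<lambda>(b, z). if b = a then f z else M (b, z))"

lemma setarr_apply [simp]: "setarr M a f (b, z) = (if b = a then f z else M (b, z))"
  by (simp add: setarr_def)

primrec arrs :: "aexp \<Rightarrow> string set" where
  "arrs (Const c) = {}"
| "arrs (Var x) = {}"
| "arrs (Read a e) = insert a (arrs e)"
| "arrs (Op f e1 e2) = arrs e1 \<union> arrs e2"

lemma reads_arrs: "(b, z) \<in> reads e l M \<Longrightarrow> b \<in> arrs e"
  by (induction e) auto

text \<open>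
  With \<open>P\<close> a power of two of order \<open>n + \<Sum>i. |S\<^sub>i|\<close>, every variable \<open>x\<close> stays below \<open>P ^ vx x\<close> and every cell
  of an array \<open>a\<close> below \<open>P ^ ax a\<close>, so all words have \<open>O(log P)\<close> bits.
\<close>

definition vx :: "string \<Rightarrow> nat" where
  "vx x = (if x = ''om'' then 104 else if x = ''i'' then 3 else 5)"

text \<open>The exponents leave room for the largest quantities. \<open>om\<close> stays within
  \<open>2 ^ (103 * K)\<close>, so a leaf of \<open>H\<close> has exponent at most 119 and a sum of
  fewer than \<open>P\<close> leaves at most 120. The weights in \<open>KA\<close> stay within
  \<open>2 ^ (22 * K)\<close>, the class sums in \<open>V\<close> and \<open>W\<close> within
  exponents 7 and 13.\<close>

definition ax :: "string \<Rightarrow> nat" where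
  "ax a = (if a = ''H'' then 120 else if a = ''KA'' then 23 else if a = ''W'' then 15
     else if a = ''V'' then 8 else if a = ''SL'' then 4 else 3)"

definition bx :: nat where "bx = 140"

text \<open>Static exponents: a sum costs one more exponent because
  \<open>2 * P ^ e \<le> P ^ (e + 1)\<close>, a product adds exponents, a comparison yields 0 or 1.
  Overflow checks thereby become a computation on the expression alone.\<close>

primrec vb :: "aexp \<Rightarrow> nat" where
  "vb (Const c) = 1"
| "vb (Var x) = vx x"
| "vb (Read a e) = ax a"
| "vb (Op f e1 e2) = (case f of Add \<Rightarrow> Suc (max (vb e1) (vb e2)) | Sub \<Rightarrow> Suc (max (vb e1) (vb e2))
     | Mult \<Rightarrow> vb e1 + vb e2 | Div \<Rightarrow> vb e1 | Mod \<Rightarrow> max (vb e1) (vb e2) | Less \<Rightarrow> 0 | Eq \<Rightarrow> 0)"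

primrec ok :: "aexp \<Rightarrow> bool" where
  "ok (Const c) \<longleftrightarrow> \<bar>c\<bar> \<le> 1000"
| "ok (Var x) \<longleftrightarrow> vx x \<le> bx"
| "ok (Read a e) \<longleftrightarrow> ok e \<and> ax a \<le> bx"
| "ok (Op f e1 e2) \<longleftrightarrow> ok e1 \<and> ok e2 \<and> vb (Op f e1 e2) \<le> bx"

lemma abs_div_le: "\<bar>x div y\<bar> \<le> \<bar>x :: int\<bar>"
proof (cases "y = 0")
  case False
  have a: "\<bar>u div v\<bar> \<le> \<bar>u\<bar>" if "0 < v" for u v :: int
  proof (cases "0 \<le> u")
    case True
    then show ?thesis using that div_le_dividend[of "nat u" "nat v"]
      by (metis abs_of_nonneg div_by_1 int_one_le_iff_zero_less pos_imp_zdiv_nonneg_iff zdiv_mono2 zero_less_one)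
  next
    case False
    have "u \<le> u div v"
    proof -
      have "u * v \<le> u * 1" using False that by (intro mult_left_mono_neg) auto
      then have "u * v div v \<le> u div v" by (intro zdiv_mono1) (use that in auto)
      then show ?thesis using that by simp
    qed
    moreover have "u div v < 0" using False that pos_imp_zdiv_neg_iff[of v u] by simp
    ultimately show ?thesis using False by auto
  qed
  show ?thesis
  proof (cases "0 < y")
    case True then show ?thesis by (rule a)
  next
    case F: False
    then have "0 < - y" using False by simp
    from a[OF this, of "- x"] show ?thesis by simp
  qed
qed simp

lemma abs_mod_le: "\<bar>x mod y\<bar> \<le> max \<bar>x\<bar> \<bar>y :: int\<bar>"
proof -
  consider "y = 0" | "0 < y" | "y < 0" by linarith
  then show ?thesis
  proof cases
    case 2 then show ?thesis using pos_mod_bound[of y x] pos_mod_sign[of y x]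
      by (metis abs_of_nonneg le_max_iff_disj less_imp_le order_refl)
  next
    case 3 then show ?thesis using neg_mod_bound[of y x] neg_mod_sign[of y x] by linarith
  qed simp
qed

text \<open>The effect of a parallel loop of single stores on the array that it writes:
  \<open>g\<close> is the old content, \<open>f\<close> the new one. It is a relation because the
  new values are given per iteration and not per index.\<close>

definition mapped :: "nat \<Rightarrow> (nat \<Rightarrow> int) \<Rightarrow> (nat \<Rightarrow> int) \<Rightarrow> (int \<Rightarrow> int) \<Rightarrow> (int \<Rightarrow> int) \<Rightarrow> bool" where
  "mapped k idx val g f \<longleftrightarrow>
     (\<forall>i<k. f (idx i) = val i) \<and> (\<forall>z. z \<notin> idx ` {..<k} \<longrightarrow> f z = g z)"

lemma mapped_exists:
  assumes "inj_on idx {..<k}"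
  shows "\<exists>f. mapped k idx val g f"
proof -
  define f where "f z = (if z \<in> idx ` {..<k} then val (the_inv_into {..<k} idx z) else g z)" for z
  have "mapped k idx val g f"
    unfolding mapped_def f_def using assms by (auto simp: the_inv_into_f_f)
  then show ?thesis by blast
qed

text \<open>When the body is one store, freedom from conflicts reduces to injective target indices
  and to no iteration reading the target of another one. An iteration may read its own target, which
  permits updates in place.\<close>

lemma exec_map:
  assumes "fits B e l M" and "aval e l M = int k"
    and "\<And>i. i < k \<Longrightarrow> fits B ie (l(x := int i)) M"
    and "\<And>i. i < k \<Longrightarrow> fits B ve (l(x := int i)) M"
    and ix: "\<And>i. i < k \<Longrightarrow> aval ie (l(x := int i)) M = idx i"
    and vl: "\<And>i. i < k \<Longrightarrow> aval ve (l(x := int i)) M = val i"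
    and inj: "inj_on idx {..<k}"
    and rd: "\<And>i j. i < k \<Longrightarrow> j < k \<Longrightarrow> i \<noteq> j \<Longrightarrow>
      (a, idx i) \<notin> reads ie (l(x := int j)) M \<union> reads ve (l(x := int j)) M"
    and f: "mapped k idx val (\<lambda>z. M (a, z)) f"
  shows "exec B (ParFor x e (Store a ie ve)) l M l (setarr M a f)
    (reads e l M \<union> (\<Union>i<k. reads ie (l(x := int i)) M \<union> reads ve (l(x := int i)) M))
    (\<Union>i<k. {(a, idx i)})
    (1 + cost e + (\<Sum>i<k. 1 + (1 + cost ie + cost ve)))
    (1 + cost e + Max (insert 0 ((\<lambda>i. 1 + (1 + cost ie + cost ve)) ` {..<k})))"
proof (rule exec.ParFor[where ls = "\<lambda>i. l(x := int i)" and Ms = "\<lambda>i. M((a, idx i) := val i)"])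
  fix i assume i: "i < k"
  show "exec B (Store a ie ve) (l(x := int i)) M (l(x := int i)) (M((a, idx i) := val i))
    (reads ie (l(x := int i)) M \<union> reads ve (l(x := int i)) M) {(a, idx i)}
    (1 + cost ie + cost ve) (1 + cost ie + cost ve)"
    using exec.Store[of B ie "l(x := int i)" M ve a] assms(3)[OF i] assms(4)[OF i] ix[OF i] vl[OF i]
    by simp
next
  fix i j assume "i < k" "j < k" "i \<noteq> j"
  then show "{(a, idx i)} \<inter> ((reads ie (l(x := int j)) M \<union> reads ve (l(x := int j)) M) \<union> {(a, idx j)}) = {}"
    using rd[of i j] inj by (auto dest: inj_onD)
next
  fix ad assume "ad \<notin> (\<Union>i<k. {(a, idx i)})"
  then show "setarr M a f ad = M ad"
    using f by (cases ad) (auto simp: mapped_def)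
qed (use assms f in \<open>auto simp: mapped_def\<close>)

lemma Max_const_le: "Max (insert 0 ((\<lambda>i. c) ` {..<k :: nat})) \<le> (c :: nat)"
  by (rule Max.boundedI) auto

section \<open>Word bounds, work and depth of composed programs\<close>

locale machine =
  fixes B :: int and P :: nat
  assumes P_ge: "1000 \<le> P" and B_ge: "int P ^ bx \<le> B"
begin

lemma P_pow_mono: "a \<le> b \<Longrightarrow> int P ^ a \<le> int P ^ b"
  using P_ge by (intro power_increasing) auto

definition TB :: "locals \<Rightarrow> memory \<Rightarrow> bool" where
  "TB l M \<longleftrightarrow> (\<forall>x. \<bar>l x\<bar> \<le> int P ^ vx x) \<and> (\<forall>a z. \<bar>M (a, z)\<bar> \<le> int P ^ ax a)"

lemma aval_bound: "TB l M \<Longrightarrow> ok e \<Longrightarrow> \<bar>aval e l M\<bar> \<le> int P ^ vb e"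
proof (induction e)
  case (Const c)
  then show ?case using P_ge by simp
next
  case (Op f e1 e2)
  let ?a = "aval e1 l M" and ?b = "aval e2 l M"
  let ?m = "max (vb e1) (vb e2)"
  have 1: "\<bar>?a\<bar> \<le> int P ^ vb e1" "\<bar>?b\<bar> \<le> int P ^ vb e2" using Op by auto
  have 2: "\<bar>?a\<bar> \<le> int P ^ ?m" "\<bar>?b\<bar> \<le> int P ^ ?m"
    using 1 P_pow_mono[of "vb e1" ?m] P_pow_mono[of "vb e2" ?m] by auto
  have 3: "2 * int P ^ ?m \<le> int P ^ Suc ?m" using P_ge by simp
  show ?case
  proof (cases f)
    case Add
    have "\<bar>?a + ?b\<bar> \<le> int P ^ Suc ?m" using 2 3 by linarith
    then show ?thesis using Add by simp
  next
    case Sub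
    have "\<bar>?a - ?b\<bar> \<le> int P ^ Suc ?m" using 2 3 by linarith
    then show ?thesis using Sub by simp
  next
    case Mult then show ?thesis using 1 by (simp add: abs_mult power_add mult_mono)
  next
    case Div then show ?thesis using 1 abs_div_le[of ?a ?b] by simp
  next
    case Mod then show ?thesis using order_trans[OF abs_mod_le[of ?a ?b] max.boundedI[OF 2]] by simp
  qed auto
qed (auto simp: TB_def)

lemma fits_ok: "TB l M \<Longrightarrow> ok e \<Longrightarrow> fits B e l M"
proof -
  have le: "\<bar>x\<bar> \<le> B" if "\<bar>x\<bar> \<le> int P ^ a" "a \<le> bx" for x a
    using that P_pow_mono[of a bx] B_ge by linarith
  assume "TB l M" "ok e"
  then show "fits B e l M"
  proof (induction e)
    case (Const c)
    then show ?case using le[of c 1] P_ge by (simp add: bx_def)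
  next
    case (Var x)
    then show ?case using le[of "l x" "vx x"] by (auto simp: TB_def)
  next
    case (Read a e)
    then show ?case using le[of "M (a, aval e l M)" "ax a"] by (auto simp: TB_def)
  next
    case (Op f e1 e2)
    then show ?case using le[OF aval_bound[of l M "Op f e1 e2"]] by simp
  qed
qed

text \<open>Work is measured in multiples of \<open>P\<close>, so that a single number bounds both resources.\<close>

definition runs :: "com \<Rightarrow> locals \<Rightarrow> memory \<Rightarrow> nat \<Rightarrow> (locals \<Rightarrow> memory \<Rightarrow> bool) \<Rightarrow> bool" where
  "runs c l M a Q \<longleftrightarrow> (TB l M \<longrightarrow> (\<exists>l' M' R W w d. exec B c l M l' M' R W w d \<and>
     w \<le> a * P \<and> d \<le> a \<and> TB l' M' \<and> Q l' M'))"

lemma runs_mono: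
  assumes "runs c l M a Q" "a \<le> a'" "\<And>l' M'. TB l' M' \<Longrightarrow> Q l' M' \<Longrightarrow> Q' l' M'"
  shows "runs c l M a' Q'"
  using assms unfolding runs_def by (meson le_trans mult_le_mono1)

lemma runs_Seq:
  assumes "runs c1 l M a1 Q1" "\<And>l' M'. TB l' M' \<Longrightarrow> Q1 l' M' \<Longrightarrow> runs c2 l' M' a2 Q" "a1 + a2 \<le> a"
  shows "runs (Seq c1 c2) l M a Q"
  unfolding runs_def
proof
  assume "TB l M"
  then obtain l1 M1 R1 W1 w1 d1 where 1: "exec B c1 l M l1 M1 R1 W1 w1 d1" "w1 \<le> a1 * P" "d1 \<le> a1"
    "TB l1 M1" "Q1 l1 M1" using assms(1) unfolding runs_def by blast
  obtain l2 M2 R2 W2 w2 d2 where 2: "exec B c2 l1 M1 l2 M2 R2 W2 w2 d2" "w2 \<le> a2 * P" "d2 \<le> a2"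
    "TB l2 M2" "Q l2 M2" using assms(2)[OF 1(4,5)] 1(4) unfolding runs_def by blast
  have "w1 + w2 \<le> a * P" using 1(2) 2(2) mult_le_mono1[OF assms(3), of P] by (simp add: add_mult_distrib)
  moreover have "d1 + d2 \<le> a" using 1(3) 2(3) assms(3) by simp
  ultimately show "\<exists>l' M' R W w d. exec B (Seq c1 c2) l M l' M' R W w d \<and>
     w \<le> a * P \<and> d \<le> a \<and> TB l' M' \<and> Q l' M'"
    using exec.Seq[OF 1(1) 2(1)] 2(4,5) by blast
qed

lemma le_mult_P: "a \<le> b \<Longrightarrow> a \<le> b * P"
  using P_ge mult_le_mono[of a b 1 P] by simp

lemma runs_Assign:
  assumes "ok e" "TB l M \<Longrightarrow> \<bar>aval e l M\<bar> \<le> int P ^ vx x" "1 + cost e \<le> a" "Q (l(x := aval e l M)) M"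
  shows "runs (Assign x e) l M a Q"
  unfolding runs_def
proof
  assume T: "TB l M"
  have "TB (l(x := aval e l M)) M" using T assms(2) by (auto simp: TB_def)
  then show "\<exists>l' M' R W w d. exec B (Assign x e) l M l' M' R W w d \<and>
     w \<le> a * P \<and> d \<le> a \<and> TB l' M' \<and> Q l' M'"
    using exec.Assign[OF fits_ok[OF T assms(1)], of x] assms(3,4) le_mult_P[OF assms(3)] by blast
qed

lemma runs_let:
  assumes "ok e" "aval e l M = v" "\<bar>v\<bar> \<le> int P ^ vx x" "1 + cost e \<le> b"
    "runs c (l(x := v)) M a Q" "b + a \<le> a'"
  shows "runs (Seq (Assign x e) c) l M a' Q"
proof (rule runs_Seq[where ?a1.0 = b and ?a2.0 = a and ?Q1.0 = "\<lambda>l' M'. l' = l(x := v) \<and> M' = M"], goal_cases)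
  case 1
  show ?case
    by (intro runs_Assign) (use assms in auto)
qed (use assms in auto)

lemma runs_If:
  assumes "ok e" "aval e l M \<noteq> 0 \<Longrightarrow> runs c1 l M a Q" "aval e l M = 0 \<Longrightarrow> runs c2 l M a Q"
    "1 + cost e + a \<le> a'"
  shows "runs (If e c1 c2) l M a' Q"
  unfolding runs_def
proof
  assume T: "TB l M"
  have "runs (if aval e l M \<noteq> 0 then c1 else c2) l M a Q" using assms by simp
  then obtain l' M' R W w d where 1: "exec B (if aval e l M \<noteq> 0 then c1 else c2) l M l' M' R W w d"
    "w \<le> a * P" "d \<le> a" "TB l' M'" "Q l' M'" using T unfolding runs_def by blast
  have "1 + cost e + w \<le> a' * P"
    using 1(2) mult_le_mono1[OF assms(4), of P] le_mult_P[of "1 + cost e" "1 + cost e"]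
    by (simp only: add_mult_distrib) linarith
  moreover have "1 + cost e + d \<le> a'" using 1(3) assms(4) by simp
  ultimately show "\<exists>l' M' R W w d. exec B (If e c1 c2) l M l' M' R W w d \<and>
     w \<le> a' * P \<and> d \<le> a' \<and> TB l' M' \<and> Q l' M'"
    using exec.If[OF fits_ok[OF T assms(1)] 1(1)] 1(4,5) by blast
qed

text \<open>The invariant carries the iteration number and the number \<open>T\<close> of iterations
  is known in advance, so termination and the budget come from the same induction on
  \<open>T - t\<close>.\<close>

lemma runs_While:
  assumes "ok e" and step: "\<And>t l M. t < T \<Longrightarrow> I t l M \<Longrightarrow> aval e l M \<noteq> 0 \<and> runs c l M a (I (Suc t))"
    and "\<And>l M. I T l M \<Longrightarrow> aval e l M = 0" "I 0 l M" "(T + 1) * (1 + cost e + a) \<le> a'"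
    and "\<And>l M. TB l M \<Longrightarrow> I T l M \<Longrightarrow> Q l M"
  shows "runs (While e c) l M a' Q"
proof -
  have "runs (While e c) l M ((T - t + 1) * (1 + cost e + a)) Q" if "t \<le> T" "I t l M" for t l M
    using that
  proof (induction "T - t" arbitrary: t l M)
    case 0
    then have t: "t = T" by simp
    show ?case unfolding runs_def
    proof
      assume T: "TB l M"
      have "1 + cost e \<le> (T - t + 1) * (1 + cost e + a)" using t by simp
      then show "\<exists>l' M' R W w d. exec B (While e c) l M l' M' R W w d \<and>
        w \<le> (T - t + 1) * (1 + cost e + a) * P \<and> d \<le> (T - t + 1) * (1 + cost e + a) \<and> TB l' M' \<and> Q l' M'"
        using exec.WhileFalse[OF fits_ok[OF T assms(1)], of c] assms(3) 0 t T assms(6) le_mult_P by blast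
    qed
  next
    case (Suc s)
    then have t: "t < T" by simp
    have st: "aval e l M \<noteq> 0" "runs c l M a (I (Suc t))" using step[OF t Suc.prems(2)] by auto
    have IH: "runs (While e c) l' M' ((T - Suc t + 1) * (1 + cost e + a)) Q" if "I (Suc t) l' M'" for l' M'
      using Suc.hyps(1)[of "Suc t"] Suc.hyps(2) t that by simp
    let ?b = "(T - Suc t + 1) * (1 + cost e + a)"
    have eq: "(T - t + 1) * (1 + cost e + a) = (1 + cost e + a) + ?b"
      using t by (simp add: Suc_diff_Suc[symmetric])
    show ?case unfolding runs_def
    proof
      assume T: "TB l M"
      obtain l1 M1 R1 W1 w1 d1 where 1: "exec B c l M l1 M1 R1 W1 w1 d1" "w1 \<le> a * P" "d1 \<le> a"
        "TB l1 M1" "I (Suc t) l1 M1" using st(2) T unfolding runs_def by blast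
      obtain l2 M2 R2 W2 w2 d2 where 2: "exec B (While e c) l1 M1 l2 M2 R2 W2 w2 d2" "w2 \<le> ?b * P" "d2 \<le> ?b"
        "TB l2 M2" "Q l2 M2" using IH[OF 1(5)] 1(4) unfolding runs_def by blast
      have "1 + cost e + w1 + w2 \<le> (T - t + 1) * (1 + cost e + a) * P"
        unfolding eq using 1(2) 2(2) le_mult_P[of "1 + cost e" "1 + cost e"]
        by (simp only: add_mult_distrib) linarith
      moreover have "1 + cost e + d1 + d2 \<le> (T - t + 1) * (1 + cost e + a)"
        unfolding eq using 1(3) 2(3) by simp
      ultimately show "\<exists>l' M' R W w d. exec B (While e c) l M l' M' R W w d \<and>
        w \<le> (T - t + 1) * (1 + cost e + a) * P \<and> d \<le> (T - t + 1) * (1 + cost e + a) \<and> TB l' M' \<and> Q l' M'"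
        using exec.WhileTrue[OF fits_ok[OF T assms(1)] st(1) 1(1) 2(1)] 2(4,5) by blast
    qed
  qed
  from this[of 0] show ?thesis using assms(4,5) runs_mono by fastforce
qed

text \<open>There are two ways to show that the stored values fit the array: the static exponent of
  the expression, or an explicit bound on \<open>val\<close>. The second is for values that are
  updated again and again, where an invariant limits the growth and the expression alone does not.
  The static bound on \<open>val\<close> is also handed on to \<open>Q\<close>.\<close>

lemma runs_map:
  assumes okk: "ok e" "ok ie" "ok ve"
    and k: "aval e l M = int k" "k \<le> P" and vx: "1 \<le> vx x"
    and ix: "\<And>i. i < k \<Longrightarrow> aval ie (l(x := int i)) M = idx i"
    and vl: "\<And>i. i < k \<Longrightarrow> aval ve (l(x := int i)) M = val i"
    and inj: "inj_on idx {..<k}"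
    and rd: "\<And>i j. i < k \<Longrightarrow> j < k \<Longrightarrow> i \<noteq> j \<Longrightarrow>
      (a, idx i) \<notin> reads ie (l(x := int j)) M \<union> reads ve (l(x := int j)) M"
    and bd: "vb ve \<le> ax a \<or> (\<forall>i<k. \<bar>val i\<bar> \<le> int P ^ ax a)"
    and c: "3 + cost e + cost ie + cost ve \<le> b"
    and Q: "\<And>f. mapped k idx val (\<lambda>z. M (a, z)) f \<Longrightarrow> (\<And>i. i < k \<Longrightarrow> \<bar>val i\<bar> \<le> int P ^ vb ve) \<Longrightarrow> Q l (setarr M a f)"
  shows "runs (ParFor x e (Store a ie ve)) l M b Q"
  unfolding runs_def
proof
  assume T: "TB l M"
  have T': "TB (l(x := int i)) M" if "i < k" for i
  proof -
    have "int i \<le> int P ^ 1" using that k by simp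
    also have "\<dots> \<le> int P ^ vx x" by (rule P_pow_mono) (rule vx)
    finally show ?thesis using T by (auto simp: TB_def)
  qed
  obtain f where f: "mapped k idx val (\<lambda>z. M (a, z)) f" using mapped_exists[OF inj] by blast
  have vbd: "\<bar>val i\<bar> \<le> int P ^ vb ve" if "i < k" for i
    using aval_bound[OF T'[OF that] okk(3)] vl[OF that] by simp
  have "\<bar>val i\<bar> \<le> int P ^ ax a" if "i < k" for i
    using bd
  proof
    assume "vb ve \<le> ax a"
    then show ?thesis
      using vbd[OF that] P_pow_mono[of "vb ve" "ax a"] by simp
  qed (use that in blast)
  then have fb: "\<bar>f z\<bar> \<le> int P ^ ax a" for z
    using f T unfolding mapped_def TB_def by (cases "z \<in> idx ` {..<k}") auto
  have TB: "TB l (setarr M a f)" using T fb by (auto simp: TB_def)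
  have "1 + cost e + k * (2 + cost ie + cost ve) \<le> (1 + cost e) * P + P * (2 + cost ie + cost ve)"
    by (intro add_mono mult_le_mono1 le_mult_P) (use k in auto)
  also have "\<dots> = (3 + cost e + cost ie + cost ve) * P" by (simp add: algebra_simps)
  also have "\<dots> \<le> b * P" using c by (rule mult_le_mono1)
  finally have w: "1 + cost e + (\<Sum>i<k. 1 + (1 + cost ie + cost ve)) \<le> b * P" by simp
  have d: "1 + cost e + Max (insert 0 ((\<lambda>i. 1 + (1 + cost ie + cost ve)) ` {..<k})) \<le> b"
    using Max_const_le[of "1 + (1 + cost ie + cost ve)" k] c by linarith
  have "exec B (ParFor x e (Store a ie ve)) l M l (setarr M a f)
    (reads e l M \<union> (\<Union>i<k. reads ie (l(x := int i)) M \<union> reads ve (l(x := int i)) M))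
    (\<Union>i<k. {(a, idx i)})
    (1 + cost e + (\<Sum>i<k. 1 + (1 + cost ie + cost ve)))
    (1 + cost e + Max (insert 0 ((\<lambda>i. 1 + (1 + cost ie + cost ve)) ` {..<k})))"
    by (rule exec_map[where val = val]) (use fits_ok okk T T' k ix vl inj rd f in blast)+
  then show "\<exists>l' M' R W w d. exec B (ParFor x e (Store a ie ve)) l M l' M' R W w d \<and>
     w \<le> b * P \<and> d \<le> b \<and> TB l' M' \<and> Q l' M'"
    using w d TB Q[OF f vbd] by blast
qed

lemma runs_map':
  assumes "ok e" "ok ie" "ok ve"
    and "aval e l M = int k" "k \<le> P" "1 \<le> vx x"
    and "\<And>i. i < k \<Longrightarrow> aval ie (l(x := int i)) M = idx i"
    and "\<And>i. i < k \<Longrightarrow> aval ve (l(x := int i)) M = val i"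
    and "inj_on idx {..<k}"
    and "a \<notin> arrs ie \<union> arrs ve"
    and "vb ve \<le> ax a \<or> (\<forall>i<k. \<bar>val i\<bar> \<le> int P ^ ax a)"
    and "3 + cost e + cost ie + cost ve \<le> b"
    and "\<And>f. mapped k idx val (\<lambda>z. M (a, z)) f \<Longrightarrow> (\<And>i. i < k \<Longrightarrow> \<bar>val i\<bar> \<le> int P ^ vb ve) \<Longrightarrow> Q l (setarr M a f)"
  shows "runs (ParFor x e (Store a ie ve)) l M b Q"
  by (rule runs_map[where k = k and idx = idx and val = val])
    (use assms reads_arrs[of a] in auto)

text \<open>Work is charged to the total number of inner iterations, \<open>\<Sum>i<k. h i\<close>,
  and not to \<open>k\<close> times the longest inner loop. This keeps copying the sets linear in
  their total size.\<close>

lemma runs_map2: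
  assumes okk: "ok e" "ok e2" "ok ie" "ok ve"
    and k: "aval e l M = int k" "k \<le> P" and vx: "1 \<le> vx x" "1 \<le> vx y"
    and k2: "\<And>i. i < k \<Longrightarrow> aval e2 (l(x := int i)) M = int (h i)" "(\<Sum>i<k. h i) \<le> P"
    and ix: "\<And>i j. i < k \<Longrightarrow> j < h i \<Longrightarrow> aval ie (l(x := int i, y := int j)) M = idx i j"
    and vl: "\<And>i j. i < k \<Longrightarrow> j < h i \<Longrightarrow> aval ve (l(x := int i, y := int j)) M = val i j"
    and inj: "\<And>i j i' j'. i < k \<Longrightarrow> j < h i \<Longrightarrow> i' < k \<Longrightarrow> j' < h i' \<Longrightarrow> idx i j = idx i' j' \<Longrightarrow> i = i' \<and> j = j'"
    and rd: "a \<notin> arrs e2 \<union> arrs ie \<union> arrs ve"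
    and bd: "vb ve \<le> ax a"
    and c: "5 + cost e + cost e2 + cost ie + cost ve \<le> b"
    and f: "\<And>i j. i < k \<Longrightarrow> j < h i \<Longrightarrow> f (idx i j) = val i j"
      "\<And>z. (\<And>i j. i < k \<Longrightarrow> j < h i \<Longrightarrow> z \<noteq> idx i j) \<Longrightarrow> f z = M (a, z)"
    and Q: "Q l (setarr M a f)"
  shows "runs (ParFor x e (ParFor y e2 (Store a ie ve))) l M b Q"
  unfolding runs_def
proof
  assume T: "TB l M"
  have T1: "TB (l'(x' := int i)) M" if "TB l' M" "i < P" "1 \<le> vx x'" for i l' x'
  proof -
    have "int i \<le> int P ^ 1" using that by simp
    also have "\<dots> \<le> int P ^ vx x'" by (rule P_pow_mono) (rule that)
    finally show ?thesis using that by (auto simp: TB_def)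
  qed
  have hP: "h i \<le> P" if "i < k" for i
    using member_le_sum[of i "{..<k}" h] k2(2) that by simp
  have T': "TB (l(x := int i)) M" if "i < k" for i
    using T1[OF T, of i x] that k vx by simp
  have T2: "TB (l(x := int i, y := int j)) M" if "i < k" "j < h i" for i j
    using T1[OF T'[OF that(1)], of j y] that hP[of i] vx by simp
  define F where "F i = (SOME g. mapped (h i) (idx i) (val i) (\<lambda>z. M (a, z)) g)" for i
  have F: "mapped (h i) (idx i) (val i) (\<lambda>z. M (a, z)) (F i)" if "i < k" for i
    using someI_ex[OF mapped_exists[of "idx i" "h i" "val i" "\<lambda>z. M (a, z)"]] inj that
    unfolding F_def by (auto simp: inj_on_def)
  let ?R = "\<lambda>i. reads e2 (l(x := int i)) M \<union> (\<Union>j<h i. reads ie (l(x := int i, y := int j)) M \<union> reads ve (l(x := int i, y := int j)) M)"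
  let ?W = "\<lambda>i. \<Union>j<h i. {(a, idx i j)}"
  let ?w = "\<lambda>i. 1 + cost e2 + (\<Sum>j<h i. 1 + (1 + cost ie + cost ve))"
  let ?d = "\<lambda>i. 1 + cost e2 + Max (insert 0 ((\<lambda>j. 1 + (1 + cost ie + cost ve)) ` {..<h i}))"
  have notin: "(a, z) \<notin> ?R i" for z i using rd reads_arrs[of a] by auto
  have fb: "\<bar>f z\<bar> \<le> int P ^ ax a" for z
  proof (cases "\<exists>i j. i < k \<and> j < h i \<and> z = idx i j")
    case True
    then obtain i j where ij: "i < k" "j < h i" "z = idx i j" by blast
    show ?thesis using aval_bound[OF T2[OF ij(1,2)] okk(4)] vl[OF ij(1,2)] f(1)[OF ij(1,2)] ij(3)
        P_pow_mono[OF bd] by simp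
  next
    case False
    then have "f z = M (a, z)" using f(2) by blast
    then show ?thesis using T by (simp add: TB_def)
  qed
  have TB: "TB l (setarr M a f)" using T fb by (auto simp: TB_def)
  have E: "exec B (ParFor x e (ParFor y e2 (Store a ie ve))) l M l (setarr M a f)
    (reads e l M \<union> (\<Union>i<k. ?R i)) (\<Union>i<k. ?W i)
    (1 + cost e + (\<Sum>i<k. 1 + ?w i)) (1 + cost e + Max (insert 0 ((\<lambda>i. 1 + ?d i) ` {..<k})))"
  proof (rule exec.ParFor[where ls = "\<lambda>i. l(x := int i)" and Ms = "\<lambda>i. setarr M a (F i)"])
    fix i assume i: "i < k"
    show "exec B (ParFor y e2 (Store a ie ve)) (l(x := int i)) M (l(x := int i)) (setarr M a (F i))
       (?R i) (?W i) (?w i) (?d i)"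
    proof (rule exec_map[where val = "val i"])
      show "inj_on (idx i) {..<h i}" using inj i by (auto simp: inj_on_def)
      show "mapped (h i) (idx i) (val i) (\<lambda>z. M (a, z)) (F i)" by (rule F[OF i])
    qed (use fits_ok okk T' T2 k2 ix vl i rd reads_arrs[of a] in \<open>auto\<close>)
  next
    fix i j assume ij: "i < k" "j < k" "i \<noteq> j"
    then show "?W i \<inter> (?R j \<union> ?W j) = {}"
      using notin[of _ j] inj[of i _ j] by (fastforce)
  next
    fix i ad assume "i < k" "ad \<in> ?W i"
    then show "setarr M a f ad = setarr M a (F i) ad"
      using F[of i] f(1) by (auto simp: mapped_def)
  next
    fix ad assume "ad \<notin> (\<Union>i<k. ?W i)"
    then show "setarr M a f ad = M ad" using f(2) by (cases ad) auto
  qed (use fits_ok okk T k in auto)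
  have "(\<Sum>i<k. 1 + ?w i) = (\<Sum>i<k. (2 + cost e2) + h i * (2 + cost ie + cost ve))"
    by (intro sum.cong) auto
  also have "\<dots> = k * (2 + cost e2) + (\<Sum>i<k. h i) * (2 + cost ie + cost ve)"
    by (simp only: sum.distrib sum_distrib_right sum_constant card_lessThan) simp
  also have "\<dots> \<le> P * (2 + cost e2) + P * (2 + cost ie + cost ve)"
    by (intro add_mono mult_le_mono1) (use k k2 in auto)
  finally have "1 + cost e + (\<Sum>i<k. 1 + ?w i) \<le> (1 + cost e) * P + (P * (2 + cost e2) + P * (2 + cost ie + cost ve))"
    using le_mult_P[of "1 + cost e" "1 + cost e"] by linarith
  also have "\<dots> = (5 + cost e + cost e2 + cost ie + cost ve) * P" by (simp add: algebra_simps)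
  also have "\<dots> \<le> b * P" using c by (rule mult_le_mono1)
  finally have w: "1 + cost e + (\<Sum>i<k. 1 + ?w i) \<le> b * P" .
  have "?d i \<le> 3 + cost e2 + cost ie + cost ve" for i
    using Max_const_le[of "1 + (1 + cost ie + cost ve)" "h i"] by linarith
  then have "Max (insert 0 ((\<lambda>i. 1 + ?d i) ` {..<k})) \<le> 4 + cost e2 + cost ie + cost ve"
    by (intro Max.boundedI) (auto simp del: Max_insert simp: le_Suc_eq)
  then have d: "1 + cost e + Max (insert 0 ((\<lambda>i. 1 + ?d i) ` {..<k})) \<le> b" using c by linarith
  show "\<exists>l' M' R W w d. exec B (ParFor x e (ParFor y e2 (Store a ie ve))) l M l' M' R W w d \<and>
     w \<le> b * P \<and> d \<le> b \<and> TB l' M' \<and> Q l' M'"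
    using E w d TB Q by blast
qed

end

section \<open>Pairwise independent signs and their derandomization\<close>

text \<open>A binary tree read from the leaves. Node \<open>u\<close> of level \<open>k\<close>
  stands for the indices \<open>j\<close> with \<open>j div 2 ^ k = u\<close>, and its value is the
  sum of \<open>sg r k j * f j\<close> over them (\<open>agg_support\<close>). Merging two siblings
  multiplies the right one, whose indices have bit \<open>k\<close> set, by
  \<open>r k\<close>.\<close>

primrec agg :: "(nat \<Rightarrow> int) \<Rightarrow> nat \<Rightarrow> (nat \<Rightarrow> int) \<Rightarrow> nat \<Rightarrow> int" where
  "agg r 0 f u = f u"
| "agg r (Suc k) f u = agg r k f (2 * u) + r k * agg r k f (2 * u + 1)"

text \<open>A Walsh function of the seed \<open>r\<close>, using the lowest \<open>k\<close> bits of
  the index. Once \<open>k\<close> covers all bits of two distinct indices, the product of their two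
  functions is again a nontrivial Walsh function and averages to 0; this is the pairwise
  independence.\<close>

definition sg :: "(nat \<Rightarrow> int) \<Rightarrow> nat \<Rightarrow> nat \<Rightarrow> int" where
  "sg r k j = (\<Prod>l<k. if odd (j div 2 ^ l) then r l else 1)"

lemma sg_0 [simp]: "sg r 0 j = 1"
  by (simp add: sg_def)

lemma sg_Suc: "sg r (Suc k) j = sg r k j * (1 + int (j div 2 ^ k mod 2) * (r k - 1))"
  by (auto simp: sg_def odd_iff_mod_2_eq_one even_iff_mod_2_eq_zero)

lemma sg_cong: "(\<And>l. l < k \<Longrightarrow> r l = r' l) \<Longrightarrow> sg r k j = sg r' k j"
  unfolding sg_def by (intro prod.cong) auto

lemma agg_cong: "(\<And>l. l < k \<Longrightarrow> r l = r' l) \<Longrightarrow> agg r k f u = agg r' k f u"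
  by (induction k arbitrary: u) auto

lemma sg_sign:
  assumes "\<And>k. r k = 1 \<or> r k = -1"
  shows "sg r k j = 1 \<or> sg r k j = -1"
proof (induction k)
  case (Suc k)
  then show ?case using assms[of k] by (auto simp: sg_def)
qed simp

lemma sum_split_pairs: "(\<Sum>x<2 * (n :: nat). g x) = (\<Sum>u<n. g (2 * u) + g (2 * u + 1))"
  for g :: "nat \<Rightarrow> 'a :: comm_monoid_add"
  by (induction n) (auto simp: add.assoc)

lemma sum_lessThan_add: "(\<Sum>x<m + (n :: nat). g x) = (\<Sum>x<m. g x) + (\<Sum>x<n. g (m + x))"
  for g :: "nat \<Rightarrow> 'a :: comm_monoid_add"
  by (induction n) (auto simp: add.assoc)

lemma agg_eq: "agg r k f u = (\<Sum>x<2 ^ k. sg r k x * f (u * 2 ^ k + x))"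
proof (induction k arbitrary: u)
  case (Suc k)
  let ?p = "2 ^ k :: nat"
  have s: "sg r (Suc k) x = sg r k x" if "x < ?p" for x
    using that by (simp add: sg_Suc)
  \<comment> \<open>In the upper half bit \<open>k\<close> is set and contributes
    \<open>r k\<close>, while the lower bits agree with those of \<open>x\<close>.\<close>
  have s': "sg r (Suc k) (?p + x) = sg r k x * r k" if "x < ?p" for x
  proof -
    have "(?p + x) div 2 ^ k = 1" using that by simp
    moreover have "sg r k (?p + x) = sg r k x" unfolding sg_def
    proof (intro prod.cong refl)
      fix l assume "l \<in> {..<k}"
      then have "(2::nat) ^ k = 2 ^ l * 2 ^ (k - l)" and e: "even ((2::nat) ^ (k - l))"
        by (auto simp flip: power_add)
      then have "(?p + x) div 2 ^ l = 2 ^ (k - l) + x div 2 ^ l" by simp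
      then show "(if odd ((?p + x) div 2 ^ l) then r l else 1) = (if odd (x div 2 ^ l) then r l else 1)"
        using e by simp
    qed
    ultimately show ?thesis by (simp add: sg_Suc)
  qed
  have t: "sg r (Suc k) (?p + x) * f (u * 2 ^ Suc k + (?p + x)) = r k * (sg r k x * f ((2 * u + 1) * 2 ^ k + x))"
    if "x < ?p" for x
  proof -
    have "u * 2 ^ Suc k + (?p + x) = (2 * u + 1) * 2 ^ k + x" by (simp add: algebra_simps)
    then show ?thesis by (simp only: s'[OF that]) simp
  qed
  have "(\<Sum>x<2 ^ Suc k. sg r (Suc k) x * f (u * 2 ^ Suc k + x))
    = (\<Sum>x<?p. sg r (Suc k) x * f (u * 2 ^ Suc k + x)) + (\<Sum>x<?p. sg r (Suc k) (?p + x) * f (u * 2 ^ Suc k + (?p + x)))"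
    by (simp only: power_Suc mult_2 sum_lessThan_add)
  also have "(\<Sum>x<?p. sg r (Suc k) x * f (u * 2 ^ Suc k + x)) = (\<Sum>x<?p. sg r k x * f (2 * u * 2 ^ k + x))"
    by (intro sum.cong refl) (simp add: s mult.assoc mult.left_commute)
  also have "(\<Sum>x<?p. sg r (Suc k) (?p + x) * f (u * 2 ^ Suc k + (?p + x)))
    = r k * (\<Sum>x<?p. sg r k x * f ((2 * u + 1) * 2 ^ k + x))"
    unfolding sum_distrib_left by (intro sum.cong refl) (simp only: lessThan_iff t)
  finally show ?case using Suc by simp
qed simp

lemma sg_add:
  assumes "x < 2 ^ k" shows "sg r k (u * 2 ^ k + x) = sg r k x"
  unfolding sg_def
proof (intro prod.cong refl)
  fix l assume "l \<in> {..<k}"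
  then have p: "(2::nat) ^ k = 2 ^ l * 2 ^ (k - l)" and e: "even ((2::nat) ^ (k - l))"
    by (auto simp flip: power_add)
  have "(u * 2 ^ k + x) div 2 ^ l = u * 2 ^ (k - l) + x div 2 ^ l"
  proof -
    have "u * 2 ^ k + x = x + u * 2 ^ (k - l) * 2 ^ l" by (simp add: p)
    then show ?thesis by (simp only:) (simp only: div_mult_self1 power_not_zero zero_neq_numeral not_False_eq_True)
  qed
  then show "(if odd ((u * 2 ^ k + x) div 2 ^ l) then r l else 1) = (if odd (x div 2 ^ l) then r l else 1)"
    using e by simp
qed

lemma agg_support:
  assumes "finite A" "\<And>j. j \<notin> A \<Longrightarrow> f j = 0"
  shows "agg r k f u = (\<Sum>j\<in>A. of_bool (j div 2 ^ k = u) * (sg r k j * f j))"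
proof -
  have "agg r k f u = (\<Sum>x<2 ^ k. sg r k (u * 2 ^ k + x) * f (u * 2 ^ k + x))"
    unfolding agg_eq by (intro sum.cong refl) (simp add: sg_add)
  also have "\<dots> = (\<Sum>j\<in>(\<lambda>x. u * 2 ^ k + x) ` {..<2 ^ k}. sg r k j * f j)"
    by (subst sum.reindex) auto
  also have "(\<lambda>x. u * 2 ^ k + x) ` {..<2 ^ k} = {j. j div 2 ^ k = u}"
  proof (intro set_eqI iffI)
    fix j assume "j \<in> {j. j div 2 ^ k = u}"
    then have "j = u * 2 ^ k + j mod 2 ^ k" by (metis (mono_tags) div_mult_mod_eq mem_Collect_eq)
    then show "j \<in> (\<lambda>x. u * 2 ^ k + x) ` {..<2 ^ k}" by (rule image_eqI) simp
  qed auto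
  also have "(\<Sum>j\<in>{j. j div 2 ^ k = u}. sg r k j * f j) = (\<Sum>j\<in>{j \<in> A. j div 2 ^ k = u}. sg r k j * f j)"
  proof (rule sum.mono_neutral_right)
    have "{j. j div 2 ^ k = u} \<subseteq> {..<(u + 1) * 2 ^ k}"
      by (auto simp: dividend_less_div_times dividend_less_times_div div_less_iff_less_mult)
    then show "finite {j. j div 2 ^ k = u}" using finite_subset by blast
  qed (use assms in auto)
  also have "\<dots> = (\<Sum>j\<in>A. of_bool (j div 2 ^ k = u) * (sg r k j * f j))"
    unfolding sum.inter_filter[OF assms(1)] by (intro sum.cong) auto
  finally show ?thesis .
qed

lemma agg_full: "agg r k f 0 = (\<Sum>x<2 ^ k. sg r k x * f x)"
  by (simp add: agg_eq)

text \<open>With all signs 1 the tree computes plain sums. The sum of the squared coefficients is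
  thus obtained by the same merging program as the signed sums.\<close>

lemma agg_one: "agg (\<lambda>_. 1) k f 0 = (\<Sum>x<2 ^ k. f x)"
  by (simp add: agg_eq sg_def)

lemma agg_abs_le:
  assumes "\<And>k. r k = 1 \<or> r k = -1" "\<And>x. \<bar>f x\<bar> \<le> c"
  shows "\<bar>agg r k f u\<bar> \<le> 2 ^ k * c"
proof -
  have "\<bar>agg r k f u\<bar> \<le> (\<Sum>x<2 ^ k. \<bar>sg r k x * f (u * 2 ^ k + x)\<bar>)"
    unfolding agg_eq by (rule sum_abs)
  also have "\<dots> \<le> (\<Sum>x<(2::nat) ^ k. c)"
  proof (rule sum_mono)
    fix x
    show "\<bar>sg r k x * f (u * 2 ^ k + x)\<bar> \<le> c"
      using sg_sign[of r k x, OF assms(1)] assms(2)[of "u * 2 ^ k + x"] by auto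
  qed
  finally show ?thesis by simp
qed

lemma agg_zero:
  assumes "\<And>j. j div 2 ^ k = u \<Longrightarrow> f j = 0"
  shows "agg r k f u = 0"
  unfolding agg_eq by (intro sum.neutral) (auto intro: assms)

text \<open>Since \<open>r k\<close> squares to 1, merging siblings changes the sum of squares only
  by cross terms, and these are linear in \<open>r k\<close>.\<close>

lemma agg_sq_Suc:
  assumes "r k = 1 \<or> r k = -1"
  shows "(\<Sum>u<n. (agg r (Suc k) f u)\<^sup>2) =
    (\<Sum>u<2 * n. (agg r k f u)\<^sup>2) + 2 * r k * (\<Sum>u<n. agg r k f (2 * u) * agg r k f (2 * u + 1))"
proof -
  have "r k * r k = 1" using assms by auto
  then have "(agg r (Suc k) f u)\<^sup>2 = (agg r k f (2 * u))\<^sup>2 + (agg r k f (2 * u + 1))\<^sup>2 +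
     2 * r k * (agg r k f (2 * u) * agg r k f (2 * u + 1))" for u
    by (simp add: power2_sum power_mult_distrib power2_eq_square algebra_simps)
  then show ?thesis
    by (simp only: sum_split_pairs sum.distrib sum_distrib_left)
qed

text \<open>
  The derandomized choice of the bits \<open>r k\<close>: the conditional expectation of
  \<open>\<Sum>i. \<kappa> i * (\<nu> i * B + B\<^sup>2 - \<beta>) + \<Sum>j. \<sigma> j * e j\<close>, where \<open>B = \<Sum>j. \<sigma> j * b i j\<close> and
  \<open>\<beta> = \<Sum>j. (b i j)\<^sup>2\<close>, given the first \<open>k\<close> bits of a uniformly random seed.
\<close>

definition cexp :: "nat \<Rightarrow> nat \<Rightarrow> (nat \<Rightarrow> int) \<Rightarrow> (nat \<Rightarrow> int) \<Rightarrow> (nat \<Rightarrow> nat \<Rightarrow> int) \<Rightarrow> (nat \<Rightarrow> int)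
    \<Rightarrow> (nat \<Rightarrow> int) \<Rightarrow> nat \<Rightarrow> int" where
  "cexp I K \<kappa> \<nu> b e r k = (\<Sum>i<I. \<kappa> i * (\<nu> i * agg r k (b i) 0 +
     (\<Sum>u<2 ^ (K - k). (agg r k (b i) u)\<^sup>2) - (\<Sum>u<2 ^ K. (b i u)\<^sup>2))) + agg r k e 0"

text \<open>The coefficient of \<open>r k\<close> in the conditional expectation
  (\<open>cexp_Suc\<close>). Given the first \<open>k\<close> bits, the mean of the linear term only
  sees class 0, since every other index still contains a random sign; for the square, products from
  different classes average to 0 and the squares of the class sums remain. Fixing bit
  \<open>k\<close> merges class 1 into class 0, whence the extra term at \<open>u = 0\<close>.
  Everything is a sum over pairs \<open>(i, u)\<close>, the form that can be distributed over class
  leaders.\<close>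

definition slope :: "nat \<Rightarrow> nat \<Rightarrow> (nat \<Rightarrow> int) \<Rightarrow> (nat \<Rightarrow> int) \<Rightarrow> (nat \<Rightarrow> nat \<Rightarrow> int) \<Rightarrow> (nat \<Rightarrow> int)
    \<Rightarrow> (nat \<Rightarrow> int) \<Rightarrow> nat \<Rightarrow> int" where
  "slope I K \<kappa> \<nu> b e r k = (\<Sum>i<I. \<Sum>u<2 ^ (K - Suc k). \<kappa> i *
      (2 * (agg r k (b i) (2 * u) * agg r k (b i) (2 * u + 1))
       + (if u = 0 then \<nu> i * agg r k (b i) 1 else 0))) + agg r k e 1"

lemma cexp_Suc:
  assumes "r k = 1 \<or> r k = -1" "k < K"
  shows "cexp I K \<kappa> \<nu> b e r (Suc k) = cexp I K \<kappa> \<nu> b e r k + r k * slope I K \<kappa> \<nu> b e r k"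
proof -
  have p: "(2::nat) ^ (K - k) = 2 * 2 ^ (K - Suc k)"
    using assms(2) by (simp flip: power_Suc add: Suc_diff_Suc)
  have z: "(\<Sum>u<(2::nat) ^ (K - Suc k). if u = 0 then c else 0) = (c :: int)" for c
    by (subst sum.delta) auto
  have S: "slope I K \<kappa> \<nu> b e r k = (\<Sum>i<I. \<kappa> i *
      (2 * (\<Sum>u<2 ^ (K - Suc k). agg r k (b i) (2 * u) * agg r k (b i) (2 * u + 1))
       + \<nu> i * agg r k (b i) 1)) + agg r k e 1"
    unfolding slope_def sum_distrib_left[symmetric] sum.distrib z ..
  have "cexp I K \<kappa> \<nu> b e r (Suc k) = (\<Sum>i<I. \<kappa> i * (\<nu> i * agg r k (b i) 0 +
     (\<Sum>u<2 ^ (K - k). (agg r k (b i) u)\<^sup>2) - (\<Sum>u<2 ^ K. (b i u)\<^sup>2)) + r k * (\<kappa> i *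
      (2 * (\<Sum>u<2 ^ (K - Suc k). agg r k (b i) (2 * u) * agg r k (b i) (2 * u + 1))
       + \<nu> i * agg r k (b i) 1))) + (agg r k e 0 + r k * agg r k e 1)"
    unfolding cexp_def agg_sq_Suc[of r k, OF assms(1)] p by (simp add: algebra_simps)
  then show ?thesis unfolding S cexp_def sum.distrib by (simp add: algebra_simps sum_distrib_left)
qed

text \<open>Before any bit is fixed the expectation is 0: the squares cancel, and class 0 of level 0
  is the single index 0, whose coefficients vanish. The sign of index 0 is constantly 1, so it must
  not carry an element. Each bit is then chosen against its slope, which never increases the
  expectation.\<close>

lemma cexp_le:
  assumes "\<And>i. i < I \<Longrightarrow> b i 0 = 0" "e 0 = 0"
    and "\<And>k. k < K \<Longrightarrow> r k = (if 0 < slope I K \<kappa> \<nu> b e r k then -1 else 1)"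
  shows "(\<Sum>i<I. \<kappa> i * (\<nu> i * agg r K (b i) 0 + (agg r K (b i) 0)\<^sup>2 - (\<Sum>u<2 ^ K. (b i u)\<^sup>2)))
    + (\<Sum>j<2 ^ K. sg r K j * e j) \<le> 0"
proof -
  have "cexp I K \<kappa> \<nu> b e r k \<le> 0" if "k \<le> K" for k
    using that
  proof (induction k)
    case 0
    then show ?case using assms(1,2) by (simp add: cexp_def)
  next
    case (Suc k)
    then have "r k * slope I K \<kappa> \<nu> b e r k \<le> 0" and "r k = 1 \<or> r k = -1"
      using assms(3)[of k] by auto
    then show ?case using cexp_Suc[of r k K I \<kappa> \<nu> b e] Suc by simp
  qed
  from this[of K] show ?thesis by (simp add: cexp_def agg_full)
qed

text \<open>The choice of bit \<open>k\<close> depends on the earlier bits only, so a seed may be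
  completed arbitrarily beyond the bits fixed so far.\<close>

lemma slope_cong:
  assumes "\<And>l. l < k \<Longrightarrow> r l = r' l"
  shows "slope I K \<kappa> \<nu> b e r k = slope I K \<kappa> \<nu> b e r' k"
proof -
  have "agg r k f u = agg r' k f u" for f u by (rule agg_cong[OF assms])
  then show ?thesis by (simp only: slope_def)
qed

section \<open>Nonempty classes and their least elements\<close>

definition leader :: "(nat \<Rightarrow> nat set) \<Rightarrow> nat \<Rightarrow> nat \<Rightarrow> nat \<Rightarrow> bool" where
  "leader D k i j \<longleftrightarrow> (\<forall>j'\<in>D i. j' div 2 ^ k = j div 2 ^ k \<longrightarrow> j \<le> j')"

definition occ :: "(nat \<Rightarrow> nat set) \<Rightarrow> nat \<Rightarrow> nat \<Rightarrow> nat \<Rightarrow> bool" where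
  "occ D k i u \<longleftrightarrow> (\<exists>j\<in>D i. j div 2 ^ k = u)"

lemma leader_0: "leader D 0 i j"
  by (simp add: leader_def)

lemma div_pow_Suc: "(j :: nat) div 2 ^ Suc k = j div 2 ^ k div 2"
  by (simp add: div_mult2_eq power_Suc2 del: power_Suc)

text \<open>The least element of a node stays the least one of the parent, except in a right child
  whose left sibling is occupied: all indices of the left child are smaller. So the flags of the
  next level need a single look at the sibling.\<close>

lemma leader_Suc:
  "leader D (Suc k) i j \<longleftrightarrow> leader D k i j \<and> \<not> (odd (j div 2 ^ k) \<and> occ D k i (j div 2 ^ k - 1))"
proof (intro iffI conjI notI)
  assume L: "leader D (Suc k) i j"
  then show "leader D k i j" unfolding leader_def div_pow_Suc by metis
  assume "odd (j div 2 ^ k) \<and> occ D k i (j div 2 ^ k - 1)"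
  then obtain j' where j': "j' \<in> D i" "j' div 2 ^ k = j div 2 ^ k - 1" and o: "odd (j div 2 ^ k)"
    by (auto simp: occ_def)
  then have "j' div 2 ^ Suc k = j div 2 ^ Suc k" unfolding div_pow_Suc
    by (auto elim!: oddE)
  then have "j \<le> j'" using L j' by (auto simp: leader_def)
  then have "j div 2 ^ k \<le> j' div 2 ^ k" by (rule div_le_mono)
  then show False using j' o by (auto elim!: oddE)
next
  assume A: "leader D k i j \<and> \<not> (odd (j div 2 ^ k) \<and> occ D k i (j div 2 ^ k - 1))"
  show "leader D (Suc k) i j" unfolding leader_def
  proof (intro ballI impI)
    fix j' assume j': "j' \<in> D i" "j' div 2 ^ Suc k = j div 2 ^ Suc k"
    let ?v = "j' div 2 ^ k" and ?u = "j div 2 ^ k"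
    \<comment> \<open>Two nodes with the same parent are equal or siblings; if \<open>v\<close> is
      neither \<open>w\<close> nor its left sibling, it is its right sibling and hence
      larger.\<close>
    have g: "v = w \<or> odd w \<and> v = w - 1 \<or> w < v" if "v div 2 = w div 2" for v w :: nat
    proof -
      have "v = 2 * (w div 2) + v mod 2" "w = 2 * (w div 2) + w mod 2" "v mod 2 < 2" "w mod 2 < 2"
        using that mult_div_mod_eq[of 2 v] mult_div_mod_eq[of 2 w] by simp_all
      then show ?thesis unfolding odd_iff_mod_2_eq_one by linarith
    qed
    have "?v div 2 = ?u div 2" using j'(2) by (simp only: div_pow_Suc)
    from g[OF this] have "?v = ?u \<or> odd ?u \<and> ?v = ?u - 1 \<or> ?u < ?v" .
    moreover have "j \<le> j'" if "?v = ?u" using A j' that by (auto simp: leader_def)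
    moreover have False if "odd ?u \<and> ?v = ?u - 1" using A j' that by (auto simp: occ_def)
    moreover have "j \<le> j'" if "?u < ?v" using that div_le_mono[of j' j "2 ^ k"] by linarith
    ultimately show "j \<le> j'" by blast
  qed
qed

text \<open>Every nonempty class has exactly one leader and the empty classes contribute 0. A sum
  over all pairs of a set and a class therefore costs only one term per position \<open>q\<close>,
  linear in the input even though the classes may be far more numerous.\<close>

lemma sum_leaders:
  fixes F :: "nat \<Rightarrow> nat \<Rightarrow> int"
  assumes bij: "bij_betw (\<lambda>q. (ow q, el q)) {..<N} (SIGMA i:{..<I}. D i)"
    and fin: "\<And>i. i < I \<Longrightarrow> finite (D i)"
    and zero: "\<And>i u. i < I \<Longrightarrow> \<not> occ D k i u \<Longrightarrow> F i u = 0"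
    and n: "\<And>i j. i < I \<Longrightarrow> j \<in> D i \<Longrightarrow> j div 2 ^ k < n"
  shows "(\<Sum>q<N. (if leader D k (ow q) (el q) then 1 else 0) * F (ow q) (el q div 2 ^ k))
    = (\<Sum>i<I. \<Sum>u<n. F i u)"
proof -
  have "(\<Sum>q<N. (if leader D k (ow q) (el q) then 1 else 0) * F (ow q) (el q div 2 ^ k))
    = (\<Sum>(i, j)\<in>(SIGMA i:{..<I}. D i). (if leader D k i j then 1 else 0) * F i (j div 2 ^ k))"
    using sum.reindex_bij_betw[OF bij, of "\<lambda>(i, j). (if leader D k i j then 1 else 0) * F i (j div 2 ^ k)"]
    by simp
  also have "\<dots> = (\<Sum>i<I. \<Sum>j\<in>D i. (if leader D k i j then 1 else 0) * F i (j div 2 ^ k))"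
    by (rule sum.Sigma[symmetric]) (use fin in auto)
  also have "\<dots> = (\<Sum>i<I. \<Sum>u<n. F i u)"
  proof (rule sum.cong[OF refl])
    fix i assume "i \<in> {..<I}"
    then have i: "i < I" by simp
    let ?L = "{j \<in> D i. leader D k i j}"
    have "(\<Sum>j\<in>D i. (if leader D k i j then 1 else 0) * F i (j div 2 ^ k)) = (\<Sum>j\<in>?L. F i (j div 2 ^ k))"
      using fin[OF i] by (subst sum.inter_filter) (auto intro!: sum.cong)
    also have "\<dots> = (\<Sum>u\<in>(\<lambda>j. j div 2 ^ k) ` ?L. F i u)"
      by (subst sum.reindex) (auto simp: inj_on_def leader_def intro!: antisym)
    also have "\<dots> = (\<Sum>u<n. F i u)"
    proof (rule sum.mono_neutral_left)
      show "\<forall>u\<in>{..<n} - (\<lambda>j. j div 2 ^ k) ` ?L. F i u = 0"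
      proof
        fix u assume u: "u \<in> {..<n} - (\<lambda>j. j div 2 ^ k) ` ?L"
        have "\<not> occ D k i u"
        proof
          assume "occ D k i u"
          then have ne: "{j \<in> D i. j div 2 ^ k = u} \<noteq> {}" by (auto simp: occ_def)
          have f: "finite {j \<in> D i. j div 2 ^ k = u}" using fin[OF i] by simp
          let ?j = "Min {j \<in> D i. j div 2 ^ k = u}"
          have m: "?j \<in> D i" "?j div 2 ^ k = u" using Min_in[OF f ne] by auto
          have "leader D k i ?j" unfolding leader_def
            using Min_le[OF f] m(2) by auto
          then have "u \<in> (\<lambda>j. j div 2 ^ k) ` ?L" using m by (intro image_eqI[of _ _ ?j]) auto
          then show False using u by blast
        qed
        then show "F i u = 0" using zero i by blast
      qed
    qed (use n[OF i] in auto)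
    finally show "(\<Sum>j\<in>D i. (if leader D k i j then 1 else 0) * F i (j div 2 ^ k)) = (\<Sum>u<n. F i u)" .
  qed
  finally show ?thesis .
qed

section \<open>The random walk of the fractional values\<close>

lemma exp_le_quad: "\<bar>x :: real\<bar> \<le> 1 \<Longrightarrow> exp x \<le> 1 + x + x\<^sup>2"
proof (cases "0 \<le> x")
  case False
  assume "\<bar>x\<bar> \<le> 1"
  define y where "y = - x"
  have y: "0 < y" using False by (simp add: y_def)
  \<comment> \<open>For \<open>x = - y\<close> the claim says that this product is at least 1.
    Replacing \<open>exp y\<close> by \<open>1 + y\<close> suffices, because the product then
    becomes \<open>1 + y ^ 3\<close>.\<close>
  have "exp y * (1 - y + y\<^sup>2) \<ge> (1 + y) * (1 - y + y\<^sup>2)"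
  proof (rule mult_right_mono)
    have "0 \<le> (1 - y / 2)\<^sup>2 + 3 / 4 * y\<^sup>2" by simp
    also have "\<dots> = 1 - y + y\<^sup>2" by (simp add: power2_eq_square field_simps)
    finally show "0 \<le> 1 - y + y\<^sup>2" .
  qed (rule exp_ge_add_one_self)
  moreover have "(1 + y) * (1 - y + y\<^sup>2) = 1 + y ^ 3"
    by (simp add: power2_eq_square power3_eq_cube algebra_simps)
  moreover have "0 < y ^ 3" using y by simp
  ultimately have "1 \<le> exp y * (1 - y + y\<^sup>2)" by linarith
  then show ?thesis by (simp add: y_def exp_minus field_simps)
qed (use exp_bound in auto)

text \<open>If \<open>b\<close> has mean 0 and \<open>b\<^sup>2\<close> has mean \<beta>, the
  right-hand side has mean 1: subtracting 2\<beta> in the exponent turns the exponential into a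
  supermartingale with one \<beta> to spare for third-order terms. The bounds 1/8 are what makes the
  factor \<open>1 + 4 * b - 4 * \<beta>\<close> nonnegative.\<close>

lemma exp_drift_le:
  fixes b \<beta> :: real
  assumes "\<bar>b\<bar> \<le> 1 / 8" "0 \<le> \<beta>" "\<beta> \<le> 1 / 8"
  shows "exp (b - 2 * \<beta>) \<le> 1 + b + b\<^sup>2 - \<beta>"
proof -
  have "exp (b - 2 * \<beta>) \<le> 1 + (b - 2 * \<beta>) + (b - 2 * \<beta>)\<^sup>2"
    by (rule exp_le_quad) (use assms in auto)
  also have "\<dots> = 1 + b + b\<^sup>2 - \<beta> - \<beta> * (1 + 4 * b - 4 * \<beta>)"
    by (simp add: power2_eq_square algebra_simps)
  also have "\<dots> \<le> 1 + b + b\<^sup>2 - \<beta>" using assms by (simp add: mult_nonneg_nonneg)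
  finally show ?thesis .
qed

lemma sum_squares_le: "finite A \<Longrightarrow> (\<And>x. x \<in> A \<Longrightarrow> 0 \<le> f x) \<Longrightarrow> (\<Sum>x\<in>A. (f x)\<^sup>2) \<le> (\<Sum>x\<in>A. f x)\<^sup>2"
  for f :: "'a \<Rightarrow> int"
proof (induction A rule: finite_induct)
  case (insert x A)
  have "0 \<le> f x * sum f A" using insert by (intro mult_nonneg_nonneg sum_nonneg) auto
  then show ?case using insert by (simp add: power2_sum)
qed simp

text \<open>
  The state of an element is a pair \<open>(y, c)\<close> and represents the fractional value
  \<open>y * c\<^sup>2 / (16 * E * cm\<^sup>2)\<close>.  An active element moves by one unit in \<open>y\<close>; on reaching a
  boundary of its level it is renormalized to \<open>y = 4 * E\<close>, so that the step \<open>c\<^sup>2\<close> stays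
  proportional to the value.
\<close>

definition active :: "int \<Rightarrow> int \<Rightarrow> bool" where
  "active E y \<longleftrightarrow> 0 < y \<and> y < 16 * E"

definition moved :: "int \<Rightarrow> int \<Rightarrow> int \<Rightarrow> int" where
  "moved E s y = y + s * of_bool (active E y)"

definition level_up :: "int \<Rightarrow> int \<Rightarrow> int \<Rightarrow> int \<Rightarrow> bool" where
  "level_up E cm y c \<longleftrightarrow> y = 16 * E \<and> c < cm"

definition level_down :: "int \<Rightarrow> int \<Rightarrow> int \<Rightarrow> bool" where
  "level_down E y c \<longleftrightarrow> y = E \<and> 1 < c"

text \<open>Both renormalizations lead to \<open>4 * E\<close> and keep the value:
  \<open>16 * E * c\<^sup>2 = 4 * E * (2 * c)\<^sup>2\<close>, and
  \<open>E * c\<^sup>2 = 4 * E * (c / 2)\<^sup>2\<close> for even \<open>c\<close>. Case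
  distinctions are written as multiplication by 0 or 1, as in the expressions of the
  program.\<close>

definition next_y :: "int \<Rightarrow> int \<Rightarrow> int \<Rightarrow> int \<Rightarrow> int \<Rightarrow> int" where
  "next_y E cm s y c = moved E s y - 12 * E * of_bool (level_up E cm (moved E s y) c)
     + 3 * E * of_bool (level_down E (moved E s y) c)"

definition next_c :: "int \<Rightarrow> int \<Rightarrow> int \<Rightarrow> int \<Rightarrow> int \<Rightarrow> int" where
  "next_c E cm s y c = c + c * of_bool (level_up E cm (moved E s y) c)
     - c div 2 * of_bool (level_down E (moved E s y) c)"

text \<open>Absorption happens only at the ends of the unit interval: \<open>y = 16 * E\<close>
  forces the top level \<open>c = cm\<close> (value 1), and \<open>y = 0\<close> forces the bottom
  level \<open>c = 1\<close> (value 0), since above the bottom \<open>y\<close> stays larger than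
  \<open>E\<close>.\<close>

definition valid :: "int \<Rightarrow> int \<Rightarrow> int \<Rightarrow> int \<Rightarrow> bool" where
  "valid E cm y c \<longleftrightarrow> 0 \<le> y \<and> y \<le> 16 * E \<and> (\<exists>e :: nat. c = 2 ^ e) \<and> c \<le> cm
     \<and> (1 < c \<longrightarrow> E < y) \<and> (y = 16 * E \<longrightarrow> c = cm)"

text \<open>A concave parabola whose second difference is -2, so an unbiased move lowers it by 1 on
  average. Its values at \<open>E\<close>, \<open>4 * E\<close> and \<open>16 * E\<close> are 99,
  192 and 384 times \<open>E * E\<close>: twice 192 is 384 and half of 192 is at most 99, so
  \<open>c * shape E y\<close> does not grow when \<open>c\<close> is doubled or halved. On
  \<open>[0, 16 * E]\<close> it is at most \<open>384 * E * E\<close>.\<close>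

definition shape :: "int \<Rightarrow> int \<Rightarrow> int" where
  "shape E y = - (y * y) + 36 * E * y + 64 * E * E"

text \<open>As the value scales with \<open>c\<^sup>2\<close>, the factor \<open>c\<close> makes
  this behave like the square root of the value across the levels, which is what keeps it concave
  globally.\<close>

definition liveness :: "int \<Rightarrow> int \<Rightarrow> int \<Rightarrow> int" where
  "liveness E y c = of_bool (active E y) * (c * shape E y)"

lemma pow2_double_le:
  assumes "c = 2 ^ (e :: nat)" "cm = 2 ^ (e' :: nat)" "c < (cm :: int)"
  shows "2 * c \<le> cm"
proof -
  have "e < e'" using assms by simp
  then have "(2 :: int) ^ Suc e \<le> 2 ^ e'" by (intro power_increasing) auto
  then show ?thesis using assms by simp
qed

lemma pow2_half:
  assumes "c = 2 ^ (e :: nat)" "1 < (c :: int)"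
  obtains e' where "c = 2 * 2 ^ e'" "c div 2 = 2 ^ (e' :: nat)"
proof (cases e)
  case (Suc e')
  then show ?thesis using assms that[of e'] by simp
qed (use assms in auto)

text \<open>The two renormalizations exclude each other because \<open>E\<close> and
  \<open>16 * E\<close> differ, and without one, reaching \<open>16 * E\<close> means
  \<open>c = cm\<close>.\<close>

lemma step_cases:
  assumes v: "valid E cm y c" and E: "1 \<le> E" and cm: "cm = 2 ^ (e0 :: nat)" and s: "s = 1 \<or> s = -1"
  obtains (stuck) "\<not> active E y" "next_y E cm s y c = y" "next_c E cm s y c = c"
    | (move) "active E y" "next_y E cm s y c = y + s" "next_c E cm s y c = c"
        "y + s = 16 * E \<Longrightarrow> c = cm" "1 < c \<Longrightarrow> E < y + s" "0 \<le> y + s" "y + s \<le> 16 * E"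
    | (up) "active E y" "next_y E cm s y c = 4 * E" "next_c E cm s y c = 2 * c" "y + s = 16 * E" "c < cm"
    | (down) e where "active E y" "next_y E cm s y c = 4 * E" "next_c E cm s y c = 2 ^ e" "y + s = E" "c = 2 * 2 ^ e"
proof (cases "active E y")
  case False
  then have "\<not> level_up E cm y c" "\<not> level_down E y c"
    using v E by (auto simp: valid_def active_def level_up_def level_down_def)
  then show ?thesis using stuck False by (simp add: next_y_def next_c_def moved_def)
next
  case True
  then have m: "moved E s y = y + s" by (simp add: moved_def)
  consider "level_up E cm (y + s) c" | "\<not> level_up E cm (y + s) c" "level_down E (y + s) c"
    | "\<not> level_up E cm (y + s) c" "\<not> level_down E (y + s) c" by blast
  then show ?thesis
  proof cases
    case 1
    then have "\<not> level_down E (y + s) c" using E by (auto simp: level_up_def level_down_def)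
    then show ?thesis using up True 1 m by (simp add: next_y_def next_c_def level_up_def)
  next
    case 2
    obtain e where "c = 2 ^ e" using v by (auto simp: valid_def)
    then obtain e' where "c = 2 * 2 ^ e'" "c div 2 = 2 ^ e'"
      using pow2_half[of c e] 2 by (auto simp: level_down_def)
    then show ?thesis using down[of e'] True 2 m by (simp add: next_y_def next_c_def level_down_def)
  next
    case 3
    have "y + s = 16 * E \<Longrightarrow> c = cm" using 3 v by (auto simp: valid_def level_up_def)
    moreover have "E < y + s" if "1 < c"
    proof -
      have "E < y" using v that by (simp add: valid_def)
      moreover have "y + s \<noteq> E" using 3 that by (auto simp: level_down_def)
      ultimately show ?thesis using s by auto
    qed
    moreover have "0 \<le> y + s" "y + s \<le> 16 * E" using True s by (auto simp: active_def)
    ultimately show ?thesis using move True 3 m by (simp add: next_y_def next_c_def)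
  qed
qed

lemma shape_pos: "1 \<le> E \<Longrightarrow> 0 \<le> y \<Longrightarrow> y \<le> 16 * E \<Longrightarrow> 1 \<le> shape E y"
proof -
  assume a: "1 \<le> E" "0 \<le> y" "y \<le> 16 * E"
  have "0 \<le> y * (36 * E - y)" using a by (intro mult_nonneg_nonneg) auto
  moreover have "1 \<le> E * E" using mult_mono[of 1 E 1 E] a by simp
  ultimately show ?thesis by (simp add: shape_def algebra_simps)
qed

lemma shape_le: "1 \<le> E \<Longrightarrow> 0 \<le> y \<Longrightarrow> y \<le> 16 * E \<Longrightarrow> shape E y \<le> 384 * E * E"
proof -
  assume a: "1 \<le> E" "0 \<le> y" "y \<le> 16 * E"
  have "0 \<le> (16 * E - y) * (20 * E - y)" using a by (intro mult_nonneg_nonneg) auto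
  then show ?thesis by (simp add: shape_def algebra_simps)
qed

lemma shape_move: "s = 1 \<or> s = -1 \<Longrightarrow> shape E (y + s) = shape E y + s * (36 * E - 2 * y) - 1"
  by (auto simp: shape_def algebra_simps)

text \<open>The value changes by exactly the sign times \<open>c\<^sup>2\<close>, also across a
  renormalization. Liveness obeys the move formula of the parabola as an inequality, because
  renormalization and absorption can only lower it.\<close>

lemma step_facts:
  assumes v: "valid E cm y c" and E: "1 \<le> E" and cm: "cm = 2 ^ (e0 :: nat)" and s: "s = 1 \<or> s = -1"
  shows step_valid: "valid E cm (next_y E cm s y c) (next_c E cm s y c)"
    and step_value: "next_y E cm s y c * (next_c E cm s y c)\<^sup>2 = y * c\<^sup>2 + s * (of_bool (active E y) * c\<^sup>2)"
    and step_liveness: "liveness E (next_y E cm s y c) (next_c E cm s y c)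
      \<le> of_bool (active E y) * (c * (shape E y + s * (36 * E - 2 * y) - 1))"
proof -
  obtain e where e: "c = 2 ^ e" using v by (auto simp: valid_def)
  have c: "1 \<le> c" unfolding e by simp
  have EE: "0 \<le> E * E" by simp
  have "valid E cm (next_y E cm s y c) (next_c E cm s y c) \<and>
    next_y E cm s y c * (next_c E cm s y c)\<^sup>2 = y * c\<^sup>2 + s * (of_bool (active E y) * c\<^sup>2) \<and>
    liveness E (next_y E cm s y c) (next_c E cm s y c)
      \<le> of_bool (active E y) * (c * (shape E y + s * (36 * E - 2 * y) - 1))"
    using v E cm s
  proof (cases rule: step_cases)
    case stuck
    then show ?thesis using v by (simp add: liveness_def)
  next
    case move
    have "valid E cm (y + s) c" using move v by (auto simp: valid_def)
    moreover have "(y + s) * c\<^sup>2 = y * c\<^sup>2 + s * c\<^sup>2" by (simp add: algebra_simps)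
    moreover have "liveness E (y + s) c \<le> c * shape E (y + s)"
      using shape_pos[OF E move(6,7)] c by (simp add: liveness_def)
    ultimately show ?thesis using move(1-3) shape_move[OF s, of E y] by simp
  next
    case up
    have "2 * c \<le> cm" using pow2_double_le[OF e cm up(5)] .
    moreover have "\<exists>e. 2 * c = 2 ^ e" unfolding e by (metis power_Suc)
    ultimately have "valid E cm (4 * E) (2 * c)" using E c by (auto simp: valid_def)
    moreover have "4 * E * (2 * c)\<^sup>2 = (y + s) * c\<^sup>2" unfolding up(4) by (simp add: power_mult_distrib)
    then have "4 * E * (2 * c)\<^sup>2 = y * c\<^sup>2 + s * c\<^sup>2" by (simp add: algebra_simps)
    moreover have "liveness E (4 * E) (2 * c) \<le> c * shape E (y + s)" unfolding up(4)
      using E by (simp add: liveness_def active_def shape_def)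
    ultimately show ?thesis using up(1-3) shape_move[OF s, of E y] by simp
  next
    case (down e')
    have "valid E cm (4 * E) (2 ^ e')" using E c v down(5) by (auto simp: valid_def)
    moreover have "4 * E * (2 ^ e')\<^sup>2 = (y + s) * c\<^sup>2" unfolding down(4,5) by (simp add: power_mult_distrib)
    then have "4 * E * (2 ^ e')\<^sup>2 = y * c\<^sup>2 + s * c\<^sup>2" by (simp add: algebra_simps)
    moreover have "liveness E (4 * E) (2 ^ e') \<le> c * shape E (y + s)" unfolding down(4) down(5)
      using E mult_left_mono[OF EE, of "2 ^ e'"] by (simp add: liveness_def active_def shape_def)
    ultimately show ?thesis using down(1-3) shape_move[OF s, of E y] by simp
  qed
  then show "valid E cm (next_y E cm s y c) (next_c E cm s y c)"
    "next_y E cm s y c * (next_c E cm s y c)\<^sup>2 = y * c\<^sup>2 + s * (of_bool (active E y) * c\<^sup>2)"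
    "liveness E (next_y E cm s y c) (next_c E cm s y c)
      \<le> of_bool (active E y) * (c * (shape E y + s * (36 * E - 2 * y) - 1))" by auto
qed

text \<open>An integer version of \<open>G * (1 + 1 / G) ^ t\<close>. Since \<open>shape\<close> is
  at most \<open>G\<close>, the unit that an active element loses on average is at least a fraction
  1/G of its shape, so the weight may grow by that fraction per round. Starting at \<open>G\<close>
  keeps the rounded quotient positive.\<close>

primrec om :: "int \<Rightarrow> nat \<Rightarrow> int" where
  "om G 0 = G"
| "om G (Suc t) = om G t + om G t div G"

lemma om_ge: "1 \<le> G \<Longrightarrow> G \<le> om G t"
  by (induction t) (auto simp: pos_imp_zdiv_nonneg_iff intro: add_increasing2)

text \<open>Rounding a quotient that is at least 1 down loses at most half of it, so half of the
  intended growth rate remains.\<close>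

lemma om_lower:
  assumes "1 \<le> G"
  shows "real_of_int G * (1 + 1 / (2 * real_of_int G)) ^ t \<le> real_of_int (om G t)"
proof (induction t)
  case (Suc t)
  let ?o = "om G t"
  have "?o = G * (?o div G) + ?o mod G" by simp
  moreover have "?o mod G < G" using assms by simp
  moreover have "G \<le> ?o" using om_ge[OF assms] .
  moreover have "1 \<le> ?o div G" using \<open>G \<le> ?o\<close> zdiv_mono1[of G ?o G] assms by simp
  then have "G * 1 \<le> G * (?o div G)" using assms by (intro mult_left_mono) auto
  ultimately have "?o \<le> 2 * (G * (?o div G))" by linarith
  then have "real_of_int ?o \<le> real_of_int (2 * (G * (?o div G)))" by (simp only: of_int_le_iff)
  then have "real_of_int ?o \<le> 2 * real_of_int G * real_of_int (?o div G)" by simp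
  then have "real_of_int ?o / (2 * real_of_int G) \<le> real_of_int (?o div G)"
    using assms by (simp add: field_simps)
  then have "real_of_int ?o * (1 + 1 / (2 * real_of_int G)) \<le> real_of_int (om G (Suc t))"
    by (simp add: algebra_simps)
  moreover have "real_of_int G * (1 + 1 / (2 * real_of_int G)) ^ Suc t
      \<le> real_of_int ?o * (1 + 1 / (2 * real_of_int G))"
    using mult_right_mono[OF Suc, of "1 + 1 / (2 * real_of_int G)"] assms by (simp add: mult_ac)
  ultimately show ?case by linarith
qed simp

lemma om_upper:
  assumes "1 \<le> G"
  shows "real_of_int (om G t) \<le> real_of_int G * (1 + 1 / real_of_int G) ^ t"
proof (induction t)
  case (Suc t)
  let ?o = "om G t"
  have "real_of_int (?o div G) \<le> real_of_int ?o / real_of_int G" by (rule real_of_int_div4)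
  then have "real_of_int (om G (Suc t)) \<le> real_of_int ?o * (1 + 1 / real_of_int G)"
    by (simp add: algebra_simps)
  also have "\<dots> \<le> real_of_int G * (1 + 1 / real_of_int G) ^ t * (1 + 1 / real_of_int G)"
    using Suc assms by (intro mult_right_mono) auto
  finally show ?case by (simp add: mult_ac)
qed simp

text \<open>By Bernoulli's inequality \<open>2 * G\<close> rounds at least double the
  weight.\<close>

lemma om_large:
  assumes "1 \<le> G"
  shows "2 ^ k \<le> om G (2 * nat G * k)"
proof -
  let ?x = "1 + 1 / (2 * real_of_int G)"
  have "1 + real (2 * nat G) * (1 / (2 * real_of_int G)) \<le> ?x ^ (2 * nat G)"
    by (rule Bernoulli_inequality) (use assms in \<open>auto simp: field_simps\<close>)
  then have "2 \<le> ?x ^ (2 * nat G)" using assms by simp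
  then have "2 ^ k \<le> (?x ^ (2 * nat G)) ^ k" by (intro power_mono) auto
  also have "\<dots> = ?x ^ (2 * nat G * k)" by (simp add: power_mult)
  also have "\<dots> \<le> real_of_int G * ?x ^ (2 * nat G * k)"
    using assms mult_right_mono[of 1 "real_of_int G" "?x ^ (2 * nat G * k)"] by simp
  also have "\<dots> \<le> real_of_int (om G (2 * nat G * k))" by (rule om_lower[OF assms])
  finally have "real_of_int (2 ^ k) \<le> real_of_int (om G (2 * nat G * k))" by simp
  then show ?thesis by (simp only: of_int_le_iff)
qed

lemma om_mono: "1 \<le> G \<Longrightarrow> t \<le> t' \<Longrightarrow> om G t \<le> om G t'"
proof (rule lift_Suc_mono_le[of "om G"])
  fix t assume "1 \<le> G"
  then have "0 \<le> om G t div G" using om_ge[of G t] by (simp add: pos_imp_zdiv_nonneg_iff)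
  then show "om G t \<le> om G (Suc t)" by simp
qed

text \<open>The matching upper bound, which keeps the weight within a word: \<open>G\<close> rounds
  multiply it by at most \<open>exp 1\<close>, hence by less than 4.\<close>

lemma om_small:
  assumes "1 \<le> G" "t \<le> nat G * k"
  shows "om G t \<le> G * 4 ^ k"
proof -
  let ?x = "1 + 1 / real_of_int G"
  have "?x \<le> exp (1 / real_of_int G)" by (rule exp_ge_add_one_self)
  then have "?x ^ nat G \<le> exp (1 / real_of_int G) ^ nat G" using assms by (intro power_mono) auto
  also have "\<dots> = exp 1" using assms by (simp add: exp_of_nat_mult[symmetric])
  also have "\<dots> \<le> 4" using exp_le by linarith
  finally have "(?x ^ nat G) ^ k \<le> 4 ^ k" using assms by (intro power_mono) auto
  then have "real_of_int G * ?x ^ (nat G * k) \<le> real_of_int G * 4 ^ k"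
    using assms by (intro mult_left_mono) (auto simp: power_mult)
  then have "real_of_int (om G (nat G * k)) \<le> real_of_int (G * 4 ^ k)"
    using om_upper[OF assms(1), of "nat G * k"] by simp
  then show ?thesis using om_mono[OF assms] by (simp only: of_int_le_iff)
qed


text \<open>\<open>SL i\<close> is a signed 1/\<lambda>, measured in the units of
  \<open>y * c\<^sup>2\<close>, where the value 1 is \<open>16 * E * cm\<^sup>2\<close>. Every set
  occurs with both signs (\<open>mirror\<close>), one per tail. \<open>SL_scale\<close> makes a
  single element small against 1/\<lambda>, \<open>SL_step\<close> bounds the movement of the whole
  set in one round, and \<open>SL_dev\<close> makes \<open>K\<close> times 1/\<lambda> a tenth of
  the initial mass at most.\<close>

locale walk =
  fixes n I K :: nat and E cm y0 :: int and SL :: "nat \<Rightarrow> int" and D :: "nat \<Rightarrow> nat set"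
  assumes K_ge: "10 \<le> K" and I_ge: "1 \<le> I" and I_le: "I \<le> 2 ^ K" and n_less: "n < 2 ^ K"
    and D_sub: "i < I \<Longrightarrow> D i \<subseteq> {1..n}"
    and E_ge: "1 \<le> E" and E_le: "E \<le> 2 ^ K" and cm_pow: "\<exists>e :: nat. cm = 2 ^ e" and cm_le: "cm \<le> 2 ^ K"
    and y0_ge: "4 * E \<le> y0" and y0_le: "y0 \<le> 16 * E" and y0_eq: "y0 = 16 * E \<Longrightarrow> cm = 1"
    and SL_scale: "i < I \<Longrightarrow> 640 * E * cm\<^sup>2 \<le> \<bar>SL i\<bar>"
    and SL_step: "i < I \<Longrightarrow> 29 * int (card (D i)) * y0 \<le> E * \<bar>SL i\<bar>"
    and SL_dev: "i < I \<Longrightarrow> 10 * int K * \<bar>SL i\<bar> \<le> int (card (D i)) * y0"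
    and SL_le: "i < I \<Longrightarrow> \<bar>SL i\<bar> \<le> 2 ^ (3 * K)"
    and mirror: "i < I \<Longrightarrow> \<exists>i'<I. D i' = D i \<and> SL i' = - SL i"
begin

text \<open>The integer that represents the fractional value 1.\<close>

definition U :: int where "U = 16 * E * cm\<^sup>2"
definition G :: int where "G = 384 * E * E"
text \<open>\<open>2 * G\<close> rounds double \<open>om\<close>, and \<open>25 * K\<close>
  doublings push it beyond every value that the potential permits.\<close>

definition steps :: nat where "steps = 50 * nat G * K"
text \<open>The common starting scale of the exponential potentials. Rounding costs at most
  \<open>SL i ^ 4\<close>, hence \<open>2 ^ (12 * K)\<close>, per set and round, over at most
  \<open>2 ^ (5 * K)\<close> rounds; \<open>2 ^ (20 * K)\<close> dwarfs the total.\<close>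

definition F0 :: int where "F0 = 2 ^ (20 * K)"

definition mass :: "nat \<Rightarrow> (nat \<Rightarrow> int) \<Rightarrow> (nat \<Rightarrow> int) \<Rightarrow> int" where
  "mass i y c = (\<Sum>j\<in>D i. y j * (c j)\<^sup>2)"

definition energy :: "nat \<Rightarrow> (nat \<Rightarrow> int) \<Rightarrow> (nat \<Rightarrow> int) \<Rightarrow> int" where
  "energy i y c = (\<Sum>j\<in>D i. (y j * (c j)\<^sup>2)\<^sup>2)"

text \<open>The logarithm of the Chernoff potential; the sign of \<open>SL i\<close> selects the tail.\<close>

definition \<Psi> :: "nat \<Rightarrow> (nat \<Rightarrow> int) \<Rightarrow> (nat \<Rightarrow> int) \<Rightarrow> real" where
  "\<Psi> i y c = mass i y c / SL i - 4 * energy i y c / (real_of_int (SL i))\<^sup>2"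

text \<open>The coefficient of sign \<open>j\<close> in the change of \<open>\<Psi> i\<close>,
  multiplied by the square of \<open>SL i\<close>. The 8 is twice the 4 in \<open>\<Psi>\<close>,
  from the mixed term when the square of the value is expanded.\<close>

definition coef :: "(nat \<Rightarrow> int) \<Rightarrow> (nat \<Rightarrow> int) \<Rightarrow> nat \<Rightarrow> nat \<Rightarrow> int" where
  "coef y c i j = of_bool (j \<in> D i \<and> active E (y j)) * ((c j)\<^sup>2 * (SL i - 8 * (y j * (c j)\<^sup>2)))"

definition drift :: "int \<Rightarrow> (nat \<Rightarrow> int) \<Rightarrow> (nat \<Rightarrow> int) \<Rightarrow> nat \<Rightarrow> int" where
  "drift w y c j = of_bool (j \<in> {1..n} \<and> active E (y j)) * (w * (c j * (36 * E - 2 * y j)))"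

definition new_y :: "(nat \<Rightarrow> int) \<Rightarrow> (nat \<Rightarrow> int) \<Rightarrow> (nat \<Rightarrow> int) \<Rightarrow> nat \<Rightarrow> int" where
  "new_y r y c j = next_y E cm (sg r K j) (y j) (c j)"

definition new_c :: "(nat \<Rightarrow> int) \<Rightarrow> (nat \<Rightarrow> int) \<Rightarrow> (nat \<Rightarrow> int) \<Rightarrow> nat \<Rightarrow> int" where
  "new_c r y c j = next_c E cm (sg r K j) (y j) (c j)"

text \<open>\<open>SL i ^ 4\<close> times the polynomial \<open>1 + b + b\<^sup>2 - \<beta>\<close>
  of \<open>exp_drift_le\<close>, with the denominators cleared.\<close>

definition factor :: "nat \<Rightarrow> int \<Rightarrow> int \<Rightarrow> int" where
  "factor i b w = SL i ^ 4 + (SL i)\<^sup>2 * b + b\<^sup>2 - w"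

text \<open>The added 1 makes the quotient an upper bound, so the integer weight continues to
  dominate the exponential potential.\<close>

definition new_\<kappa> :: "(nat \<Rightarrow> int) \<Rightarrow> (nat \<Rightarrow> int) \<Rightarrow> (nat \<Rightarrow> int) \<Rightarrow> (nat \<Rightarrow> int) \<Rightarrow> nat \<Rightarrow> int" where
  "new_\<kappa> r \<kappa> y c i =
     \<kappa> i * factor i (agg r K (coef y c i) 0) (agg (\<lambda>_. 1) K (\<lambda>j. (coef y c i j)\<^sup>2) 0) div SL i ^ 4 + 1"

definition potential :: "nat \<Rightarrow> (nat \<Rightarrow> int) \<Rightarrow> (nat \<Rightarrow> int) \<Rightarrow> (nat \<Rightarrow> int) \<Rightarrow> int" where
  "potential t \<kappa> y c = (\<Sum>i<I. \<kappa> i * SL i ^ 4) + om G t * (\<Sum>j\<in>{1..n}. liveness E (y j) (c j))"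

text \<open>The weights are tied to the true potentials only by an inequality. The last clause
  bounds everything together: the initial potential (weights rounded up once, liveness at most
  \<open>G\<close> per element with weight \<open>G\<close>) plus a rounding allowance per
  round.\<close>

definition good :: "nat \<Rightarrow> (nat \<Rightarrow> int) \<Rightarrow> (nat \<Rightarrow> int) \<Rightarrow> (nat \<Rightarrow> int) \<Rightarrow> bool" where
  "good t \<kappa> y c \<longleftrightarrow> (\<forall>j\<in>{1..n}. valid E cm (y j) (c j)) \<and>
     (\<forall>i<I. 1 \<le> \<kappa> i \<and> F0 * exp (\<Psi> i y c - \<Psi> i (\<lambda>_. y0) (\<lambda>_. 1)) \<le> \<kappa> i * SL i ^ 4) \<and>
     potential t \<kappa> y c \<le> int I * F0 + int I * 2 ^ (12 * K) + G * G * int n + int t * (int I * 2 ^ (12 * K))"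

lemma U_ge: "16 \<le> U"
proof -
  obtain e :: nat where e: "cm = 2 ^ e" using cm_pow by blast
  have "1 \<le> cm" unfolding e by simp
  then have "1 * 1 \<le> E * cm\<^sup>2" using E_ge by (intro mult_mono) auto
  then show ?thesis by (simp add: U_def)
qed

lemma SL_U: "i < I \<Longrightarrow> 40 * U \<le> \<bar>SL i\<bar>"
  using SL_scale[of i] by (simp add: U_def)

lemma SL_ne: "i < I \<Longrightarrow> SL i \<noteq> 0"
  using SL_U[of i] U_ge by auto

lemma SL4_pos: "i < I \<Longrightarrow> 0 < SL i ^ 4"
  using SL_ne[of i] by simp

lemma SL4_le: "i < I \<Longrightarrow> SL i ^ 4 \<le> 2 ^ (12 * K)"
proof -
  assume i: "i < I"
  have "\<bar>SL i\<bar> ^ 4 \<le> (2 ^ (3 * K)) ^ 4" using SL_le[OF i] by (intro power_mono) auto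
  then show ?thesis by (simp add: power_mult[symmetric] mult.commute)
qed

lemma pow_K: "1000 \<le> (2 :: int) ^ K"
proof -
  have "(2 :: int) ^ 10 \<le> 2 ^ K" using K_ge by (intro power_increasing) auto
  then show ?thesis by simp
qed

lemma G_ge: "1 \<le> G" using mult_mono[of 1 E 1 E] E_ge by (simp add: G_def)

lemma G_le: "G \<le> 2 ^ (3 * K)"
proof -
  have "E * E \<le> 2 ^ K * 2 ^ K" using E_ge E_le by (intro mult_mono) auto
  moreover have "384 * (2 ^ K * 2 ^ K) \<le> (2 ^ K * (2 ^ K * 2 ^ K) :: int)"
    by (rule mult_right_mono) (use pow_K in linarith, simp)
  moreover have "(2 :: int) ^ (3 * K) = 2 ^ K * (2 ^ K * 2 ^ K)" by (simp flip: power_add)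
  ultimately show ?thesis unfolding G_def by linarith
qed

lemma steps_le: "int steps \<le> 2 ^ (5 * K)"
proof -
  have K: "int K \<le> 2 ^ K" using less_exp[of K] by (simp flip: of_nat_le_iff)
  have "int steps = 50 * (G * int K)" using G_ge by (simp add: steps_def)
  also have "\<dots> \<le> 2 ^ K * (2 ^ (3 * K) * 2 ^ K)"
    using pow_K G_le K G_ge by (intro mult_mono) auto
  also have "\<dots> = 2 ^ (5 * K)" by (simp flip: power_add)
  finally show ?thesis .
qed

lemma om_le:
  assumes "t \<le> steps" shows "om G t \<le> 2 ^ (103 * K)"
proof -
  have "om G t \<le> G * 4 ^ (50 * K)"
    by (rule om_small[OF G_ge]) (use assms in \<open>simp add: steps_def mult_ac\<close>)
  also have "\<dots> \<le> 2 ^ (3 * K) * 4 ^ (50 * K)" using G_le by (intro mult_right_mono) auto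
  also have "(4 :: int) ^ (50 * K) = 2 ^ (100 * K)"
    using power_mult[of "2 :: int" 2 "50 * K"] by simp
  finally show ?thesis by (simp flip: power_add)
qed

lemma finite_D: "i < I \<Longrightarrow> finite (D i)"
  using D_sub finite_subset by blast

text \<open>Each of the three error terms is at most \<open>I * 2 ^ (17 * K)\<close>, and
  \<open>F0\<close> is larger than that by the factor \<open>2 ^ (3 * K)\<close>.\<close>

lemma bound_le:
  assumes "t \<le> steps"
  shows "int I * F0 + int I * 2 ^ (12 * K) + G * G * int n + int t * (int I * 2 ^ (12 * K)) \<le> 2 * (int I * F0)"
proof -
  have p: "(2 :: int) ^ (a * K) * 2 ^ (b * K) = 2 ^ ((a + b) * K)" for a b
    by (simp add: power_add[symmetric] algebra_simps)
  have I1: "1 \<le> int I" using I_ge by simp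
  have "G * G * int n \<le> 2 ^ (3 * K) * 2 ^ (3 * K) * 2 ^ (1 * K)"
    using G_le G_ge n_less by (intro mult_mono) (auto simp flip: of_nat_le_iff)
  also have "\<dots> = 2 ^ (7 * K)" by (simp only: p) simp
  also have "\<dots> \<le> int I * 2 ^ (17 * K)"
    using mult_mono[OF I1 power_increasing[of "7 * K" "17 * K" "2 :: int"]] by simp
  finally have a: "G * G * int n \<le> int I * 2 ^ (17 * K)" .
  have "int t * (int I * 2 ^ (12 * K)) \<le> 2 ^ (5 * K) * (int I * 2 ^ (12 * K))"
    using assms steps_le by (intro mult_right_mono) auto
  also have "\<dots> = int I * (2 ^ (5 * K) * 2 ^ (12 * K))" by simp
  also have "\<dots> = int I * 2 ^ (17 * K)" by (simp only: p) simp
  finally have b: "int t * (int I * 2 ^ (12 * K)) \<le> int I * 2 ^ (17 * K)" .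
  have c: "int I * 2 ^ (12 * K) \<le> int I * 2 ^ (17 * K)" by (intro mult_left_mono power_increasing) auto
  have "3 * (2 :: int) ^ (17 * K) \<le> 2 ^ (3 * K) * 2 ^ (17 * K)"
  proof (rule mult_right_mono)
    have "(2 :: int) ^ K \<le> 2 ^ (3 * K)" by (intro power_increasing) auto
    then show "3 \<le> (2 :: int) ^ (3 * K)" using pow_K by linarith
  qed simp
  also have "\<dots> = F0" unfolding F0_def by (simp only: p) simp
  finally have "int I * (3 * 2 ^ (17 * K)) \<le> int I * F0" by (intro mult_left_mono) auto
  then show ?thesis using a b c by (simp add: algebra_simps)
qed

text \<open>The fourth fact says that a step is at most a fraction 1/E of the value, up to an
  additive \<open>E\<close> on the bottom level, where \<open>c = 1\<close> and \<open>y\<close> may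
  be small.\<close>

lemma valid_facts:
  assumes "valid E cm y c"
  shows "1 \<le> c" "0 \<le> y" "y * c\<^sup>2 \<le> U" "of_bool (active E y) * (E * c\<^sup>2) \<le> y * c\<^sup>2 + of_bool (active E y) * E"
    "0 \<le> liveness E y c"
proof -
  obtain e :: nat where "c = 2 ^ e" using assms by (auto simp: valid_def)
  then show c: "1 \<le> c" by simp
  show y: "0 \<le> y" using assms by (simp add: valid_def)
  have "y * c\<^sup>2 \<le> 16 * E * cm\<^sup>2"
    using assms c E_ge by (intro mult_mono power_mono) (auto simp: valid_def)
  then show "y * c\<^sup>2 \<le> U" by (simp add: U_def)
  show "of_bool (active E y) * (E * c\<^sup>2) \<le> y * c\<^sup>2 + of_bool (active E y) * E"
  proof (cases "1 < c")
    case True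
    then have "E * c\<^sup>2 \<le> y * c\<^sup>2" using assms by (intro mult_right_mono) (auto simp: valid_def)
    moreover have "0 \<le> y * c\<^sup>2" using y by simp
    ultimately show ?thesis using E_ge by auto
  next
    case False
    then have "c = 1" using c by simp
    then show ?thesis using y by simp
  qed
  show "0 \<le> liveness E y c"
    using assms c shape_pos[OF E_ge, of y] by (simp add: liveness_def valid_def)
qed

lemma \<kappa>_le:
  assumes "good t \<kappa> y c" "t \<le> steps" "i < I"
  shows "\<kappa> i * SL i ^ 4 \<le> 2 * (int I * F0)"
proof -
  have "0 \<le> om G t * (\<Sum>j\<in>{1..n}. liveness E (y j) (c j))"
    using assms(1) om_ge[OF G_ge, of t] G_ge valid_facts(5)
    by (intro mult_nonneg_nonneg sum_nonneg) (auto simp: good_def)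
  moreover have "\<kappa> i * SL i ^ 4 \<le> (\<Sum>i<I. \<kappa> i * SL i ^ 4)"
    by (rule member_le_sum[of i "{..<I}"]) (use assms in \<open>force simp: good_def\<close>)+
  ultimately show ?thesis using assms(1) bound_le[OF assms(2)] by (simp add: good_def potential_def)
qed

lemma \<kappa>_le':
  assumes "good t \<kappa> y c" "t \<le> steps" "i < I"
  shows "\<kappa> i \<le> 2 ^ (22 * K)"
proof -
  have "\<kappa> i * 1 \<le> \<kappa> i * SL i ^ 4"
  proof (rule mult_left_mono)
    show "1 \<le> SL i ^ 4" using SL4_pos[OF assms(3)] by linarith
    show "0 \<le> \<kappa> i" using assms(1,3) by (force simp: good_def)
  qed
  also have "\<dots> \<le> 2 * (int I * F0)" by (rule \<kappa>_le[OF assms])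
  also have "\<dots> \<le> 2 ^ K * (2 ^ K * 2 ^ (20 * K))"
    unfolding F0_def using pow_K I_le by (intro mult_mono) (auto simp flip: of_nat_le_iff)
  also have "\<dots> = 2 ^ (22 * K)" by (simp flip: power_add)
  finally show ?thesis by simp
qed

text \<open>The total potential at most doubles, so a single exponential potential grows by at most
  the factor \<open>2 * I\<close>, whose logarithm is below \<open>K\<close>.\<close>

lemma \<Psi>_le:
  assumes "good t \<kappa> y c" "t \<le> steps" "i < I"
  shows "\<Psi> i y c - \<Psi> i (\<lambda>_. y0) (\<lambda>_. 1) \<le> real K"
proof -
  let ?d = "\<Psi> i y c - \<Psi> i (\<lambda>_. y0) (\<lambda>_. 1)"
  have F: "0 < F0" by (simp add: F0_def)
  have "F0 * exp ?d \<le> real_of_int (\<kappa> i * SL i ^ 4)" using assms(1,3) by (simp add: good_def)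
  also have "\<dots> \<le> real_of_int (2 * (int I * F0))" using \<kappa>_le[OF assms] by (simp only: of_int_le_iff)
  also have "\<dots> = F0 * (2 * real I)" by simp
  finally have "exp ?d \<le> 2 * real I" using F by simp
  also have "\<dots> \<le> 2 * 2 ^ K" using I_le by (simp flip: of_nat_le_iff)
  \<comment> \<open>The base of the exponential exceeds 5/2, and for \<open>K \<ge> 10\<close> the
    ratio of \<open>(5 / 2) ^ K\<close> to \<open>2 ^ K\<close> already absorbs the extra factor
    2.\<close>
  also have "\<dots> \<le> exp (real K)"
  proof -
    have "5 / 2 \<le> exp (1 :: real)" using exp_lower_Taylor_quadratic[of 1] by simp
    then have "(5 / 2) ^ K \<le> exp (1 :: real) ^ K" by (intro power_mono) auto
    also have "\<dots> = exp (real K)" by (simp add: exp_of_nat_mult[symmetric])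
    finally have "(5 / 2) ^ K \<le> exp (real K)" .
    moreover have "2 \<le> (5 / 4 :: real) ^ K"
    proof -
      have "2 \<le> (5 / 4 :: real) ^ 4" by (simp add: power4_eq_xxxx)
      also have "\<dots> \<le> (5 / 4) ^ K" using K_ge by (intro power_increasing) auto
      finally show ?thesis .
    qed
    then have "2 * 2 ^ K \<le> (5 / 4 :: real) ^ K * 2 ^ K" by (intro mult_right_mono) auto
    moreover have "(5 / 4 :: real) ^ K * 2 ^ K = (5 / 2) ^ K" by (simp flip: power_mult_distrib)
    ultimately show ?thesis by linarith
  qed
  finally show ?thesis by simp
qed

lemma mass_0: "mass i (\<lambda>_. y0) (\<lambda>_. 1) = int (card (D i)) * y0"
  by (simp add: mass_def)

lemma energy_nonneg: "0 \<le> energy i y c"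
  by (simp add: energy_def sum_nonneg)

lemma energy_le:
  assumes "\<forall>j\<in>{1..n}. valid E cm (y j) (c j)" "i < I"
  shows "energy i y c \<le> U * mass i y c"
  unfolding energy_def mass_def sum_distrib_left
proof (rule sum_mono)
  fix j assume "j \<in> D i"
  then have v: "valid E cm (y j) (c j)" using assms D_sub by blast
  then have "y j * (c j)\<^sup>2 \<le> U" "0 \<le> y j * (c j)\<^sup>2" using valid_facts[of "y j" "c j"] by auto
  then show "(y j * (c j)\<^sup>2)\<^sup>2 \<le> U * (y j * (c j)\<^sup>2)"
    by (simp add: power2_eq_square mult_right_mono)
qed

lemma mass_nonneg:
  assumes "\<forall>j\<in>{1..n}. valid E cm (y j) (c j)" "i < I"
  shows "0 \<le> mass i y c"
  unfolding mass_def
proof (rule sum_nonneg)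
  fix j assume "j \<in> D i"
  then have v: "valid E cm (y j) (c j)" using assms D_sub by blast
  then show "0 \<le> y j * (c j)\<^sup>2" using valid_facts(2) by simp
qed

text \<open>Write \<open>X\<close>, \<open>A\<close> for the current and initial mass and
  \<open>L\<close> for \<open>\<bar>SL i\<bar>\<close>. Growth of \<open>\<Psi>\<close> by at most
  \<open>K\<close> for both signs bounds the deviation of \<open>X\<close> from \<open>A\<close> by
  \<open>K * L\<close> plus the compensator. The former is at most \<epsilon>/10 of
  \<open>A\<close>; as the energy is at most \<open>U * X\<close> and
  \<open>40 * U \<le> \<epsilon> * L\<close>, the latter is at most \<epsilon>/10 of
  \<open>X\<close>. Solving for \<open>X\<close> stays within \<epsilon>/4.\<close>

lemma mass_bounds:
  fixes \<epsilon> :: real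
  assumes g: "good t \<kappa> y c" "t \<le> steps" "i < I"
    and \<epsilon>: "0 < \<epsilon>" "\<epsilon> \<le> 1" "40 * U \<le> \<epsilon> * \<bar>SL i\<bar>" "10 * K * \<bar>SL i\<bar> \<le> \<epsilon> * (card (D i) * y0)"
  shows "(1 - \<epsilon> / 4) * (card (D i) * y0) \<le> mass i y c" "mass i y c \<le> (1 + \<epsilon> / 4) * (card (D i) * y0)"
proof -
  have v: "\<forall>j\<in>{1..n}. valid E cm (y j) (c j)" using g by (simp add: good_def)
  have v0: "\<forall>j\<in>{1..n}. valid E cm y0 1"
    using y0_ge y0_le y0_eq E_ge cm_pow
    by (auto simp: valid_def intro: exI[of _ 0])
  define L where "L = real_of_int \<bar>SL i\<bar>"
  define X where "X = real_of_int (mass i y c)"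
  define A where "A = real_of_int (card (D i) * y0)"
  define Q where "Q = real_of_int (energy i y c)"
  define Q0 where "Q0 = real_of_int (energy i (\<lambda>_. y0) (\<lambda>_. 1))"
  have L0: "0 < L" using SL_ne[OF g(3)] by (simp add: L_def)
  have X0: "0 \<le> X" using mass_nonneg[OF v g(3)] by (simp add: X_def)
  have A0: "0 \<le> A" using y0_ge E_ge by (simp add: A_def)
  have Q0: "0 \<le> Q" "0 \<le> Q0" using energy_nonneg by (auto simp: Q_def Q0_def)
  have U0: "0 < real_of_int U" using U_ge by simp
  have QX: "Q \<le> U * X"
    using energy_le[OF v g(3)] unfolding Q_def X_def by (simp only: of_int_mult[symmetric] of_int_le_iff)
  have q: "4 * Q / L \<le> \<epsilon> / 10 * X"
  proof -
    have "4 * Q \<le> 4 * U * X" using QX by simp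
    also have "\<dots> \<le> \<epsilon> * L / 10 * X" using \<epsilon>(3) X0 by (intro mult_right_mono) (auto simp: L_def)
    finally show ?thesis using L0 by (simp add: pos_divide_le_eq mult_ac)
  qed
  have KL: "K * L \<le> \<epsilon> * A / 10" using \<epsilon>(4) by (simp add: L_def A_def)
  have *: "s * (X - A) - 4 * (Q - Q0) / L \<le> K * L" if "i' < I" "D i' = D i" "real_of_int (SL i') = s * L" "s = 1 \<or> s = -1" for s i'
  proof -
    have m: "mass i' = mass i" "energy i' = energy i" using that(2) by (auto simp: mass_def energy_def fun_eq_iff)
    have "\<Psi> i' y c - \<Psi> i' (\<lambda>_. y0) (\<lambda>_. 1) \<le> K" using \<Psi>_le[OF g(1,2) that(1)] .
    then have "X / (s * L) - 4 * Q / (s * L)\<^sup>2 - (A / (s * L) - 4 * Q0 / (s * L)\<^sup>2) \<le> K"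
      unfolding \<Psi>_def m mass_0 that(3) X_def A_def Q_def Q0_def by simp
    moreover have "X / (s * L) - 4 * Q / (s * L)\<^sup>2 - (A / (s * L) - 4 * Q0 / (s * L)\<^sup>2)
      = (s * (X - A) - 4 * (Q - Q0) / L) / L"
    proof -
      have "X / (s * L) = s * X / L" "A / (s * L) = s * A / L" "(s * L)\<^sup>2 = L * L"
        using that(4) by (auto simp: power2_eq_square)
      then show ?thesis by (simp add: diff_divide_distrib right_diff_distrib)
    qed
    ultimately show ?thesis using L0 by (simp add: pos_divide_le_eq)
  qed
  obtain i' where i': "i' < I" "D i' = D i" "SL i' = - SL i" using mirror[OF g(3)] by blast
  have both: "X - A - 4 * (Q - Q0) / L \<le> K * L" "- (X - A) - 4 * (Q - Q0) / L \<le> K * L"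
  proof -
    consider "real_of_int (SL i) = L" "real_of_int (SL i') = - L" | "real_of_int (SL i) = - L" "real_of_int (SL i') = L"
      using i'(3) by (cases "0 \<le> SL i") (auto simp: L_def)
    then have "X - A - 4 * (Q - Q0) / L \<le> K * L \<and> - (X - A) - 4 * (Q - Q0) / L \<le> K * L"
      using *[of i 1] *[of i' "-1"] *[of i "-1"] *[of i' 1] g(3) i' by cases auto
    then show "X - A - 4 * (Q - Q0) / L \<le> K * L" "- (X - A) - 4 * (Q - Q0) / L \<le> K * L" by auto
  qed
  have d: "4 * (Q - Q0) / L \<le> 4 * Q / L" "4 * (Q - Q0) / L = 4 * Q / L - 4 * Q0 / L"
    using Q0 L0 by (simp_all add: divide_right_mono diff_divide_distrib right_diff_distrib)
  have "X * (1 - \<epsilon> / 10) \<le> A * (1 + \<epsilon> / 10)"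
    using both(1) q KL d(1) by (simp add: algebra_simps)
  also have "\<dots> \<le> A * ((1 + \<epsilon> / 4) * (1 - \<epsilon> / 10))"
  proof (rule mult_left_mono)
    have "\<epsilon> * \<epsilon> \<le> 1 * \<epsilon>" using \<epsilon> by (intro mult_right_mono) auto
    then have "\<epsilon> * \<epsilon> \<le> 2 * \<epsilon>" using \<epsilon> by linarith
    then show "1 + \<epsilon> / 10 \<le> (1 + \<epsilon> / 4) * (1 - \<epsilon> / 10)" by (simp add: field_simps)
  qed (rule A0)
  finally have "X * (1 - \<epsilon> / 10) \<le> (1 + \<epsilon> / 4) * A * (1 - \<epsilon> / 10)" by (simp add: mult_ac)
  then have "X \<le> (1 + \<epsilon> / 4) * A" using \<epsilon> by simp
  then show "mass i y c \<le> (1 + \<epsilon> / 4) * (card (D i) * y0)" by (simp add: X_def A_def)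
  have "0 \<le> 4 * Q0 / L" using Q0 L0 by simp
  then have "A * (1 - \<epsilon> / 10) \<le> X * (1 + \<epsilon> / 10)"
    using both(2) q KL d(1) by (simp add: algebra_simps)
  moreover have "A * ((1 - \<epsilon> / 4) * (1 + \<epsilon> / 10)) \<le> A * (1 - \<epsilon> / 10)"
  proof (rule mult_left_mono)
    have "0 \<le> \<epsilon> * \<epsilon>" using \<epsilon> by simp
    then show "(1 - \<epsilon> / 4) * (1 + \<epsilon> / 10) \<le> 1 - \<epsilon> / 10" using \<epsilon> by (simp add: field_simps)
  qed (rule A0)
  ultimately have "(1 - \<epsilon> / 4) * A * (1 + \<epsilon> / 10) \<le> X * (1 + \<epsilon> / 10)" by (simp add: mult_ac)
  then have "(1 - \<epsilon> / 4) * A \<le> X" using \<epsilon> by (simp add: mult_le_cancel_right)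
  then show "(1 - \<epsilon> / 4) * (card (D i) * y0) \<le> mass i y c" by (simp add: X_def A_def)
qed

text \<open>The case \<epsilon> = 1. This crude bound is fed back into the next round, where it
  limits the total step size of a set.\<close>

lemma mass_le: "good t \<kappa> y c \<Longrightarrow> t \<le> steps \<Longrightarrow> i < I \<Longrightarrow> 4 * mass i y c \<le> 5 * (int (card (D i)) * y0)"
proof -
  assume a: "good t \<kappa> y c" "t \<le> steps" "i < I"
  have "real_of_int (40 * U) \<le> real_of_int \<bar>SL i\<bar>"
    using SL_U[OF a(3)] by (simp only: of_int_le_iff)
  moreover have "real_of_int (10 * int K * \<bar>SL i\<bar>) \<le> real_of_int (int (card (D i)) * y0)"
    using SL_dev[OF a(3)] by (simp only: of_int_le_iff)
  ultimately have "real_of_int (mass i y c) \<le> (1 + 1 / 4) * real_of_int (int (card (D i)) * y0)"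
    using mass_bounds(2)[OF a, of 1] by simp
  then have "real_of_int (4 * mass i y c) \<le> real_of_int (5 * (int (card (D i)) * y0))" by simp
  then show ?thesis by (simp only: of_int_le_iff)
qed

lemma sum_coef:
  fixes f :: "nat \<Rightarrow> int \<Rightarrow> int"
  assumes "i < I" and f0: "\<And>u. f u 0 = 0"
  shows "(\<Sum>u<2 ^ K. f u (coef y c i u)) = (\<Sum>j\<in>D i. f j (coef y c i j))"
proof (rule sum.mono_neutral_right)
  show "D i \<subseteq> {..<2 ^ K}" using D_sub[OF assms(1)] n_less by force
  show "\<forall>u\<in>{..<2 ^ K} - D i. f u (coef y c i u) = 0" using f0 by (simp add: coef_def)
qed simp

lemma good_init: "good 0 (\<lambda>i. F0 div SL i ^ 4 + 1) (\<lambda>_. y0) (\<lambda>_. 1)"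
proof -
  let ?\<kappa> = "\<lambda>i. F0 div SL i ^ 4 + 1"
  have v: "valid E cm y0 1"
    using y0_ge y0_le y0_eq E_ge cm_pow by (auto simp: valid_def intro: exI[of _ 0])
  have F: "0 \<le> F0" by (simp add: F0_def)
  have d: "F0 = F0 div SL i ^ 4 * SL i ^ 4 + F0 mod SL i ^ 4" for i by (simp only: div_mult_mod_eq)
  have k: "F0 \<le> ?\<kappa> i * SL i ^ 4" "?\<kappa> i * SL i ^ 4 \<le> F0 + 2 ^ (12 * K)" "1 \<le> ?\<kappa> i" if "i < I" for i
  proof -
    have "0 \<le> F0 mod SL i ^ 4" "F0 mod SL i ^ 4 < SL i ^ 4" using SL4_pos[OF that] by auto
    then show "F0 \<le> ?\<kappa> i * SL i ^ 4" "?\<kappa> i * SL i ^ 4 \<le> F0 + 2 ^ (12 * K)"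
      using d[of i] SL4_le[OF that] by (simp_all only: distrib_right mult_1)
    show "1 \<le> ?\<kappa> i" using F SL4_pos[OF that] by (simp add: pos_imp_zdiv_nonneg_iff)
  qed
  have "(\<Sum>i<I. ?\<kappa> i * SL i ^ 4) \<le> (\<Sum>i<I. F0 + 2 ^ (12 * K))"
    using k(2) by (intro sum_mono) auto
  moreover have "liveness E y0 1 \<le> G"
    using shape_le[OF E_ge, of y0] y0_ge y0_le E_ge G_ge by (auto simp: liveness_def G_def)
  then have "G * (int n * liveness E y0 1) \<le> G * (int n * G)" using G_ge by (intro mult_left_mono) auto
  ultimately have "potential 0 ?\<kappa> (\<lambda>_. y0) (\<lambda>_. 1)
      \<le> int I * F0 + int I * 2 ^ (12 * K) + G * G * int n + int 0 * (int I * 2 ^ (12 * K))"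
    by (simp add: potential_def algebra_simps)
  moreover have "F0 * exp (\<Psi> i (\<lambda>_. y0) (\<lambda>_. 1) - \<Psi> i (\<lambda>_. y0) (\<lambda>_. 1)) \<le> ?\<kappa> i * SL i ^ 4" if "i < I" for i
    using k(1)[OF that] by (simp only: of_int_le_iff diff_self exp_zero mult_1_right)
  ultimately show ?thesis using v k(3) by (simp add: good_def)
qed

text \<open>The hypothesis \<open>H\<close> is what the derandomized choice of signs provides. For
  each set the true change of \<open>\<Psi> i\<close> is bounded by the quadratic polynomial,
  whatever the signs are; for each element the liveness is bounded by a function that is affine in
  its sign. Summing up leaves exactly the left-hand side of \<open>H\<close> and the rounding
  allowance.\<close>

lemma good_step:
  assumes g: "good t \<kappa> y c" and t: "t < steps" and r: "\<And>k. r k = 1 \<or> r k = -1"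
    and H: "(\<Sum>i<I. \<kappa> i * ((SL i)\<^sup>2 * agg r K (coef y c i) 0 + (agg r K (coef y c i) 0)\<^sup>2
        - (\<Sum>u<2 ^ K. (coef y c i u)\<^sup>2))) + (\<Sum>j<2 ^ K. sg r K j * drift (om G (Suc t)) y c j) \<le> 0"
  shows "good (Suc t) (new_\<kappa> r \<kappa> y c) (new_y r y c) (new_c r y c)"
proof -
  obtain e0 :: nat where cm: "cm = 2 ^ e0" using cm_pow by blast
  define s where "s = sg r K"
  have s: "s j = 1 \<or> s j = -1" for j unfolding s_def by (rule sg_sign[of r, OF r])
  have v: "valid E cm (y j) (c j)" if "j \<in> {1..n}" for j using g that by (simp add: good_def)
  let ?y = "new_y r y c" and ?c = "new_c r y c"
  define B where "B i = agg r K (coef y c i) 0" for i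
  define W where "W i = (\<Sum>u<2 ^ K. (coef y c i u)\<^sup>2)" for i
  have facts: "valid E cm (?y j) (?c j)" "?y j * (?c j)\<^sup>2 = y j * (c j)\<^sup>2 + s j * (of_bool (active E (y j)) * (c j)\<^sup>2)"
    "liveness E (?y j) (?c j) \<le> of_bool (active E (y j)) * (c j * (shape E (y j) + s j * (36 * E - 2 * y j) - 1))"
    if "j \<in> {1..n}" for j
    using step_facts[OF v[OF that] E_ge cm s[of j]] by (simp_all add: new_y_def new_c_def s_def)
  have new: "new_\<kappa> r \<kappa> y c i = \<kappa> i * factor i (B i) (W i) div SL i ^ 4 + 1" for i
    by (simp add: new_\<kappa>_def B_def W_def agg_one)
  have set: "1 \<le> new_\<kappa> r \<kappa> y c i \<and> \<kappa> i * factor i (B i) (W i) \<le> new_\<kappa> r \<kappa> y c i * SL i ^ 4 \<and>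
     new_\<kappa> r \<kappa> y c i * SL i ^ 4 \<le> \<kappa> i * factor i (B i) (W i) + SL i ^ 4 \<and>
     exp (\<Psi> i ?y ?c - \<Psi> i y c) * SL i ^ 4 \<le> factor i (B i) (W i)" if i: "i < I" for i
  proof -
    define h where "h j = of_bool (active E (y j)) * (c j)\<^sup>2" for j
    define X where "X j = y j * (c j)\<^sup>2" for j
    define N where "N = (SL i)\<^sup>2"
    define A where "A = int (card (D i)) * y0"
    define SC where "SC = (\<Sum>j\<in>D i. \<bar>coef y c i j\<bar>)"
    have jn: "j \<in> {1..n}" if "j \<in> D i" for j using D_sub[OF i] that by blast
    have h0: "0 \<le> h j" for j by (simp add: h_def)
    have co: "coef y c i j = h j * (SL i - 8 * X j)" if "j \<in> D i" for j
      using that by (simp add: coef_def h_def X_def)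
    have Xb: "0 \<le> X j" "X j \<le> U" if "j \<in> D i" for j
      using valid_facts[OF v[OF jn[OF that]]] by (auto simp: X_def)
    \<comment> \<open>From \<open>40 * U \<le> \<bar>SL i\<bar>\<close> and
      \<open>X j \<le> U\<close>, the correction \<open>8 * X j\<close> is at most a fifth of
      \<open>\<bar>SL i\<bar>\<close>.\<close>
    have SLX: "5 * \<bar>SL i - 8 * X j\<bar> \<le> 6 * \<bar>SL i\<bar>" if "j \<in> D i" for j
    proof -
      have "\<bar>SL i - 8 * X j\<bar> \<le> \<bar>SL i\<bar> + 8 * X j" using Xb[OF that] by arith
      moreover have "5 * a \<le> 6 * b" if "a \<le> b + 8 * x" "x \<le> u" "40 * u \<le> b" for a b x u :: int
        using that by linarith
      ultimately show ?thesis using Xb[OF that] SL_U[OF i] by blast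
    qed
    have N0: "0 < N" using SL_ne[OF i] by (simp add: N_def)
    have Bsum: "B i = (\<Sum>j\<in>D i. s j * coef y c i j)"
      unfolding B_def agg_full s_def using sum_coef[OF i, of "\<lambda>u z. sg r K u * z" y c] by simp
    have Wsum: "W i = (\<Sum>j\<in>D i. (coef y c i j)\<^sup>2)"
      unfolding W_def using sum_coef[OF i, of "\<lambda>u z. z\<^sup>2" y c] by simp
    have BSC: "\<bar>B i\<bar> \<le> SC"
    proof -
      have "\<bar>B i\<bar> \<le> (\<Sum>j\<in>D i. \<bar>s j * coef y c i j\<bar>)" unfolding Bsum by (rule sum_abs)
      also have "\<dots> = SC" unfolding SC_def
      proof (intro sum.cong refl)
        fix j show "\<bar>s j * coef y c i j\<bar> = \<bar>coef y c i j\<bar>" using s[of j] by auto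
      qed
      finally show ?thesis .
    qed
    have WSC: "W i \<le> SC\<^sup>2"
      using sum_squares_le[OF finite_D[OF i], of "\<lambda>j. \<bar>coef y c i j\<bar>"] by (simp add: Wsum SC_def)
    have W0: "0 \<le> W i" unfolding Wsum by (intro sum_nonneg) auto
    \<comment> \<open>Each step is at most 1/E of the value plus the bottom-level allowance. The
      values sum to at most 5/4 of \<open>A\<close>, and the allowances, \<open>E\<close> per
      element, to at most \<open>A / 4\<close> because \<open>4 * E \<le> y0\<close>.\<close>
    have hsum: "4 * (E * (\<Sum>j\<in>D i. h j)) \<le> 6 * A"
    proof -
      have "E * (\<Sum>j\<in>D i. h j) \<le> (\<Sum>j\<in>D i. X j + E)" unfolding sum_distrib_left
      proof (rule sum_mono)
        fix j assume "j \<in> D i"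
        then have "E * h j \<le> X j + of_bool (active E (y j)) * E"
          using valid_facts(4)[OF v[OF jn]] by (simp add: h_def X_def mult_ac)
        then show "E * h j \<le> X j + E" using E_ge by (cases "active E (y j)") simp_all
      qed
      also have "\<dots> = mass i y c + int (card (D i)) * E" by (simp add: sum.distrib mass_def X_def)
      finally have "4 * (E * (\<Sum>j\<in>D i. h j)) \<le> 4 * mass i y c + int (card (D i)) * (4 * E)" by simp
      moreover have "int (card (D i)) * (4 * E) \<le> A" unfolding A_def
        using y0_ge by (intro mult_left_mono) auto
      moreover have "4 * mass i y c \<le> 5 * A" unfolding A_def
        using mass_le[OF g _ i] t by simp
      ultimately show ?thesis by linarith
    qed
    \<comment> \<open>This holds for every choice of signs and gives the bounds 1/8 that
      \<open>exp_drift_le\<close> requires. The previous estimates yield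
      \<open>20 * E * SC \<le> 36 * \<bar>SL i\<bar> * A\<close>; the constant 29 of
      \<open>SL_step\<close> turns this into \<open>580 * SC \<le> 36 * N\<close>.\<close>
    have SCN: "8 * SC \<le> N"
    proof -
      have "5 * SC \<le> (\<Sum>j\<in>D i. h j * (6 * \<bar>SL i\<bar>))" unfolding SC_def sum_distrib_left
      proof (rule sum_mono)
        fix j assume j: "j \<in> D i"
        have "5 * \<bar>coef y c i j\<bar> = h j * (5 * \<bar>SL i - 8 * X j\<bar>)"
          using co[OF j] h0[of j] by (simp add: abs_mult)
        also have "\<dots> \<le> h j * (6 * \<bar>SL i\<bar>)" using SLX[OF j] h0 by (intro mult_left_mono) auto
        finally show "5 * \<bar>coef y c i j\<bar> \<le> h j * (6 * \<bar>SL i\<bar>)" .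
      qed
      also have "\<dots> = 6 * \<bar>SL i\<bar> * (\<Sum>j\<in>D i. h j)" by (simp add: sum_distrib_left sum_distrib_right mult_ac)
      finally have 1: "5 * SC \<le> 6 * \<bar>SL i\<bar> * (\<Sum>j\<in>D i. h j)" .
      have "E * (20 * SC) \<le> E * (4 * (6 * \<bar>SL i\<bar> * (\<Sum>j\<in>D i. h j)))"
        using 1 E_ge by (intro mult_left_mono) auto
      also have "\<dots> = 6 * \<bar>SL i\<bar> * (4 * (E * (\<Sum>j\<in>D i. h j)))" by (simp add: mult_ac)
      also have "\<dots> \<le> 6 * \<bar>SL i\<bar> * (6 * A)" using hsum by (intro mult_left_mono) auto
      finally have "E * (20 * SC) \<le> \<bar>SL i\<bar> * (36 * A)" by simp
      moreover have "29 * A \<le> E * \<bar>SL i\<bar>" using SL_step[OF i] by (simp add: A_def mult_ac)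
      then have "\<bar>SL i\<bar> * (29 * A) \<le> \<bar>SL i\<bar> * (E * \<bar>SL i\<bar>)" by (intro mult_left_mono) auto
      moreover have "\<bar>SL i\<bar> * (E * \<bar>SL i\<bar>) = E * N" by (simp add: N_def power2_eq_square)
      ultimately have "29 * (E * (20 * SC)) \<le> 36 * (E * N)" by linarith
      then have "E * (580 * SC) \<le> E * (36 * N)" by simp
      then have "580 * SC \<le> 36 * N" using E_ge by simp
      then show ?thesis using N0 by linarith
    qed
    \<comment> \<open>The origin of the 4 in \<open>\<Psi>\<close>: the square of 6/5 is below 2, so
      the decrease \<open>4 * (\<Sum>j. (h j)\<^sup>2) / N\<close> caused by the energy term is at
      least the required 2\<beta>.\<close>
    have Wh: "W i \<le> 2 * N * (\<Sum>j\<in>D i. (h j)\<^sup>2)"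
      unfolding Wsum sum_distrib_left
    proof (rule sum_mono)
      fix j assume j: "j \<in> D i"
      have "(5 * \<bar>SL i - 8 * X j\<bar>)\<^sup>2 \<le> (6 * \<bar>SL i\<bar>)\<^sup>2" using SLX[OF j] by (intro power_mono) auto
      then have "25 * (SL i - 8 * X j)\<^sup>2 \<le> 36 * N" by (simp add: power_mult_distrib N_def)
      then have "(SL i - 8 * X j)\<^sup>2 \<le> 2 * N" using N0 by linarith
      then have "(h j)\<^sup>2 * (SL i - 8 * X j)\<^sup>2 \<le> (h j)\<^sup>2 * (2 * N)" by (intro mult_left_mono) auto
      then show "(coef y c i j)\<^sup>2 \<le> 2 * N * (h j)\<^sup>2"
        by (simp add: co[OF j] power_mult_distrib mult_ac)
    qed
    have mass': "mass i ?y ?c = mass i y c + (\<Sum>j\<in>D i. s j * h j)"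
      unfolding mass_def sum.distrib[symmetric]
      by (intro sum.cong refl) (use facts(2) jn in \<open>simp add: h_def\<close>)
    have ss: "s j * s j = 1" for j using s[of j] by auto
    have energy': "energy i ?y ?c = energy i y c + 2 * (\<Sum>j\<in>D i. s j * (X j * h j)) + (\<Sum>j\<in>D i. (h j)\<^sup>2)"
      unfolding energy_def sum.distrib[symmetric] sum_distrib_left
    proof (intro sum.cong refl)
      fix j assume "j \<in> D i"
      then have "?y j * (?c j)\<^sup>2 = X j + s j * h j" using facts(2) jn by (simp add: h_def X_def)
      moreover have "(X j + s j * h j)\<^sup>2 = (X j)\<^sup>2 + 2 * (s j * (X j * h j)) + s j * s j * (h j)\<^sup>2"
        by (simp add: power2_eq_square algebra_simps)
      ultimately show "(?y j * (?c j)\<^sup>2)\<^sup>2 = (y j * (c j)\<^sup>2)\<^sup>2 + 2 * (s j * (X j * h j)) + (h j)\<^sup>2"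
        by (simp add: ss X_def)
    qed
    have Bh: "B i = SL i * (\<Sum>j\<in>D i. s j * h j) - 8 * (\<Sum>j\<in>D i. s j * (X j * h j))"
      unfolding Bsum sum_distrib_left sum_subtractf[symmetric]
      by (intro sum.cong refl) (simp add: co algebra_simps)
    define b where "b = B i / real_of_int N"
    define \<beta> where "\<beta> = W i / (real_of_int N)\<^sup>2"
    have rN: "0 < real_of_int N" using N0 by simp
    have SLne: "real_of_int (SL i) \<noteq> 0" using SL_ne[OF i] by simp
    have "\<Psi> i ?y ?c - \<Psi> i y c = b - 4 * (\<Sum>j\<in>D i. (h j)\<^sup>2) / real_of_int N"
    proof -
      have "\<Psi> i ?y ?c - \<Psi> i y c = real_of_int (\<Sum>j\<in>D i. s j * h j) / SL i
        - 4 * real_of_int (2 * (\<Sum>j\<in>D i. s j * (X j * h j)) + (\<Sum>j\<in>D i. (h j)\<^sup>2)) / (real_of_int (SL i))\<^sup>2"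
        unfolding \<Psi>_def mass' energy' by (simp add: add_divide_distrib distrib_left del: of_int_sum)
      moreover have "real_of_int (\<Sum>j\<in>D i. s j * h j) / SL i = SL i * real_of_int (\<Sum>j\<in>D i. s j * h j) / (real_of_int (SL i))\<^sup>2"
        using SLne by (simp add: power2_eq_square del: of_int_sum)
      moreover have "b = (SL i * real_of_int (\<Sum>j\<in>D i. s j * h j) - 8 * real_of_int (\<Sum>j\<in>D i. s j * (X j * h j))) / (real_of_int (SL i))\<^sup>2"
        unfolding b_def Bh N_def by (simp del: of_int_sum)
      ultimately show ?thesis
        by (simp add: N_def diff_divide_distrib add_divide_distrib distrib_left del: of_int_sum)
    qed
    moreover have "2 * \<beta> \<le> 4 * (\<Sum>j\<in>D i. (h j)\<^sup>2) / real_of_int N"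
    proof -
      have "real_of_int (W i) \<le> real_of_int (2 * N * (\<Sum>j\<in>D i. (h j)\<^sup>2))" using Wh by (simp only: of_int_le_iff)
      then have "real_of_int (W i) \<le> 2 * real_of_int N * real_of_int (\<Sum>j\<in>D i. (h j)\<^sup>2)" by simp
      then have "real_of_int (W i) / (real_of_int N)\<^sup>2 \<le> 2 * real_of_int (\<Sum>j\<in>D i. (h j)\<^sup>2) / real_of_int N"
        using rN by (simp add: divide_simps power2_eq_square mult_ac del: of_int_sum)
      then show ?thesis unfolding \<beta>_def by simp
    qed
    ultimately have "exp (\<Psi> i ?y ?c - \<Psi> i y c) \<le> exp (b - 2 * \<beta>)" by simp
    also have "\<dots> \<le> 1 + b + b\<^sup>2 - \<beta>"
    proof (rule exp_drift_le)
      have "8 * \<bar>B i\<bar> \<le> N" using BSC SCN by linarith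
      then have "real_of_int (8 * \<bar>B i\<bar>) \<le> real_of_int N" by (simp only: of_int_le_iff)
      then show "\<bar>b\<bar> \<le> 1 / 8" using rN by (simp add: b_def abs_divide field_simps)
      show "0 \<le> \<beta>" using W0 by (simp add: \<beta>_def)
      have "8 * W i \<le> 8 * SC\<^sup>2" using WSC by simp
      also have "\<dots> \<le> (8 * SC)\<^sup>2" by (simp add: power_mult_distrib)
      also have "\<dots> \<le> N\<^sup>2" using SCN BSC by (intro power_mono) auto
      finally have "real_of_int (8 * W i) \<le> real_of_int (N\<^sup>2)" by (simp only: of_int_le_iff)
      then show "\<beta> \<le> 1 / 8" using rN by (simp add: \<beta>_def field_simps)
    qed
    finally have "exp (\<Psi> i ?y ?c - \<Psi> i y c) * (real_of_int N)\<^sup>2 \<le> (1 + b + b\<^sup>2 - \<beta>) * (real_of_int N)\<^sup>2"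
      by (rule mult_right_mono) simp
    also have "\<dots> = real_of_int (factor i (B i) (W i))"
    proof -
      have "(1 + x / N' + (x / N')\<^sup>2 - z / N'\<^sup>2) * N'\<^sup>2 = N'\<^sup>2 + N' * x + x\<^sup>2 - z"
        if "N' \<noteq> 0" for x z N' :: real using that by (simp add: field_simps power2_eq_square)
      from this[of "real_of_int N"] show ?thesis using rN
        by (simp add: b_def \<beta>_def factor_def N_def flip: power_mult)
    qed
    finally have ex: "exp (\<Psi> i ?y ?c - \<Psi> i y c) * SL i ^ 4 \<le> factor i (B i) (W i)"
      by (simp add: N_def flip: power_mult)
    have "0 \<le> exp (\<Psi> i ?y ?c - \<Psi> i y c) * SL i ^ 4" using SL4_pos[OF i] by (simp flip: of_int_power)
    then have "0 \<le> real_of_int (factor i (B i) (W i))" using ex by linarith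
    then have f0: "0 \<le> factor i (B i) (W i)" by (simp only: of_int_0_le_iff)
    have kf: "0 \<le> \<kappa> i * factor i (B i) (W i)" using g i f0 by (intro mult_nonneg_nonneg) (force simp: good_def)+
    define z where "z = \<kappa> i * factor i (B i) (W i)"
    have "z = z div SL i ^ 4 * SL i ^ 4 + z mod SL i ^ 4" by (simp only: div_mult_mod_eq)
    moreover have "0 \<le> z mod SL i ^ 4" "z mod SL i ^ 4 < SL i ^ 4" using SL4_pos[OF i] by auto
    ultimately have "z \<le> (z div SL i ^ 4 + 1) * SL i ^ 4" "(z div SL i ^ 4 + 1) * SL i ^ 4 \<le> z + SL i ^ 4"
      by (simp_all only: distrib_right mult_1)
    moreover have "0 \<le> z div SL i ^ 4" using kf SL4_pos[OF i] by (simp add: z_def pos_imp_zdiv_nonneg_iff)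
    ultimately show ?thesis using ex by (simp add: new z_def)
  qed
  have 1: "F0 * exp (\<Psi> i ?y ?c - \<Psi> i (\<lambda>_. y0) (\<lambda>_. 1)) \<le> new_\<kappa> r \<kappa> y c i * SL i ^ 4" if i: "i < I" for i
  proof -
    let ?p = "F0 * exp (\<Psi> i y c - \<Psi> i (\<lambda>_. y0) (\<lambda>_. 1))" and ?x = "exp (\<Psi> i ?y ?c - \<Psi> i y c)"
    have "F0 * exp (\<Psi> i ?y ?c - \<Psi> i (\<lambda>_. y0) (\<lambda>_. 1)) = ?p * ?x" by (simp add: exp_add[symmetric])
    also have "\<dots> \<le> \<kappa> i * SL i ^ 4 * ?x" using g i by (intro mult_right_mono) (auto simp: good_def)
    also have "\<dots> = \<kappa> i * (?x * SL i ^ 4)" by simp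
    also have "\<dots> \<le> real_of_int (\<kappa> i) * factor i (B i) (W i)"
      using set[OF i] g i by (intro mult_left_mono) (force simp: good_def)+
    also have "\<dots> \<le> real_of_int (new_\<kappa> r \<kappa> y c i * SL i ^ 4)"
      using set[OF i] by (simp only: of_int_le_iff flip: of_int_mult)
    finally show ?thesis by simp
  qed
  let ?w = "om G (Suc t)"
  have w: "0 \<le> ?w" "G \<le> om G t" using om_ge[OF G_ge, of "Suc t"] om_ge[OF G_ge, of t] G_ge by auto
  have live: "?w * liveness E (?y j) (?c j) \<le> om G t * liveness E (y j) (c j) + s j * drift ?w y c j"
    if j: "j \<in> {1..n}" for j
  proof (cases "active E (y j)")
    case True
    have c1: "1 \<le> c j" using valid_facts[OF v[OF j]] by simp
    have f: "shape E (y j) \<le> G" "1 \<le> shape E (y j)"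
      using shape_le[OF E_ge, of "y j"] shape_pos[OF E_ge, of "y j"] True by (auto simp: active_def G_def)
    have d0: "0 \<le> om G t div G" using w G_ge by (simp add: pos_imp_zdiv_nonneg_iff)
    \<comment> \<open>The growth of the weight is paid by the unit that the parabola loses: the
      increment is at most \<open>om G t div G\<close> times \<open>G\<close>, which does not exceed
      \<open>om G t\<close>.\<close>
    have "om G t div G * (shape E (y j) - 1) \<le> om G t div G * G"
      using f d0 by (intro mult_left_mono) auto
    moreover have "om G t = om G t div G * G + om G t mod G" by simp
    moreover have "0 \<le> om G t mod G" using G_ge by simp
    ultimately have "?w * (shape E (y j) - 1) \<le> om G t * shape E (y j)"
      by (simp only: om.simps algebra_simps)
    then have "c j * (?w * (shape E (y j) - 1)) \<le> c j * (om G t * shape E (y j))"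
      using c1 by (intro mult_left_mono) auto
    moreover have "?w * liveness E (?y j) (?c j) \<le> ?w * (c j * (shape E (y j) + s j * (36 * E - 2 * y j) - 1))"
      using facts(3)[OF j] True w(1) by (intro mult_left_mono) auto
    moreover have "?w * (c j * (shape E (y j) + s j * (36 * E - 2 * y j) - 1)) =
      c j * (?w * (shape E (y j) - 1)) + s j * (?w * (c j * (36 * E - 2 * y j)))" by (simp only: algebra_simps)
    moreover have "drift ?w y c j = ?w * (c j * (36 * E - 2 * y j))" "liveness E (y j) (c j) = c j * shape E (y j)"
      using True j by (simp_all add: drift_def liveness_def)
    ultimately show ?thesis by (simp only: mult_ac)
  next
    case False
    then have "liveness E (?y j) (?c j) \<le> 0" using facts(3)[OF j] by simp
    then have "?w * liveness E (?y j) (?c j) \<le> ?w * 0" using w(1) by (intro mult_left_mono)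
    then show ?thesis using False by (simp add: liveness_def drift_def)
  qed
  have dr: "(\<Sum>j<2 ^ K. sg r K j * drift ?w y c j) = (\<Sum>j\<in>{1..n}. s j * drift ?w y c j)"
    unfolding s_def by (rule sum.mono_neutral_right) (use n_less in \<open>auto simp: drift_def\<close>)
  have "(\<Sum>j\<in>{1..n}. ?w * liveness E (?y j) (?c j)) \<le> (\<Sum>j\<in>{1..n}. om G t * liveness E (y j) (c j) + s j * drift ?w y c j)"
    by (rule sum_mono) (rule live)
  then have L: "?w * (\<Sum>j\<in>{1..n}. liveness E (?y j) (?c j)) \<le> om G t * (\<Sum>j\<in>{1..n}. liveness E (y j) (c j))
      + (\<Sum>j<2 ^ K. sg r K j * drift ?w y c j)"
    unfolding dr by (simp only: sum.distrib sum_distrib_left)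
  have "(\<Sum>i<I. new_\<kappa> r \<kappa> y c i * SL i ^ 4) \<le> (\<Sum>i<I. \<kappa> i * SL i ^ 4
      + \<kappa> i * ((SL i)\<^sup>2 * B i + (B i)\<^sup>2 - W i) + 2 ^ (12 * K))"
  proof (rule sum_mono)
    fix i assume "i \<in> {..<I}"
    then have i: "i < I" by simp
    have "\<kappa> i * factor i (B i) (W i) = \<kappa> i * SL i ^ 4 + \<kappa> i * ((SL i)\<^sup>2 * B i + (B i)\<^sup>2 - W i)"
      by (simp add: factor_def algebra_simps)
    then show "new_\<kappa> r \<kappa> y c i * SL i ^ 4 \<le> \<kappa> i * SL i ^ 4
      + \<kappa> i * ((SL i)\<^sup>2 * B i + (B i)\<^sup>2 - W i) + 2 ^ (12 * K)"
      using set[OF i] SL4_le[OF i] by linarith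
  qed
  then have KS: "(\<Sum>i<I. new_\<kappa> r \<kappa> y c i * SL i ^ 4) \<le> (\<Sum>i<I. \<kappa> i * SL i ^ 4)
      + (\<Sum>i<I. \<kappa> i * ((SL i)\<^sup>2 * B i + (B i)\<^sup>2 - W i)) + int I * 2 ^ (12 * K)"
    by (simp add: sum.distrib)
  have "potential (Suc t) (new_\<kappa> r \<kappa> y c) ?y ?c \<le> potential t \<kappa> y c + int I * 2 ^ (12 * K)"
    using KS L H unfolding potential_def B_def W_def by linarith
  then have "potential (Suc t) (new_\<kappa> r \<kappa> y c) ?y ?c
      \<le> int I * F0 + int I * 2 ^ (12 * K) + G * G * int n + int (Suc t) * (int I * 2 ^ (12 * K))"
    using g by (simp add: good_def algebra_simps)
  then show ?thesis using facts(1) set 1 by (simp add: good_def)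
qed

text \<open>An element that still moves has liveness at least 1, so \<open>om G steps\<close>, which
  is at least \<open>2 ^ (25 * K)\<close>, would be bounded by the total potential, at most
  \<open>2 ^ (22 * K)\<close>.\<close>

lemma good_end:
  assumes g: "good steps \<kappa> y c" and j: "j \<in> {1..n}"
  shows "y j * (c j)\<^sup>2 = U * of_bool (y j = 16 * E)"
proof -
  have v: "valid E cm (y j) (c j)" if "j \<in> {1..n}" for j using g that by (simp add: good_def)
  have "\<not> active E (y j)"
  proof
    assume a: "active E (y j)"
    have "1 * 1 \<le> c j * shape E (y j)"
      using valid_facts(1)[OF v[OF j]] shape_pos[OF E_ge, of "y j"] a by (intro mult_mono) (auto simp: active_def)
    then have l1: "1 \<le> liveness E (y j) (c j)" using a by (simp add: liveness_def)
    also have "\<dots> \<le> (\<Sum>j\<in>{1..n}. liveness E (y j) (c j))"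
      by (rule member_le_sum) (use j v valid_facts(5) in auto)
    finally have "om G steps * 1 \<le> om G steps * (\<Sum>j\<in>{1..n}. liveness E (y j) (c j))"
      using om_ge[OF G_ge, of steps] G_ge by (intro mult_left_mono) auto
    moreover have "0 \<le> (\<Sum>i<I. \<kappa> i * SL i ^ 4)"
      using g by (intro sum_nonneg) (force simp: good_def)
    ultimately have "om G steps \<le> 2 * (int I * F0)"
      using g bound_le[of steps] by (simp add: good_def potential_def)
    also have "\<dots> \<le> 2 ^ K * (2 ^ K * 2 ^ (20 * K))"
      unfolding F0_def using pow_K I_le by (intro mult_mono) (auto simp flip: of_nat_le_iff)
    also have "\<dots> = 2 ^ (22 * K)" by (simp flip: power_add)
    also have "\<dots> < 2 ^ (25 * K)" using K_ge by (intro power_strict_increasing) auto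
    also have "\<dots> \<le> om G (2 * nat G * (25 * K))" by (rule om_large[OF G_ge])
    also have "2 * nat G * (25 * K) = steps" by (simp add: steps_def)
    finally show False by simp
  qed
  then have "y j = 0 \<or> y j = 16 * E \<and> c j = cm"
    using v[OF j] by (auto simp: active_def valid_def)
  then show ?thesis using E_ge by (auto simp: U_def)
qed

lemma good_final:
  fixes \<epsilon> :: real
  assumes g: "good steps \<kappa> y c" and i: "i < I"
    and \<epsilon>: "0 < \<epsilon>" "\<epsilon> \<le> 1" "40 * U \<le> \<epsilon> * \<bar>SL i\<bar>" "10 * K * \<bar>SL i\<bar> \<le> \<epsilon> * (card (D i) * y0)"
  shows "(1 - \<epsilon> / 4) * (card (D i) * y0) \<le> U * real (card {j \<in> D i. y j = 16 * E})"
    "U * real (card {j \<in> D i. y j = 16 * E}) \<le> (1 + \<epsilon> / 4) * (card (D i) * y0)"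
proof -
  have "mass i y c = (\<Sum>j\<in>D i. U * of_bool (y j = 16 * E))"
    unfolding mass_def by (intro sum.cong refl good_end[OF g]) (use D_sub[OF i] in blast)
  also have "\<dots> = U * int (card {j \<in> D i. y j = 16 * E})"
    using finite_D[OF i] by (simp add: sum_distrib_left[symmetric] sum.If_cases of_bool_def Int_def)
  finally have "real_of_int (mass i y c) = U * real (card {j \<in> D i. y j = 16 * E})" by simp
  then show "(1 - \<epsilon> / 4) * (card (D i) * y0) \<le> U * real (card {j \<in> D i. y j = 16 * E})"
    "U * real (card {j \<in> D i. y j = 16 * E}) \<le> (1 + \<epsilon> / 4) * (card (D i) * y0)"
    using mass_bounds[OF g _ i \<epsilon>] by auto
qed

end

section \<open>The walk as a parallel program\<close>

abbreviation add_e (infixl "\<oplus>" 65) where "a \<oplus> b \<equiv> Op Add a b"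
abbreviation sub_e (infixl "\<ominus>" 65) where "a \<ominus> b \<equiv> Op Sub a b"
abbreviation mult_e (infixl "\<otimes>" 70) where "a \<otimes> b \<equiv> Op Mult a b"
abbreviation div_e (infixl "\<oslash>" 70) where "a \<oslash> b \<equiv> Op Div a b"
abbreviation seq_c (infixr ";;" 60) where "c ;; d \<equiv> Seq c d"

abbreviation own_e :: aexp where "own_e \<equiv> Read ''ow'' (Var ''q'')"
abbreviation elt_e :: aexp where "elt_e \<equiv> Read ''el'' (Var ''q'')"
abbreviation nxt_e :: aexp where "nxt_e \<equiv> Var ''k'' \<oplus> Const 1"

text \<open>The row of a level and a set has room for all classes, but only occupied classes are
  ever touched. The others rely on memory being 0 initially, so no work is spent on clearing
  rows.\<close>

abbreviation cell_e :: "aexp \<Rightarrow> aexp \<Rightarrow> aexp" where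
  "cell_e k u \<equiv> ((k \<otimes> Var ''M2'') \<oplus> own_e) \<otimes> Var ''P'' \<oplus> u"
abbreviation flag_e :: "aexp \<Rightarrow> aexp" where
  "flag_e k \<equiv> Read ''LD'' (k \<otimes> Var ''N2'' \<oplus> Var ''q'')"
abbreviation half_e :: aexp where "half_e \<equiv> elt_e \<oslash> (Const 2 \<otimes> Var ''pk'')"
abbreviation bit_e :: aexp where "bit_e \<equiv> (Var ''j'' \<oplus> Const 1) \<oslash> Var ''pk''"
abbreviation elem_e :: "string \<Rightarrow> aexp" where "elem_e a \<equiv> Read a (Var ''j'' \<oplus> Const 1)"

text \<open>
  Only the leader of a class writes its cell; every other position writes to a private cell with
  a negative index, which is never read.
\<close>

abbreviation lead_e :: "aexp \<Rightarrow> aexp \<Rightarrow> aexp" where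
  "lead_e k u \<equiv> flag_e k \<otimes> cell_e k u \<oplus> (Const 1 \<ominus> flag_e k) \<otimes> (Const (-1) \<ominus> Var ''q'')"

definition leaders_init :: com where
  "leaders_init =
     ParFor ''q'' (Var ''N2'') (Store ''LD'' (Var ''q'') (Const 1)) ;;
     ParFor ''q'' (Var ''N2'') (Store ''OC'' (cell_e (Const 0) elt_e) (Const 1))"

definition leaders_step :: com where
  "leaders_step =
     ParFor ''q'' (Var ''N2'') (Store ''LD'' (nxt_e \<otimes> Var ''N2'' \<oplus> Var ''q'')
       (flag_e (Var ''k'') \<otimes> (Const 1 \<ominus> Op Mod (elt_e \<oslash> Var ''pk'') (Const 2) \<otimes>
          Read ''OC'' (cell_e (Var ''k'') (elt_e \<oslash> Var ''pk'') \<ominus> Const 1)))) ;;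
     ParFor ''q'' (Var ''N2'') (Store ''OC'' (lead_e nxt_e half_e) (Const 1))"

abbreviation next_level :: com where
  "next_level \<equiv> Assign ''k'' (Var ''k'' \<oplus> Const 1) ;; Assign ''pk'' (Var ''pk'' \<oplus> Var ''pk'')"

definition leaders_com :: com where
  "leaders_com = leaders_init ;; Assign ''k'' (Const 0) ;; Assign ''pk'' (Const 1) ;;
     While (Op Less (Var ''k'') (Var ''K'')) (leaders_step ;; next_level)"

text \<open>A heap: the leaves are the cells \<open>P\<close> to \<open>2 * P - 1\<close>, the
  children of \<open>z\<close> are \<open>2 * z\<close> and \<open>2 * z + 1\<close>, and the root
  is cell 1.\<close>

definition tree_sum :: com where
  "tree_sum = Assign ''w'' (Var ''P'' \<oslash> Const 2) ;;
     While (Op Less (Const 0) (Var ''w''))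
      (ParFor ''q'' (Var ''w'') (Store ''H'' (Var ''w'' \<oplus> Var ''q'')
         (Read ''H'' (Const 2 \<otimes> (Var ''w'' \<oplus> Var ''q'')) \<oplus> Read ''H'' (Const 2 \<otimes> (Var ''w'' \<oplus> Var ''q'') \<oplus> Const 1))) ;;
       Assign ''w'' (Var ''w'' \<oslash> Const 2))"

definition merge_com :: "string \<Rightarrow> aexp \<Rightarrow> com" where
  "merge_com a e = ParFor ''q'' (Var ''N2'') (Store a (lead_e nxt_e half_e)
     (Read a (cell_e (Var ''k'') (Const 2 \<otimes> half_e))
       \<oplus> e \<otimes> Read a (cell_e (Var ''k'') (Const 2 \<otimes> half_e) \<oplus> Const 1)))"

abbreviation act_e :: "aexp \<Rightarrow> aexp" where
  "act_e y \<equiv> Op Less (Const 0) y \<otimes> Op Less y (Const 16 \<otimes> Var ''E'')"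

definition leaves_sets :: com where
  "leaves_sets = (let v0 = Read ''V'' (cell_e (Var ''k'') (Const 2 \<otimes> half_e));
       v1 = Read ''V'' (cell_e (Var ''k'') (Const 2 \<otimes> half_e) \<oplus> Const 1);
       sl = Read ''SL'' own_e in
     ParFor ''q'' (Var ''N2'') (Store ''H'' (Var ''P'' \<oplus> Var ''q'')
       (flag_e nxt_e \<otimes> (Read ''KA'' own_e \<otimes>
          (Const 2 \<otimes> (v0 \<otimes> v1) \<oplus> Op Eq half_e (Const 0) \<otimes> (sl \<otimes> sl \<otimes> v1))))))"

text \<open>The elements contribute the linear term \<open>agg r k e 1\<close> of the slope, that
  is, the indices whose quotient by \<open>2 ^ k\<close> is 1. Their leaves follow those of the
  \<open>N2\<close> positions.\<close>

definition leaves_elems :: com where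
  "leaves_elems = ParFor ''j'' (Var ''n'') (Store ''H'' (Var ''P'' \<oplus> Var ''N2'' \<oplus> Var ''j'')
     (Op Eq bit_e (Const 1) \<otimes> (elem_e ''SG'' \<otimes> (act_e (elem_e ''Y'') \<otimes> (Var ''om'' \<otimes>
       (elem_e ''C'' \<otimes> (Const 36 \<otimes> Var ''E'' \<ominus> Const 2 \<otimes> elem_e ''Y'')))))))"

definition sign_com :: com where
  "sign_com = ParFor ''j'' (Var ''n'') (Store ''SG'' (Var ''j'' \<oplus> Const 1)
     (elem_e ''SG'' \<otimes> (Const 1 \<oplus> Op Mod bit_e (Const 2) \<otimes> (Var ''r'' \<ominus> Const 1))))"

definition level_com :: com where
  "level_com = leaves_sets ;; leaves_elems ;; tree_sum ;;
     Assign ''r'' (Const 1 \<ominus> Const 2 \<otimes> Op Less (Const 0) (Read ''H'' (Const 1))) ;;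
     merge_com ''V'' (Var ''r'') ;; merge_com ''W'' (Const 1) ;; sign_com ;; next_level"

abbreviation coef_e :: aexp where
  "coef_e \<equiv> (let y = Read ''Y'' elt_e; c = Read ''C'' elt_e in
     act_e y \<otimes> ((c \<otimes> c) \<otimes> (Read ''SL'' own_e \<ominus> Const 8 \<otimes> (y \<otimes> (c \<otimes> c)))))"

definition base_com :: com where
  "base_com = ParFor ''j'' (Var ''n'') (Store ''SG'' (Var ''j'' \<oplus> Const 1) (Const 1)) ;;
     ParFor ''q'' (Var ''N2'') (Store ''V'' (cell_e (Const 0) elt_e) coef_e) ;;
     ParFor ''q'' (Var ''N2'') (Store ''W'' (cell_e (Const 0) elt_e) (coef_e \<otimes> coef_e))"

definition weights_com :: com where
  "weights_com = (let sl = Read ''SL'' (Var ''i''); nu = sl \<otimes> sl;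
       root = ((Var ''K'' \<otimes> Var ''M2'') \<oplus> Var ''i'') \<otimes> Var ''P'' in
     ParFor ''i'' (Var ''M2'') (Store ''KA'' (Var ''i'')
       (Read ''KA'' (Var ''i'') \<otimes> (nu \<otimes> nu \<oplus> nu \<otimes> Read ''V'' root \<oplus> Read ''V'' root \<otimes> Read ''V'' root
          \<ominus> Read ''W'' root) \<oslash> (nu \<otimes> nu) \<oplus> Const 1)))"

abbreviation up_e :: aexp where
  "up_e \<equiv> Op Eq (elem_e ''Y2'') (Const 16 \<otimes> Var ''E'') \<otimes> Op Less (elem_e ''C'') (Var ''cm'')"
abbreviation down_e :: aexp where
  "down_e \<equiv> Op Eq (elem_e ''Y2'') (Var ''E'') \<otimes> Op Less (Const 1) (elem_e ''C'')"

definition move_com :: com where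
  "move_com =
     ParFor ''j'' (Var ''n'') (Store ''Y2'' (Var ''j'' \<oplus> Const 1)
       (elem_e ''Y'' \<oplus> elem_e ''SG'' \<otimes> act_e (elem_e ''Y''))) ;;
     ParFor ''j'' (Var ''n'') (Store ''Y'' (Var ''j'' \<oplus> Const 1)
       (elem_e ''Y2'' \<ominus> Const 12 \<otimes> Var ''E'' \<otimes> up_e \<oplus> Const 3 \<otimes> Var ''E'' \<otimes> down_e)) ;;
     ParFor ''j'' (Var ''n'') (Store ''C'' (Var ''j'' \<oplus> Const 1)
       (elem_e ''C'' \<oplus> elem_e ''C'' \<otimes> up_e \<ominus> (elem_e ''C'' \<oslash> Const 2) \<otimes> down_e))"

definition step_com :: com where
  "step_com = Assign ''om'' (Var ''om'' \<oplus> Var ''om'' \<oslash> Var ''G'') ;; base_com ;;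
     Assign ''k'' (Const 0) ;; Assign ''pk'' (Const 1) ;;
     While (Op Less (Var ''k'') (Var ''K'')) level_com ;;
     weights_com ;; move_com ;; Assign ''t'' (Var ''t'' \<oplus> Const 1)"

definition core_com :: com where
  "core_com = leaders_com ;; Assign ''om'' (Var ''G'') ;; Assign ''t'' (Const 0) ;;
     While (Op Less (Var ''t'') (Var ''Tn'')) step_com ;;
     ParFor ''j'' (Var ''n'') (Store ''T'' (Var ''j'' \<oplus> Const 1) (Op Eq (elem_e ''Y'') (Const 16 \<otimes> Var ''E'')))"

lemmas bounds_simps = vx_def ax_def bx_def

section \<open>Correctness of the program on a fixed memory layout\<close>

locale layout = walk n I K E cm y0 SL D + machine B "2 ^ K"
  for B :: int and n I K :: nat and E cm y0 :: int and SL :: "nat \<Rightarrow> int" and D :: "nat \<Rightarrow> nat set" +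
  fixes N2 :: nat and ow el :: "nat \<Rightarrow> nat"
  assumes pos: "bij_betw (\<lambda>q. (ow q, el q)) {..<N2} (SIGMA i:{..<I}. D i)"
    and size: "N2 + n < 2 ^ K"
begin

definition fixed :: "locals \<Rightarrow> memory \<Rightarrow> bool" where
  "fixed l M \<longleftrightarrow> l ''n'' = int n \<and> l ''N2'' = int N2 \<and> l ''M2'' = int I \<and> l ''P'' = 2 ^ K \<and> l ''K'' = int K
     \<and> l ''E'' = E \<and> l ''cm'' = cm \<and> l ''G'' = G \<and> l ''Tn'' = int steps
     \<and> (\<forall>q<N2. M (''ow'', int q) = int (ow q) \<and> M (''el'', int q) = int (el q)) \<and> (\<forall>i<I. M (''SL'', int i) = SL i)"

lemma fixed_upd [simp]:
  "''n'' \<noteq> x \<Longrightarrow> ''N2'' \<noteq> x \<Longrightarrow> ''M2'' \<noteq> x \<Longrightarrow> ''P'' \<noteq> x \<Longrightarrow> ''K'' \<noteq> x \<Longrightarrow> ''E'' \<noteq> x \<Longrightarrow>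
    ''cm'' \<noteq> x \<Longrightarrow> ''G'' \<noteq> x \<Longrightarrow> ''Tn'' \<noteq> x \<Longrightarrow> fixed (l(x := v)) M = fixed l M"
  "''ow'' \<noteq> a \<Longrightarrow> ''el'' \<noteq> a \<Longrightarrow> ''SL'' \<noteq> a \<Longrightarrow> fixed l (setarr M a f) = fixed l M"
  unfolding fixed_def by (simp_all only: fun_upd_other setarr_apply if_False not_False_eq_True)

definition cell :: "nat \<Rightarrow> nat \<Rightarrow> nat \<Rightarrow> nat" where
  "cell k i u = (k * I + i) * 2 ^ K + u"

lemma cell_eq:
  assumes "i < I" "i' < I" "u < 2 ^ K" "u' < 2 ^ K"
  shows "cell k i u = cell k' i' u' \<longleftrightarrow> k = k' \<and> i = i' \<and> u = u'"
proof
  assume e: "cell k i u = cell k' i' u'"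
  have "cell k i u div 2 ^ K = k * I + i" "cell k' i' u' div 2 ^ K = k' * I + i'"
    using assms by (auto simp: cell_def)
  then have 1: "k * I + i = k' * I + i'" using e by simp
  have "(k * I + i) div I = k" "(k' * I + i') div I = k'" using assms by auto
  then have "k = k'" using 1 by metis
  then show "k = k' \<and> i = i' \<and> u = u'" using 1 e by (simp add: cell_def)
qed simp

lemma pos_facts:
  assumes "q < N2"
  shows "ow q < I" "el q \<in> D (ow q)" "1 \<le> el q" "el q \<le> n" "el q < 2 ^ K"
proof -
  have "(ow q, el q) \<in> (SIGMA i:{..<I}. D i)" using pos assms by (auto simp: bij_betw_def)
  then show 1: "ow q < I" "el q \<in> D (ow q)" by auto
  then show "1 \<le> el q" "el q \<le> n" "el q < 2 ^ K" using D_sub[of "ow q"] n_less by force+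
qed

lemma pos_inj: "q < N2 \<Longrightarrow> q' < N2 \<Longrightarrow> ow q = ow q' \<Longrightarrow> el q = el q' \<Longrightarrow> q = q'"
  using pos by (auto simp: bij_betw_def inj_on_def)

lemma pos_ex: "i < I \<Longrightarrow> j \<in> D i \<Longrightarrow> \<exists>q<N2. ow q = i \<and> el q = j"
proof -
  assume "i < I" "j \<in> D i"
  then have "(i, j) \<in> (\<lambda>q. (ow q, el q)) ` {..<N2}" using pos by (auto simp: bij_betw_def)
  then show ?thesis by auto
qed

lemma leader_ex:
  assumes "i < I" "occ D k i u"
  shows "\<exists>q<N2. ow q = i \<and> el q div 2 ^ k = u \<and> leader D k (ow q) (el q)"
proof -
  let ?S = "{j \<in> D i. j div 2 ^ k = u}"
  have f: "finite ?S" "?S \<noteq> {}" using finite_D[OF assms(1)] assms(2) by (auto simp: occ_def)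
  have m: "Min ?S \<in> ?S" using Min_in[OF f] .
  then obtain q where q: "q < N2" "ow q = i" "el q = Min ?S" using pos_ex[OF assms(1)] by blast
  have "leader D k i (Min ?S)" unfolding leader_def using Min_le[OF f(1)] m by auto
  then show ?thesis using q m by auto
qed

text \<open>The target of position \<open>q\<close>. The negative indices keep the targets of all
  iterations distinct, as the machine forbids concurrent writes even of equal values.\<close>

definition lidx :: "nat \<Rightarrow> nat \<Rightarrow> int" where
  "lidx k q = (if leader D k (ow q) (el q) then int (cell k (ow q) (el q div 2 ^ k)) else - 1 - int q)"

lemma div_less: "u < 2 ^ K \<Longrightarrow> u div 2 ^ k < 2 ^ K" for u :: nat
  using div_le_dividend[of u "2 ^ k"] by linarith

lemma lidx_inj: "inj_on (lidx k) {..<N2}"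
proof (rule inj_onI)
  fix q q' assume q: "q \<in> {..<N2}" "q' \<in> {..<N2}" and e: "lidx k q = lidx k q'"
  show "q = q'"
  proof (cases "leader D k (ow q) (el q)"; cases "leader D k (ow q') (el q')")
    assume L: "leader D k (ow q) (el q)" "leader D k (ow q') (el q')"
    then have "cell k (ow q) (el q div 2 ^ k) = cell k (ow q') (el q' div 2 ^ k)"
      using e by (simp add: lidx_def)
    then have "ow q = ow q'" "el q div 2 ^ k = el q' div 2 ^ k"
      using cell_eq pos_facts q div_less by (metis lessThan_iff)+
    moreover have "el q = el q'" using L calculation pos_facts(2) q unfolding leader_def
      by (metis antisym lessThan_iff)
    ultimately show ?thesis using pos_inj q by auto
  qed (use e in \<open>auto simp: lidx_def\<close>)
qed

text \<open>Among the proper cells, the stores of one level reach exactly the occupied classes of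
  that level; this decides for every cell whether it was overwritten.\<close>

lemma lidx_mem:
  assumes "i < I" "u < 2 ^ K"
  shows "int (cell k' i u) \<in> lidx k ` {..<N2} \<longleftrightarrow> k' = k \<and> occ D k i u"
proof
  assume "int (cell k' i u) \<in> lidx k ` {..<N2}"
  then obtain q where q: "q < N2" "int (cell k' i u) = lidx k q" by auto
  then have "cell k' i u = cell k (ow q) (el q div 2 ^ k)" by (auto simp: lidx_def split: if_splits)
  then have "k' = k" "i = ow q" "u = el q div 2 ^ k"
    using cell_eq assms pos_facts[OF q(1)] div_less by metis+
  then show "k' = k \<and> occ D k i u" using pos_facts(2)[OF q(1)] by (auto simp: occ_def)
next
  assume a: "k' = k \<and> occ D k i u"
  then obtain q where "q < N2" "ow q = i" "el q div 2 ^ k = u" "leader D k (ow q) (el q)"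
    using leader_ex assms by blast
  then show "int (cell k' i u) \<in> lidx k ` {..<N2}" using a by (intro image_eqI[of _ _ q]) (auto simp: lidx_def)
qed

definition LDok :: "nat \<Rightarrow> memory \<Rightarrow> bool" where
  "LDok k M \<longleftrightarrow> (\<forall>k'\<le>k. \<forall>q<N2. M (''LD'', int (k' * N2 + q)) = of_bool (leader D k' (ow q) (el q)))"

definition OCok :: "nat \<Rightarrow> memory \<Rightarrow> bool" where
  "OCok k M \<longleftrightarrow> (\<forall>k' i u. i < I \<longrightarrow> u < 2 ^ K \<longrightarrow> M (''OC'', int (cell k' i u)) = of_bool (k' \<le> k \<and> occ D k' i u))"

lemma fixedD:
  assumes "fixed l M"
  shows "l ''n'' = int n" "l ''N2'' = int N2" "l ''M2'' = int I" "l ''P'' = 2 ^ K" "l ''K'' = int K"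
     "l ''E'' = E" "l ''cm'' = cm" "l ''G'' = G" "l ''Tn'' = int steps"
     "q < N2 \<Longrightarrow> M (''ow'', int q) = int (ow q)" "q < N2 \<Longrightarrow> M (''el'', int q) = int (el q)"
     "i < I \<Longrightarrow> M (''SL'', int i) = SL i"
  using assms by (auto simp: fixed_def)

lemma size': "N2 \<le> 2 ^ K" "n \<le> 2 ^ K"
  using size by auto

lemma run_leaders_init:
  assumes f: "fixed l M" and z: "\<And>z. M (''OC'', z) = 0"
  shows "runs leaders_init l M 60 (\<lambda>l' M'. l' = l \<and> (\<exists>f g. M' = setarr (setarr M ''LD'' f) ''OC'' g) \<and> LDok 0 M' \<and> OCok 0 M')"
  unfolding leaders_init_def
proof (rule runs_Seq[where ?a1.0 = 20 and ?a2.0 = 40 and ?Q1.0 = "\<lambda>l' M'. l' = l \<and> (\<exists>f. M' = setarr M ''LD'' f \<and> (\<forall>q<N2. f (int q) = 1))"], goal_cases first second)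
  case first
  show ?case
    by (rule runs_map'[where k = N2 and idx = int and val = "\<lambda>_. 1"])
      (use fixedD[OF f] size' in \<open>auto simp: bounds_simps mapped_def\<close>)
next
  case (second l' M')
  note a = second(2)
  then obtain h where h: "l' = l" "M' = setarr M ''LD'' h" "\<forall>q<N2. h (int q) = 1" by blast
  have f': "fixed l M'" using f h by simp
  have e: "(\<lambda>q. int (cell 0 (ow q) (el q))) = lidx 0" by (auto simp: lidx_def leader_0)
  show ?case
    unfolding h(1)
  proof (rule runs_map'[where k = N2 and idx = "lidx 0" and val = "\<lambda>_. 1"])
    fix g assume g: "mapped N2 (lidx 0) (\<lambda>_. 1) (\<lambda>z. M' (''OC'', z)) g"
    have "g (int (cell k' i u)) = of_bool (k' \<le> 0 \<and> occ D k' i u)" if "i < I" "u < 2 ^ K" for k' i u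
    proof (cases "int (cell k' i u) \<in> lidx 0 ` {..<N2}")
      case True
      then show ?thesis using g lidx_mem[OF that, of k' 0] by (auto simp: mapped_def)
    next
      case False
      then show ?thesis using g lidx_mem[OF that, of k' 0] h(2) z by (auto simp: mapped_def)
    qed
    then show "l = l \<and> (\<exists>f ga. setarr M' ''OC'' g = setarr (setarr M ''LD'' f) ''OC'' ga)
       \<and> LDok 0 (setarr M' ''OC'' g) \<and> OCok 0 (setarr M' ''OC'' g)"
      using h by (auto simp: LDok_def OCok_def leader_0)
  qed (use fixedD[OF f'] size' lidx_inj in \<open>auto simp: bounds_simps lidx_def leader_0 cell_def\<close>)
qed simp

lemma run_leaders_step:
  assumes f: "fixed l M" and L: "LDok k M" "OCok k M" and k: "k < K" "l ''k'' = int k" "l ''pk'' = 2 ^ k"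
  shows "runs leaders_step l M 200 (\<lambda>l' M'. l' = l \<and> (\<exists>f g. M' = setarr (setarr M ''LD'' f) ''OC'' g) \<and> LDok (Suc k) M' \<and> OCok (Suc k) M')"
  unfolding leaders_step_def
proof (rule runs_Seq[where ?a1.0 = 80 and ?a2.0 = 120 and ?Q1.0 = "\<lambda>l' M'. l' = l \<and> (\<exists>f. M' = setarr M ''LD'' f) \<and> LDok (Suc k) M'"], goal_cases first second)
  have val: "M (''LD'', int (k * N2 + q)) * (1 - int (el q) div 2 ^ k mod 2 *
      M (''OC'', (int k * int I + int (ow q)) * 2 ^ K + int (el q) div 2 ^ k - 1))
    = of_bool (leader D (Suc k) (ow q) (el q))" if q: "q < N2" for q
  proof (cases "odd (el q div 2 ^ k)")
    case True
    have b: "int (el q) div 2 ^ k mod 2 = int (el q div 2 ^ k mod 2)" by (simp add: zdiv_int zmod_int)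
    from True have "int (el q div 2 ^ k - 1) = int (el q div 2 ^ k) - 1" by (auto elim: oddE)
    then have "(int k * int I + int (ow q)) * 2 ^ K + int (el q) div 2 ^ k - 1 = int (cell k (ow q) (el q div 2 ^ k - 1))"
      by (simp add: cell_def zdiv_int)
    moreover have "el q div 2 ^ k - 1 < 2 ^ K" using div_less[of "el q" k] pos_facts[OF q] by linarith
    moreover have "int (el q) div 2 ^ k mod 2 = 1"
      unfolding b using True by (simp add: odd_iff_mod_2_eq_one)
    ultimately show ?thesis using L pos_facts[OF q] q True
      by (simp add: leader_Suc LDok_def OCok_def)
  next
    case False
    have b: "int (el q) div 2 ^ k mod 2 = int (el q div 2 ^ k mod 2)" by (simp add: zdiv_int zmod_int)
    \<comment> \<open>An even class has no left sibling. The address one below then belongs to an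
      unrelated class, possibly in another row, and this factor 0 discards what is read
      there.\<close>
    have "int (el q) div 2 ^ k mod 2 = 0"
      unfolding b using False by (simp add: even_iff_mod_2_eq_zero)
    then show ?thesis using L q False by (simp add: leader_Suc LDok_def)
  qed
  case first
  show ?case
  proof (rule runs_map[where k = N2 and idx = "\<lambda>q. int (Suc k * N2 + q)" and val = "\<lambda>q. of_bool (leader D (Suc k) (ow q) (el q))"])
    fix q assume q: "q < N2"
    show "aval (flag_e (Var ''k'') \<otimes> (Const 1 \<ominus> Op Mod (elt_e \<oslash> Var ''pk'') (Const 2) \<otimes>
          Read ''OC'' (cell_e (Var ''k'') (elt_e \<oslash> Var ''pk'') \<ominus> Const 1))) (l(''q'' := int q)) M
        = of_bool (leader D (Suc k) (ow q) (el q))"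
      using val[OF q] q fixedD[OF f] k by simp
  next
    fix q q' assume "q < N2" "q' < N2" "q \<noteq> q'"
    \<comment> \<open>\<open>LD\<close> is both read and written here, but in the different rows
      \<open>k\<close> and \<open>k + 1\<close>.\<close>
    then have "int k * int N2 + int q' < (1 + int k) * int N2 + int q" by (simp add: algebra_simps)
    then show "(''LD'', int (Suc k * N2 + q)) \<notin> reads (nxt_e \<otimes> Var ''N2'' \<oplus> Var ''q'') (l(''q'' := int q')) M \<union>
       reads (flag_e (Var ''k'') \<otimes> (Const 1 \<ominus> Op Mod (elt_e \<oslash> Var ''pk'') (Const 2) \<otimes>
          Read ''OC'' (cell_e (Var ''k'') (elt_e \<oslash> Var ''pk'') \<ominus> Const 1))) (l(''q'' := int q')) M"
      using fixedD[OF f] k by (simp add: algebra_simps)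
  next
    fix h assume h: "mapped N2 (\<lambda>q. int (Suc k * N2 + q)) (\<lambda>q. of_bool (leader D (Suc k) (ow q) (el q)))
      (\<lambda>z. M (''LD'', z)) h"
    have "h (int (k' * N2 + q)) = of_bool (leader D k' (ow q) (el q))" if "k' \<le> Suc k" "q < N2" for k' q
    proof (cases "k' = Suc k")
      case True
      then show ?thesis using h that by (simp add: mapped_def)
    next
      case False
      then have "k' \<le> k" using that by simp
      then have "k' * N2 \<le> k * N2" by simp
      then have "k' * N2 + q < Suc k * N2 + x" for x unfolding mult_Suc using that by linarith
      then have "int (k' * N2 + q) \<notin> (\<lambda>q. int (Suc k * N2 + q)) ` {..<N2}"
        unfolding image_iff of_nat_eq_iff by (metis less_irrefl)
      then have "h (int (k' * N2 + q)) = M (''LD'', int (k' * N2 + q))" using h unfolding mapped_def by blast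
      then show ?thesis using L \<open>k' \<le> k\<close> that by (simp add: LDok_def)
    qed
    then show "l = l \<and> (\<exists>f. setarr M ''LD'' h = setarr M ''LD'' f) \<and> LDok (Suc k) (setarr M ''LD'' h)"
      by (auto simp: LDok_def)
  qed (use fixedD[OF f] size' k in \<open>auto simp: bounds_simps inj_on_def algebra_simps\<close>)
next
  case (second l' M')
  note a = second(2)
  then obtain h where h: "l' = l" "M' = setarr M ''LD'' h" "LDok (Suc k) M'" by blast
  have f': "fixed l M'" using f h by simp
  show ?case
    unfolding h(1)
  proof (rule runs_map'[where k = N2 and idx = "lidx (Suc k)" and val = "\<lambda>_. 1"])
    fix q assume q: "q < N2"
    have "M' (''LD'', int (Suc k * N2 + q)) = of_bool (leader D (Suc k) (ow q) (el q))"
      using h(3) q unfolding LDok_def by blast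
    then show "aval (lead_e nxt_e half_e) (l(''q'' := int q)) M' = lidx (Suc k) q"
      using q fixedD[OF f'] k by (simp add: lidx_def cell_def zdiv_int algebra_simps)
  next
    fix g assume g: "mapped N2 (lidx (Suc k)) (\<lambda>_. 1) (\<lambda>z. M' (''OC'', z)) g"
    have "g (int (cell k' i u)) = of_bool (k' \<le> Suc k \<and> occ D k' i u)" if "i < I" "u < 2 ^ K" for k' i u
    proof (cases "int (cell k' i u) \<in> lidx (Suc k) ` {..<N2}")
      case True
      then show ?thesis using g lidx_mem[OF that, of k' "Suc k"] by (auto simp: mapped_def)
    next
      case False
      then have "g (int (cell k' i u)) = M (''OC'', int (cell k' i u))" using g h(2) by (auto simp: mapped_def)
      then show ?thesis using False lidx_mem[OF that, of k' "Suc k"] L(2) that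
        by (auto simp: OCok_def le_Suc_eq)
    qed
    then show "l = l \<and> (\<exists>f ga. setarr M' ''OC'' g = setarr (setarr M ''LD'' f) ''OC'' ga)
       \<and> LDok (Suc k) (setarr M' ''OC'' g) \<and> OCok (Suc k) (setarr M' ''OC'' g)"
      using h by (auto simp: LDok_def OCok_def)
  qed (use fixedD[OF f'] size' lidx_inj in \<open>auto simp: bounds_simps\<close>)
qed simp

definition agree :: "string set \<Rightarrow> memory \<Rightarrow> memory \<Rightarrow> bool" where
  "agree S M M' \<longleftrightarrow> (\<forall>a z. a \<notin> S \<longrightarrow> M' (a, z) = M (a, z))"

lemma agree_refl: "agree S M M"
  by (simp add: agree_def)

lemma agree_setarr: "agree S M M' \<Longrightarrow> a \<in> S \<Longrightarrow> agree S M (setarr M' a f)"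
  by (auto simp: agree_def)

lemma leP: "\<bar>x\<bar> \<le> 2 ^ (a * K) \<Longrightarrow> a \<le> b \<Longrightarrow> \<bar>x\<bar> \<le> int (2 ^ K) ^ b"
proof -
  assume a: "\<bar>x\<bar> \<le> 2 ^ (a * K)" "a \<le> b"
  have "(2 :: int) ^ (a * K) \<le> 2 ^ (b * K)" using a(2) by (intro power_increasing) auto
  also have "\<dots> = int (2 ^ K) ^ b" by (simp add: power_mult[symmetric] mult.commute)
  finally show ?thesis using a(1) by simp
qed

lemma K_less: "int K \<le> 2 ^ K"
  using less_exp[of K] by (simp flip: of_nat_le_iff)

lemma run_next_level:
  assumes "k < K" "l ''k'' = int k" "l ''pk'' = 2 ^ k" "Q (l(''k'' := int (Suc k), ''pk'' := 2 ^ Suc k)) M"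
  shows "runs next_level l M 10 Q"
proof -
  have "int k + 1 \<le> 2 ^ K" using assms(1) K_less by linarith
  then have k: "\<bar>int k + 1\<bar> \<le> int (2 ^ K) ^ 5" by (intro leP[of _ 1]) simp_all
  have "(2 :: int) ^ Suc k \<le> 2 ^ (1 * K)" using assms(1) by (intro power_increasing) auto
  then have pk: "\<bar>2 ^ Suc k :: int\<bar> \<le> int (2 ^ K) ^ 5" by (intro leP[of _ 1]) simp_all
  show ?thesis
  proof (rule runs_let[where v = "int (Suc k)" and b = 5 and a = 5], goal_cases)
    case 5
    show ?case by (intro runs_Assign) (use assms pk in \<open>auto simp: bounds_simps\<close>)
  qed (use assms k in \<open>auto simp: bounds_simps add.commute\<close>)
qed

text \<open>Loop counters start at 0 and elements at 1, hence the shift. The array itself may be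
  read, but only at the element's own index.\<close>

lemma run_elems:
  assumes n: "l ''n'' = int n" and ve: "ok ve" "cost ve + 7 \<le> b"
    and val: "\<And>j. j \<in> {1..n} \<Longrightarrow> aval ve (l(''j'' := int j - 1)) M = val j"
    and rd: "a \<notin> arrs ve \<or> (\<forall>z j. (a, z) \<in> reads ve (l(''j'' := j)) M \<longrightarrow> z = j + 1)"
    and bd: "vb ve \<le> ax a \<or> (\<forall>j\<in>{1..n}. \<bar>val j\<bar> \<le> int (2 ^ K) ^ ax a)"
    and Q: "\<And>f. (\<And>j. j \<in> {1..n} \<Longrightarrow> f (int j) = val j) \<Longrightarrow> Q l (setarr M a f)"
  shows "runs (ParFor ''j'' (Var ''n'') (Store a (Var ''j'' \<oplus> Const 1) ve)) l M b Q"
proof (rule runs_map[where k = n and idx = "\<lambda>j. int (Suc j)" and val = "\<lambda>j. val (Suc j)"])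
  show "aval ve (l(''j'' := int j)) M = val (Suc j)" if "j < n" for j
    using val[of "Suc j"] that by simp
  show "(a, int (Suc i)) \<notin> reads (Var ''j'' \<oplus> Const 1) (l(''j'' := int j)) M \<union> reads ve (l(''j'' := int j)) M"
    if "i \<noteq> j" for i j
  proof -
    have "int (Suc i) \<noteq> int j + 1" using that by simp
    then have "(a, int (Suc i)) \<notin> reads ve (l(''j'' := int j)) M" using rd reads_arrs by blast
    then show ?thesis by simp
  qed
  fix f assume f: "mapped n (\<lambda>j. int (Suc j)) (\<lambda>j. val (Suc j)) (\<lambda>z. M (a, z)) f"
  show "Q l (setarr M a f)"
  proof (rule Q)
    fix j assume "j \<in> {1..n}"
    then have "j - 1 < n" "Suc (j - 1) = j" by auto
    then show "f (int j) = val j" using f unfolding mapped_def by metis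
  qed
next
  show "vb ve \<le> ax a \<or> (\<forall>j<n. \<bar>val (Suc j)\<bar> \<le> int (2 ^ K) ^ ax a)" using bd by auto
qed (use n ve size' in \<open>auto simp: bounds_simps inj_on_def\<close>)

lemma run_start_levels:
  assumes "runs c (l(''k'' := 0, ''pk'' := 1)) M a Q" "4 + a \<le> a'"
  shows "runs (Assign ''k'' (Const 0) ;; Assign ''pk'' (Const 1) ;; c) l M a' Q"
proof (rule runs_Seq[where ?a1.0 = 2 and ?a2.0 = "2 + a" and ?Q1.0 = "\<lambda>l' M'. l' = l(''k'' := 0) \<and> M' = M"], goal_cases first second)
  case first
  show ?case
    by (intro runs_Assign) auto
next
  case (second l' M')
  note second(2)
  then show "runs (Assign ''pk'' (Const 1) ;; c) l' M' (2 + a) Q"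
    using assms(1)
    by (intro runs_Seq[where ?a1.0 = 2 and ?a2.0 = a and ?Q1.0 = "\<lambda>l' M'. l' = l(''k'' := 0, ''pk'' := 1) \<and> M' = M"] runs_Assign)
      auto
qed (use assms in simp)

lemma run_leaders:
  assumes f: "fixed l M" and z: "\<And>z. M (''OC'', z) = 0"
  shows "runs leaders_com l M (70 + (K + 1) * 220) (\<lambda>l' M'. fixed l' M' \<and> LDok K M' \<and> agree {''LD'', ''OC''} M M')"
  unfolding leaders_com_def
proof (rule runs_Seq[OF run_leaders_init[OF f z], where ?a2.0 = "10 + (K + 1) * 220"], goal_cases first second)
  case (first l1 M1)
  note first(2)
  then have 1: "fixed l1 M1" "LDok 0 M1" "OCok 0 M1" "agree {''LD'', ''OC''} M M1"
    using f by (auto intro!: agree_setarr agree_refl)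
  let ?I = "\<lambda>k l' M'. fixed l' M' \<and> l' ''k'' = int k \<and> l' ''pk'' = 2 ^ k \<and> LDok k M' \<and> OCok k M' \<and> agree {''LD'', ''OC''} M M'"
  show ?case
  proof (rule run_start_levels)
    let ?l2 = "l1(''k'' := 0, ''pk'' := 1)"
    have I: "?I 0 ?l2 M1" using 1 by simp
    show "runs (While (Op Less (Var ''k'') (Var ''K'')) (leaders_step ;; next_level)) ?l2 M1 ((K + 1) * 220)
     (\<lambda>l' M'. fixed l' M' \<and> LDok K M' \<and> agree {''LD'', ''OC''} M M')"
    proof (rule runs_While[where T = K and I = ?I and a = 210])
      fix k l3 M3 assume k: "k < K" and I: "?I k l3 M3"
      have "runs (leaders_step ;; next_level) l3 M3 210 (?I (Suc k))"
      proof (rule runs_Seq[OF run_leaders_step[of l3 M3 k], where ?a2.0 = 10], goal_cases)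
        case (7 l4 M4)
        note 7(2)
        then obtain f g where fg: "l4 = l3" "M4 = setarr (setarr M3 ''LD'' f) ''OC'' g" "LDok (Suc k) M4" "OCok (Suc k) M4"
          by blast
        have "agree {''LD'', ''OC''} M M3" using I by blast
        then have "agree {''LD'', ''OC''} M M4" unfolding fg(2) by (intro agree_setarr) simp_all
        with fg have 4: "l4 = l3" "fixed l3 M4" "LDok (Suc k) M4" "OCok (Suc k) M4" "agree {''LD'', ''OC''} M M4"
          using I by simp_all
        show ?case
          by (rule run_next_level[of k]) (use k I 4 in auto)
      qed (use k I in auto)
      then show "aval (Op Less (Var ''k'') (Var ''K'')) l3 M3 \<noteq> 0 \<and> runs (leaders_step ;; next_level) l3 M3 210 (?I (Suc k))"
        using I k fixedD[of l3 M3] by simp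
    qed (use I fixedD in \<open>auto simp: bounds_simps\<close>)
  qed simp
qed simp

section \<open>Summation along a balanced tree\<close>

lemma sum_pairs_image: "(\<Sum>z\<in>{2 * w..<4 * w}. g z) = (\<Sum>z\<in>{w..<2 * w}. g (2 * z) + g (2 * z + 1))"
  for g :: "nat \<Rightarrow> int"
proof -
  have e: "{2 * w..<4 * w} = {0 + 2 * w..<2 * w + 2 * w}" "{w..<2 * w} = {0 + w..<w + w}" by auto
  show ?thesis unfolding e sum.shift_bounds_nat_ivl atLeast0LessThan sum_split_pairs
    by (intro sum.cong) (auto simp: algebra_simps)
qed

text \<open>The sum of absolute values over the current level never increases, so one bound at the
  leaves prevents overflow everywhere. The leaves themselves remain intact, which preserves the zero
  padding for the next use.\<close>

lemma run_tree_sum: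
  assumes P: "l ''P'' = 2 ^ K" and b: "(\<Sum>z\<in>{2 ^ K..<2 * 2 ^ K}. \<bar>M (''H'', int z)\<bar>) \<le> int (2 ^ K) ^ 120"
    and Q: "\<And>f v. f 1 = (\<Sum>z\<in>{2 ^ K..<2 * 2 ^ K}. M (''H'', int z)) \<Longrightarrow> (\<And>z. 2 ^ K \<le> z \<Longrightarrow> f z = M (''H'', z))
      \<Longrightarrow> Q (l(''w'' := v)) (setarr M ''H'' f)"
  shows "runs tree_sum l M (10 + (K + 1) * 60) Q"
  unfolding tree_sum_def
proof -
  let ?p = "\<lambda>e. 2 ^ (K - e) :: nat"
  let ?I = "\<lambda>e l' M'. l' = l(''w'' := int (?p e div 2)) \<and> (\<exists>f. M' = setarr M ''H'' f \<and>
     (\<Sum>z\<in>{?p e..<2 * ?p e}. f (int z)) = (\<Sum>z\<in>{2 ^ K..<2 * 2 ^ K}. M (''H'', int z)) \<and>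
     (\<Sum>z\<in>{?p e..<2 * ?p e}. \<bar>f (int z)\<bar>) \<le> int (2 ^ K) ^ 120 \<and> (\<forall>z\<ge>2 ^ K. f z = M (''H'', z)))"
  show "runs (Assign ''w'' (Var ''P'' \<oslash> Const 2) ;;
     While (Op Less (Const 0) (Var ''w''))
      (ParFor ''q'' (Var ''w'') (Store ''H'' (Var ''w'' \<oplus> Var ''q'')
         (Read ''H'' (Const 2 \<otimes> (Var ''w'' \<oplus> Var ''q'')) \<oplus> Read ''H'' (Const 2 \<otimes> (Var ''w'' \<oplus> Var ''q'') \<oplus> Const 1))) ;;
       Assign ''w'' (Var ''w'' \<oslash> Const 2))) l M (10 + (K + 1) * 60) Q"
  proof (rule runs_Seq[where ?a1.0 = 10 and ?a2.0 = "(K + 1) * 60" and ?Q1.0 = "?I 0"], goal_cases first second)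
    have M: "M = setarr M ''H'' (\<lambda>z. M (''H'', z))" by (auto simp: setarr_def)
    have "(2 :: int) ^ K div 2 \<le> 2 ^ K" using abs_div_le[of "2 ^ K" 2] by simp
    then have "\<bar>2 ^ K div 2\<bar> \<le> (2 :: int) ^ (1 * K)" by simp
    case first
    from leP[OF \<open>\<bar>2 ^ K div 2\<bar> \<le> (2 :: int) ^ (1 * K)\<close>, of 5] show ?case
      by (intro runs_Assign) (use P b M in \<open>auto simp: bounds_simps zdiv_int\<close>)
  next
    case (second l1 M1)
    note I0 = second(2)
    show ?case
    proof (rule runs_While[where T = K and I = ?I and a = 50])
      fix e l2 M2 assume e: "e < K" and I: "?I e l2 M2"
      then obtain f where f: "M2 = setarr M ''H'' f"
        "(\<Sum>z\<in>{?p e..<2 * ?p e}. f (int z)) = (\<Sum>z\<in>{2 ^ K..<2 * 2 ^ K}. M (''H'', int z))"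
        "(\<Sum>z\<in>{?p e..<2 * ?p e}. \<bar>f (int z)\<bar>) \<le> int (2 ^ K) ^ 120" "\<forall>z\<ge>2 ^ K. f z = M (''H'', z)" by blast
      define w where "w = ?p (Suc e)"
      have pe: "?p e = 2 * w" using e by (simp add: w_def Suc_diff_Suc flip: power_Suc)
      have l2: "l2 = l(''w'' := int w)" using I pe by simp
      have w0: "0 < w" by (simp add: w_def)
      have w2: "2 * w \<le> 2 ^ K" unfolding pe[symmetric] by (intro power_increasing) auto
      have S: "(\<Sum>z\<in>{2 * w..<4 * w}. f (int z)) = (\<Sum>z\<in>{2 ^ K..<2 * 2 ^ K}. M (''H'', int z))"
        "(\<Sum>z\<in>{2 * w..<4 * w}. \<bar>f (int z)\<bar>) \<le> int (2 ^ K) ^ 120" using f(2,3) pe by simp_all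
      have S2: "(\<Sum>z\<in>{w..<2 * w}. \<bar>f (int (2 * z)) + f (int (2 * z + 1))\<bar>) \<le> int (2 ^ K) ^ 120"
      proof -
        have "(\<Sum>z\<in>{w..<2 * w}. \<bar>f (int (2 * z)) + f (int (2 * z + 1))\<bar>)
          \<le> (\<Sum>z\<in>{w..<2 * w}. \<bar>f (int (2 * z))\<bar> + \<bar>f (int (2 * z + 1))\<bar>)"
          by (intro sum_mono abs_triangle_ineq)
        then show ?thesis using S(2) unfolding sum_pairs_image[of "\<lambda>z. \<bar>f (int z)\<bar>"] by linarith
      qed
      have one: "\<bar>f (int (2 * z)) + f (int (2 * z + 1))\<bar> \<le> int (2 ^ K) ^ 120" if "z \<in> {w..<2 * w}" for z
        using order_trans[OF member_le_sum[OF that] S2] by simp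
      have "runs (ParFor ''q'' (Var ''w'') (Store ''H'' (Var ''w'' \<oplus> Var ''q'')
         (Read ''H'' (Const 2 \<otimes> (Var ''w'' \<oplus> Var ''q'')) \<oplus> Read ''H'' (Const 2 \<otimes> (Var ''w'' \<oplus> Var ''q'') \<oplus> Const 1))) ;;
         Assign ''w'' (Var ''w'' \<oslash> Const 2)) l2 M2 50 (?I (Suc e))"
      proof (rule runs_Seq[where ?a1.0 = 40 and ?a2.0 = 10 and ?Q1.0 = "\<lambda>l' M'. l' = l2 \<and> (\<exists>f. M' = setarr M ''H'' f \<and>
         (\<Sum>z\<in>{w..<2 * w}. f (int z)) = (\<Sum>z\<in>{2 ^ K..<2 * 2 ^ K}. M (''H'', int z)) \<and>
         (\<Sum>z\<in>{w..<2 * w}. \<bar>f (int z)\<bar>) \<le> int (2 ^ K) ^ 120 \<and> (\<forall>z\<ge>2 ^ K. f z = M (''H'', z)))"], goal_cases first second)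
        case first
        show ?case
        \<comment> \<open>Writes go to the cells from \<open>w\<close> to \<open>2 * w - 1\<close>
          and reads to those from \<open>2 * w\<close> on, so the level is combined without
          conflict.\<close>
        proof (rule runs_map[where k = w and idx = "\<lambda>i. int (w + i)"
              and val = "\<lambda>i. f (int (2 * (w + i))) + f (int (2 * (w + i) + 1))"])
          fix h assume h: "mapped w (\<lambda>i. int (w + i)) (\<lambda>i. f (int (2 * (w + i))) + f (int (2 * (w + i) + 1)))
            (\<lambda>z. M2 (''H'', z)) h"
          have hz: "h (int z) = f (int (2 * z)) + f (int (2 * z + 1))" if "z \<in> {w..<2 * w}" for z
          proof -
            have "z - w < w" "w + (z - w) = z" using that by auto
            then show ?thesis using h unfolding mapped_def by metis
          qed
          have "h z = M (''H'', z)" if "2 ^ K \<le> z" for z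
          proof -
            have "2 * int w \<le> 2 ^ K" using w2 by (metis of_nat_le_iff of_nat_mult of_nat_numeral of_nat_power)
            then have "z \<notin> (\<lambda>i. int (w + i)) ` {..<w}" using that by auto
            then show ?thesis using h f(1,4) that by (simp add: mapped_def)
          qed
          moreover have "(\<Sum>z\<in>{w..<2 * w}. h (int z)) = (\<Sum>z\<in>{w..<2 * w}. f (int (2 * z)) + f (int (2 * z + 1)))"
            "(\<Sum>z\<in>{w..<2 * w}. \<bar>h (int z)\<bar>) = (\<Sum>z\<in>{w..<2 * w}. \<bar>f (int (2 * z)) + f (int (2 * z + 1))\<bar>)"
            by (intro sum.cong refl; simp only: hz)+
          moreover have "setarr M2 ''H'' h = setarr M ''H'' h" using f(1) by (auto simp: setarr_def fun_eq_iff)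
          ultimately show "l2 = l2 \<and> (\<exists>f. setarr M2 ''H'' h = setarr M ''H'' f \<and>
             (\<Sum>z\<in>{w..<2 * w}. f (int z)) = (\<Sum>z\<in>{2 ^ K..<2 * 2 ^ K}. M (''H'', int z)) \<and>
             (\<Sum>z\<in>{w..<2 * w}. \<bar>f (int z)\<bar>) \<le> int (2 ^ K) ^ 120 \<and> (\<forall>z\<ge>2 ^ K. f z = M (''H'', z)))"
            using S2 S(1) unfolding sum_pairs_image[of "\<lambda>z. f (int z)"] by auto
        next
          show "vb (Read ''H'' (Const 2 \<otimes> (Var ''w'' \<oplus> Var ''q'')) \<oplus> Read ''H'' (Const 2 \<otimes> (Var ''w'' \<oplus> Var ''q'') \<oplus> Const 1)) \<le> ax ''H''
            \<or> (\<forall>i<w. \<bar>f (int (2 * (w + i))) + f (int (2 * (w + i) + 1))\<bar> \<le> int (2 ^ K) ^ ax ''H'')"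
          proof (intro disjI2 allI impI)
            fix i assume "i < w"
            then have "w + i \<in> {w..<2 * w}" by auto
            then show "\<bar>f (int (2 * (w + i))) + f (int (2 * (w + i) + 1))\<bar> \<le> int (2 ^ K) ^ ax ''H''"
              using one[of "w + i"] by (simp add: ax_def)
          qed
        qed (use l2 f(1) w2 w0 in \<open>auto simp: bounds_simps inj_on_def algebra_simps\<close>)
      next
        case (second l3 M3)
        note a = second(2)
        have "w div 2 \<le> 2 ^ K" using w2 by linarith
        then have "int (w div 2) \<le> int (2 ^ K)" by (simp only: of_nat_le_iff)
        then have "int w div 2 \<le> 2 ^ K" by (simp add: zdiv_int)
        then have "\<bar>int w div 2\<bar> \<le> 2 ^ (1 * K)" by simp
        from leP[OF this, of 5] show "runs (Assign ''w'' (Var ''w'' \<oslash> Const 2)) l3 M3 10 (?I (Suc e))"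
          by (intro runs_Assign) (use a l2 in \<open>auto simp: bounds_simps w_def zdiv_int\<close>)
      qed simp
      then show "aval (Op Less (Const 0) (Var ''w'')) l2 M2 \<noteq> 0 \<and> runs (ParFor ''q'' (Var ''w'') (Store ''H'' (Var ''w'' \<oplus> Var ''q'')
         (Read ''H'' (Const 2 \<otimes> (Var ''w'' \<oplus> Var ''q'')) \<oplus> Read ''H'' (Const 2 \<otimes> (Var ''w'' \<oplus> Var ''q'') \<oplus> Const 1))) ;;
         Assign ''w'' (Var ''w'' \<oslash> Const 2)) l2 M2 50 (?I (Suc e))"
        using l2 w0 by simp
    next
      fix l2 M2 assume I: "?I K l2 M2"
      then show "aval (Op Less (Const 0) (Var ''w'')) l2 M2 = 0" by simp
      have "{Suc 0..<2} = {Suc 0}" by auto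
      then show "Q l2 M2" using I Q by auto
    qed (use I0 in \<open>auto simp: bounds_simps\<close>)
  qed simp
qed

section \<open>Signed class sums, level by level\<close>

definition Vok :: "string \<Rightarrow> (nat \<Rightarrow> int) \<Rightarrow> (nat \<Rightarrow> nat \<Rightarrow> int) \<Rightarrow> nat \<Rightarrow> memory \<Rightarrow> bool" where
  "Vok a r \<phi> k M \<longleftrightarrow> (\<forall>i<I. \<forall>u<2 ^ K. M (a, int (cell k i u)) = agg r k (\<phi> i) u)"

text \<open>Holds for all levels at once and throughout the computation. It allows \<open>V\<close>
  and \<open>W\<close> to be reused in each round without clearing: cells of occupied classes are
  overwritten before they are read, the others stay 0.\<close>

definition Vz :: "string \<Rightarrow> memory \<Rightarrow> bool" where
  "Vz a M \<longleftrightarrow> (\<forall>k i u. i < I \<longrightarrow> u < 2 ^ K \<longrightarrow> \<not> occ D k i u \<longrightarrow> M (a, int (cell k i u)) = 0)"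

lemma agg_unocc: "(\<And>j. j \<notin> D i \<Longrightarrow> \<phi> j = 0) \<Longrightarrow> \<not> occ D k i u \<Longrightarrow> agg r k \<phi> u = 0"
  by (rule agg_zero) (auto simp: occ_def)

text \<open>Both children of the class stay inside the row of \<open>2 ^ K\<close> cells, so reading
  them never reaches a neighbouring row.\<close>

lemma half_less:
  assumes "k < K" "x < 2 ^ K" shows "2 * (x div 2 ^ Suc k) + 1 < (2 :: nat) ^ K"
proof -
  obtain K' where K': "K = Suc K'" using assms(1) by (cases K) auto
  have "x div 2 ^ Suc k \<le> x div 2"
    by (rule div_le_mono2) simp_all
  moreover have "x div 2 < 2 ^ K'" using assms(2) K' by (simp add: div_less_iff_less_mult mult.commute)
  ultimately have "x div 2 ^ Suc k < 2 ^ K'" by linarith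
  then show ?thesis unfolding K' power_Suc by linarith
qed

lemma cell_Suc: "int (cell k i u) + 1 = int (cell k i (u + 1))"
  by (simp add: cell_def)

lemma cell_left: "(int k * int I + int (ow q)) * 2 ^ K + 2 * (int (el q) div (2 * 2 ^ k))
    = int (cell k (ow q) (2 * (el q div 2 ^ Suc k)))"
  by (simp add: cell_def zdiv_int)

lemma lidx_ne: "q < N2 \<Longrightarrow> i < I \<Longrightarrow> u < 2 ^ K \<Longrightarrow> lidx (Suc k) q \<noteq> int (cell k i u)"
proof
  assume a: "q < N2" "i < I" "u < 2 ^ K" "lidx (Suc k) q = int (cell k i u)"
  then have "int (cell k i u) \<in> lidx (Suc k) ` {..<N2}" by (metis imageI lessThan_iff)
  then show False using lidx_mem[of i u k "Suc k"] a by simp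
qed

lemma aval_lead:
  assumes f: "fixed l M" and L: "LDok K M" and k: "k < K" "l ''k'' = int k" "l ''pk'' = 2 ^ k" and q: "q < N2"
  shows "aval (lead_e nxt_e half_e) (l(''q'' := int q)) M = lidx (Suc k) q"
    "M (''LD'', (int k + 1) * int N2 + int q) = of_bool (leader D (Suc k) (ow q) (el q))"
proof -
  have "M (''LD'', int (Suc k * N2 + q)) = of_bool (leader D (Suc k) (ow q) (el q))"
    using L q k(1) unfolding LDok_def by (metis Suc_leI)
  then show "aval (lead_e nxt_e half_e) (l(''q'' := int q)) M = lidx (Suc k) q"
    "M (''LD'', (int k + 1) * int N2 + int q) = of_bool (leader D (Suc k) (ow q) (el q))"
    using q fixedD[OF f] k by (simp_all add: lidx_def cell_def zdiv_int algebra_simps)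
qed

text \<open>An occupied class is written by its leader. For an empty one the true sum is 0 and so is
  the cell, hence the whole row is correct although only occupied cells were written.\<close>

lemma run_merge:
  assumes f: "fixed l M" and L: "LDok K M" and k: "k < K" "l ''k'' = int k" "l ''pk'' = 2 ^ k"
    and V: "Vok a r \<phi> k M" "Vz a M" and a: "a \<in> {''V'', ''W''}"
    and e: "e = Var ''r'' \<and> l ''r'' = r k \<or> e = Const 1 \<and> r k = 1"
    and \<phi>: "\<And>i j. i < I \<Longrightarrow> j \<notin> D i \<Longrightarrow> \<phi> i j = 0"
    and bd: "\<And>i u. i < I \<Longrightarrow> \<bar>agg r (Suc k) (\<phi> i) u\<bar> \<le> int (2 ^ K) ^ ax a"
  shows "runs (merge_com a e) l M 200 (\<lambda>l' M'. l' = l \<and> (\<exists>f. M' = setarr M a f) \<and> Vok a r \<phi> (Suc k) M' \<and> Vz a M')"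
  unfolding merge_com_def
proof (rule runs_map[where k = N2 and idx = "lidx (Suc k)"
    and val = "\<lambda>q. agg r (Suc k) (\<phi> (ow q)) (el q div 2 ^ Suc k)"])
  have an: "a \<noteq> ''LD''" "a \<noteq> ''ow''" "a \<noteq> ''el''" using a by auto
  have ee: "aval e (l(''q'' := z)) M = r k" "reads e (l(''q'' := z)) M = {}" for z using e by auto
  have uu: "2 * (el q div 2 ^ Suc k) < 2 ^ K" "2 * (el q div 2 ^ Suc k) + 1 < 2 ^ K" if "q < N2" for q
    using half_less[OF k(1) pos_facts(5)[OF that]] by auto
  let ?ve = "Read a (cell_e (Var ''k'') (Const 2 \<otimes> half_e)) \<oplus> e \<otimes> Read a (cell_e (Var ''k'') (Const 2 \<otimes> half_e) \<oplus> Const 1)"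
  have adr: "aval (cell_e (Var ''k'') (Const 2 \<otimes> half_e)) (l(''q'' := int q)) M = int (cell k (ow q) (2 * (el q div 2 ^ Suc k)))"
    if "q < N2" for q
    using that fixedD[OF f] k by (simp add: cell_left del: power_Suc)
  show "aval ?ve (l(''q'' := int q)) M = agg r (Suc k) (\<phi> (ow q)) (el q div 2 ^ Suc k)" if q: "q < N2" for q
  proof -
    have "aval ?ve (l(''q'' := int q)) M = M (a, int (cell k (ow q) (2 * (el q div 2 ^ Suc k))))
      + r k * M (a, int (cell k (ow q) (2 * (el q div 2 ^ Suc k))) + 1)"
      using adr[OF q] ee by simp
    then show ?thesis using V(1) pos_facts(1)[OF q] uu[OF q] by (simp add: Vok_def cell_Suc)
  qed
  show "aval (lead_e nxt_e half_e) (l(''q'' := int q)) M = lidx (Suc k) q" if "q < N2" for q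
    by (rule aval_lead[OF f L k that])
  fix q q' assume q: "q < N2" "q' < N2" "q \<noteq> q'"
  \<comment> \<open>Stores reach only level \<open>k + 1\<close> or negative indices, whereas both
    reads lie in level \<open>k\<close>.\<close>
  have "lidx (Suc k) q \<noteq> int (cell k (ow q') (2 * (el q' div 2 ^ Suc k)))"
    "lidx (Suc k) q \<noteq> int (cell k (ow q') (2 * (el q' div 2 ^ Suc k))) + 1"
    unfolding cell_Suc by (intro lidx_ne; use q pos_facts uu in blast)+
  moreover have "reads ?ve (l(''q'' := int q')) M =
      insert (a, int (cell k (ow q') (2 * (el q' div 2 ^ Suc k)))) (reads (cell_e (Var ''k'') (Const 2 \<otimes> half_e)) (l(''q'' := int q')) M)
      \<union> insert (a, int (cell k (ow q') (2 * (el q' div 2 ^ Suc k))) + 1)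
          (reads (cell_e (Var ''k'') (Const 2 \<otimes> half_e) \<oplus> Const 1) (l(''q'' := int q')) M)"
    unfolding adr[OF q(2), symmetric] by (simp only: reads.simps ee aval.simps binop_val.simps Un_empty_left)
  moreover have "a \<notin> arrs (lead_e nxt_e half_e)" "a \<notin> arrs (cell_e (Var ''k'') (Const 2 \<otimes> half_e))"
    "a \<notin> arrs (cell_e (Var ''k'') (Const 2 \<otimes> half_e) \<oplus> Const 1)"
    using an by simp_all
  then have "(a, z) \<notin> reads (lead_e nxt_e half_e) (l(''q'' := int q')) M"
    "(a, z) \<notin> reads (cell_e (Var ''k'') (Const 2 \<otimes> half_e)) (l(''q'' := int q')) M"
    "(a, z) \<notin> reads (cell_e (Var ''k'') (Const 2 \<otimes> half_e) \<oplus> Const 1) (l(''q'' := int q')) M" for z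
    using reads_arrs by blast+
  ultimately show "(a, lidx (Suc k) q) \<notin> reads (lead_e nxt_e half_e) (l(''q'' := int q')) M \<union> reads ?ve (l(''q'' := int q')) M"
    by blast
next
  fix g assume g: "mapped N2 (lidx (Suc k)) (\<lambda>q. agg r (Suc k) (\<phi> (ow q)) (el q div 2 ^ Suc k)) (\<lambda>z. M (a, z)) g"
  have val: "g (int (cell k' i u)) = (if k' = Suc k \<and> occ D k' i u then agg r k' (\<phi> i) u else M (a, int (cell k' i u)))"
    if iu: "i < I" "u < 2 ^ K" for k' i u
  proof (cases "k' = Suc k \<and> occ D k' i u")
    case True
    then obtain q where q: "q < N2" "ow q = i" "el q div 2 ^ Suc k = u" "leader D (Suc k) (ow q) (el q)"
      using leader_ex[of i "Suc k" u] iu by blast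
    then have "g (lidx (Suc k) q) = agg r (Suc k) (\<phi> i) u" using g unfolding mapped_def by blast
    moreover have "lidx (Suc k) q = int (cell k' i u)" unfolding lidx_def using q True by simp
    ultimately have "g (int (cell k' i u)) = agg r k' (\<phi> i) u" using True by simp
    then show ?thesis by (simp only: if_P[OF True])
  next
    case False
    have "int (cell k' i u) \<in> lidx (Suc k) ` {..<N2} \<longleftrightarrow> k' = Suc k \<and> occ D k' i u"
      using lidx_mem[OF iu, of k' "Suc k"] by (cases "k' = Suc k") simp_all
    with False have "int (cell k' i u) \<notin> lidx (Suc k) ` {..<N2}" by argo
    then have "g (int (cell k' i u)) = M (a, int (cell k' i u))" using g unfolding mapped_def by blast
    then show ?thesis by (simp only: if_not_P[OF False])
  qed
  have "Vok a r \<phi> (Suc k) (setarr M a g)"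
    unfolding Vok_def
  proof (intro allI impI)
    fix i u assume iu: "i < I" "u < (2 :: nat) ^ K"
    show "setarr M a g (a, int (cell (Suc k) i u)) = agg r (Suc k) (\<phi> i) u"
    proof (cases "occ D (Suc k) i u")
      case True
      then show ?thesis using val[OF iu, of "Suc k"] by simp
    next
      case False
      then have "agg r (Suc k) (\<phi> i) u = 0" using agg_unocc[of i "\<phi> i" "Suc k" u r] \<phi>[OF iu(1)] by blast
      moreover have "M (a, int (cell (Suc k) i u)) = 0" using V(2) iu False by (simp add: Vz_def)
      ultimately show ?thesis using val[OF iu, of "Suc k"] False by simp
    qed
  qed
  moreover have "Vz a (setarr M a g)" unfolding Vz_def using val V(2) by (simp add: Vz_def)
  ultimately show "l = l \<and> (\<exists>f. setarr M a g = setarr M a f) \<and> Vok a r \<phi> (Suc k) (setarr M a g) \<and> Vz a (setarr M a g)"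
    by blast
next
  show "vb (Read a (cell_e (Var ''k'') (Const 2 \<otimes> half_e)) \<oplus> e \<otimes> Read a (cell_e (Var ''k'') (Const 2 \<otimes> half_e) \<oplus> Const 1)) \<le> ax a
    \<or> (\<forall>q<N2. \<bar>agg r (Suc k) (\<phi> (ow q)) (el q div 2 ^ Suc k)\<bar> \<le> int (2 ^ K) ^ ax a)"
    using bd pos_facts(1) by blast
qed (use fixedD[OF f] size' lidx_inj e a in \<open>auto simp: bounds_simps\<close>)

definition stE :: "(nat \<Rightarrow> int) \<Rightarrow> (nat \<Rightarrow> int) \<Rightarrow> memory \<Rightarrow> bool" where
  "stE y c M \<longleftrightarrow> (\<forall>j\<in>{1..n}. M (''Y'', int j) = y j \<and> M (''C'', int j) = c j)"

definition stK :: "(nat \<Rightarrow> int) \<Rightarrow> memory \<Rightarrow> bool" where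
  "stK \<kappa> M \<longleftrightarrow> (\<forall>i<I. M (''KA'', int i) = \<kappa> i)"

definition stS :: "(nat \<Rightarrow> int) \<Rightarrow> nat \<Rightarrow> memory \<Rightarrow> bool" where
  "stS r k M \<longleftrightarrow> (\<forall>j\<in>{1..n}. M (''SG'', int j) = sg r k j)"

text \<open>The padding of the tree: leaves behind those of the positions and the elements must
  contribute 0 to every sum.\<close>

definition Hz :: "memory \<Rightarrow> bool" where
  "Hz M \<longleftrightarrow> (\<forall>z. N2 + n \<le> z \<longrightarrow> z < 2 ^ K \<longrightarrow> M (''H'', int (2 ^ K + z)) = 0)"

definition set_leaf :: "(nat \<Rightarrow> int) \<Rightarrow> (nat \<Rightarrow> nat \<Rightarrow> int) \<Rightarrow> (nat \<Rightarrow> int) \<Rightarrow> nat \<Rightarrow> nat \<Rightarrow> nat \<Rightarrow> int" where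
  "set_leaf \<kappa> b r k i u = \<kappa> i * (2 * (agg r k (b i) (2 * u) * agg r k (b i) (2 * u + 1))
       + (if u = 0 then (SL i)\<^sup>2 * agg r k (b i) 1 else 0))"

lemma active_aval: "(if 0 < y then 1 else 0) * (if y < 16 * E then 1 else 0) = (of_bool (active E y) :: int)"
  by (simp add: active_def)

lemma run_leaves_sets:
  assumes f: "fixed l M" and L: "LDok K M" and k: "k < K" "l ''k'' = int k" "l ''pk'' = 2 ^ k"
    and V: "Vok ''V'' r b k M" and S: "stK \<kappa> M"
    and Q: "\<And>h. mapped N2 (\<lambda>q. int (2 ^ K + q))
          (\<lambda>q. of_bool (leader D (Suc k) (ow q) (el q)) * set_leaf \<kappa> b r k (ow q) (el q div 2 ^ Suc k)) (\<lambda>z. M (''H'', z)) h \<Longrightarrow>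
        (\<And>q. q < N2 \<Longrightarrow> \<bar>h (int (2 ^ K + q))\<bar> \<le> int (2 ^ K) ^ 119) \<Longrightarrow> Q l (setarr M ''H'' h)"
  shows "runs leaves_sets l M 200 Q"
  unfolding leaves_sets_def Let_def
proof (rule runs_map'[where k = N2 and idx = "\<lambda>q. int (2 ^ K + q)"
    and val = "\<lambda>q. of_bool (leader D (Suc k) (ow q) (el q)) * set_leaf \<kappa> b r k (ow q) (el q div 2 ^ Suc k)"])
  let ?v0 = "Read ''V'' (cell_e (Var ''k'') (Const 2 \<otimes> half_e))"
  let ?v1 = "Read ''V'' (cell_e (Var ''k'') (Const 2 \<otimes> half_e) \<oplus> Const 1)"
  let ?sl = "Read ''SL'' own_e"
  let ?ve = "flag_e nxt_e \<otimes> (Read ''KA'' own_e \<otimes>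
          (Const 2 \<otimes> (?v0 \<otimes> ?v1) \<oplus> Op Eq half_e (Const 0) \<otimes> (?sl \<otimes> ?sl \<otimes> ?v1)))"
  fix q assume q: "q < N2"
  have u: "2 * (el q div 2 ^ Suc k) < 2 ^ K" "2 * (el q div 2 ^ Suc k) + 1 < 2 ^ K"
    using half_less[OF k(1) pos_facts(5)[OF q]] by auto
  have adr: "aval (cell_e (Var ''k'') (Const 2 \<otimes> half_e)) (l(''q'' := int q)) M = int (cell k (ow q) (2 * (el q div 2 ^ Suc k)))"
    using q fixedD[OF f] k by (simp add: cell_left del: power_Suc)
  have v: "aval ?v0 (l(''q'' := int q)) M = agg r k (b (ow q)) (2 * (el q div 2 ^ Suc k))"
    "aval ?v1 (l(''q'' := int q)) M = agg r k (b (ow q)) (2 * (el q div 2 ^ Suc k) + 1)"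
    using adr V pos_facts(1)[OF q] u by (simp_all add: Vok_def cell_Suc del: power_Suc)
  have h: "aval half_e (l(''q'' := int q)) M = int (el q div 2 ^ Suc k)"
    using q fixedD[OF f] k by (simp add: zdiv_int)
  have fl: "aval (flag_e nxt_e) (l(''q'' := int q)) M = of_bool (leader D (Suc k) (ow q) (el q))"
    using aval_lead(2)[OF f L k q] fixedD[OF f] k by simp
  have o: "aval (Read ''KA'' own_e) (l(''q'' := int q)) M = \<kappa> (ow q)" "aval ?sl (l(''q'' := int q)) M = SL (ow q)"
    using q fixedD[OF f] pos_facts(1)[OF q] S by (simp_all add: stK_def)
  have "aval ?ve (l(''q'' := int q)) M = aval (flag_e nxt_e) (l(''q'' := int q)) M * (aval (Read ''KA'' own_e) (l(''q'' := int q)) M *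
      (2 * (aval ?v0 (l(''q'' := int q)) M * aval ?v1 (l(''q'' := int q)) M)
       + (if aval half_e (l(''q'' := int q)) M = 0 then 1 else 0) *
         (aval ?sl (l(''q'' := int q)) M * aval ?sl (l(''q'' := int q)) M * aval ?v1 (l(''q'' := int q)) M)))"
    by (simp only: aval.simps binop_val.simps)
  then show "aval ?ve (l(''q'' := int q)) M = of_bool (leader D (Suc k) (ow q) (el q)) * set_leaf \<kappa> b r k (ow q) (el q div 2 ^ Suc k)"
    unfolding v h fl o set_leaf_def by (simp add: power2_eq_square del: power_Suc)
next
  fix h assume h: "mapped N2 (\<lambda>q. int (2 ^ K + q))
          (\<lambda>q. of_bool (leader D (Suc k) (ow q) (el q)) * set_leaf \<kappa> b r k (ow q) (el q div 2 ^ Suc k)) (\<lambda>z. M (''H'', z)) h"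
   and bd: "\<And>q. q < N2 \<Longrightarrow> \<bar>of_bool (leader D (Suc k) (ow q) (el q)) * set_leaf \<kappa> b r k (ow q) (el q div 2 ^ Suc k)\<bar>
      \<le> int (2 ^ K) ^ vb (flag_e nxt_e \<otimes> (Read ''KA'' own_e \<otimes>
          (Const 2 \<otimes> (Read ''V'' (cell_e (Var ''k'') (Const 2 \<otimes> half_e)) \<otimes> Read ''V'' (cell_e (Var ''k'') (Const 2 \<otimes> half_e) \<oplus> Const 1))
           \<oplus> Op Eq half_e (Const 0) \<otimes> (Read ''SL'' own_e \<otimes> Read ''SL'' own_e \<otimes> Read ''V'' (cell_e (Var ''k'') (Const 2 \<otimes> half_e) \<oplus> Const 1)))))"
  show "Q l (setarr M ''H'' h)"
  proof (rule Q[OF h])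
    fix q assume q: "q < N2"
    have "h (int (2 ^ K + q)) = of_bool (leader D (Suc k) (ow q) (el q)) * set_leaf \<kappa> b r k (ow q) (el q div 2 ^ Suc k)"
      using h q unfolding mapped_def by blast
    then show "\<bar>h (int (2 ^ K + q))\<bar> \<le> int (2 ^ K) ^ 119"
      using bd[OF q] by (elim ssubst, elim order_trans) (rule P_pow_mono, simp add: bounds_simps)
  qed
qed (use fixedD[OF f] size' in \<open>auto simp: bounds_simps inj_on_def\<close>)

lemma run_leaves_elems:
  assumes f: "fixed l M" and k: "k < K" "l ''pk'' = 2 ^ k" "l ''om'' = w"
    and S: "stE y c M" "stS r k M"
    and Q: "\<And>h. mapped n (\<lambda>j. int (2 ^ K + N2 + j))
          (\<lambda>j. of_bool (Suc j div 2 ^ k = 1) * (sg r k (Suc j) * drift w y c (Suc j))) (\<lambda>z. M (''H'', z)) h \<Longrightarrow>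
        (\<And>j. j < n \<Longrightarrow> \<bar>h (int (2 ^ K + N2 + j))\<bar> \<le> int (2 ^ K) ^ 119) \<Longrightarrow> Q l (setarr M ''H'' h)"
  shows "runs leaves_elems l M 100 Q"
  unfolding leaves_elems_def
proof (rule runs_map'[where k = n and idx = "\<lambda>j. int (2 ^ K + N2 + j)"
    and val = "\<lambda>j. of_bool (Suc j div 2 ^ k = 1) * (sg r k (Suc j) * drift w y c (Suc j))"])
  let ?ve = "Op Eq bit_e (Const 1) \<otimes> (elem_e ''SG'' \<otimes> (act_e (elem_e ''Y'') \<otimes> (Var ''om'' \<otimes>
       (elem_e ''C'' \<otimes> (Const 36 \<otimes> Var ''E'' \<ominus> Const 2 \<otimes> elem_e ''Y'')))))"
  fix j assume j: "j < n"
  have e: "int j + 1 = int (Suc j)" by simp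
  have b: "(int (Suc j) div 2 ^ k = 1) = (Suc j div 2 ^ k = 1)"
    by (metis of_nat_1 of_nat_eq_iff of_nat_numeral of_nat_power zdiv_int)
  have m: "M (''Y'', int (Suc j)) = y (Suc j)" "M (''C'', int (Suc j)) = c (Suc j)" "M (''SG'', int (Suc j)) = sg r k (Suc j)"
    using S j by (auto simp: stE_def stS_def simp del: of_nat_Suc)
  have "aval ?ve (l(''j'' := int j)) M = (if int (Suc j) div 2 ^ k = 1 then 1 else 0) * (M (''SG'', int (Suc j)) *
      ((if 0 < M (''Y'', int (Suc j)) then 1 else 0) * (if M (''Y'', int (Suc j)) < 16 * E then 1 else 0) *
       (w * (M (''C'', int (Suc j)) * (36 * E - 2 * M (''Y'', int (Suc j)))))))"
    using fixedD[OF f] k by (simp add: e del: of_nat_Suc)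
  then show "aval ?ve (l(''j'' := int j)) M = of_bool (Suc j div 2 ^ k = 1) * (sg r k (Suc j) * drift w y c (Suc j))"
    unfolding m b active_aval drift_def using j by simp
next
  fix h assume h: "mapped n (\<lambda>j. int (2 ^ K + N2 + j))
          (\<lambda>j. of_bool (Suc j div 2 ^ k = 1) * (sg r k (Suc j) * drift w y c (Suc j))) (\<lambda>z. M (''H'', z)) h"
   and bd: "\<And>j. j < n \<Longrightarrow> \<bar>of_bool (Suc j div 2 ^ k = 1) * (sg r k (Suc j) * drift w y c (Suc j))\<bar>
      \<le> int (2 ^ K) ^ vb (Op Eq bit_e (Const 1) \<otimes> (elem_e ''SG'' \<otimes> (act_e (elem_e ''Y'') \<otimes> (Var ''om'' \<otimes>
       (elem_e ''C'' \<otimes> (Const 36 \<otimes> Var ''E'' \<ominus> Const 2 \<otimes> elem_e ''Y''))))))"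
  show "Q l (setarr M ''H'' h)"
  proof (rule Q[OF h])
    fix j assume j: "j < n"
    have "h (int (2 ^ K + N2 + j)) = of_bool (Suc j div 2 ^ k = 1) * (sg r k (Suc j) * drift w y c (Suc j))"
      using h j unfolding mapped_def by blast
    then show "\<bar>h (int (2 ^ K + N2 + j))\<bar> \<le> int (2 ^ K) ^ 119"
      using bd[OF j] by (elim ssubst, elim order_trans) (rule P_pow_mono, simp add: bounds_simps)
  qed
qed (use fixedD[OF f] size' in \<open>auto simp: bounds_simps inj_on_def\<close>)

end

context layout
begin

section \<open>Choosing one bit of the seed\<close>

lemma setarr_simps [simp]:
  "''LD'' \<noteq> a \<Longrightarrow> LDok k (setarr M a f) = LDok k M"
  "''Y'' \<noteq> a \<Longrightarrow> ''C'' \<noteq> a \<Longrightarrow> stE y c (setarr M a f) = stE y c M"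
  "''KA'' \<noteq> a \<Longrightarrow> stK \<kappa> (setarr M a f) = stK \<kappa> M"
  "''SG'' \<noteq> a \<Longrightarrow> stS r k (setarr M a f) = stS r k M"
  "''H'' \<noteq> a \<Longrightarrow> Hz (setarr M a f) = Hz M"
  "b \<noteq> a \<Longrightarrow> Vz b (setarr M a f) = Vz b M"
  "b \<noteq> a \<Longrightarrow> Vok b r \<phi> k (setarr M a f) = Vok b r \<phi> k M"
  unfolding LDok_def stE_def stK_def stS_def Hz_def Vz_def Vok_def
  by (simp_all only: setarr_apply if_False)

text \<open>The slope is the sum of the tree leaves: the part of the sets is spread over the class
  leaders, the linear part of the elements over the elements themselves. An empty parent class has
  two empty children and contributes nothing.\<close>

lemma slope_sum:
  assumes k: "k < K"
  shows "slope I K \<kappa> (\<lambda>i. (SL i)\<^sup>2) (coef y c) (drift w y c) r k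
    = (\<Sum>q<N2. of_bool (leader D (Suc k) (ow q) (el q)) * set_leaf \<kappa> (coef y c) r k (ow q) (el q div 2 ^ Suc k))
      + (\<Sum>j<n. of_bool (Suc j div 2 ^ k = 1) * (sg r k (Suc j) * drift w y c (Suc j)))"
proof -
  have z: "set_leaf \<kappa> (coef y c) r k i u = 0" if "i < I" "\<not> occ D (Suc k) i u" for i u
  proof -
    have c0: "coef y c i j = 0" if "j \<notin> D i" for j using that by (simp add: coef_def)
    have o: "\<not> occ D k i (2 * u)" "\<not> occ D k i (2 * u + 1)"
      using that(2) by (auto simp: occ_def div_pow_Suc simp del: power_Suc)
    have "agg r k (coef y c i) (2 * u) = 0" "agg r k (coef y c i) (2 * u + 1) = 0"
      by (rule agg_unocc; use c0 o in blast)+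
    then show ?thesis by (cases "u = 0") (simp_all add: set_leaf_def)
  qed
  have "(\<Sum>q<N2. of_bool (leader D (Suc k) (ow q) (el q)) * set_leaf \<kappa> (coef y c) r k (ow q) (el q div 2 ^ Suc k))
    = (\<Sum>i<I. \<Sum>u<2 ^ (K - Suc k). set_leaf \<kappa> (coef y c) r k i u)"
    unfolding of_bool_def
  proof (rule sum_leaders[OF pos])
    fix i j assume "i < I" "j \<in> D i"
    then have "j < 2 ^ K" using D_sub[of i] n_less by force
    also have "(2 :: nat) ^ K = 2 ^ (K - Suc k) * 2 ^ Suc k" using k by (simp only: power_add[symmetric]) simp
    finally show "j div 2 ^ Suc k < 2 ^ (K - Suc k)" by (simp only: div_less_iff_less_mult zero_less_power pos2)
  qed (use finite_D z in auto)
  moreover have "agg r k (drift w y c) 1 = (\<Sum>j\<in>{1..n}. of_bool (j div 2 ^ k = 1) * (sg r k j * drift w y c j))"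
    by (rule agg_support) (auto simp: drift_def)
  moreover have "\<dots> = (\<Sum>j<n. of_bool (Suc j div 2 ^ k = 1) * (sg r k (Suc j) * drift w y c (Suc j)))"
    using sum.atLeast1_atMost_eq[of "\<lambda>j. of_bool (j div 2 ^ k = 1) * (sg r k j * drift w y c j)" n] by simp
  ultimately show ?thesis unfolding slope_def set_leaf_def by simp
qed

definition pick :: "(nat \<Rightarrow> int) \<Rightarrow> (nat \<Rightarrow> int) \<Rightarrow> (nat \<Rightarrow> int) \<Rightarrow> int \<Rightarrow> (nat \<Rightarrow> int) \<Rightarrow> nat \<Rightarrow> int" where
  "pick \<kappa> y c w r k = (if 0 < slope I K \<kappa> (\<lambda>i. (SL i)\<^sup>2) (coef y c) (drift w y c) r k then -1 else 1)"

text \<open>Stated with the remaining program as a continuation, since sequential composition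
  associates to the right.\<close>

lemma run_pick:
  assumes f: "fixed l M" and L: "LDok K M" and k: "k < K" "l ''k'' = int k" "l ''pk'' = 2 ^ k" "l ''om'' = w"
    and V: "Vok ''V'' r (coef y c) k M" and S: "stK \<kappa> M" "stE y c M" "stS r k M" and H: "Hz M"
    and Q: "\<And>h v. Hz (setarr M ''H'' h) \<Longrightarrow> runs rest (l(''w'' := v, ''r'' := pick \<kappa> y c w r k)) (setarr M ''H'' h) a Q"
    and a: "400 + (K + 1) * 60 + a \<le> a'"
  shows "runs (leaves_sets ;; leaves_elems ;; tree_sum ;;
     Assign ''r'' (Const 1 \<ominus> Const 2 \<otimes> Op Less (Const 0) (Read ''H'' (Const 1))) ;; rest) l M a' Q"
proof -
  let ?g = "\<lambda>q. of_bool (leader D (Suc k) (ow q) (el q)) * set_leaf \<kappa> (coef y c) r k (ow q) (el q div 2 ^ Suc k)"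
  let ?e = "\<lambda>j. of_bool (Suc j div 2 ^ k = 1) * (sg r k (Suc j) * drift w y c (Suc j))"
  let ?Q1 = "\<lambda>l' M'. l' = l \<and> (\<exists>h. M' = setarr M ''H'' h \<and> mapped N2 (\<lambda>q. int (2 ^ K + q)) ?g (\<lambda>z. M (''H'', z)) h \<and>
     (\<forall>q<N2. \<bar>h (int (2 ^ K + q))\<bar> \<le> int (2 ^ K) ^ 119))"
  show ?thesis
  proof (rule runs_Seq[where ?a1.0 = 200 and ?a2.0 = "130 + (K + 1) * 60 + a" and ?Q1.0 = ?Q1], goal_cases first second)
  case first
  show ?case
    by (rule run_leaves_sets[OF f L k(1-3) V S(1)]) blast
  case (second l1 M1)
  note second(2)
  then obtain h where h: "l1 = l" "M1 = setarr M ''H'' h" "mapped N2 (\<lambda>q. int (2 ^ K + q)) ?g (\<lambda>z. M (''H'', z)) h"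
     "\<forall>q<N2. \<bar>h (int (2 ^ K + q))\<bar> \<le> int (2 ^ K) ^ 119" by blast
  let ?Q2 = "\<lambda>l' M'. l' = l \<and> (\<exists>h'. M' = setarr M1 ''H'' h' \<and> mapped n (\<lambda>j. int (2 ^ K + N2 + j)) ?e (\<lambda>z. M1 (''H'', z)) h' \<and>
     (\<forall>j<n. \<bar>h' (int (2 ^ K + N2 + j))\<bar> \<le> int (2 ^ K) ^ 119))"
  show ?case
  proof (rule runs_Seq[where ?a1.0 = 100 and ?a2.0 = "30 + (K + 1) * 60 + a" and ?Q1.0 = ?Q2], goal_cases first second)
    case first
    show ?case
      unfolding h(1) by (rule run_leaves_elems[where y = y and c = c and r = r and w = w and k = k]) (use f k S h(2) in auto)
    case (second l2 M2)
    note second(2)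
    then obtain h' where h': "l2 = l" "M2 = setarr M1 ''H'' h'" "mapped n (\<lambda>j. int (2 ^ K + N2 + j)) ?e (\<lambda>z. M1 (''H'', z)) h'"
      "\<forall>j<n. \<bar>h' (int (2 ^ K + N2 + j))\<bar> \<le> int (2 ^ K) ^ 119" by blast
    have M2: "M2 = setarr M ''H'' h'" unfolding h'(2) h(2) by (auto simp: setarr_def fun_eq_iff)
    have v1: "h' (int (2 ^ K + q)) = ?g q" "\<bar>?g q\<bar> \<le> int (2 ^ K) ^ 119" if "q < N2" for q
    proof -
      have "int (2 ^ K + q) \<notin> (\<lambda>j. int (2 ^ K + N2 + j)) ` {..<n}" unfolding image_iff of_nat_eq_iff using that by simp
      then have "h' (int (2 ^ K + q)) = h (int (2 ^ K + q))" using h'(3) h(2) unfolding mapped_def by simp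
      moreover have "h (int (2 ^ K + q)) = ?g q" using h(3) that unfolding mapped_def by blast
      ultimately show "h' (int (2 ^ K + q)) = ?g q" "\<bar>?g q\<bar> \<le> int (2 ^ K) ^ 119" using h(4) that by auto
    qed
    have v2: "h' (int (2 ^ K + N2 + j)) = ?e j" "\<bar>?e j\<bar> \<le> int (2 ^ K) ^ 119" if "j < n" for j
    proof -
      show "h' (int (2 ^ K + N2 + j)) = ?e j" using h'(3) that unfolding mapped_def by blast
      then show "\<bar>?e j\<bar> \<le> int (2 ^ K) ^ 119" using h'(4) that by metis
    qed
    have v3: "h' (int (2 ^ K + z)) = 0" if "N2 + n \<le> z" "z < 2 ^ K" for z
    proof -
      have "int (2 ^ K + z) \<notin> (\<lambda>j. int (2 ^ K + N2 + j)) ` {..<n}" "int (2 ^ K + z) \<notin> (\<lambda>j. int (2 ^ K + j)) ` {..<N2}"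
        unfolding image_iff of_nat_eq_iff using that by auto
      then have "h' (int (2 ^ K + z)) = M (''H'', int (2 ^ K + z))" using h'(3) h(2,3) unfolding mapped_def by simp
      then show ?thesis using H that unfolding Hz_def by simp
    qed
    \<comment> \<open>The leaves form three blocks: positions, elements and padding. The general
      \<open>F\<close> serves both the sum itself and the sum of absolute values.\<close>
    have split: "(\<Sum>z\<in>{2 ^ K..<2 * 2 ^ K}. F (h' (int z))) = (\<Sum>q<N2. F (?g q)) + (\<Sum>j<n. F (?e j))"
      if F0: "F 0 = 0" for F :: "int \<Rightarrow> int"
    proof -
      have "{2 ^ K..<2 * 2 ^ K} = {0 + 2 ^ K..<2 ^ K + (2 :: nat) ^ K}" by auto
      then have "(\<Sum>z\<in>{2 ^ K..<2 * 2 ^ K}. F (h' (int z))) = (\<Sum>z<2 ^ K. F (h' (int (2 ^ K + z))))"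
        by (simp only: sum.shift_bounds_nat_ivl atLeast0LessThan add.commute)
      also have "\<dots> = (\<Sum>z<N2 + (n + (2 ^ K - N2 - n)). F (h' (int (2 ^ K + z))))"
        by (rule arg_cong[where f = "\<lambda>m. \<Sum>z<m. F (h' (int (2 ^ K + z)))"]) (use size in simp)
      also have "\<dots> = (\<Sum>q<N2. F (h' (int (2 ^ K + q)))) + ((\<Sum>j<n. F (h' (int (2 ^ K + (N2 + j)))))
          + (\<Sum>z<2 ^ K - N2 - n. F (h' (int (2 ^ K + (N2 + (n + z)))))))"
        by (simp only: sum_lessThan_add)
      also have "(\<Sum>z<2 ^ K - N2 - n. F (h' (int (2 ^ K + (N2 + (n + z)))))) = 0"
      proof (intro sum.neutral ballI)
        fix z assume "z \<in> {..<2 ^ K - N2 - n}"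
        then show "F (h' (int (2 ^ K + (N2 + (n + z))))) = 0" using v3[of "N2 + (n + z)"] F0 by simp
      qed
      also have "(\<Sum>q<N2. F (h' (int (2 ^ K + q)))) = (\<Sum>q<N2. F (?g q))"
        by (intro sum.cong refl) (simp only: lessThan_iff v1)
      also have "(\<Sum>j<n. F (h' (int (2 ^ K + (N2 + j))))) = (\<Sum>j<n. F (?e j))"
        by (intro sum.cong refl) (simp only: lessThan_iff add.assoc[symmetric] v2)
      finally show ?thesis by (simp only: add_0_right)
    qed
    have tot: "(\<Sum>z\<in>{2 ^ K..<2 * 2 ^ K}. M2 (''H'', int z)) = slope I K \<kappa> (\<lambda>i. (SL i)\<^sup>2) (coef y c) (drift w y c) r k"
      unfolding slope_sum[OF k(1)] M2 using split[of "\<lambda>x. x"] by simp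
    have "(\<Sum>z\<in>{2 ^ K..<2 * 2 ^ K}. \<bar>M2 (''H'', int z)\<bar>) = (\<Sum>q<N2. \<bar>?g q\<bar>) + (\<Sum>j<n. \<bar>?e j\<bar>)"
      unfolding M2 using split[of abs] by simp
    also have "\<dots> \<le> (\<Sum>q<N2. int (2 ^ K) ^ 119) + (\<Sum>j<n. int (2 ^ K) ^ 119)"
      by (intro add_mono sum_mono) (use v1(2) v2(2) in blast)+
    also have "\<dots> = int (N2 + n) * int (2 ^ K) ^ 119" by (simp add: algebra_simps)
    also have "\<dots> \<le> int (2 ^ K) * int (2 ^ K) ^ 119"
      using size by (intro mult_right_mono) (auto simp del: of_nat_add of_nat_power simp flip: of_nat_le_iff)
    also have "\<dots> = int (2 ^ K) ^ Suc 119" by (simp only: power_Suc)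
    finally have bd: "(\<Sum>z\<in>{2 ^ K..<2 * 2 ^ K}. \<bar>M2 (''H'', int z)\<bar>) \<le> int (2 ^ K) ^ 120" by simp
    let ?s = "slope I K \<kappa> (\<lambda>i. (SL i)\<^sup>2) (coef y c) (drift w y c) r k"
    show ?case
    proof (rule runs_Seq[where ?a1.0 = "10 + (K + 1) * 60" and ?a2.0 = "20 + a" and
        ?Q1.0 = "\<lambda>l' M'. \<exists>v h. l' = l(''w'' := v) \<and> M' = setarr M ''H'' h \<and> Hz M' \<and> h 1 = ?s"], goal_cases first second)
      case first
      show ?case
      proof (rule run_tree_sum)
        fix g v assume g: "g 1 = (\<Sum>z\<in>{2 ^ K..<2 * 2 ^ K}. M2 (''H'', int z))" "\<And>z. 2 ^ K \<le> z \<Longrightarrow> g z = M2 (''H'', z)"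
        have "setarr M2 ''H'' g = setarr M ''H'' g" unfolding M2 by (auto simp: setarr_def fun_eq_iff)
        moreover have "Hz (setarr M ''H'' g)"
          using g(2) v3 unfolding Hz_def M2 by simp
        ultimately show "\<exists>v' h. l2(''w'' := v) = l(''w'' := v') \<and> setarr M2 ''H'' g = setarr M ''H'' h \<and> Hz (setarr M2 ''H'' g) \<and> h 1 = ?s"
          using g(1) tot h'(1) by auto
      qed (use h'(1) fixedD[OF f] bd in auto)
    next
      case (second l3 M3)
      note second(2)
      then obtain v g where 3: "l3 = l(''w'' := v)" "M3 = setarr M ''H'' g" "Hz M3" "g 1 = ?s" by blast
      have p1: "1 \<le> int (2 ^ K) ^ 5" by simp
      show ?case
      proof (rule runs_Seq[where ?a1.0 = 20 and ?a2.0 = a and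
          ?Q1.0 = "\<lambda>l' M'. l' = l(''w'' := v, ''r'' := pick \<kappa> y c w r k) \<and> M' = M3"], goal_cases first second)
        case first
        show ?case
          by (intro runs_Assign) (use 3 p1 in \<open>auto simp: bounds_simps pick_def\<close>)
        case (second l' M')
        then show ?case using Q[of g v] 3 by simp
      qed simp
    qed simp
  qed simp
qed (use a in simp)
qed

lemma run_sign:
  assumes f: "fixed l M" and k: "k < K" "l ''pk'' = 2 ^ k" "l ''r'' = r k" and r: "\<And>k. r k = 1 \<or> r k = -1"
    and S: "stS r k M"
  shows "runs sign_com l M 60 (\<lambda>l' M'. l' = l \<and> (\<exists>h. M' = setarr M ''SG'' h) \<and> stS r (Suc k) M')"
  unfolding sign_com_def
proof (rule run_elems[where val = "sg r (Suc k)"])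
  fix j assume j: "j \<in> {1..n}"
  have "int j div 2 ^ k mod 2 = int (j div 2 ^ k mod 2)" by (simp add: zdiv_int zmod_int)
  then show "aval (elem_e ''SG'' \<otimes> (Const 1 \<oplus> Op Mod bit_e (Const 2) \<otimes> (Var ''r'' \<ominus> Const 1))) (l(''j'' := int j - 1)) M
    = sg r (Suc k) j"
    using k j S by (simp add: sg_Suc stS_def)
next
  have "\<bar>sg r (Suc k) j\<bar> \<le> int (2 ^ K) ^ 3" for j using sg_sign[of r "Suc k" j, OF r] by auto
  then show "vb (elem_e ''SG'' \<otimes> (Const 1 \<oplus> Op Mod bit_e (Const 2) \<otimes> (Var ''r'' \<ominus> Const 1))) \<le> ax ''SG''
    \<or> (\<forall>j\<in>{1..n}. \<bar>sg r (Suc k) j\<bar> \<le> int (2 ^ K) ^ ax ''SG'')"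
    unfolding ax_def by simp
qed (use fixedD[OF f] in \<open>auto simp: bounds_simps stS_def\<close>)

definition LI :: "(nat \<Rightarrow> int) \<Rightarrow> (nat \<Rightarrow> int) \<Rightarrow> (nat \<Rightarrow> int) \<Rightarrow> int \<Rightarrow> int \<Rightarrow> nat \<Rightarrow> locals \<Rightarrow> memory \<Rightarrow> bool" where
  "LI \<kappa> y c w t k l M \<longleftrightarrow> fixed l M \<and> l ''k'' = int k \<and> l ''pk'' = 2 ^ k \<and> l ''om'' = w \<and> l ''t'' = t \<and>
     LDok K M \<and> stE y c M \<and> stK \<kappa> M \<and> Hz M \<and> Vz ''V'' M \<and> Vz ''W'' M \<and>
     (\<exists>r. (\<forall>k. r k = 1 \<or> r k = -1) \<and> (\<forall>k'<k. r k' = pick \<kappa> y c w r k') \<and>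
       Vok ''V'' r (coef y c) k M \<and> Vok ''W'' (\<lambda>_. 1) (\<lambda>i j. (coef y c i j)\<^sup>2) k M \<and> stS r k M)"

text \<open>One bit is chosen by a tree sum of depth proportional to \<open>K\<close>; the remaining
  work of the level has constant depth.\<close>

lemma run_level:
  assumes cb: "\<And>i j. i < I \<Longrightarrow> \<bar>coef y c i j\<bar> \<le> 2 ^ (6 * K)" and k: "k < K" and L: "LI \<kappa> y c w t k l M"
  shows "runs level_com l M (900 + (K + 1) * 60) (LI \<kappa> y c w t (Suc k))"
proof -
  obtain r0 where l: "fixed l M" "l ''k'' = int k" "l ''pk'' = 2 ^ k" "l ''om'' = w" "l ''t'' = t"
     "LDok K M" "stE y c M" "stK \<kappa> M" "Hz M" "Vz ''V'' M" "Vz ''W'' M"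
    and r0: "\<forall>k. r0 k = 1 \<or> r0 k = -1" "\<forall>k'<k. r0 k' = pick \<kappa> y c w r0 k'"
      "Vok ''V'' r0 (coef y c) k M" "Vok ''W'' (\<lambda>_. 1) (\<lambda>i j. (coef y c i j)\<^sup>2) k M" "stS r0 k M"
    using L unfolding LI_def by blast
  \<comment> \<open>The seed in the invariant is arbitrary from entry \<open>k\<close> on. Entry
    \<open>k\<close> is replaced by the chosen sign; this is consistent because neither the sums of
    level \<open>k\<close> nor the slope depend on that entry.\<close>
  define r where "r = r0(k := pick \<kappa> y c w r0 k)"
  have same: "r k' = r0 k'" if "k' < k" for k' using that by (simp add: r_def)
  have pk: "pick \<kappa> y c w r k' = pick \<kappa> y c w r0 k'" if "k' \<le> k" for k'
    unfolding pick_def using slope_cong[of k' r r0] same that by simp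
  have rs: "r k = 1 \<or> r k = -1" for k using r0(1) by (auto simp: r_def pick_def)
  have rp: "\<forall>k'<Suc k. r k' = pick \<kappa> y c w r k'"
  proof (intro allI impI)
    fix k' assume "k' < Suc k"
    then show "r k' = pick \<kappa> y c w r k'" using pk[of k'] r0(2) by (cases "k' = k") (auto simp: r_def)
  qed
  have V: "Vok ''V'' r (coef y c) k M" using r0(3) unfolding Vok_def using agg_cong[of k r r0] same by simp
  have S: "stS r k M" using r0(5) unfolding stS_def using sg_cong[of k r r0] same by simp
  have c0: "coef y c i j = 0" if "j \<notin> D i" for i j using that by (simp add: coef_def)
  have kb: "(2 :: int) ^ Suc k * 2 ^ (a * K) \<le> 2 ^ ((a + 1) * K)" for a
    unfolding power_add[symmetric] using k by (intro power_increasing) auto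
  have b1: "\<bar>agg r (Suc k) (coef y c i) u\<bar> \<le> int (2 ^ K) ^ ax ''V''" if "i < I" for i u
  proof (rule leP[of _ 7])
    show "\<bar>agg r (Suc k) (coef y c i) u\<bar> \<le> 2 ^ (7 * K)"
      using agg_abs_le[of r "coef y c i" "2 ^ (6 * K)" "Suc k" u, OF rs cb[OF that]] kb[of 6] by simp
  qed (simp add: ax_def)
  have b2: "\<bar>agg (\<lambda>_. 1) (Suc k) (\<lambda>j. (coef y c i j)\<^sup>2) u\<bar> \<le> int (2 ^ K) ^ ax ''W''" if "i < I" for i u
  proof (rule leP[of _ 13])
    have "\<bar>(coef y c i x)\<^sup>2\<bar> \<le> 2 ^ (12 * K)" for x
    proof -
      have "\<bar>coef y c i x\<bar>\<^sup>2 \<le> (2 ^ (6 * K))\<^sup>2" using cb[OF that] by (intro power_mono) auto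
      then show ?thesis by (simp add: power_mult[symmetric] mult.commute)
    qed
    from agg_abs_le[of "\<lambda>_. 1" "\<lambda>j. (coef y c i j)\<^sup>2" "2 ^ (12 * K)" "Suc k" u, OF _ this]
    show "\<bar>agg (\<lambda>_. 1) (Suc k) (\<lambda>j. (coef y c i j)\<^sup>2) u\<bar> \<le> 2 ^ (13 * K)"
      using kb[of 12] by simp
  qed (simp add: ax_def)
  show ?thesis unfolding level_com_def
  proof (rule run_pick[OF l(1,6) k l(2,3,4) V l(8,7) S l(9), where a = 500])
    fix h v assume H: "Hz (setarr M ''H'' h)"
    let ?l = "l(''w'' := v, ''r'' := pick \<kappa> y c w r k)" and ?M = "setarr M ''H'' h"
    have rk: "pick \<kappa> y c w r k = r k" using rp by simp
    let ?Q1 = "\<lambda>l' M'. l' = ?l \<and> (\<exists>f. M' = setarr ?M ''V'' f) \<and> Vok ''V'' r (coef y c) (Suc k) M' \<and> Vz ''V'' M'"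
    show "runs (merge_com ''V'' (Var ''r'') ;; merge_com ''W'' (Const 1) ;; sign_com ;; next_level) ?l ?M 500 (LI \<kappa> y c w t (Suc k))"
    proof (rule runs_Seq[where ?Q1.0 = ?Q1 and ?a1.0 = 200 and ?a2.0 = 300], goal_cases first second)
      case first
      show ?case
        by (rule run_merge[where k = k]) (use l k V rk c0 b1 in auto)
      case (second l1 M1)
      note 1 = second(2)
      then obtain f1 where f1: "l1 = ?l" "M1 = setarr ?M ''V'' f1" by blast
      let ?Q2 = "\<lambda>l' M'. l' = ?l \<and> (\<exists>f. M' = setarr M1 ''W'' f) \<and> Vok ''W'' (\<lambda>_. 1) (\<lambda>i j. (coef y c i j)\<^sup>2) (Suc k) M' \<and> Vz ''W'' M'"
      show ?case
      proof (rule runs_Seq[where ?Q1.0 = ?Q2 and ?a1.0 = 200 and ?a2.0 = 100], goal_cases first second)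
        case first
        show ?case
          unfolding f1(1) by (rule run_merge[where k = k]) (use l k r0(4) c0 b2 f1 in auto)
        case (second l2 M2)
        note 2 = second(2)
        then obtain f2 where f2: "l2 = ?l" "M2 = setarr M1 ''W'' f2" by blast
        let ?Q3 = "\<lambda>l' M'. l' = ?l \<and> (\<exists>f. M' = setarr M2 ''SG'' f) \<and> stS r (Suc k) M'"
        show ?case
        proof (rule runs_Seq[where ?Q1.0 = ?Q3 and ?a1.0 = 60 and ?a2.0 = 40], goal_cases first second)
          case first
          show ?case
            unfolding f2(1) by (rule run_sign[where k = k]) (use l k rk rs S f1 f2 in auto)
          case (second l3 M3)
          note 3 = second(2)
          then obtain f3 where f3: "l3 = ?l" "M3 = setarr M2 ''SG'' f3" by blast
          have "LI \<kappa> y c w t (Suc k) (?l(''k'' := int (Suc k), ''pk'' := 2 ^ Suc k)) M3"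
            unfolding LI_def
          proof (intro conjI exI[of _ r])
            show "Hz M3" unfolding f3(2) f2(2) f1(2) using H by simp
            show "Vz ''V'' M3" unfolding f3(2) f2(2) using 1 by simp
            show "Vz ''W'' M3" unfolding f3(2) using 2 by simp
            show "Vok ''V'' r (coef y c) (Suc k) M3" unfolding f3(2) f2(2) using 1 by simp
            show "Vok ''W'' (\<lambda>_. 1) (\<lambda>i j. (coef y c i j)\<^sup>2) (Suc k) M3" unfolding f3(2) using 2 by simp
            show "stS r (Suc k) M3" using 3 by blast
            show "\<forall>k. r k = 1 \<or> r k = -1" using rs by blast
          qed (use l rp f3(2) f2(2) f1(2) in \<open>simp_all del: power_Suc\<close>)
          then show "runs next_level l3 M3 40 (LI \<kappa> y c w t (Suc k))"
            by (intro runs_mono[OF run_next_level[OF k]]) (use f3 l in auto)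
        qed simp
      qed simp
    qed simp
  qed simp
qed

section \<open>One round of the walk\<close>

lemma run_root:
  assumes f: "fixed l M" and V: "Vz a M" and a: "a \<in> {''V'', ''W''}" and ve: "ok ve" "a \<notin> arrs ve" "cost ve \<le> 110"
    and val: "\<And>q. q < N2 \<Longrightarrow> aval ve (l(''q'' := int q)) M = \<phi> (ow q) (el q)"
    and bd: "\<And>i j. i < I \<Longrightarrow> \<bar>\<phi> i j\<bar> \<le> int (2 ^ K) ^ ax a" and \<phi>: "\<And>i j. i < I \<Longrightarrow> j \<notin> D i \<Longrightarrow> \<phi> i j = 0"
  shows "runs (ParFor ''q'' (Var ''N2'') (Store a (cell_e (Const 0) elt_e) ve)) l M 140
    (\<lambda>l' M'. l' = l \<and> (\<exists>f. M' = setarr M a f) \<and> Vok a r \<phi> 0 M' \<and> Vz a M')"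
proof (rule runs_map'[where k = N2 and idx = "lidx 0" and val = "\<lambda>q. \<phi> (ow q) (el q)"])
  fix g assume g: "mapped N2 (lidx 0) (\<lambda>q. \<phi> (ow q) (el q)) (\<lambda>z. M (a, z)) g"
  have val: "g (int (cell k' i u)) = (if k' = 0 \<and> occ D k' i u then \<phi> i u else M (a, int (cell k' i u)))"
    if iu: "i < I" "u < 2 ^ K" for k' i u
  proof (cases "k' = 0 \<and> occ D k' i u")
    case True
    \<comment> \<open>On level 0 every class is a single element, so each position is the leader of
      its own class.\<close>
    then obtain q where q: "q < N2" "ow q = i" "el q = u"
      using leader_ex[of i 0 u] iu by auto
    then have "g (lidx 0 q) = \<phi> i u" using g unfolding mapped_def by blast
    moreover have "lidx 0 q = int (cell k' i u)" unfolding lidx_def using q True by (simp add: leader_0)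
    ultimately have "g (int (cell k' i u)) = \<phi> i u" by simp
    then show ?thesis by (simp only: if_P[OF True])
  next
    case False
    have "int (cell k' i u) \<in> lidx 0 ` {..<N2} \<longleftrightarrow> k' = 0 \<and> occ D k' i u"
      using lidx_mem[OF iu, of k' 0] by (cases "k' = 0") simp_all
    with False have "int (cell k' i u) \<notin> lidx 0 ` {..<N2}" by argo
    then have "g (int (cell k' i u)) = M (a, int (cell k' i u))" using g unfolding mapped_def by blast
    then show ?thesis by (simp only: if_not_P[OF False])
  qed
  have "Vok a r \<phi> 0 (setarr M a g)"
    unfolding Vok_def
  proof (intro allI impI)
    fix i u assume iu: "i < I" "u < (2 :: nat) ^ K"
    show "setarr M a g (a, int (cell 0 i u)) = agg r 0 (\<phi> i) u"
    proof (cases "occ D 0 i u")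
      case True
      then show ?thesis using val[OF iu, of 0] by simp
    next
      case False
      then have "\<phi> i u = 0" using \<phi>[OF iu(1)] by (auto simp: occ_def)
      moreover have "M (a, int (cell 0 i u)) = 0" using V iu False by (simp add: Vz_def)
      ultimately show ?thesis using val[OF iu, of 0] False by simp
    qed
  qed
  moreover have "Vz a (setarr M a g)" unfolding Vz_def using val V by (simp add: Vz_def)
  ultimately show "l = l \<and> (\<exists>f. setarr M a g = setarr M a f) \<and> Vok a r \<phi> 0 (setarr M a g) \<and> Vz a (setarr M a g)"
    by blast
next
  show "vb ve \<le> ax a \<or> (\<forall>q<N2. \<bar>\<phi> (ow q) (el q)\<bar> \<le> int (2 ^ K) ^ ax a)"
    using bd pos_facts(1) by blast
qed (use fixedD[OF f] size' lidx_inj ve val a in \<open>auto simp: bounds_simps lidx_def leader_0 cell_def\<close>)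

lemma run_base:
  assumes f: "fixed l M" and S: "stE y c M" and V: "Vz ''V'' M" "Vz ''W'' M"
    and cb: "\<And>i j. i < I \<Longrightarrow> \<bar>coef y c i j\<bar> \<le> 2 ^ (6 * K)"
  shows "runs base_com l M 300 (\<lambda>l' M'. l' = l \<and> (\<exists>f g h. M' = setarr (setarr (setarr M ''SG'' f) ''V'' g) ''W'' h) \<and>
    stS r 0 M' \<and> Vok ''V'' r (coef y c) 0 M' \<and> Vok ''W'' (\<lambda>_. 1) (\<lambda>i j. (coef y c i j)\<^sup>2) 0 M' \<and> Vz ''V'' M' \<and> Vz ''W'' M')"
  unfolding base_com_def
proof (rule runs_Seq[where ?a1.0 = 20 and ?a2.0 = 280 and
    ?Q1.0 = "\<lambda>l' M'. l' = l \<and> (\<exists>f. M' = setarr M ''SG'' f) \<and> stS r 0 M'"], goal_cases first second)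
  case first
  show ?case
    by (rule run_elems[where val = "\<lambda>_. 1"]) (use fixedD[OF f] in \<open>auto simp: bounds_simps stS_def\<close>)
next
  have c0: "coef y c i j = 0" if "j \<notin> D i" for i j using that by (simp add: coef_def)
  have val: "aval coef_e (l(''q'' := int q)) M' = coef y c (ow q) (el q)" if q: "q < N2" and "fixed l M'" "stE y c M'" for q M'
  proof -
    have j: "el q \<in> {1..n}" using pos_facts[OF q] by auto
    have m: "M' (''Y'', int (el q)) = y (el q)" "M' (''C'', int (el q)) = c (el q)" using that(3) j by (auto simp: stE_def)
    have "aval coef_e (l(''q'' := int q)) M' = (if 0 < y (el q) then 1 else 0) * (if y (el q) < 16 * E then 1 else 0) *
        (c (el q) * c (el q) * (SL (ow q) - 8 * (y (el q) * (c (el q) * c (el q)))))"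
      using q fixedD[OF that(2)] pos_facts(1)[OF q] m by (simp add: Let_def)
    then show ?thesis unfolding active_aval coef_def using pos_facts(2)[OF q] by (simp add: power2_eq_square)
  qed
  case (second l1 M1)
  note 1 = second(2)
  then obtain f1 where f1: "l1 = l" "M1 = setarr M ''SG'' f1" by blast
  have fx1: "fixed l M1" "stE y c M1" "Vz ''V'' M1" "Vz ''W'' M1" using f1 f S V by simp_all
  let ?Q2 = "\<lambda>l' M'. l' = l \<and> (\<exists>f. M' = setarr M1 ''V'' f) \<and> Vok ''V'' r (coef y c) 0 M' \<and> Vz ''V'' M'"
  show ?case
  proof (rule runs_Seq[where ?Q1.0 = ?Q2 and ?a1.0 = 140 and ?a2.0 = 140], goal_cases first second)
    have b: "\<bar>coef y c i j\<bar> \<le> int (2 ^ K) ^ ax ''V''" if "i < I" for i j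
      by (rule leP[OF cb[OF that]]) (simp add: ax_def)
    case first
    show ?case
      unfolding f1(1)
      by (rule run_root[OF fx1(1,3) _ _ _ _ val b]) (use fx1 c0 in \<open>auto simp: bounds_simps Let_def\<close>)
    case (second l2 M2)
    note 2 = second(2)
    then obtain f2 where f2: "l2 = l" "M2 = setarr M1 ''V'' f2" by blast
    have fx2: "fixed l M2" "stE y c M2" "Vz ''W'' M2" "stS r 0 M2" using f2 fx1 1 by simp_all
    have b: "\<bar>(coef y c i j)\<^sup>2\<bar> \<le> int (2 ^ K) ^ ax ''W''" if "i < I" for i j
    proof (rule leP[of _ 12])
      have "\<bar>coef y c i j\<bar>\<^sup>2 \<le> (2 ^ (6 * K))\<^sup>2" using cb[OF that] by (intro power_mono) auto
      then show "\<bar>(coef y c i j)\<^sup>2\<bar> \<le> 2 ^ (12 * K)" by (simp add: power_mult[symmetric] mult.commute)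
    qed (simp add: ax_def)
    have val2: "aval (coef_e \<otimes> coef_e) (l(''q'' := int q)) M2 = (coef y c (ow q) (el q))\<^sup>2" if "q < N2" for q
      by (simp only: aval.simps binop_val.simps val[OF that fx2(1,2)] power2_eq_square)
    show ?case
      unfolding f2(1)
    proof (rule runs_mono[OF run_root[where \<phi> = "\<lambda>i j. (coef y c i j)\<^sup>2" and r = "\<lambda>_. 1"]])
      fix l3 M3 assume 3: "l3 = l \<and> (\<exists>f. M3 = setarr M2 ''W'' f) \<and> Vok ''W'' (\<lambda>_. 1) (\<lambda>i j. (coef y c i j)\<^sup>2) 0 M3 \<and> Vz ''W'' M3"
      then obtain f3 where f3: "M3 = setarr M2 ''W'' f3" by blast
      have "M3 = setarr (setarr (setarr M ''SG'' f1) ''V'' f2) ''W'' f3" unfolding f3 f2(2) f1(2) ..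
      moreover have "stS r 0 M3" "Vok ''V'' r (coef y c) 0 M3" "Vz ''V'' M3" unfolding f3 using fx2 2 by simp_all
      ultimately show "l3 = l \<and> (\<exists>f g h. M3 = setarr (setarr (setarr M ''SG'' f) ''V'' g) ''W'' h) \<and>
        stS r 0 M3 \<and> Vok ''V'' r (coef y c) 0 M3 \<and> Vok ''W'' (\<lambda>_. 1) (\<lambda>i j. (coef y c i j)\<^sup>2) 0 M3 \<and> Vz ''V'' M3 \<and> Vz ''W'' M3"
        using 3 by blast
    qed (use fx2 c0 b val2 in \<open>auto simp: bounds_simps Let_def\<close>)
  qed simp
qed simp

lemma run_weights:
  assumes f: "fixed l M" and S: "stK \<kappa> M"
    and V: "Vok ''V'' r (coef y c) K M" "Vok ''W'' (\<lambda>_. 1) (\<lambda>i j. (coef y c i j)\<^sup>2) K M"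
    and bd: "\<And>i. i < I \<Longrightarrow> \<bar>new_\<kappa> r \<kappa> y c i\<bar> \<le> int (2 ^ K) ^ 23"
  shows "runs weights_com l M 120 (\<lambda>l' M'. l' = l \<and> (\<exists>f. M' = setarr M ''KA'' f) \<and> stK (new_\<kappa> r \<kappa> y c) M')"
  unfolding weights_com_def Let_def
proof (rule runs_map[where k = I and idx = int and val = "new_\<kappa> r \<kappa> y c"])
  fix i assume i: "i < I"
  let ?nu = "Read ''SL'' (Var ''i'') \<otimes> Read ''SL'' (Var ''i'')"
  let ?root = "((Var ''K'' \<otimes> Var ''M2'') \<oplus> Var ''i'') \<otimes> Var ''P''"
  have root: "aval ?root (l(''i'' := int i)) M = int (cell K i 0)"
    using fixedD[OF f] by (simp add: cell_def)
  have z: "(0 :: nat) < 2 ^ K" by simp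
  have "aval (Read ''KA'' (Var ''i'') \<otimes> (?nu \<otimes> ?nu \<oplus> ?nu \<otimes> Read ''V'' ?root \<oplus> Read ''V'' ?root \<otimes> Read ''V'' ?root
          \<ominus> Read ''W'' ?root) \<oslash> (?nu \<otimes> ?nu) \<oplus> Const 1) (l(''i'' := int i)) M
    = \<kappa> i * (SL i * SL i * (SL i * SL i) + SL i * SL i * M (''V'', aval ?root (l(''i'' := int i)) M)
        + M (''V'', aval ?root (l(''i'' := int i)) M) * M (''V'', aval ?root (l(''i'' := int i)) M)
        - M (''W'', aval ?root (l(''i'' := int i)) M)) div (SL i * SL i * (SL i * SL i)) + 1"
    using i fixedD[OF f] S by (simp add: stK_def)
  also have "\<dots> = new_\<kappa> r \<kappa> y c i"
    unfolding root new_\<kappa>_def factor_def using V i z by (simp add: Vok_def power2_eq_square power4_eq_xxxx mult.assoc)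
  finally show "aval (Read ''KA'' (Var ''i'') \<otimes> (?nu \<otimes> ?nu \<oplus> ?nu \<otimes> Read ''V'' ?root \<oplus> Read ''V'' ?root \<otimes> Read ''V'' ?root
          \<ominus> Read ''W'' ?root) \<oslash> (?nu \<otimes> ?nu) \<oplus> Const 1) (l(''i'' := int i)) M = new_\<kappa> r \<kappa> y c i" .
next
  fix h assume "mapped I int (new_\<kappa> r \<kappa> y c) (\<lambda>z. M (''KA'', z)) h"
  then have "stK (new_\<kappa> r \<kappa> y c) (setarr M ''KA'' h)" unfolding stK_def mapped_def by simp
  then show "l = l \<and> (\<exists>f. setarr M ''KA'' h = setarr M ''KA'' f) \<and> stK (new_\<kappa> r \<kappa> y c) (setarr M ''KA'' h)" by blast
next
  let ?nu = "Read ''SL'' (Var ''i'') \<otimes> Read ''SL'' (Var ''i'')"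
  let ?root = "((Var ''K'' \<otimes> Var ''M2'') \<oplus> Var ''i'') \<otimes> Var ''P''"
  show "vb (Read ''KA'' (Var ''i'') \<otimes> (?nu \<otimes> ?nu \<oplus> ?nu \<otimes> Read ''V'' ?root \<oplus> Read ''V'' ?root \<otimes> Read ''V'' ?root
          \<ominus> Read ''W'' ?root) \<oslash> (?nu \<otimes> ?nu) \<oplus> Const 1) \<le> ax ''KA'' \<or> (\<forall>i<I. \<bar>new_\<kappa> r \<kappa> y c i\<bar> \<le> int (2 ^ K) ^ ax ''KA'')"
    using bd by (intro disjI2) (simp add: ax_def)
qed (use fixedD[OF f] I_le in \<open>auto simp: bounds_simps inj_on_def\<close>)

text \<open>The ranges come from \<open>valid\<close>: each expression adds to the previous content,
  so its static exponent exceeds that of the array.\<close>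

lemma run_move:
  assumes f: "fixed l M" and S: "stE y c M" "stS r K M" and r: "\<And>k. r k = 1 \<or> r k = -1"
    and v: "\<And>j. j \<in> {1..n} \<Longrightarrow> valid E cm (y j) (c j)"
      "\<And>j. j \<in> {1..n} \<Longrightarrow> valid E cm (new_y r y c j) (new_c r y c j)"
  shows "runs move_com l M 180 (\<lambda>l' M'. l' = l \<and> (\<exists>f g h. M' = setarr (setarr (setarr M ''Y2'' f) ''Y'' g) ''C'' h) \<and>
    stE (new_y r y c) (new_c r y c) M')"
  unfolding move_com_def
proof -
  let ?y2 = "\<lambda>j. moved E (sg r K j) (y j)"
  note fx = fixedD[OF f]
  have eb: "16 * E \<le> 2 ^ (2 * K)"
  proof -
    have "16 * E \<le> 2 ^ K * 2 ^ K" using pow_K E_le E_ge by (intro mult_mono) auto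
    then show ?thesis by (simp add: mult_2 power_add)
  qed
  have yb: "\<bar>z\<bar> \<le> int (2 ^ K) ^ 3" if "0 \<le> z" "z \<le> 16 * E" for z
    by (rule leP[of _ 2]) (use that eb in auto)
  have cb: "\<bar>z\<bar> \<le> int (2 ^ K) ^ 3" if "1 \<le> z" "z \<le> cm" for z
    by (rule leP[of _ 1]) (use that cm_le in auto)
  have b: "\<bar>?y2 j\<bar> \<le> int (2 ^ K) ^ 3" "\<bar>new_y r y c j\<bar> \<le> int (2 ^ K) ^ 3" "\<bar>new_c r y c j\<bar> \<le> int (2 ^ K) ^ 3"
    if j: "j \<in> {1..n}" for j
  proof -
    have V: "valid E cm (y j) (c j)" "valid E cm (new_y r y c j) (new_c r y c j)" using v j by blast+
    show "\<bar>?y2 j\<bar> \<le> int (2 ^ K) ^ 3"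
      using V(1) sg_sign[of r K j, OF r] by (intro yb) (auto simp: moved_def active_def valid_def)
    show "\<bar>new_y r y c j\<bar> \<le> int (2 ^ K) ^ 3" using V(2) by (intro yb) (auto simp: valid_def)
    show "\<bar>new_c r y c j\<bar> \<le> int (2 ^ K) ^ 3" using V(2) valid_facts(1)[OF V(2)] by (intro cb) (auto simp: valid_def)
  qed
  show "runs (ParFor ''j'' (Var ''n'') (Store ''Y2'' (Var ''j'' \<oplus> Const 1) (elem_e ''Y'' \<oplus> elem_e ''SG'' \<otimes> act_e (elem_e ''Y''))) ;;
     ParFor ''j'' (Var ''n'') (Store ''Y'' (Var ''j'' \<oplus> Const 1)
       (elem_e ''Y2'' \<ominus> Const 12 \<otimes> Var ''E'' \<otimes> up_e \<oplus> Const 3 \<otimes> Var ''E'' \<otimes> down_e)) ;;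
     ParFor ''j'' (Var ''n'') (Store ''C'' (Var ''j'' \<oplus> Const 1)
       (elem_e ''C'' \<oplus> elem_e ''C'' \<otimes> up_e \<ominus> (elem_e ''C'' \<oslash> Const 2) \<otimes> down_e))) l M 180
    (\<lambda>l' M'. l' = l \<and> (\<exists>f g h. M' = setarr (setarr (setarr M ''Y2'' f) ''Y'' g) ''C'' h) \<and> stE (new_y r y c) (new_c r y c) M')"
  proof (rule runs_Seq[where ?a1.0 = 60 and ?a2.0 = 120 and
      ?Q1.0 = "\<lambda>l' M'. l' = l \<and> (\<exists>f. M' = setarr M ''Y2'' f \<and> (\<forall>j\<in>{1..n}. f (int j) = ?y2 j))"], goal_cases first second)
    case first
    show ?case
    proof (rule run_elems[where val = ?y2])
      fix j assume "j \<in> {1..n}"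
      then have "aval (elem_e ''Y'' \<oplus> elem_e ''SG'' \<otimes> act_e (elem_e ''Y'')) (l(''j'' := int j - 1)) M
        = y j + sg r K j * ((if 0 < y j then 1 else 0) * (if y j < 16 * E then 1 else 0))"
        using fx S by (simp add: stE_def stS_def)
      then show "aval (elem_e ''Y'' \<oplus> elem_e ''SG'' \<otimes> act_e (elem_e ''Y'')) (l(''j'' := int j - 1)) M = ?y2 j"
        unfolding active_aval moved_def by simp
    qed (use fx b(1) in \<open>auto simp: bounds_simps\<close>)
  next
    case (second l1 M1)
    note second(2)
    then obtain f1 where 1: "l1 = l" "M1 = setarr M ''Y2'' f1" "\<And>j. j \<in> {1..n} \<Longrightarrow> f1 (int j) = ?y2 j" by blast
    show ?case
    proof (rule runs_Seq[where ?a1.0 = 60 and ?a2.0 = 60 and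
        ?Q1.0 = "\<lambda>l' M'. l' = l \<and> (\<exists>f. M' = setarr M1 ''Y'' f \<and> (\<forall>j\<in>{1..n}. f (int j) = new_y r y c j))"], goal_cases first second)
      case first
      show ?case
        unfolding 1(1)
      proof (rule run_elems[where val = "new_y r y c"])
        fix j assume "j \<in> {1..n}"
        then show "aval (elem_e ''Y2'' \<ominus> Const 12 \<otimes> Var ''E'' \<otimes> up_e \<oplus> Const 3 \<otimes> Var ''E'' \<otimes> down_e) (l(''j'' := int j - 1)) M1
          = new_y r y c j"
          using fx S 1(2,3) by (simp add: stE_def new_y_def next_y_def level_up_def level_down_def)
      qed (use fx b(2) in \<open>auto simp: bounds_simps\<close>)
    next
      case (second l2 M2)
      note second(2)
      then obtain f2 where 2: "l2 = l" "M2 = setarr M1 ''Y'' f2" "\<And>j. j \<in> {1..n} \<Longrightarrow> f2 (int j) = new_y r y c j" by blast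
      show ?case
        unfolding 2(1)
      proof (rule run_elems[where val = "new_c r y c"])
        fix h assume h: "\<And>j. j \<in> {1..n} \<Longrightarrow> h (int j) = new_c r y c j"
        have "setarr M2 ''C'' h = setarr (setarr (setarr M ''Y2'' f1) ''Y'' f2) ''C'' h" unfolding 2(2) 1(2) ..
        moreover have "stE (new_y r y c) (new_c r y c) (setarr M2 ''C'' h)"
          unfolding stE_def 2(2) using h 2(3) by simp
        ultimately show "l = l \<and> (\<exists>f g h'. setarr M2 ''C'' h = setarr (setarr (setarr M ''Y2'' f) ''Y'' g) ''C'' h') \<and>
           stE (new_y r y c) (new_c r y c) (setarr M2 ''C'' h)" by blast
      next
        fix j assume "j \<in> {1..n}"
        then show "aval (elem_e ''C'' \<oplus> elem_e ''C'' \<otimes> up_e \<ominus> (elem_e ''C'' \<oslash> Const 2) \<otimes> down_e) (l(''j'' := int j - 1)) M2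
          = new_c r y c j"
          using fx S 1(2,3) 2(2) by (simp add: stE_def new_c_def next_c_def level_up_def level_down_def)
      qed (use fx b(3) in \<open>auto simp: bounds_simps\<close>)
    qed simp
  qed simp
qed

text \<open>The exponent 6 is 2 for the square of \<open>c j\<close> plus 4 for the bracket, which
  is at most \<open>2 * \<bar>SL i\<bar>\<close> because \<open>8 * U\<close> is small against
  \<open>\<bar>SL i\<bar>\<close>.\<close>

lemma coef_le:
  assumes "\<And>j. j \<in> {1..n} \<Longrightarrow> valid E cm (y j) (c j)" "i < I"
  shows "\<bar>coef y c i j\<bar> \<le> 2 ^ (6 * K)"
proof (cases "j \<in> D i")
  case True
  then have v: "valid E cm (y j) (c j)" using assms D_sub[of i] by blast
  have c: "1 \<le> c j" "c j \<le> 2 ^ K" using valid_facts(1)[OF v] v cm_le by (auto simp: valid_def)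
  have X: "0 \<le> y j * (c j)\<^sup>2" "y j * (c j)\<^sup>2 \<le> U" using valid_facts[OF v] by auto
  have "\<bar>SL i - 8 * (y j * (c j)\<^sup>2)\<bar> \<le> \<bar>SL i\<bar> + 8 * (y j * (c j)\<^sup>2)" using X by arith
  also have "\<dots> \<le> 2 * \<bar>SL i\<bar>" using X(2) SL_U[OF assms(2)] X(1) by linarith
  also have "\<dots> \<le> 2 * 2 ^ (3 * K)" using SL_le[OF assms(2)] by simp
  also have "\<dots> \<le> 2 ^ K * 2 ^ (3 * K)" using pow_K by (intro mult_right_mono) auto
  finally have 1: "\<bar>SL i - 8 * (y j * (c j)\<^sup>2)\<bar> \<le> 2 ^ (4 * K)" by (simp flip: power_add)
  have "(c j)\<^sup>2 \<le> (2 ^ K)\<^sup>2" using c by (intro power_mono) auto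
  then have 2: "(c j)\<^sup>2 \<le> 2 ^ (2 * K)" by (simp add: power_mult[symmetric] mult.commute)
  have "\<bar>coef y c i j\<bar> \<le> (c j)\<^sup>2 * \<bar>SL i - 8 * (y j * (c j)\<^sup>2)\<bar>"
    by (simp add: coef_def abs_mult)
  also have "\<dots> \<le> 2 ^ (2 * K) * 2 ^ (4 * K)" using 1 2 by (intro mult_mono) auto
  finally show ?thesis by (simp flip: power_add)
qed (simp add: coef_def)

definition Inv :: "nat \<Rightarrow> locals \<Rightarrow> memory \<Rightarrow> bool" where
  "Inv t l M \<longleftrightarrow> fixed l M \<and> l ''t'' = int t \<and> l ''om'' = om G t \<and> LDok K M \<and> Hz M \<and> Vz ''V'' M \<and> Vz ''W'' M \<and>
     (\<exists>\<kappa> y c. good t \<kappa> y c \<and> stE y c M \<and> stK \<kappa> M)"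

text \<open>The budget is quadratic in \<open>K\<close>: there are \<open>K\<close> bits to fix,
  each by one tree sum. Together with the number of rounds this gives the depth of the whole
  algorithm.\<close>

lemma run_step:
  assumes t: "t < steps" and inv: "Inv t l M"
  shows "runs step_com l M (700 + (K + 1) * (904 + (K + 1) * 60)) (Inv (Suc t))"
proof -
  obtain \<kappa> y c where I: "fixed l M" "l ''t'' = int t" "l ''om'' = om G t" "LDok K M" "Hz M" "Vz ''V'' M" "Vz ''W'' M"
    "good t \<kappa> y c" "stE y c M" "stK \<kappa> M" using inv unfolding Inv_def by blast
  have v: "valid E cm (y j) (c j)" if "j \<in> {1..n}" for j using I(8) that by (simp add: good_def)
  have cb: "\<bar>coef y c i j\<bar> \<le> 2 ^ (6 * K)" if "i < I" for i j by (rule coef_le) (use v that in auto)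
  let ?w = "om G (Suc t)"
  have wb: "\<bar>?w\<bar> \<le> int (2 ^ K) ^ 104"
  proof (rule leP[of _ 103])
    show "\<bar>?w\<bar> \<le> 2 ^ (103 * K)" using om_le[of "Suc t"] om_ge[OF G_ge, of "Suc t"] G_ge t by (simp only: abs_of_nonneg)
  qed simp
  have "int t + 1 \<le> int steps" using t by simp
  then have "\<bar>int t + 1\<bar> \<le> 2 ^ (5 * K)" using steps_le by linarith
  then have tb: "\<bar>int t + 1\<bar> \<le> int (2 ^ K) ^ 5" by (rule leP) simp
  let ?l1 = "l(''om'' := ?w)"
  have f1: "fixed ?l1 M" using I(1) by simp
  show ?thesis unfolding step_com_def
  proof (rule runs_Seq[where ?a1.0 = 10 and ?a2.0 = "690 + (K + 1) * (904 + (K + 1) * 60)" and ?Q1.0 = "\<lambda>l' M'. l' = ?l1 \<and> M' = M"], goal_cases first second)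
    case first
    show ?case
      by (intro runs_Assign) (use I fixedD[OF I(1)] wb in \<open>auto simp: bounds_simps\<close>)
    case (second l1 M1)
    note 1 = second(2)
    let ?Q = "\<lambda>l' M'. l' = ?l1 \<and> (\<exists>f g h. M' = setarr (setarr (setarr M ''SG'' f) ''V'' g) ''W'' h) \<and>
      stS (\<lambda>_. 1) 0 M' \<and> Vok ''V'' (\<lambda>_. 1) (coef y c) 0 M' \<and> Vok ''W'' (\<lambda>_. 1) (\<lambda>i j. (coef y c i j)\<^sup>2) 0 M' \<and> Vz ''V'' M' \<and> Vz ''W'' M'"
    let ?L = "LI \<kappa> y c ?w (int t)"
    show ?case
    proof (rule runs_Seq[where ?a1.0 = 300 and ?a2.0 = "380 + (K + 1) * (904 + (K + 1) * 60)" and ?Q1.0 = ?Q], goal_cases first second)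
      case first
      show ?case using 1 by (simp only:) (rule run_base[OF f1 I(9,6,7) cb])
      case (second l2 M2)
      note Q = second(2)
      then obtain f g h where M2: "M2 = setarr (setarr (setarr M ''SG'' f) ''V'' g) ''W'' h" by blast
      have L0: "?L 0 (l2(''k'' := 0, ''pk'' := 1)) M2"
        unfolding LI_def
      proof (intro conjI exI[of _ "\<lambda>_. 1"])
        show "stS (\<lambda>_. 1) 0 M2" "Vok ''V'' (\<lambda>_. 1) (coef y c) 0 M2" "Vok ''W'' (\<lambda>_. 1) (\<lambda>i j. (coef y c i j)\<^sup>2) 0 M2"
          "Vz ''V'' M2" "Vz ''W'' M2" using Q by blast+
        show "fixed (l2(''k'' := 0, ''pk'' := 1)) M2" "LDok K M2" "stE y c M2" "stK \<kappa> M2" "Hz M2"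
          unfolding M2 using I Q by simp_all
      qed (use I Q in simp_all)
      show ?case
      proof (rule run_start_levels)
        show "runs (While (Op Less (Var ''k'') (Var ''K'')) level_com ;; weights_com ;; move_com ;; Assign ''t'' (Var ''t'' \<oplus> Const 1))
          (l2(''k'' := 0, ''pk'' := 1)) M2 (370 + (K + 1) * (904 + (K + 1) * 60)) (Inv (Suc t))"
        proof (rule runs_Seq[where ?a1.0 = "(K + 1) * (904 + (K + 1) * 60)" and ?a2.0 = 370 and ?Q1.0 = "?L K"], goal_cases first second)
          case first
          show ?case
          proof (rule runs_While[where T = K and I = ?L and a = "900 + (K + 1) * 60"])
            fix k l3 M3 assume k: "k < K" and L: "?L k l3 M3"
            show "aval (Op Less (Var ''k'') (Var ''K'')) l3 M3 \<noteq> 0 \<and> runs level_com l3 M3 (900 + (K + 1) * 60) (?L (Suc k))"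
              using run_level[OF cb k L] L k fixedD(5)[of l3 M3] by (simp add: LI_def)
          next
            fix l3 M3 assume L: "?L K l3 M3"
            then show "aval (Op Less (Var ''k'') (Var ''K'')) l3 M3 = 0" using fixedD(5)[of l3 M3] by (simp add: LI_def)
          qed (use L0 in \<open>auto simp: bounds_simps\<close>)
          case (second l4 M4)
          note second(2)
          then obtain r where 4: "fixed l4 M4" "l4 ''om'' = ?w" "l4 ''t'' = int t" "LDok K M4" "stE y c M4" "stK \<kappa> M4" "Hz M4"
              "Vz ''V'' M4" "Vz ''W'' M4"
            and r: "\<forall>k. r k = 1 \<or> r k = -1" "\<forall>k'<K. r k' = pick \<kappa> y c ?w r k'" "Vok ''V'' r (coef y c) K M4"
              "Vok ''W'' (\<lambda>_. 1) (\<lambda>i j. (coef y c i j)\<^sup>2) K M4" "stS r K M4" unfolding LI_def by blast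
          have rr: "r k = 1 \<or> r k = -1" for k using r(1) by blast
          have H: "(\<Sum>i<I. \<kappa> i * ((SL i)\<^sup>2 * agg r K (coef y c i) 0 + (agg r K (coef y c i) 0)\<^sup>2
            - (\<Sum>u<2 ^ K. (coef y c i u)\<^sup>2))) + (\<Sum>j<2 ^ K. sg r K j * drift ?w y c j) \<le> 0"
          proof (rule cexp_le)
            fix i assume "i < I"
            then have "0 \<notin> D i" using D_sub[of i] by auto
            then show "coef y c i 0 = 0" by (simp add: coef_def)
          next
            show "drift ?w y c 0 = 0" by (simp add: drift_def)
            show "r k = (if 0 < slope I K \<kappa> (\<lambda>i. (SL i)\<^sup>2) (coef y c) (drift ?w y c) r k then -1 else 1)" if "k < K" for k
              using r(2) that unfolding pick_def by blast
          qed
          have gd: "good (Suc t) (new_\<kappa> r \<kappa> y c) (new_y r y c) (new_c r y c)"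
            by (rule good_step[OF I(8) t rr H])
          have kb: "\<bar>new_\<kappa> r \<kappa> y c i\<bar> \<le> int (2 ^ K) ^ 23" if "i < I" for i
          proof (rule leP[of _ 22])
            have "1 \<le> new_\<kappa> r \<kappa> y c i" using gd that by (simp add: good_def)
            then show "\<bar>new_\<kappa> r \<kappa> y c i\<bar> \<le> 2 ^ (22 * K)" using \<kappa>_le'[OF gd _ that] t by simp
          qed simp
          let ?Q5 = "\<lambda>l' M'. l' = l4 \<and> (\<exists>f. M' = setarr M4 ''KA'' f) \<and> stK (new_\<kappa> r \<kappa> y c) M'"
          show ?case
          proof (rule runs_Seq[where ?a1.0 = 120 and ?a2.0 = 250 and ?Q1.0 = ?Q5], goal_cases first second)
            case first
            show ?case by (rule run_weights[OF 4(1,6) r(3,4) kb])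
            case (second l5 M5)
            note 5 = second(2)
            then obtain f5 where f5: "l5 = l4" "M5 = setarr M4 ''KA'' f5" by blast
            let ?Q6 = "\<lambda>l' M'. l' = l4 \<and> (\<exists>f g h. M' = setarr (setarr (setarr M5 ''Y2'' f) ''Y'' g) ''C'' h) \<and>
               stE (new_y r y c) (new_c r y c) M'"
            show ?case
            proof (rule runs_Seq[where ?a1.0 = 180 and ?a2.0 = 70 and ?Q1.0 = ?Q6], goal_cases first second)
              case first
              show ?case unfolding f5(1)
                by (rule run_move) (use f5 4 r v gd rr in \<open>simp_all add: good_def\<close>)
              case (second l6 M6)
              note 6 = second(2)
              then obtain f6 g6 h6 where f6: "M6 = setarr (setarr (setarr M5 ''Y2'' f6) ''Y'' g6) ''C'' h6" by blast
              have "Inv (Suc t) (l4(''t'' := int (Suc t))) M6" unfolding Inv_def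
              proof (intro conjI exI)
                show "good (Suc t) (new_\<kappa> r \<kappa> y c) (new_y r y c) (new_c r y c)" by (rule gd)
                show "stE (new_y r y c) (new_c r y c) M6" using 6 by blast
                show "stK (new_\<kappa> r \<kappa> y c) M6" unfolding f6 using 5 by simp
              qed (use 4 in \<open>simp_all add: f6 f5\<close>)
              then show "runs (Assign ''t'' (Var ''t'' \<oplus> Const 1)) l6 M6 70 (Inv (Suc t))"
                by (intro runs_Assign) (use 4 6 tb in \<open>auto simp: bounds_simps add.commute\<close>)
            qed simp
          qed simp
        qed simp
      qed simp
    qed simp
  qed simp
qed

lemma run_core:
  assumes f: "fixed l M" and z: "\<And>a z. a \<in> {''OC'', ''H'', ''V'', ''W''} \<Longrightarrow> M (a, z) = 0"
    and S: "stE (\<lambda>_. y0) (\<lambda>_. 1) M" "stK (\<lambda>i. F0 div SL i ^ 4 + 1) M"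
  shows "runs core_com l M (200 + (K + 1) * 220 + (steps + 1) * (704 + (K + 1) * (904 + (K + 1) * 60)))
    (\<lambda>l' M'. \<exists>\<kappa> y c. good steps \<kappa> y c \<and> (\<forall>j\<in>{1..n}. M' (''T'', int j) = of_bool (y j = 16 * E)))"
    (is "runs _ _ _ _ ?Q")
  unfolding core_com_def
proof (rule runs_Seq[where ?a1.0 = "70 + (K + 1) * 220" and ?a2.0 = "130 + (steps + 1) * (704 + (K + 1) * (904 + (K + 1) * 60))"
    and ?Q1.0 = "\<lambda>l' M'. fixed l' M' \<and> LDok K M' \<and> agree {''LD'', ''OC''} M M'"], goal_cases first second)
  case first
  show ?case
    by (rule run_leaders[OF f]) (use z in simp)
  case (second l1 M1)
  note 1 = second(2)
  let ?l2 = "l1(''om'' := G)" and ?l3 = "l1(''om'' := G, ''t'' := 0)"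
  have same: "M1 (a, z) = M (a, z)" if "a \<notin> {''LD'', ''OC''}" for a z using 1 that by (simp add: agree_def)
  have gb: "\<bar>G\<bar> \<le> int (2 ^ K) ^ 104" by (rule leP[of _ 3]) (use G_le G_ge in auto)
  have I0: "Inv 0 ?l3 M1" unfolding Inv_def
  proof (intro conjI exI)
    show "good 0 (\<lambda>i. F0 div SL i ^ 4 + 1) (\<lambda>_. y0) (\<lambda>_. 1)" by (rule good_init)
    show "stE (\<lambda>_. y0) (\<lambda>_. 1) M1" "stK (\<lambda>i. F0 div SL i ^ 4 + 1) M1"
      using S same unfolding stE_def stK_def by simp_all
    show "Hz M1" "Vz ''V'' M1" "Vz ''W'' M1" unfolding Hz_def Vz_def using same z by simp_all
  qed (use 1 in simp_all)
  show ?case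
  proof (rule runs_Seq[where ?a1.0 = 10 and ?a2.0 = "120 + (steps + 1) * (704 + (K + 1) * (904 + (K + 1) * 60))"
      and ?Q1.0 = "\<lambda>l' M'. l' = ?l2 \<and> M' = M1"], goal_cases first second)
    case first
    show ?case
      by (intro runs_Assign) (use 1 gb fixedD(8)[of l1 M1] in \<open>auto simp: bounds_simps\<close>)
    case (second l2 M2)
    note 2 = second(2)
    show ?case
    proof (rule runs_Seq[where ?a1.0 = 10 and ?a2.0 = "110 + (steps + 1) * (704 + (K + 1) * (904 + (K + 1) * 60))"
        and ?Q1.0 = "\<lambda>l' M'. l' = ?l3 \<and> M' = M1"], goal_cases first second)
      case first
      show ?case
        by (intro runs_Assign) (use 2 in auto)
      case (second l3 M3)
      note 3 = second(2)
      show ?case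
      proof (rule runs_Seq[where ?a1.0 = "(steps + 1) * (704 + (K + 1) * (904 + (K + 1) * 60))" and ?a2.0 = 110 and ?Q1.0 = "Inv steps"], goal_cases first second)
        case first
        show ?case
        proof (rule runs_While[where T = steps and I = Inv and a = "700 + (K + 1) * (904 + (K + 1) * 60)"])
          fix t l4 M4 assume t: "t < steps" and I: "Inv t l4 M4"
          show "aval (Op Less (Var ''t'') (Var ''Tn'')) l4 M4 \<noteq> 0 \<and> runs step_com l4 M4 (700 + (K + 1) * (904 + (K + 1) * 60)) (Inv (Suc t))"
            using run_step[OF t I] I t fixedD(9)[of l4 M4] by (simp add: Inv_def)
        next
          fix l4 M4 assume "Inv steps l4 M4"
          then show "aval (Op Less (Var ''t'') (Var ''Tn'')) l4 M4 = 0" using fixedD(9)[of l4 M4] by (simp add: Inv_def)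
        qed (use I0 3 in \<open>auto simp: bounds_simps\<close>)
        case (second l4 M4)
        note second(2)
        then obtain \<kappa> y c where 4: "fixed l4 M4" "good steps \<kappa> y c" "stE y c M4" unfolding Inv_def by blast
        show ?case
        proof (rule run_elems[where val = "\<lambda>j. of_bool (y j = 16 * E)"])
          fix h :: "int \<Rightarrow> int" assume h: "\<And>j. j \<in> {1..n} \<Longrightarrow> h (int j) = of_bool (y j = 16 * E)"
          then have "\<forall>j\<in>{1..n}. setarr M4 ''T'' h (''T'', int j) = of_bool (y j = 16 * E)" by simp
          then show "?Q l4 (setarr M4 ''T'' h)" using 4(2) by blast
        qed (use fixedD[OF 4(1)] 4(3) in \<open>auto simp: bounds_simps stE_def\<close>)
      qed simp
    qed simp
  qed simp
qed simp

end

section \<open>Fixed-point parameters\<close>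

definition offset :: "'a list list \<Rightarrow> nat \<Rightarrow> nat" where
  "offset ys i = length (concat (take i ys))"

definition owner :: "'a list list \<Rightarrow> nat \<Rightarrow> nat" where
  "owner ys q = (SOME i. i < length ys \<and> (\<exists>t<length (ys ! i). q = offset ys i + t))"

lemma offset_Suc: "i < length ys \<Longrightarrow> offset ys (Suc i) = offset ys i + length (ys ! i)"
  by (simp add: offset_def take_Suc_conv_app_nth)

lemma offset_mono: "i \<le> j \<Longrightarrow> offset ys i \<le> offset ys j"
proof (rule lift_Suc_mono_le[of "offset ys"])
  show "offset ys k \<le> offset ys (Suc k)" for k
    by (cases "k < length ys") (simp_all add: offset_Suc, simp add: offset_def)
qed

lemma offset_less:
  assumes "i < length ys" "t < length (ys ! i)"
  shows "offset ys i + t < length (concat ys)"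
proof -
  have "offset ys (Suc i) \<le> offset ys (length ys)" using assms by (intro offset_mono) simp
  then show ?thesis using assms offset_Suc[of i ys] by (simp add: offset_def)
qed

lemma offset_unique:
  assumes "i < length ys" "t < length (ys ! i)" "i' < length ys" "t' < length (ys ! i')"
    "offset ys i + t = offset ys i' + t'"
  shows "i = i' \<and> t = t'"
proof -
  have "\<not> a < b" if "a < length ys" "s < length (ys ! a)" "offset ys a + s = offset ys b + s'" for a b s s'
  proof
    assume "a < b"
    then have "offset ys (Suc a) \<le> offset ys b" by (intro offset_mono) simp
    then show False using that offset_Suc[of a ys] by simp
  qed
  from this[of i t i' t'] this[of i' t' i t] have "i = i'" using assms by simp
  then show ?thesis using assms by simp
qed

lemma offset_ex: "q < length (concat ys) \<Longrightarrow> \<exists>i<length ys. \<exists>t<length (ys ! i). q = offset ys i + t"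
proof (induction ys rule: rev_induct)
  case (snoc x ys)
  show ?case
  proof (cases "q < length (concat ys)")
    case True
    then obtain i t where "i < length ys" "t < length (ys ! i)" "q = offset ys i + t" using snoc.IH by blast
    then show ?thesis by (intro exI[of _ i]) (auto simp: offset_def nth_append)
  next
    case False
    then show ?thesis using snoc.prems
      by (intro exI[of _ "length ys"]) (auto simp: offset_def nth_append intro!: exI[of _ "q - length (concat ys)"])
  qed
qed simp

lemma nth_concat_offset:
  assumes "i < length ys" "t < length (ys ! i)"
  shows "concat ys ! (offset ys i + t) = ys ! i ! t"
proof -
  have "concat ys = concat (take i ys) @ ys ! i @ concat (drop (Suc i) ys)"
    using id_take_nth_drop[OF assms(1)] by (metis concat.simps(2) concat_append)
  then show ?thesis using assms by (simp add: offset_def nth_append)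
qed

lemma owner_offset:
  assumes "i < length ys" "t < length (ys ! i)"
  shows "owner ys (offset ys i + t) = i"
proof -
  let ?P = "\<lambda>j. j < length ys \<and> (\<exists>s<length (ys ! j). offset ys i + t = offset ys j + s)"
  have "?P (owner ys (offset ys i + t))" unfolding owner_def by (rule someI[of ?P i]) (use assms in auto)
  then show ?thesis using offset_unique[of i ys t] assms by metis
qed

lemma bij_owner:
  assumes "\<And>x. x \<in> set ys \<Longrightarrow> distinct x"
  shows "bij_betw (\<lambda>q. (owner ys q, concat ys ! q)) {..<length (concat ys)} (SIGMA i:{..<length ys}. set (ys ! i))"
  unfolding bij_betw_def
proof
  show "inj_on (\<lambda>q. (owner ys q, concat ys ! q)) {..<length (concat ys)}"
  proof (rule inj_onI)
    fix q q' assume q: "q \<in> {..<length (concat ys)}" "q' \<in> {..<length (concat ys)}"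
      and e: "(owner ys q, concat ys ! q) = (owner ys q', concat ys ! q')"
    obtain i t where i: "i < length ys" "t < length (ys ! i)" "q = offset ys i + t" using offset_ex q(1) by blast
    obtain i' t' where i': "i' < length ys" "t' < length (ys ! i')" "q' = offset ys i' + t'" using offset_ex q(2) by blast
    have "i = i'" "ys ! i ! t = ys ! i' ! t'"
      using e i i' by (auto simp: owner_offset nth_concat_offset)
    then show "q = q'" using assms[of "ys ! i"] i i' by (simp add: nth_eq_iff_index_eq)
  qed
  show "(\<lambda>q. (owner ys q, concat ys ! q)) ` {..<length (concat ys)} = (SIGMA i:{..<length ys}. set (ys ! i))"
  proof (intro set_eqI iffI)
    fix z assume "z \<in> (\<lambda>q. (owner ys q, concat ys ! q)) ` {..<length (concat ys)}"
    then obtain q where q: "q < length (concat ys)" "z = (owner ys q, concat ys ! q)" by auto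
    obtain i t where i: "i < length ys" "t < length (ys ! i)" "q = offset ys i + t" using offset_ex q(1) by blast
    then show "z \<in> (SIGMA i:{..<length ys}. set (ys ! i))" using q(2) by (auto simp: owner_offset nth_concat_offset)
  next
    fix z assume "z \<in> (SIGMA i:{..<length ys}. set (ys ! i))"
    then obtain i x where z: "z = (i, x)" "i < length ys" "x \<in> set (ys ! i)" by auto
    then obtain t where t: "t < length (ys ! i)" "x = ys ! i ! t" by (metis in_set_conv_nth)
    have "z = (owner ys (offset ys i + t), concat ys ! (offset ys i + t))"
      using z t by (simp add: owner_offset nth_concat_offset)
    moreover have "offset ys i + t < length (concat ys)" using offset_less z t by blast
    ultimately show "z \<in> (\<lambda>q. (owner ys q, concat ys ! q)) ` {..<length (concat ys)}" by blast
  qed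
qed

text \<open>For \<open>x \<ge> 1\<close> the base is at least 2, so constants and the sum of two
  terms are absorbed by additional powers. This replaces the unspecified polynomials of the
  statement by the exponents \<open>a0\<close> and \<open>b\<close>.\<close>

lemma poly_le_power:
  fixes q :: "real poly"
  shows "\<exists>a. \<forall>x\<ge>1. \<bar>poly q x\<bar> \<le> (x + 1) ^ a"
proof (induction q)
  case (pCons c q)
  then obtain a where a: "\<And>x. 1 \<le> x \<Longrightarrow> \<bar>poly q x\<bar> \<le> (x + 1) ^ a" by blast
  obtain b :: nat where b: "\<bar>c\<bar> \<le> 2 ^ b" using real_arch_pow[of 2 "\<bar>c\<bar>"] by (auto intro: less_imp_le)
  have "\<bar>poly (pCons c q) x\<bar> \<le> (x + 1) ^ (a + b + 2)" if x: "1 \<le> x" for x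
  proof -
    have "\<bar>poly (pCons c q) x\<bar> \<le> \<bar>c\<bar> + x * \<bar>poly q x\<bar>"
      using x by (simp add: order_trans[OF abs_triangle_ineq] abs_mult)
    also have "\<dots> \<le> (x + 1) ^ b + (x + 1) * (x + 1) ^ a"
    proof (intro add_mono mult_mono)
      show "\<bar>c\<bar> \<le> (x + 1) ^ b" using b power_mono[of 2 "x + 1" b] x by simp
    qed (use x a in auto)
    also have "\<dots> \<le> (x + 1) ^ (a + b + 1) + (x + 1) ^ (a + b + 1)"
      unfolding power_Suc[symmetric] by (intro add_mono power_increasing) (use x in auto)
    also have "\<dots> = 2 * (x + 1) ^ (a + b + 1)" by simp
    also have "\<dots> \<le> (x + 1) * (x + 1) ^ (a + b + 1)" using x by (intro mult_right_mono) auto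
    finally show ?thesis by simp
  qed
  then show ?case by blast
qed auto

lemma div_bounds:
  "real_of_int (a div b) \<le> real_of_int a / real_of_int b"
  "real_of_int a / real_of_int b - 1 < real_of_int (a div b)"
proof -
  have "a div b = \<lfloor>real_of_int a / real_of_int b\<rfloor>" by (rule floor_divide_of_int_eq[symmetric])
  then show "real_of_int (a div b) \<le> real_of_int a / real_of_int b"
    "real_of_int a / real_of_int b - 1 < real_of_int (a div b)" by (simp_all only:) linarith+
qed

text \<open>The constant 3200 is 1600 times 2: \<open>K \<le> 2 * (a0 + 2) * Log n\<close>
  (\<open>K_le\<close>), and the walk needs \<open>1600 * K \<le> p * \<epsilon>\<^sup>2 *
  \<bar>S\<^sub>i\<bar>\<close>.\<close>

locale sampling_input =
  fixes n m a0 :: nat and S :: "nat \<Rightarrow> nat set" and xss :: "nat list list" and p \<epsilon> :: real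
  assumes m_ge: "1 \<le> m" and n_ge: "1 \<le> n" and S_sub: "\<And>i. i \<in> {1..m} \<Longrightarrow> S i \<subseteq> {1..n}"
    and m_le: "real m \<le> (real n + 1) ^ a0"
    and p_ge: "0 \<le> p" and p_le: "p \<le> 1" and \<epsilon>_pos: "0 < \<epsilon>" and \<epsilon>_le: "\<epsilon> \<le> 1"
    and large: "\<And>i. i \<in> {1..m} \<Longrightarrow> 3200 * (real a0 + 2) * Log n \<le> p * \<epsilon>\<^sup>2 * real (card (S i))"
    and lists: "lists_family xss m S"
begin

text \<open>Two copies of the family, one for each tail.\<close>

definition yss :: "nat list list" where "yss = xss @ xss"
definition N :: nat where "N = length (concat xss)"
text \<open>The tree has a leaf for each of the \<open>2 * N\<close> positions and each of the
  \<open>n\<close> elements. The choice of the least exponent keeps \<open>2 ^ K\<close> linear in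
  the input.\<close>

definition K :: nat where "K = (LEAST k. 2 * N + n + 1 \<le> 2 ^ k)"
definition X :: int where "X = int n + 1"
definition SS :: int where "SS = X ^ 3"
definition ph :: int where "ph = \<lfloor>p * (real n + 1) ^ 3\<rfloor>"
definition eh :: int where "eh = \<lfloor>\<epsilon> * (real n + 1) ^ 3\<rfloor>"
text \<open>About 640 K/\<epsilon>, rounded up. Above the bottom level \<open>y\<close> exceeds
  \<open>E\<close>, so the relative step 1/y is below a multiple of \<epsilon>/K.\<close>

definition E :: int where "E = 640 * int K * SS div eh + 1"
text \<open>The least level count with \<open>4 * p * cm\<^sup>2 \<ge> 1\<close>, up to fixed-point
  rounding. By minimality \<open>p * cm\<^sup>2\<close> is below 1 unless
  \<open>cm = 1\<close>.\<close>

definition ec :: nat where "ec = (LEAST e. SS \<le> 4 * ph * (2 ^ e * 2 ^ e))"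
definition cm :: int where "cm = 2 ^ ec"
text \<open>Represents the value \<open>p\<close> on the bottom level \<open>c = 1\<close>. By the
  choice of \<open>ec\<close> it lies between \<open>4 * E\<close> and
  \<open>16 * E\<close>.\<close>

definition y0 :: int where "y0 = 16 * E * ph * (cm * cm) div SS"
definition D :: "nat \<Rightarrow> nat set" where "D i = set (yss ! i)"
text \<open>The copy \<open>i div m\<close> determines the sign. The modulus is chosen such that
  \<open>K\<close> times it is \<epsilon>/10 of the initial mass of the set.\<close>

definition SL :: "nat \<Rightarrow> int" where
  "SL i = (1 - 2 * (int i div int m)) * (eh * int (length (xss ! (i mod m))) * y0 div (SS * 10 * int K))"

lemma len_xss: "length xss = m"
  using lists by (simp add: lists_family_def)

lemma xss_facts:
  assumes "i < m"
  shows "distinct (xss ! i)" "set (xss ! i) = S (Suc i)" "length (xss ! i) = card (S (Suc i))"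
proof -
  have "Suc i \<in> {1..m}" using assms by simp
  then have "distinct (xss ! (Suc i - 1)) \<and> set (xss ! (Suc i - 1)) = S (Suc i)"
    using lists unfolding lists_family_def by blast
  then show "distinct (xss ! i)" "set (xss ! i) = S (Suc i)" by simp_all
  then show "length (xss ! i) = card (S (Suc i))" by (metis distinct_card)
qed

lemma card_le: "i \<in> {1..m} \<Longrightarrow> card (S i) \<le> n"
  using card_mono[OF _ S_sub, of i] by simp

lemma Log_ge: "1 \<le> Log n"
  by (simp add: Log_def)

text \<open>A set has at most \<open>n\<close> elements and \<open>p\<close>, \<epsilon> are at most
  1, so one set satisfying the size hypothesis forces \<open>n\<close> to be large.\<close>

lemma n_large: "6400 \<le> n"
proof -
  have 1: "1 \<in> {1..m}" using m_ge by simp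
  have "6400 * 1 \<le> 3200 * (real a0 + 2) * Log n" using Log_ge by (intro mult_mono) auto
  also have "\<dots> \<le> p * \<epsilon>\<^sup>2 * real (card (S 1))" using large[OF 1] by simp
  also have "\<dots> \<le> 1 * 1 * real n"
    using p_ge p_le \<epsilon>_pos \<epsilon>_le card_le[OF 1] by (intro mult_mono) (auto simp: power_le_one)
  finally show ?thesis by simp
qed

lemma N_eq: "N = (\<Sum>i=1..m. card (S i))"
proof -
  have "N = sum_list (map length xss)" by (simp add: N_def length_concat)
  also have "\<dots> = (\<Sum>i<m. length (xss ! i))"
    by (simp add: sum_list_sum_nth len_xss atLeast0LessThan)
  also have "\<dots> = (\<Sum>i<m. card (S (Suc i)))" using xss_facts(3) by (intro sum.cong) auto
  also have "\<dots> = (\<Sum>i=1..m. card (S i))" using sum.atLeast1_atMost_eq[of "\<lambda>i. card (S i)" m] by simp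
  finally show ?thesis .
qed

lemma K_props: "2 * N + n + 1 \<le> 2 ^ K" "2 ^ K \<le> 2 * (2 * N + n)" "\<And>k. k < K \<Longrightarrow> 2 ^ k < 2 * N + n + 1"
proof -
  have ex: "2 * N + n + 1 \<le> 2 ^ (2 * N + n + 1)" using less_exp[of "2 * N + n + 1"] by linarith
  show "2 * N + n + 1 \<le> 2 ^ K" unfolding K_def using ex by (rule LeastI)
  show l: "2 ^ k < 2 * N + n + 1" if "k < K" for k using not_less_Least[of k "\<lambda>k. 2 * N + n + 1 \<le> 2 ^ k"] that
    unfolding K_def by (auto simp: not_le)
  show "2 ^ K \<le> 2 * (2 * N + n)"
  proof (cases K)
    case 0 then show ?thesis using n_ge by simp
  next
    case (Suc k)
    then show ?thesis using l[of k] by simp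
  qed
qed

lemma K_ge: "12 \<le> K"
proof (rule ccontr)
  assume "\<not> 12 \<le> K"
  then have "(2 :: nat) ^ K \<le> 2 ^ 11" by (intro power_increasing) auto
  then show False using K_props(1) n_large by simp
qed

lemma N_le: "N \<le> m * n"
  unfolding N_eq using sum_bounded_above[of "{1..m}" "\<lambda>i. card (S i)" n] card_le by simp

text \<open>The total size is at most \<open>m * n\<close>; the remaining factor 6 is covered by one
  more power of \<open>n + 1\<close>.\<close>

lemma P_le: "(2 :: real) ^ K \<le> (real n + 1) ^ (a0 + 2)"
proof -
  have "(2 :: nat) ^ K \<le> 4 * N + 2 * n" using K_props(2) by simp
  also have "\<dots> \<le> 4 * (m * n) + 2 * (m * n)" using N_le m_ge by (intro add_mono) auto
  finally have "real (2 ^ K) \<le> real (6 * (m * n))" by (simp only: of_nat_le_iff)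
  then have "(2 :: real) ^ K \<le> 6 * (real m * real n)" by simp
  also have "\<dots> \<le> (real n + 1) * ((real n + 1) ^ a0 * (real n + 1))"
    using n_large m_le by (intro mult_mono) auto
  finally show ?thesis by (simp add: mult_ac)
qed

lemma K_le: "real K \<le> 2 * (real a0 + 2) * Log n"
proof -
  have "real K = log 2 (2 ^ K)" by simp
  also have "\<dots> \<le> log 2 ((real n + 1) ^ (a0 + 2))" using P_le by (intro log_mono) auto
  also have "\<dots> = (real a0 + 2) * log 2 (real n + 1)" by (subst log_nat_power) simp_all
  also have "log 2 (real n + 1) \<le> log 2 ((real n)\<^sup>2)"
  proof (rule log_mono)
    have "real n + 1 \<le> real n * 2" using n_large by simp
    also have "\<dots> \<le> real n * real n" using n_large by (intro mult_left_mono) auto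
    finally show "real n + 1 \<le> (real n)\<^sup>2" by (simp add: power2_eq_square)
  qed auto
  also have "log 2 ((real n)\<^sup>2) = 2 * log 2 (real n)" using n_large by (simp add: log_nat_power)
  also have "\<dots> \<le> 2 * Log n" by (simp add: Log_def)
  finally show ?thesis by (simp add: mult_ac)
qed

lemma key: "i \<in> {1..m} \<Longrightarrow> 1600 * real K \<le> p * \<epsilon>\<^sup>2 * real (card (S i))"
proof -
  assume i: "i \<in> {1..m}"
  have "1600 * real K \<le> 1600 * (2 * (real a0 + 2) * Log n)" using K_le by (intro mult_left_mono) simp_all
  also have "\<dots> = 3200 * (real a0 + 2) * Log n" by simp
  also have "\<dots> \<le> p * \<epsilon>\<^sup>2 * real (card (S i))" by (rule large[OF i])
  finally show ?thesis .
qed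

lemma key_n: "1600 * real K \<le> p * \<epsilon>\<^sup>2 * real n"
proof -
  have 1: "1 \<in> {1..m}" using m_ge by simp
  have "p * \<epsilon>\<^sup>2 * real (card (S 1)) \<le> p * \<epsilon>\<^sup>2 * real n"
    using p_ge card_le[OF 1] by (intro mult_left_mono) auto
  then show ?thesis using key[OF 1] by simp
qed

lemma key_p: "1600 * real K \<le> p * real n"
proof -
  have "p * \<epsilon>\<^sup>2 * real n \<le> p * 1 * real n"
    using p_ge \<epsilon>_pos \<epsilon>_le by (intro mult_right_mono mult_left_mono) (auto simp: power_le_one)
  then show ?thesis using key_n by simp
qed

lemma key_\<epsilon>: "1600 * real K \<le> \<epsilon> * real n" "1600 * real K \<le> \<epsilon>\<^sup>2 * real n"
proof -
  have "p * \<epsilon>\<^sup>2 * real n \<le> 1 * \<epsilon>\<^sup>2 * real n"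
    using p_le \<epsilon>_pos by (intro mult_right_mono) auto
  then show a: "1600 * real K \<le> \<epsilon>\<^sup>2 * real n" using key_n by simp
  have "\<epsilon>\<^sup>2 * real n \<le> \<epsilon> * real n"
    using \<epsilon>_pos \<epsilon>_le by (intro mult_right_mono) (auto simp: power2_eq_square mult_left_le)
  then show "1600 * real K \<le> \<epsilon> * real n" using a by simp
qed

lemma rX: "real_of_int X = real n + 1" "real_of_int SS = (real n + 1) ^ 3" "6401 \<le> X" "0 < SS"
  using n_large by (simp_all add: X_def SS_def)

text \<open>Both parameters are at least of order \<open>K / n\<close>, so with denominator
  \<open>(n + 1) ^ 3\<close> the rounding loses less than a tenth and the integer is still at least
  the square of \<open>n + 1\<close>.\<close>

lemma fixed_point:
  assumes "1600 * real K \<le> q * real n" "0 \<le> q"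
  shows "real_of_int \<lfloor>q * (real n + 1) ^ 3\<rfloor> \<le> q * SS" "9 / 10 * q * SS \<le> real_of_int \<lfloor>q * (real n + 1) ^ 3\<rfloor>"
    "X\<^sup>2 \<le> \<lfloor>q * (real n + 1) ^ 3\<rfloor>"
proof -
  have "19200 \<le> 1600 * real K" using K_ge by simp
  also have "\<dots> \<le> q * (real n + 1)" using assms by (simp add: algebra_simps)
  finally have 1: "19200 \<le> q * (real n + 1)" .
  have s: "q * SS = q * (real n + 1) * (real n + 1)\<^sup>2" by (simp add: rX power3_eq_cube power2_eq_square)
  have "19200 * (real n + 1)\<^sup>2 \<le> q * SS" unfolding s using 1 by (intro mult_right_mono) auto
  moreover have "1 \<le> (real n + 1)\<^sup>2" by simp
  ultimately have b: "19200 * (real n + 1)\<^sup>2 \<le> q * SS" "19200 \<le> q * SS" by linarith+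
  show "real_of_int \<lfloor>q * (real n + 1) ^ 3\<rfloor> \<le> q * SS" by (simp add: rX)
  have f: "q * SS - 1 \<le> real_of_int \<lfloor>q * (real n + 1) ^ 3\<rfloor>" unfolding rX(2) by linarith
  then show f2: "9 / 10 * q * SS \<le> real_of_int \<lfloor>q * (real n + 1) ^ 3\<rfloor>" using b by simp
  have "(real n + 1)\<^sup>2 \<le> real_of_int \<lfloor>q * (real n + 1) ^ 3\<rfloor>" using f2 b by simp
  then have "real_of_int (X\<^sup>2) \<le> real_of_int \<lfloor>q * (real n + 1) ^ 3\<rfloor>" by (simp add: rX)
  then show "X\<^sup>2 \<le> \<lfloor>q * (real n + 1) ^ 3\<rfloor>" by (simp only: of_int_le_iff)
qed

lemma ph_facts: "real_of_int ph \<le> p * SS" "9 / 10 * p * SS \<le> real_of_int ph" "X\<^sup>2 \<le> ph"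
  using fixed_point[OF key_p p_ge] by (simp_all add: ph_def)

lemma eh_facts: "real_of_int eh \<le> \<epsilon> * SS" "9 / 10 * \<epsilon> * SS \<le> real_of_int eh" "X\<^sup>2 \<le> eh"
  using fixed_point[OF key_\<epsilon>(1)] \<epsilon>_pos by (simp_all add: eh_def)

lemma eh_pos: "0 < eh" "0 < ph"
  using eh_facts(3) ph_facts(3) rX(3) zero_less_power[of X 2] by linarith+

text \<open>The rounding of \<epsilon> turns 640 into at most 6400/9, hence 720 in the upper bound.
  \<open>E \<le> X\<close> follows from
  \<open>1600 * K \<le> \<epsilon>\<^sup>2 * n\<close>.\<close>

lemma E_facts: "640 * real K \<le> \<epsilon> * E" "real_of_int E \<le> 720 * real K / \<epsilon> + 1" "1 \<le> E" "E \<le> X"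
proof -
  have r: "0 < real_of_int eh" "0 < real_of_int SS" using eh_pos rX by simp_all
  have "640 * real K / \<epsilon> = 640 * real K * SS / (\<epsilon> * SS)" using r by simp
  also have "\<dots> \<le> 640 * real K * SS / eh"
    by (rule divide_left_mono) (use eh_facts(1) r \<epsilon>_pos in auto)
  also have "\<dots> \<le> E" using div_bounds(2)[of "640 * int K * SS" eh] by (simp add: E_def)
  finally show "640 * real K \<le> \<epsilon> * E" using \<epsilon>_pos by (simp add: pos_divide_le_eq mult.commute)
  have "E \<le> 640 * real K * SS / eh + 1" using div_bounds(1)[of "640 * int K * SS" eh] by (simp add: E_def)
  also have "640 * real K * SS / eh \<le> 640 * real K * SS / (9 / 10 * \<epsilon> * SS)"
    by (rule divide_left_mono) (use eh_facts(2) r \<epsilon>_pos in auto)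
  also have "\<dots> = 6400 / 9 * (real K / \<epsilon>)" using r by simp
  also have "\<dots> \<le> 720 * (real K / \<epsilon>)" using \<epsilon>_pos by (intro mult_right_mono) auto
  finally show u: "real_of_int E \<le> 720 * real K / \<epsilon> + 1" by simp
  show "1 \<le> E" using eh_pos rX by (simp add: E_def pos_imp_zdiv_nonneg_iff)
  have "720 * real K \<le> 1600 * real K" by simp
  also have "\<dots> \<le> \<epsilon>\<^sup>2 * real n" by (rule key_\<epsilon>(2))
  also have "\<dots> \<le> \<epsilon> * real n"
    using \<epsilon>_pos \<epsilon>_le by (intro mult_right_mono) (auto simp: power2_eq_square mult_left_le)
  finally have "720 * real K / \<epsilon> \<le> real n" using \<epsilon>_pos by (simp add: pos_divide_le_eq mult.commute)
  then have "real_of_int E \<le> real_of_int X" using u rX by simp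
  then show "E \<le> X" by simp
qed

lemma X_le: "X \<le> 2 ^ K"
proof -
  have "int (n + 1) \<le> int (2 ^ K)" using K_props(1) by (simp only: of_nat_le_iff)
  then show ?thesis by (simp add: X_def)
qed

lemma ec_props: "SS \<le> 4 * ph * (cm * cm)" "\<And>e. e < ec \<Longrightarrow> 4 * ph * (2 ^ e * 2 ^ e) < SS" "ec \<le> K"
proof -
  let ?P = "\<lambda>e. SS \<le> 4 * ph * (2 ^ e * 2 ^ e)"
  have PK: "?P K"
  proof -
    have "X * X \<le> 2 ^ K * 2 ^ K" using X_le rX(3) by (intro mult_mono) auto
    then have "X\<^sup>2 * (X * X) \<le> (4 * ph) * (2 ^ K * 2 ^ K)"
      by (rule mult_mono[rotated]) (use ph_facts(3) eh_pos rX(3) in auto)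
    moreover have "SS * 1 \<le> SS * X" using rX by (intro mult_left_mono) auto
    moreover have "SS * X = X\<^sup>2 * (X * X)" by (simp add: SS_def power2_eq_square power3_eq_cube)
    ultimately show ?thesis by linarith
  qed
  show "SS \<le> 4 * ph * (cm * cm)" unfolding cm_def ec_def by (rule LeastI[of ?P, OF PK])
  show "4 * ph * (2 ^ e * 2 ^ e) < SS" if "e < ec" for e
    using not_less_Least[of e ?P] that unfolding ec_def by simp
  show "ec \<le> K" unfolding ec_def by (rule Least_le[of ?P, OF PK])
qed

lemma cm_pos: "1 \<le> cm" by (simp add: cm_def)

lemma cm_le: "cm \<le> 2 ^ K" unfolding cm_def using ec_props(3) by (intro power_increasing) auto

lemma cm_sq: "1 < cm \<Longrightarrow> ph * (cm * cm) < SS"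
proof -
  assume "1 < cm"
  then obtain e where e: "ec = Suc e" by (cases ec) (auto simp: cm_def)
  then show ?thesis using ec_props(2)[of e] by (simp add: cm_def algebra_simps)
qed

lemma y0_facts: "4 * E \<le> y0" "y0 \<le> 16 * E" "y0 = 16 * E \<Longrightarrow> cm = 1"
proof -
  have "4 * E * SS \<le> 4 * E * (4 * ph * (cm * cm))" using ec_props(1) E_facts(3) by (intro mult_left_mono) auto
  then have "4 * E * SS div SS \<le> y0" unfolding y0_def using rX(4) by (intro zdiv_mono1) (auto simp: mult_ac)
  then show "4 * E \<le> y0" using rX(4) by simp
  have "y0 \<le> 16 * E \<and> (y0 = 16 * E \<longrightarrow> cm = 1)"
  proof (cases "1 < cm")
    case True
    have "16 * E * ph * (cm * cm) < 16 * E * SS"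
      using mult_strict_left_mono[OF cm_sq[OF True], of "16 * E"] E_facts(3) by (simp add: mult_ac)
    moreover have "y0 * SS \<le> 16 * E * ph * (cm * cm)"
      using div_mult_mod_eq[of "16 * E * ph * (cm * cm)" SS] pos_mod_sign[OF rX(4)] unfolding y0_def by smt
    ultimately have "y0 * SS < 16 * E * SS" by linarith
    then have "y0 < 16 * E" using rX(4) by simp
    then show ?thesis by simp
  next
    case False
    then have c: "cm = 1" using cm_pos by simp
    have "real_of_int ph \<le> 1 * SS" using ph_facts(1) p_le rX by (intro order_trans[OF ph_facts(1)] mult_right_mono) auto
    then have "ph \<le> SS" by simp
    then have "16 * E * ph * (cm * cm) \<le> 16 * E * SS" using c E_facts(3) by simp
    then have "y0 \<le> 16 * E * SS div SS" unfolding y0_def using rX(4) by (intro zdiv_mono1) auto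
    then show ?thesis using c rX(4) by simp
  qed
  then show "y0 \<le> 16 * E" "y0 = 16 * E \<Longrightarrow> cm = 1" by auto
qed

definition Uu :: int where "Uu = 16 * E * cm\<^sup>2"

lemma Uu_pos: "16 \<le> Uu"
proof -
  have "1 * 1 \<le> E * cm\<^sup>2" using E_facts(3) cm_pos by (intro mult_mono) auto
  then show ?thesis by (simp add: Uu_def)
qed

text \<open>Rounding \<open>p\<close> costs at most \<open>Uu / SS \<le> 1\<close> and the division
  at most 1. Relative to \<open>p * Uu\<close> the loss 2 is at most \<epsilon>/8, because
  \<open>\<epsilon> * p * Uu\<close> is at least \<open>\<epsilon> * E\<close> and hence at least
  16.\<close>

lemma y0_Uu: "real_of_int y0 \<le> p * Uu" "(1 - \<epsilon> / 8) * (p * Uu) \<le> y0" "p * Uu / 2 \<le> y0"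
proof -
  have r: "0 < real_of_int SS" using rX by simp
  have y: "real_of_int y0 \<le> real_of_int ph * Uu / SS" "real_of_int ph * Uu / SS - 1 < real_of_int y0"
    using div_bounds[of "16 * E * ph * (cm * cm)" SS] by (simp_all add: y0_def Uu_def power2_eq_square mult_ac)
  have "real_of_int ph * Uu / SS \<le> p * SS * Uu / SS"
    using ph_facts(1) Uu_pos r by (intro divide_right_mono mult_right_mono) auto
  then show up: "real_of_int y0 \<le> p * Uu" using y(1) r by simp
  have "Uu \<le> SS"
  proof -
    have "cm * cm \<le> X"
    proof (cases "1 < cm")
      case True
      have "X\<^sup>2 * (cm * cm) \<le> ph * (cm * cm)" using ph_facts(3) by (intro mult_right_mono) auto
      also have "\<dots> < SS" by (rule cm_sq[OF True])
      also have "SS = X\<^sup>2 * X" by (simp add: SS_def power2_eq_square power3_eq_cube)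
      finally show ?thesis using rX(3) by simp
    next
      case False
      then have "cm = 1" using cm_pos by simp
      then show ?thesis using rX by simp
    qed
    then have "16 * E * cm\<^sup>2 \<le> X * X * X"
      unfolding power2_eq_square using E_facts(3,4) rX(3) by (intro mult_mono) auto
    then show ?thesis by (simp add: Uu_def SS_def power3_eq_cube)
  qed
  then have U1: "real_of_int Uu / SS \<le> 1" using r by simp
  have "p * Uu - Uu / SS = (p * SS - 1) * Uu / SS" using r by (simp add: field_simps)
  also have "\<dots> \<le> real_of_int ph * Uu / SS"
  proof (intro divide_right_mono mult_right_mono)
    show "p * SS - 1 \<le> ph" unfolding ph_def rX(2) by linarith
  qed (use Uu_pos r in auto)
  finally have lo: "p * Uu - 2 \<le> y0" using y(2) U1 by simp
  have "16 \<le> \<epsilon> * (p * Uu)"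
  proof -
    have "640 * real K \<le> \<epsilon> * E" by (rule E_facts(1))
    also have "\<dots> \<le> \<epsilon> * (p * Uu)"
    proof (rule mult_left_mono)
      have "real_of_int (4 * E) \<le> real_of_int y0" using y0_facts(1) by (simp only: of_int_le_iff)
      then show "E \<le> p * Uu" using up E_facts(3) by simp
    qed (use \<epsilon>_pos in simp)
    finally show ?thesis using K_ge by simp
  qed
  then show a: "(1 - \<epsilon> / 8) * (p * Uu) \<le> y0" using lo by (simp add: algebra_simps)
  have "1 / 2 * (p * Uu) \<le> (1 - \<epsilon> / 8) * (p * Uu)"
    using \<epsilon>_le p_ge Uu_pos by (intro mult_right_mono) auto
  then show "p * Uu / 2 \<le> y0" using a by simp
qed

lemma D_eq: "i < 2 * m \<Longrightarrow> D i = S (Suc (i mod m))"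
proof -
  assume i: "i < 2 * m"
  have "yss ! i = xss ! (i mod m)"
  proof (cases "i < m")
    case False
    then have "i mod m = i - m" using i by (simp add: le_mod_geq)
    then show ?thesis using False by (simp add: yss_def nth_append len_xss)
  qed (simp add: yss_def nth_append len_xss)
  then show ?thesis using xss_facts(2)[of "i mod m"] m_ge by (simp add: D_def)
qed

lemma D_len: "i < 2 * m \<Longrightarrow> length (xss ! (i mod m)) = card (D i)"
  using xss_facts(3)[of "i mod m"] D_eq m_ge by simp

lemma D_mem: "Suc (i mod m) \<in> {1..m}"
  using m_ge mod_less_divisor[of m i] by (simp add: Suc_le_eq)

lemma card_D: "i < 2 * m \<Longrightarrow> 1 \<le> card (D i)" "i < 2 * m \<Longrightarrow> card (D i) \<le> n"
  "i < 2 * m \<Longrightarrow> 1600 * real K \<le> p * \<epsilon>\<^sup>2 * real (card (D i))"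
proof -
  assume i: "i < 2 * m"
  show k: "1600 * real K \<le> p * \<epsilon>\<^sup>2 * real (card (D i))" using key[OF D_mem] D_eq[OF i] by simp
  have "card (D i) \<noteq> 0"
  proof
    assume "card (D i) = 0"
    then show False using k K_ge by simp
  qed
  then show "1 \<le> card (D i)" by simp
  show "card (D i) \<le> n" using card_le[OF D_mem] D_eq[OF i] by simp
qed

lemma SL_facts:
  assumes i: "i < 2 * m"
  shows "40 * real_of_int Uu \<le> \<epsilon> * real_of_int \<bar>SL i\<bar>"
    "10 * real K * real_of_int \<bar>SL i\<bar> \<le> \<epsilon> * real_of_int (int (card (D i)) * y0)"
    "29 * int (card (D i)) * y0 \<le> E * \<bar>SL i\<bar>" "\<bar>SL i\<bar> \<le> X ^ 3"
proof -
  define L where "L = eh * int (card (D i)) * y0 div (SS * 10 * int K)"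
  define A where "A = real (card (D i)) * real_of_int y0"
  have y0: "4 \<le> y0" using y0_facts(1) E_facts(3) by simp
  have K0: "0 < real K" using K_ge by simp
  have r: "0 < real_of_int SS" using rX by simp
  have "int i div int m = 0 \<or> int i div int m = 1"
  proof -
    have "i div m < 2" using i m_ge by (simp add: div_less_iff_less_mult mult.commute)
    then have "i div m = 0 \<or> i div m = 1" by linarith
    then show ?thesis by (metis of_nat_0 of_nat_1 zdiv_int)
  qed
  moreover have L0: "0 \<le> L" unfolding L_def using eh_pos y0 rX K_ge
    by (simp add: pos_imp_zdiv_nonneg_iff)
  ultimately have SL: "\<bar>SL i\<bar> = L" unfolding SL_def L_def D_len[OF i] by auto
  have A0: "0 < A" using card_D(1)[OF i] y0 by (simp add: A_def)
  have L: "real_of_int L \<le> eh * A / (SS * 10 * K)" "eh * A / (SS * 10 * K) - 1 < real_of_int L"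
    using div_bounds[of "eh * int (card (D i)) * y0" "SS * 10 * int K"] by (simp_all add: L_def A_def mult_ac)
  have "eh * A / (SS * 10 * K) \<le> \<epsilon> * SS * A / (SS * 10 * K)"
    using eh_facts(1) A0 r K0 by (intro divide_right_mono mult_right_mono) auto
  then have up: "real_of_int L \<le> \<epsilon> * A / (10 * K)" using L(1) r by simp
  have "9 / 10 * \<epsilon> * SS * A / (SS * 10 * K) \<le> eh * A / (SS * 10 * K)"
    using eh_facts(2) A0 r K0 by (intro divide_right_mono mult_right_mono) auto
  then have lo1: "9 / 10 * (\<epsilon> * A / (10 * K)) - 1 \<le> L" using L(2) r by simp
  have "E \<le> A"
  proof -
    have "real_of_int (1 * E) \<le> real_of_int (int (card (D i)) * y0)"
      unfolding of_int_le_iff using card_D(1)[OF i] y0_facts(1) E_facts(3) by (intro mult_mono) auto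
    then show ?thesis by (simp add: A_def)
  qed
  then have "\<epsilon> * E \<le> \<epsilon> * A" using \<epsilon>_pos by (intro mult_left_mono) auto
  then have "640 * real K \<le> \<epsilon> * A" using E_facts(1) by linarith
  then have "64 \<le> \<epsilon> * A / (10 * K)" using K0 by (simp add: field_simps)
  then have lo: "\<epsilon> * A / (20 * K) \<le> L" using lo1 by (simp add: field_simps)
  have "40 * real_of_int Uu \<le> \<epsilon> * (\<epsilon> * A / (20 * K))"
  proof -
    \<comment> \<open>The origin of 1600: \<open>A\<close> is at least half of
      \<open>card (D i) * p * Uu\<close>, and the modulus of \<open>SL i\<close> is at least half of
      its intended value.\<close>
    have "1600 * real K * Uu \<le> p * \<epsilon>\<^sup>2 * real (card (D i)) * Uu"
      using card_D(3)[OF i] Uu_pos by (intro mult_right_mono) auto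
    also have "\<dots> = \<epsilon>\<^sup>2 * (real (card (D i)) * (2 * (p * Uu / 2)))" by simp
    also have "\<dots> \<le> \<epsilon>\<^sup>2 * (real (card (D i)) * (2 * y0))"
      using y0_Uu(3) by (intro mult_left_mono) auto
    finally have "1600 * real K * Uu \<le> 2 * (\<epsilon> * (\<epsilon> * A))" by (simp add: A_def power2_eq_square mult_ac)
    then show ?thesis using K0 by (simp add: field_simps)
  qed
  also have "\<dots> \<le> \<epsilon> * L" using lo \<epsilon>_pos by (intro mult_left_mono) auto
  finally show "40 * real_of_int Uu \<le> \<epsilon> * real_of_int \<bar>SL i\<bar>" by (simp add: SL)
  have "10 * real K * L \<le> \<epsilon> * A" using up K0 by (simp add: field_simps)
  then show "10 * real K * real_of_int \<bar>SL i\<bar> \<le> \<epsilon> * real_of_int (int (card (D i)) * y0)" by (simp add: SL A_def)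
  \<comment> \<open>The origin of 640 in \<open>E\<close>: it yields 32, more than the 29 required
    by \<open>SL_step\<close>.\<close>
  have "32 * A = 640 * real K * (A / (20 * K))" using K0 by simp
  also have "\<dots> \<le> \<epsilon> * E * (A / (20 * K))" using E_facts(1) A0 by (intro mult_right_mono) auto
  also have "\<dots> = E * (\<epsilon> * A / (20 * K))" by simp
  also have "\<dots> \<le> E * real_of_int L" using lo E_facts(3) by (intro mult_left_mono) auto
  finally have "29 * A \<le> E * real_of_int L" using A0 by simp
  then have "real_of_int (29 * int (card (D i)) * y0) \<le> real_of_int (E * L)" by (simp add: A_def mult_ac)
  then show "29 * int (card (D i)) * y0 \<le> E * \<bar>SL i\<bar>" unfolding SL by (simp only: of_int_le_iff)
  have "real_of_int L \<le> \<epsilon> * A / (10 * K)" by (rule up)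
  also have "\<dots> \<le> 1 * A / 1" using \<epsilon>_pos \<epsilon>_le A0 K_ge by (intro frac_le mult_right_mono) auto
  also have "\<dots> = real_of_int (int (card (D i)) * y0)" by (simp add: A_def)
  finally have "L \<le> int (card (D i)) * y0" by (simp only: of_int_le_iff)
  also have "\<dots> \<le> X * (16 * X)"
    using card_D(2)[OF i] y0_facts(2) E_facts(4) y0 X_def by (intro mult_mono) auto
  also have "\<dots> \<le> X * (X * X)" using rX(3) by (intro mult_left_mono mult_right_mono) auto
  finally show "\<bar>SL i\<bar> \<le> X ^ 3" by (simp add: SL power3_eq_cube)
qed

end

section \<open>Preparing the input\<close>

abbreviation base_e :: aexp where "base_e \<equiv> Op Mod (Var ''i'') (Var ''m'')"
abbreviation len_e :: aexp where "len_e \<equiv> Read ''start'' (base_e \<oplus> Const 1) \<ominus> Read ''start'' base_e"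
abbreviation dest_e :: aexp where
  "dest_e \<equiv> (Var ''i'' \<oslash> Var ''m'') \<otimes> Var ''N'' \<oplus> Read ''start'' base_e \<oplus> Var ''j''"

text \<open>Index \<open>i\<close> stands for the set \<open>i mod m\<close> in copy
  \<open>i div m\<close>. The weights start from \<open>P ^ 20\<close>, formed as the fourth power
  of \<open>P ^ 5\<close>.\<close>

definition arrays_com :: com where
  "arrays_com =
     ParFor ''i'' (Var ''M2'') (ParFor ''j'' len_e (Store ''el'' dest_e (Read ''elem'' (Read ''start'' base_e \<oplus> Var ''j'')))) ;;
     ParFor ''i'' (Var ''M2'') (ParFor ''j'' len_e (Store ''ow'' dest_e (Var ''i''))) ;;
     ParFor ''i'' (Var ''M2'') (Store ''SL'' (Var ''i'')
       ((Const 1 \<ominus> Const 2 \<otimes> (Var ''i'' \<oslash> Var ''m'')) \<otimes>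
        (Var ''eps'' \<otimes> len_e \<otimes> Var ''y0'' \<oslash> (Var ''S'' \<otimes> Const 10 \<otimes> Var ''K'')))) ;;
     ParFor ''i'' (Var ''M2'') (Store ''KA'' (Var ''i'')
       (let p = Var ''P''; p5 = p \<otimes> p \<otimes> p \<otimes> p \<otimes> p; sl = Read ''SL'' (Var ''i'') in
        p5 \<otimes> p5 \<otimes> p5 \<otimes> p5 \<oslash> (sl \<otimes> sl \<otimes> sl \<otimes> sl) \<oplus> Const 1)) ;;
     ParFor ''j'' (Var ''n'') (Store ''Y'' (Var ''j'' \<oplus> Const 1) (Var ''y0'')) ;;
     ParFor ''j'' (Var ''n'') (Store ''C'' (Var ''j'' \<oplus> Const 1) (Const 1)) ;;
     core_com"

definition main_com :: com where
  "main_com =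
     Assign ''N'' (Read ''start'' (Var ''m'')) ;;
     Assign ''N2'' (Var ''N'' \<oplus> Var ''N'') ;;
     Assign ''M2'' (Var ''m'' \<oplus> Var ''m'') ;;
     Assign ''P'' (Const 1) ;;
     Assign ''K'' (Const 0) ;;
     While (Op Less (Var ''P'') (Var ''N2'' \<oplus> Var ''n'' \<oplus> Const 1))
       (Assign ''P'' (Var ''P'' \<oplus> Var ''P'') ;; Assign ''K'' (Var ''K'' \<oplus> Const 1)) ;;
     Assign ''S'' ((Var ''n'' \<oplus> Const 1) \<otimes> (Var ''n'' \<oplus> Const 1) \<otimes> (Var ''n'' \<oplus> Const 1)) ;;
     Assign ''E'' (Const 640 \<otimes> Var ''K'' \<otimes> Var ''S'' \<oslash> Var ''eps'' \<oplus> Const 1) ;;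
     Assign ''cm'' (Const 1) ;;
     While (Op Less (Const 4 \<otimes> Var ''p'' \<otimes> (Var ''cm'' \<otimes> Var ''cm'')) (Var ''S''))
       (Assign ''cm'' (Var ''cm'' \<oplus> Var ''cm'')) ;;
     Assign ''y0'' (Const 16 \<otimes> Var ''E'' \<otimes> Var ''p'' \<otimes> (Var ''cm'' \<otimes> Var ''cm'') \<oslash> Var ''S'') ;;
     Assign ''G'' (Const 384 \<otimes> Var ''E'' \<otimes> Var ''E'') ;;
     Assign ''Tn'' (Const 50 \<otimes> Var ''G'' \<otimes> Var ''K'') ;;
     arrays_com"

text \<open>Without any set nothing forces \<open>n\<close> to be large or \<open>p\<close> to be
  positive, and nothing has to be sampled, so the preparation is skipped.\<close>

definition sampling_com :: com where
  "sampling_com = If (Var ''m'') main_com Skip"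

section \<open>Word size and correctness of the preparation\<close>

context sampling_input
begin

definition word :: int where "word = (int n + 1) ^ (140 * (a0 + 2))"

lemma m_le_N: "m \<le> N"
proof -
  have "(\<Sum>i=1..m. 1) \<le> (\<Sum>i=1..m. card (S i))"
  proof (rule sum_mono)
    fix i assume i: "i \<in> {1..m}"
    then have "Suc ((i - 1) mod m) = i" by auto
    then show "1 \<le> card (S i)" using card_D(1)[of "i - 1"] D_eq[of "i - 1"] i by auto
  qed
  then show ?thesis by (simp add: N_eq)
qed

lemma word_ge: "int (2 ^ K) ^ bx \<le> word"
proof -
  have "real_of_int (2 ^ K) \<le> real_of_int ((int n + 1) ^ (a0 + 2))" using P_le by simp
  then have "(2 :: int) ^ K \<le> (int n + 1) ^ (a0 + 2)" by (simp only: of_int_le_iff)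
  then have "((2 :: int) ^ K) ^ 140 \<le> ((int n + 1) ^ (a0 + 2)) ^ 140" by (intro power_mono) auto
  also have "\<dots> = word" by (simp only: word_def power_mult[symmetric] mult.commute)
  finally show ?thesis by (simp add: bx_def)
qed

lemma length_concat_yss: "length (concat yss) = 2 * N"
  by (simp add: yss_def N_def)

lemma length_yss: "length yss = 2 * m"
  by (simp add: yss_def len_xss)

lemma yss_nth: "i < 2 * m \<Longrightarrow> yss ! i = xss ! (i mod m)"
proof -
  assume i: "i < 2 * m"
  show ?thesis
  proof (cases "i < m")
    case False
    then have "i mod m = i - m" using i by (simp add: le_mod_geq)
    then show ?thesis using False by (simp add: yss_def nth_append len_xss)
  qed (simp add: yss_def nth_append len_xss)
qed

lemma offset_yss: "i < 2 * m \<Longrightarrow> offset yss i = i div m * N + offset xss (i mod m)"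
proof -
  assume i: "i < 2 * m"
  show ?thesis
  proof (cases "i < m")
    case True
    then show ?thesis by (simp add: offset_def yss_def len_xss)
  next
    case False
    then obtain t where t: "i = m + t" "t < m" using i by (metis add_less_cancel_left le_add_diff_inverse mult_2 not_less)
    then show ?thesis by (simp add: offset_def yss_def len_xss N_def)
  qed
qed

sublocale layout word n "2 * m" K E cm y0 SL D "2 * N" "owner yss" "\<lambda>q. concat yss ! q"
proof
  show "10 \<le> K" using K_ge by simp
  show "1 \<le> 2 * m" using m_ge by simp
  show "2 * m \<le> 2 ^ K" using m_le_N K_props(1) by simp
  show "n < 2 ^ K" using K_props(1) by simp
  show "1 \<le> E" by (rule E_facts)
  show "E \<le> 2 ^ K" using E_facts(4) X_le by simp
  show "\<exists>e. cm = 2 ^ e" by (auto simp: cm_def)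
  show "cm \<le> 2 ^ K" by (rule cm_le)
  show "4 * E \<le> y0" "y0 \<le> 16 * E" "y0 = 16 * E \<Longrightarrow> cm = 1" using y0_facts by auto
  show "1000 \<le> (2 :: nat) ^ K"
  proof -
    have "(2 :: nat) ^ 10 \<le> 2 ^ K" using K_ge by (intro power_increasing) auto
    then show ?thesis by simp
  qed
  show "int (2 ^ K) ^ bx \<le> word" by (rule word_ge)
  show "2 * N + n < 2 ^ K" using K_props(1) by simp
  have "distinct x" if "x \<in> set yss" for x
  proof -
    have "x \<in> set xss" using that by (simp add: yss_def)
    then obtain i where "i < m" "x = xss ! i" using len_xss by (metis in_set_conv_nth)
    then show ?thesis using xss_facts(1) by simp
  qed
  from bij_owner[of yss, OF this] show "bij_betw (\<lambda>q. (owner yss q, concat yss ! q)) {..<2 * N} (SIGMA i:{..<2 * m}. D i)"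
    unfolding length_concat_yss length_yss D_def .
next
  fix i assume i: "i < 2 * m"
  show "D i \<subseteq> {1..n}" using D_eq[OF i] S_sub[OF D_mem] by simp
  have "\<epsilon> * real_of_int \<bar>SL i\<bar> \<le> 1 * real_of_int \<bar>SL i\<bar>" using \<epsilon>_le by (intro mult_right_mono) auto
  then have "real_of_int (40 * Uu) \<le> real_of_int \<bar>SL i\<bar>" using SL_facts(1)[OF i] by simp
  then have "40 * Uu \<le> \<bar>SL i\<bar>" by (simp only: of_int_le_iff)
  then show "640 * E * cm\<^sup>2 \<le> \<bar>SL i\<bar>" by (simp add: Uu_def)
  show "29 * int (card (D i)) * y0 \<le> E * \<bar>SL i\<bar>" by (rule SL_facts(3)[OF i])
  have "0 \<le> real_of_int (int (card (D i)) * y0)" using y0_facts(1) E_facts(3) by simp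
  then have "\<epsilon> * real_of_int (int (card (D i)) * y0) \<le> 1 * real_of_int (int (card (D i)) * y0)"
    using \<epsilon>_le by (intro mult_right_mono) auto
  then have "real_of_int (10 * int K * \<bar>SL i\<bar>) \<le> real_of_int (int (card (D i)) * y0)"
    using SL_facts(2)[OF i] by simp
  then show "10 * int K * \<bar>SL i\<bar> \<le> int (card (D i)) * y0" by (simp only: of_int_le_iff)
  have "X ^ 3 \<le> (2 ^ K) ^ 3" using X_le rX(3) by (intro power_mono) auto
  then show "\<bar>SL i\<bar> \<le> 2 ^ (3 * K)" using SL_facts(4)[OF i] by (simp add: power_mult[symmetric] mult.commute)
  \<comment> \<open>The partner is the same set in the other copy, at distance
    \<open>m\<close>.\<close>
  show "\<exists>i'<2 * m. D i' = D i \<and> SL i' = - SL i"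
  proof (cases "i < m")
    case True
    then have "(i + m) mod m = i" "int (i + m) div int m = 1" "int i div int m = 0" using m_ge by auto
    then show ?thesis using True D_eq[of i] D_eq[of "i + m"] by (intro exI[of _ "i + m"]) (simp add: SL_def)
  next
    case False
    then obtain t where t: "i = t + m" "t < m" using i by (metis add.commute add_less_cancel_left le_add_diff_inverse mult_2 not_less)
    then have "(t + m) mod m = t" "int (t + m) div int m = 1" "int t div int m = 0" using m_ge by auto
    then show ?thesis using t D_eq[of t] D_eq[of "t + m"] by (intro exI[of _ t]) (simp add: SL_def)
  qed
qed

lemma G_eq: "G = 384 * E * E" and steps_eq: "int steps = 50 * G * int K"
  using G_ge by (simp_all add: G_def steps_def)

definition M0 :: memory where "M0 = input_memory xss"

lemma M0_start: "b \<le> m \<Longrightarrow> M0 (''start'', int b) = int (offset xss b)"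
  by (simp add: M0_def input_memory_def offset_def len_xss)

lemma M0_elem: "r < N \<Longrightarrow> M0 (''elem'', int r) = int (concat xss ! r)"
  by (simp add: M0_def input_memory_def N_def)

lemma M0_zero: "a \<notin> {''start'', ''elem''} \<Longrightarrow> M0 (a, z) = 0"
  by (simp add: M0_def input_memory_def)

lemma offset_le: "offset xss b \<le> N"
  unfolding offset_def N_def by (metis append_take_drop_id concat_append le_add1 length_append)

definition scalars :: "locals \<Rightarrow> bool" where
  "scalars l \<longleftrightarrow> l ''n'' = int n \<and> l ''m'' = int m \<and> l ''p'' = ph \<and> l ''eps'' = eh \<and> l ''N'' = int N \<and>
     l ''N2'' = int (2 * N) \<and> l ''M2'' = int (2 * m) \<and> l ''P'' = 2 ^ K \<and> l ''K'' = int K \<and> l ''S'' = SS \<and> l ''E'' = E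
     \<and> l ''cm'' = cm \<and> l ''y0'' = y0 \<and> l ''G'' = G \<and> l ''Tn'' = int steps"

lemma scalarsD:
  assumes "scalars l"
  shows "l ''n'' = int n" "l ''m'' = int m" "l ''p'' = ph" "l ''eps'' = eh" "l ''N'' = int N"
     "l ''N2'' = int (2 * N)" "l ''M2'' = int (2 * m)" "l ''P'' = 2 ^ K" "l ''K'' = int K" "l ''S'' = SS" "l ''E'' = E"
     "l ''cm'' = cm" "l ''y0'' = y0" "l ''G'' = G" "l ''Tn'' = int steps"
  using assms by (simp_all add: scalars_def)

lemma aval_base:
  assumes "scalars l" "M (''start'', int (i mod m)) = int (offset xss (i mod m))"
    "M (''start'', int (Suc (i mod m))) = int (offset xss (Suc (i mod m)))" "i < 2 * m"
  shows "M (''start'', int i mod int m + 1) - M (''start'', int i mod int m) = int (length (yss ! i))"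
    "int i div int m * int N + M (''start'', int i mod int m) + z = int (offset yss i) + z"
proof -
  have e: "int i mod int m = int (i mod m)" "int (i mod m) + 1 = int (Suc (i mod m))" "int i div int m = int (i div m)"
    by (simp_all add: zmod_int zdiv_int)
  have "i mod m < length xss" using m_ge len_xss by simp
  from offset_Suc[OF this] have "offset xss (Suc (i mod m)) = offset xss (i mod m) + length (yss ! i)"
    using yss_nth[OF assms(4)] by simp
  then show "M (''start'', int i mod int m + 1) - M (''start'', int i mod int m) = int (length (yss ! i))"
    unfolding e(1) e(2) assms(2,3) by simp
  show "int i div int m * int N + M (''start'', int i mod int m) + z = int (offset yss i) + z"
    unfolding e(1) e(3) assms(2) offset_yss[OF assms(4)] by simp
qed

lemma sum_lengths: "(\<Sum>i<2 * m. length (yss ! i)) \<le> 2 ^ K"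
proof -
  have "(\<Sum>i<2 * m. length (yss ! i)) = length (concat yss)"
    by (simp add: length_concat sum_list_sum_nth atLeast0LessThan length_yss)
  then show ?thesis using length_concat_yss K_props(1) by simp
qed

text \<open>Destinations are the offsets in the doubled concatenation, which are pairwise distinct
  and exhaust the first \<open>2 * N\<close> cells. Fills both the elements and their
  owners.\<close>

lemma run_scatter:
  assumes l: "scalars l" and M: "agree A M0 M" "''start'' \<notin> A" and a: "a \<in> {''el'', ''ow''}"
    and ve: "ok ve" "a \<notin> arrs ve" "vb ve \<le> 3" "cost ve \<le> 20"
    and val: "\<And>i t. i < 2 * m \<Longrightarrow> t < length (yss ! i) \<Longrightarrow> aval ve (l(''i'' := int i, ''j'' := int t)) M = val (offset yss i + t)"
    and Q: "\<And>f. (\<And>q. q < 2 * N \<Longrightarrow> f (int q) = val q) \<Longrightarrow> Q l (setarr M a f)"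
  shows "runs (ParFor ''i'' (Var ''M2'') (ParFor ''j'' len_e (Store a dest_e ve))) l M 60 Q"
proof -
  let ?f = "\<lambda>z. if 0 \<le> z \<and> z < int (2 * N) then val (nat z) else M (a, z)"
  have st: "M (''start'', int b) = int (offset xss b)" if "b \<le> m" for b
    using M that M0_start by (simp add: agree_def)
  have mm: "i mod m < m" for i using m_ge by simp
  have st': "M (''start'', int (i mod m)) = int (offset xss (i mod m))"
    "M (''start'', int (Suc (i mod m))) = int (offset xss (Suc (i mod m)))" for i
    using mm[of i] by (auto intro!: st simp del: of_nat_Suc)
  have an: "a \<noteq> ''start''" using a by auto
  show ?thesis
  proof (rule runs_map2[where k = "2 * m" and h = "\<lambda>i. length (yss ! i)" and idx = "\<lambda>i t. int (offset yss i + t)"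
        and val = "\<lambda>i t. val (offset yss i + t)" and f = ?f])
    fix i assume i: "i < 2 * m"
    show "aval len_e (l(''i'' := int i)) M = int (length (yss ! i))"
      using aval_base(1)[OF l st' i] scalarsD[OF l] by simp
    fix t assume t: "t < length (yss ! i)"
    show "aval dest_e (l(''i'' := int i, ''j'' := int t)) M = int (offset yss i + t)"
      using aval_base(2)[OF l st' i, of "int t"] scalarsD[OF l] by simp
    show "?f (int (offset yss i + t)) = val (offset yss i + t)"
      using offset_less[of i yss t] i t by (simp add: length_yss length_concat_yss del: of_nat_add)
  next
    fix i j i' j' assume "i < 2 * m" "j < length (yss ! i)" "i' < 2 * m" "j' < length (yss ! i')"
      "int (offset yss i + j) = int (offset yss i' + j')"
    then show "i = i' \<and> j = j'" using offset_unique[of i yss j i' j'] by (simp add: length_yss del: of_nat_add)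
  next
    fix z assume z: "\<And>i j. i < 2 * m \<Longrightarrow> j < length (yss ! i) \<Longrightarrow> z \<noteq> int (offset yss i + j)"
    have "\<not> (0 \<le> z \<and> z < int (2 * N))"
    proof
      assume r: "0 \<le> z \<and> z < int (2 * N)"
      then have "nat z < length (concat yss)" by (simp add: length_concat_yss nat_less_iff)
      from offset_ex[OF this] obtain i t where "i < 2 * m" "t < length (yss ! i)" "nat z = offset yss i + t"
        by (auto simp: length_yss)
      then show False using z[of i t] r by auto
    qed
    then show "?f z = M (a, z)" by (rule if_not_P)
  next
    show "Q l (setarr M a ?f)" by (rule Q) simp
    show "vb ve \<le> ax a" using ve(3) a by (auto simp: ax_def)
    show "2 * m \<le> 2 ^ K" using m_le_N K_props(1) by simp
    show "(\<Sum>i<2 * m. length (yss ! i)) \<le> 2 ^ K" by (rule sum_lengths)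
  qed (use scalarsD[OF l] ve val an in \<open>auto simp: bounds_simps\<close>)
qed

lemma agree_step: "agree A M0 M \<Longrightarrow> agree (insert a A) M0 (setarr M a f)"
  by (auto simp: agree_def)

lemma agreeD: "agree A M0 M \<Longrightarrow> a \<notin> A \<Longrightarrow> M (a, z) = M0 (a, z)"
  by (simp add: agree_def)

lemma run_arrays:
  assumes l: "scalars l"
  shows "runs arrays_com l M0 (700 + (K + 1) * 220 + (steps + 1) * (704 + (K + 1) * (904 + (K + 1) * 60)))
    (\<lambda>l' M'. \<exists>\<kappa> y c. good steps \<kappa> y c \<and> (\<forall>j\<in>{1..n}. M' (''T'', int j) = of_bool (y j = 16 * E)))"
    (is "runs _ _ _ _ ?Q")
proof -
  let ?c = "200 + (K + 1) * 220 + (steps + 1) * (704 + (K + 1) * (904 + (K + 1) * 60))"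
  let ?el = "\<lambda>M. \<forall>q<2 * N. M (''el'', int q) = int (concat yss ! q)"
  let ?ow = "\<lambda>M. \<forall>q<2 * N. M (''ow'', int q) = int (owner yss q)"
  let ?sl = "\<lambda>M. \<forall>i<2 * m. M (''SL'', int i) = SL i"
  let ?ka = "\<lambda>M. \<forall>i<2 * m. M (''KA'', int i) = F0 div SL i ^ 4 + 1"
  let ?y = "\<lambda>M. \<forall>j\<in>{1..n}. M (''Y'', int j) = y0"
  have mK: "2 * m \<le> 2 ^ K" "n \<le> 2 ^ K" using m_le_N K_props(1) by simp_all
  show ?thesis unfolding arrays_com_def
  proof (rule runs_Seq[where ?a1.0 = 60 and ?a2.0 = "400 + ?c" and ?Q1.0 = "\<lambda>l' M. l' = l \<and> agree {''el''} M0 M \<and> ?el M"], goal_cases first second)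
    case first
    show ?case
    proof (rule run_scatter[where A = "{}" and val = "\<lambda>q. int (concat yss ! q)"])
      fix i t assume it: "i < 2 * m" "t < length (yss ! i)"
      have mm: "i mod m < m" using m_ge by simp
      have tt: "t < length (xss ! (i mod m))" using it yss_nth by simp
      have "offset xss (i mod m) + t < N" using offset_less[of "i mod m" xss t] mm tt len_xss by (simp add: N_def)
      then have "M0 (''elem'', int (offset xss (i mod m) + t)) = int (concat xss ! (offset xss (i mod m) + t))"
        by (rule M0_elem)
      also have "\<dots> = int (xss ! (i mod m) ! t)"
        using nth_concat_offset[of "i mod m" xss t] mm tt len_xss by simp
      also have "\<dots> = int (concat yss ! (offset yss i + t))"
        using nth_concat_offset[of i yss t] it yss_nth by (simp add: length_yss)
      finally show "aval (Read ''elem'' (Read ''start'' base_e \<oplus> Var ''j'')) (l(''i'' := int i, ''j'' := int t)) M0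
        = int (concat yss ! (offset yss i + t))"
        using scalarsD[OF l] M0_start[of "i mod m"] mm by (simp add: zmod_int)
    qed (use l agree_refl agree_step[OF agree_refl] in \<open>auto simp: bounds_simps\<close>)
  next
    case (second l1 M1)
    note 1 = second(2)
    show ?case
    proof (rule runs_Seq[where ?a1.0 = 60 and ?a2.0 = "300 + ?c" and
        ?Q1.0 = "\<lambda>l' M. l' = l \<and> agree {''ow'', ''el''} M0 M \<and> ?el M \<and> ?ow M"], goal_cases first second)
      have oo: "owner yss (offset yss i + t) = i" if "i < 2 * m" "t < length (yss ! i)" for i t
        by (rule owner_offset) (use that length_yss in simp_all)
      case first
      show ?case
        using 1 by (simp only:) (rule run_scatter[where A = "{''el''}" and val = "\<lambda>q. int (owner yss q)"],
          use l 1 agree_step[of "{''el''}" M1 "''ow''"] oo in \<open>auto simp: bounds_simps\<close>)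
    next
      case (second l2 M2)
      note 2 = second(2)
      show ?case
      proof (rule runs_Seq[where ?a1.0 = 60 and ?a2.0 = "200 + ?c" and
          ?Q1.0 = "\<lambda>l' M. l' = l \<and> agree {''SL'', ''ow'', ''el''} M0 M \<and> ?el M \<and> ?ow M \<and> ?sl M"], goal_cases first second)
        let ?ve = "(Const 1 \<ominus> Const 2 \<otimes> (Var ''i'' \<oslash> Var ''m'')) \<otimes>
          (Var ''eps'' \<otimes> len_e \<otimes> Var ''y0'' \<oslash> (Var ''S'' \<otimes> Const 10 \<otimes> Var ''K''))"
        have sb: "\<bar>SL i\<bar> \<le> int (2 ^ K) ^ 4" if "i < 2 * m" for i by (rule leP[of _ 3]) (use SL_le[OF that] in auto)
        have st: "M2 (''start'', int b) = int (offset xss b)" if "b \<le> m" for b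
          using agreeD[of "{''ow'', ''el''}" M2 "''start''"] 2 that M0_start by simp
        have mm: "i mod m < m" for i using m_ge by simp
        have st': "M2 (''start'', int (i mod m)) = int (offset xss (i mod m))"
          "M2 (''start'', int (Suc (i mod m))) = int (offset xss (Suc (i mod m)))" for i
          using mm[of i] by (auto intro!: st simp del: of_nat_Suc)
        have l2: "l2 = l" using 2 by simp
        case first
        show ?case
          unfolding l2
        proof (rule runs_map'[where k = "2 * m" and idx = int and val = SL])
          fix i assume i: "i < 2 * m"
          show "aval ?ve (l(''i'' := int i)) M2 = SL i"
            using aval_base(1)[OF l st' i] scalarsD[OF l] yss_nth[OF i] by (simp add: SL_def)
        next
          fix f assume "mapped (2 * m) int SL (\<lambda>z. M2 (''SL'', z)) f"
          then show "l = l \<and> agree {''SL'', ''ow'', ''el''} M0 (setarr M2 ''SL'' f) \<and> ?el (setarr M2 ''SL'' f) \<and> ?ow (setarr M2 ''SL'' f) \<and> ?sl (setarr M2 ''SL'' f)"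
            using 2 by (auto intro: agree_step simp: mapped_def)
        qed (use scalarsD[OF l] mK sb in \<open>auto simp: bounds_simps inj_on_def\<close>)
      next
        case (second l3 M3)
        note 3 = second(2)
        show ?case
        proof (rule runs_Seq[where ?a1.0 = 120 and ?a2.0 = "80 + ?c" and
            ?Q1.0 = "\<lambda>l' M. l' = l \<and> agree {''KA'', ''SL'', ''ow'', ''el''} M0 M \<and> ?el M \<and> ?ow M \<and> ?sl M \<and> ?ka M"], goal_cases first second)
          let ?p5 = "Var ''P'' \<otimes> Var ''P'' \<otimes> Var ''P'' \<otimes> Var ''P'' \<otimes> Var ''P''"
          let ?sl4 = "Read ''SL'' (Var ''i'') \<otimes> Read ''SL'' (Var ''i'') \<otimes> Read ''SL'' (Var ''i'') \<otimes> Read ''SL'' (Var ''i'')"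
          have l3: "l3 = l" using 3 by simp
          have p20: "(2 ^ K * 2 ^ K * 2 ^ K * 2 ^ K * 2 ^ K) * (2 ^ K * 2 ^ K * 2 ^ K * 2 ^ K * 2 ^ K)
             * (2 ^ K * 2 ^ K * 2 ^ K * 2 ^ K * 2 ^ K) * (2 ^ K * 2 ^ K * 2 ^ K * 2 ^ K * 2 ^ K) = F0"
          proof -
            have "(x * x * x * x * x) * (x * x * x * x * x) * (x * x * x * x * x) * (x * x * x * x * x) = x ^ 20" for x :: int
              by (simp add: numeral_eq_Suc mult_ac)
            from this[of "2 ^ K"] show ?thesis by (simp only: F0_def power_mult[symmetric] mult.commute)
          qed
          have kb: "\<bar>F0 div SL i ^ 4 + 1\<bar> \<le> int (2 ^ K) ^ 23" if "i < 2 * m" for i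
            by (rule leP[of _ 22]) (use \<kappa>_le'[OF good_init _ that] good_init that in \<open>auto simp: good_def\<close>)
          case first
          show ?case
            unfolding l3 Let_def
          proof (rule runs_map'[where k = "2 * m" and idx = int and val = "\<lambda>i. F0 div SL i ^ 4 + 1"])
            fix i assume i: "i < 2 * m"
            have "aval (?p5 \<otimes> ?p5 \<otimes> ?p5 \<otimes> ?p5 \<oslash> ?sl4 \<oplus> Const 1) (l(''i'' := int i)) M3
              = (2 ^ K * 2 ^ K * 2 ^ K * 2 ^ K * 2 ^ K) * (2 ^ K * 2 ^ K * 2 ^ K * 2 ^ K * 2 ^ K)
             * (2 ^ K * 2 ^ K * 2 ^ K * 2 ^ K * 2 ^ K) * (2 ^ K * 2 ^ K * 2 ^ K * 2 ^ K * 2 ^ K) div (SL i * SL i * SL i * SL i) + 1"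
              using 3 i scalarsD[OF l] by simp
            then show "aval (?p5 \<otimes> ?p5 \<otimes> ?p5 \<otimes> ?p5 \<oslash> ?sl4 \<oplus> Const 1) (l(''i'' := int i)) M3 = F0 div SL i ^ 4 + 1"
              unfolding p20 by (simp add: power4_eq_xxxx mult.assoc)
          next
            fix f assume "mapped (2 * m) int (\<lambda>i. F0 div SL i ^ 4 + 1) (\<lambda>z. M3 (''KA'', z)) f"
            then show "l = l \<and> agree {''KA'', ''SL'', ''ow'', ''el''} M0 (setarr M3 ''KA'' f) \<and> ?el (setarr M3 ''KA'' f) \<and> ?ow (setarr M3 ''KA'' f)
              \<and> ?sl (setarr M3 ''KA'' f) \<and> ?ka (setarr M3 ''KA'' f)"
              using 3 by (auto intro: agree_step simp: mapped_def)
          next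
            show "vb (?p5 \<otimes> ?p5 \<otimes> ?p5 \<otimes> ?p5 \<oslash> ?sl4 \<oplus> Const 1) \<le> ax ''KA'' \<or>
              (\<forall>i<2 * m. \<bar>F0 div SL i ^ 4 + 1\<bar> \<le> int (2 ^ K) ^ ax ''KA'')"
              using kb unfolding ax_def by simp
          qed (use scalarsD[OF l] mK in \<open>auto simp: bounds_simps inj_on_def\<close>)
        next
          case (second l4 M4)
          note 4 = second(2)
          have l4: "l4 = l" using 4 by simp
          have yb: "\<bar>y0\<bar> \<le> int (2 ^ K) ^ 3"
          proof (rule leP[of _ 2])
            have "16 * E \<le> 2 ^ K * 2 ^ K" using pow_K E_le E_ge by (intro mult_mono) auto
            then show "\<bar>y0\<bar> \<le> 2 ^ (2 * K)" using y0_facts E_ge by (simp add: mult_2 power_add)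
          qed simp
          show ?case
          proof (rule runs_Seq[where ?a1.0 = 40 and ?a2.0 = "40 + ?c" and
              ?Q1.0 = "\<lambda>l' M. l' = l \<and> agree {''Y'', ''KA'', ''SL'', ''ow'', ''el''} M0 M \<and> ?el M \<and> ?ow M \<and> ?sl M \<and> ?ka M \<and> ?y M"], goal_cases first second)
            case first
            show ?case
              unfolding l4
            proof (rule run_elems[where val = "\<lambda>_. y0"])
              fix f assume f: "\<And>j. j \<in> {1..n} \<Longrightarrow> f (int j) = y0"
              show "l = l \<and> agree {''Y'', ''KA'', ''SL'', ''ow'', ''el''} M0 (setarr M4 ''Y'' f) \<and> ?el (setarr M4 ''Y'' f) \<and> ?ow (setarr M4 ''Y'' f)
                \<and> ?sl (setarr M4 ''Y'' f) \<and> ?ka (setarr M4 ''Y'' f) \<and> ?y (setarr M4 ''Y'' f)"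
                using 4 f by (auto intro: agree_step)
            qed (use scalarsD[OF l] yb in \<open>auto simp: bounds_simps\<close>)
          next
            case (second l5 M5)
            note 5 = second(2)
            have l5: "l5 = l" using 5 by simp
            show ?case
            proof (rule runs_Seq[where ?a1.0 = 40 and ?a2.0 = ?c and
                ?Q1.0 = "\<lambda>l' M. l' = l \<and> agree {''C'', ''Y'', ''KA'', ''SL'', ''ow'', ''el''} M0 M \<and> fixed l M \<and>
                  stK (\<lambda>i. F0 div SL i ^ 4 + 1) M \<and> stE (\<lambda>_. y0) (\<lambda>_. 1) M"], goal_cases first second)
              case first
              show ?case
                unfolding l5
              proof (rule run_elems[where val = "\<lambda>_. 1"])
                fix f :: "int \<Rightarrow> int" assume f: "\<And>j. j \<in> {1..n} \<Longrightarrow> f (int j) = 1"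
                have "fixed l (setarr M5 ''C'' f)" unfolding fixed_def using 5 scalarsD[OF l] by simp
                moreover have "stK (\<lambda>i. F0 div SL i ^ 4 + 1) (setarr M5 ''C'' f)" unfolding stK_def using 5 by simp
                moreover have "stE (\<lambda>_. y0) (\<lambda>_. 1) (setarr M5 ''C'' f)" unfolding stE_def using 5 f by simp
                moreover have "agree {''C'', ''Y'', ''KA'', ''SL'', ''ow'', ''el''} M0 (setarr M5 ''C'' f)"
                  using 5 by (intro agree_step) blast
                ultimately show "l = l \<and> agree {''C'', ''Y'', ''KA'', ''SL'', ''ow'', ''el''} M0 (setarr M5 ''C'' f) \<and> fixed l (setarr M5 ''C'' f) \<and>
                  stK (\<lambda>i. F0 div SL i ^ 4 + 1) (setarr M5 ''C'' f) \<and> stE (\<lambda>_. y0) (\<lambda>_. 1) (setarr M5 ''C'' f)" by blast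
              qed (use scalarsD[OF l] in \<open>auto simp: bounds_simps\<close>)
            next
              case (second l6 M6)
              note 6 = second(2)
              have z: "M6 (a, z) = 0" if "a \<in> {''OC'', ''H'', ''V'', ''W''}" for a z
              proof -
                have "a \<notin> {''C'', ''Y'', ''KA'', ''SL'', ''ow'', ''el''} \<and> a \<notin> {''start'', ''elem''}"
                  using that by (elim insertE emptyE; hypsubst; simp)
                then show ?thesis using 6 agreeD[of "{''C'', ''Y'', ''KA'', ''SL'', ''ow'', ''el''}" M6 a] M0_zero[of a] by metis
              qed
              show ?case by (rule run_core) (use 6 z in auto)
            qed simp
          qed simp
        qed simp
      qed simp
    qed simp
  qed simp
qed

end

section \<open>The sampling program\<close>

context sampling_input
begin

definition l0 :: locals where "l0 = input_locals 3 n m p \<epsilon>"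

lemma l0_simps: "l0 ''n'' = int n" "l0 ''m'' = int m" "l0 ''p'' = ph" "l0 ''eps'' = eh"
  by (simp_all add: l0_def input_locals_def ph_def eh_def)

lemma SS_le: "SS \<le> 2 ^ (3 * K)"
proof -
  have "X ^ 3 \<le> (2 ^ K) ^ 3" using X_le rX(3) by (intro power_mono) auto
  then show ?thesis by (simp add: SS_def power_mult[symmetric] mult.commute)
qed

lemma ph_le: "\<bar>ph\<bar> \<le> 2 ^ (3 * K)" "\<bar>eh\<bar> \<le> 2 ^ (3 * K)"
proof -
  have "real_of_int ph \<le> 1 * real_of_int SS" using ph_facts(1) p_le rX(4) by (intro order_trans[OF ph_facts(1)] mult_right_mono) auto
  then have "ph \<le> SS" by simp
  then show "\<bar>ph\<bar> \<le> 2 ^ (3 * K)" using SS_le eh_pos by simp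
  have "real_of_int eh \<le> 1 * real_of_int SS" using eh_facts(1) \<epsilon>_le rX(4) by (intro order_trans[OF eh_facts(1)] mult_right_mono) auto
  then have "eh \<le> SS" by simp
  then show "\<bar>eh\<bar> \<le> 2 ^ (3 * K)" using SS_le eh_pos by simp
qed

lemma nat_le_P: "x \<le> 2 ^ K \<Longrightarrow> \<bar>int x\<bar> \<le> int (2 ^ K) ^ Suc a"
proof -
  assume "x \<le> 2 ^ K"
  then have "int x \<le> int (2 ^ K)" by (simp only: of_nat_le_iff)
  then show ?thesis by (intro leP[of _ 1]) simp_all
qed

lemma M0_bound: "\<bar>M0 (a, z)\<bar> \<le> int (2 ^ K) ^ ax a"
proof -
  have ax: "ax a = Suc (ax a - 1)" by (simp add: ax_def)
  have "\<exists>x \<le> 2 ^ K. M0 (a, z) = int x"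
  proof -
    consider b where "a = ''start''" "z = int b" "b \<le> m" | r where "a = ''elem''" "z = int r" "r < N" | "M0 (a, z) = 0"
    proof -
      assume h: "\<And>b. a = ''start'' \<Longrightarrow> z = int b \<Longrightarrow> b \<le> m \<Longrightarrow> thesis"
        "\<And>r. a = ''elem'' \<Longrightarrow> z = int r \<Longrightarrow> r < N \<Longrightarrow> thesis" "M0 (a, z) = 0 \<Longrightarrow> thesis"
      show thesis
      proof (cases "a = ''start'' \<and> 0 \<le> z \<and> z \<le> int m")
        case True then show ?thesis using h(1)[of "nat z"] by auto
      next
        case F: False
        show ?thesis
        proof (cases "a = ''elem'' \<and> 0 \<le> z \<and> z < int N")
          case True then show ?thesis using h(2)[of "nat z"] by auto
        next
          case False
          have "M0 (a, z) = 0" unfolding M0_def input_memory_def using F False by (auto simp: len_xss N_def)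
          then show ?thesis by (rule h(3))
        qed
      qed
    qed
    then show ?thesis
    proof cases
      case 1
      then show ?thesis using M0_start offset_le[of b] K_props(1) by (intro exI[of _ "offset xss b"]) auto
    next
      case 2
      have "concat xss ! r \<in> set (concat xss)" using 2 by (intro nth_mem) (simp add: N_def)
      then obtain x where "x \<in> set xss" "concat xss ! r \<in> set x" by auto
      then obtain i where "i < m" "concat xss ! r \<in> set (xss ! i)" using len_xss by (metis in_set_conv_nth)
      then have "concat xss ! r \<le> n" using xss_facts(2) S_sub[of "Suc i"] by (auto simp: Suc_le_eq)
      then show ?thesis using 2 M0_elem[of r] K_props(1) by (intro exI[of _ "concat xss ! r"]) auto
    next
      case 3 then show ?thesis by (intro exI[of _ 0]) auto
    qed
  qed
  then show ?thesis using nat_le_P by (metis ax)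
qed

lemma TB_start: "TB l0 M0"
  unfolding TB_def
proof (intro conjI allI)
  fix x
  have vx: "\<bar>v\<bar> \<le> 2 ^ (3 * K) \<Longrightarrow> \<bar>v\<bar> \<le> int (2 ^ K) ^ vx x" for v
    by (erule leP) (simp add: vx_def)
  have nb: "\<bar>int n\<bar> \<le> 2 ^ (3 * K)" "\<bar>int m\<bar> \<le> 2 ^ (3 * K)"
  proof -
    have "(2 :: nat) ^ K \<le> 2 ^ (3 * K)" by (intro power_increasing) auto
    then have "n \<le> 2 ^ (3 * K)" "m \<le> 2 ^ (3 * K)" using K_props(1) m_le_N by linarith+
    then have "int n \<le> int (2 ^ (3 * K))" "int m \<le> int (2 ^ (3 * K))" by (simp_all only: of_nat_le_iff)
    then show "\<bar>int n\<bar> \<le> 2 ^ (3 * K)" "\<bar>int m\<bar> \<le> 2 ^ (3 * K)" by simp_all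
  qed
  have "l0 x = int n \<or> l0 x = int m \<or> l0 x = ph \<or> l0 x = eh \<or> l0 x = 0"
    unfolding l0_def input_locals_def ph_def eh_def by (simp add: fun_upd_def)
  moreover have "\<bar>0 :: int\<bar> \<le> 2 ^ (3 * K)" by simp
  ultimately show "\<bar>l0 x\<bar> \<le> int (2 ^ K) ^ vx x" using vx nb ph_le by metis
qed (rule M0_bound)

definition budget :: nat where
  "budget = 1200 + (K + 1) * 300 + (steps + 1) * (704 + (K + 1) * (904 + (K + 1) * 60))"

lemma run_main:
  "runs main_com l0 M0 budget
    (\<lambda>l' M'. \<exists>\<kappa> y c. good steps \<kappa> y c \<and> (\<forall>j\<in>{1..n}. M' (''T'', int j) = of_bool (y j = 16 * E)))"
  (is "runs _ _ _ _ ?Q")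
proof -
  let ?c = "700 + (K + 1) * 220 + (steps + 1) * (704 + (K + 1) * (904 + (K + 1) * 60))"
  let ?l5 = "l0(''N'' := int N, ''N2'' := int (2 * N), ''M2'' := int (2 * m), ''P'' := 1, ''K'' := 0)"
  let ?l6 = "?l5(''P'' := 2 ^ K, ''K'' := int K)"
  let ?l9 = "?l6(''S'' := SS, ''E'' := E, ''cm'' := 1)"
  let ?l10 = "?l9(''cm'' := cm)"
  let ?l13 = "?l10(''y0'' := y0, ''G'' := G, ''Tn'' := int steps)"
  have NK: "N \<le> 2 ^ K" "2 * N \<le> 2 ^ K" "2 * m \<le> 2 ^ K" using K_props(1) m_le_N by simp_all
  have b5: "\<bar>v\<bar> \<le> int (2 ^ K) ^ vx x" if "\<bar>v\<bar> \<le> 2 ^ (3 * K)" for v x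
    using that by (rule leP) (simp add: vx_def)
  have b5': "\<bar>int v\<bar> \<le> int (2 ^ K) ^ vx x" if "v \<le> 2 ^ K" for v x
    using nat_le_P[OF that, of "vx x - 1"] by (simp add: vx_def split: if_splits)
  have k3: "(2 :: int) ^ K \<le> 2 ^ (3 * K)" by (intro power_increasing) auto
  have S0: "M0 (''start'', int m) = int N"
    using M0_start[of m] len_xss by (simp add: offset_def N_def)
  have sc: "scalars ?l13" by (simp add: scalars_def l0_simps)
  have t13: "runs arrays_com ?l13 M0 ?c ?Q" by (rule run_arrays[OF sc])
  have yb: "\<bar>y0\<bar> \<le> 2 ^ (3 * K)"
  proof -
    have "16 * E \<le> 2 ^ K * 2 ^ K" using pow_K E_le E_ge by (intro mult_mono) auto
    also have "\<dots> = 2 ^ (2 * K)" by (simp add: mult_2 power_add)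
    also have "\<dots> \<le> 2 ^ (3 * K)" by (intro power_increasing) auto
    finally show ?thesis using y0_facts E_ge by simp
  qed
  have Tb: "\<bar>int steps\<bar> \<le> int (2 ^ K) ^ vx ''Tn''"
    by (rule leP[of _ 5]) (use steps_le in \<open>simp_all add: vx_def\<close>)
  let ?tail3 = "Assign ''y0'' (Const 16 \<otimes> Var ''E'' \<otimes> Var ''p'' \<otimes> (Var ''cm'' \<otimes> Var ''cm'') \<oslash> Var ''S'') ;;
     Assign ''G'' (Const 384 \<otimes> Var ''E'' \<otimes> Var ''E'') ;;
     Assign ''Tn'' (Const 50 \<otimes> Var ''G'' \<otimes> Var ''K'') ;; arrays_com"
  have t10: "runs ?tail3 ?l10 M0 (100 + ?c) ?Q"
  proof (rule runs_let[where v = y0 and b = 20 and a = "80 + ?c"], goal_cases)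
    case 5
    show ?case
    proof (rule runs_let[where v = G and b = 20 and a = "60 + ?c"], goal_cases)
      case 5
      show ?case
        by (rule runs_let[where v = "int steps" and b = 20 and a = ?c]) (use t13 Tb in \<open>auto simp: bounds_simps steps_eq\<close>)
      show "\<bar>G\<bar> \<le> int (2 ^ K) ^ vx ''G''" by (rule b5) (use G_le G_ge in simp)
    qed (auto simp: bounds_simps G_eq)
    show "\<bar>y0\<bar> \<le> int (2 ^ K) ^ vx ''y0''" by (rule b5[OF yb])
    show "aval (Const 16 \<otimes> Var ''E'' \<otimes> Var ''p'' \<otimes> (Var ''cm'' \<otimes> Var ''cm'') \<oslash> Var ''S'') ?l10 M0 = y0"
      by (simp add: l0_simps y0_def)
  qed (auto simp: bounds_simps)
  let ?w2 = "While (Op Less (Const 4 \<otimes> Var ''p'' \<otimes> (Var ''cm'' \<otimes> Var ''cm'')) (Var ''S''))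
       (Assign ''cm'' (Var ''cm'' \<oplus> Var ''cm''))"
  have w2: "runs ?w2 ?l9 M0 ((K + 1) * 30) (\<lambda>l' M'. l' = ?l10 \<and> M' = M0)"
  proof (rule runs_While[where T = ec and I = "\<lambda>e l' M'. l' = ?l9(''cm'' := 2 ^ e) \<and> M' = M0" and a = 10])
    fix e l' M' assume e: "e < ec" and I: "l' = ?l9(''cm'' := 2 ^ e) \<and> M' = M0"
    have "(2 :: int) ^ Suc e \<le> 2 ^ (3 * K)" using e ec_props(3) by (intro power_increasing) auto
    then have cb: "\<bar>2 ^ e + 2 ^ e\<bar> \<le> int (2 ^ K) ^ vx ''cm''" by (intro b5) simp
    have "runs (Assign ''cm'' (Var ''cm'' \<oplus> Var ''cm'')) l' M' 10 (\<lambda>l' M'. l' = ?l9(''cm'' := 2 ^ Suc e) \<and> M' = M0)"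
      by (rule runs_Assign) (use I cb in \<open>auto simp: bounds_simps\<close>)
    then show "aval (Op Less (Const 4 \<otimes> Var ''p'' \<otimes> (Var ''cm'' \<otimes> Var ''cm'')) (Var ''S'')) l' M' \<noteq> 0 \<and>
      runs (Assign ''cm'' (Var ''cm'' \<oplus> Var ''cm'')) l' M' 10 (\<lambda>l' M'. l' = ?l9(''cm'' := 2 ^ Suc e) \<and> M' = M0)"
      using I ec_props(2)[OF e] by (simp add: l0_simps)
  next
    fix l' M' assume "l' = ?l9(''cm'' := 2 ^ ec) \<and> M' = M0"
    then show "aval (Op Less (Const 4 \<otimes> Var ''p'' \<otimes> (Var ''cm'' \<otimes> Var ''cm'')) (Var ''S'')) l' M' = 0"
      using ec_props(1) by (simp add: l0_simps cm_def)
  next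
    have "(ec + 1) * 30 \<le> (K + 1) * 30" using ec_props(3) by simp
    then show "(ec + 1) * (1 + cost (Op Less (Const 4 \<otimes> Var ''p'' \<otimes> (Var ''cm'' \<otimes> Var ''cm'')) (Var ''S'')) + 10) \<le> (K + 1) * 30"
      by simp
  qed (auto simp: bounds_simps cm_def)
  let ?tail2 = "Assign ''S'' ((Var ''n'' \<oplus> Const 1) \<otimes> (Var ''n'' \<oplus> Const 1) \<otimes> (Var ''n'' \<oplus> Const 1)) ;;
     Assign ''E'' (Const 640 \<otimes> Var ''K'' \<otimes> Var ''S'' \<oslash> Var ''eps'' \<oplus> Const 1) ;;
     Assign ''cm'' (Const 1) ;; ?w2 ;; ?tail3"
  have t9: "runs (?w2 ;; ?tail3) ?l9 M0 (100 + (K + 1) * 30 + ?c) ?Q"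
    by (rule runs_Seq[OF w2, where ?a2.0 = "100 + ?c"]) (use t10 in auto)
  have t6: "runs ?tail2 ?l6 M0 (200 + (K + 1) * 30 + ?c) ?Q"
  proof (rule runs_let[where v = SS and b = 20 and a = "160 + (K + 1) * 30 + ?c"], goal_cases)
    case 5
    show ?case
    proof (rule runs_let[where v = E and b = 20 and a = "120 + (K + 1) * 30 + ?c"], goal_cases)
      case 5
      show ?case
        by (rule runs_let[where v = 1 and b = 10 and a = "100 + (K + 1) * 30 + ?c"]) (use t9 b5[of 1 "''cm''"] in auto)
      have "E \<le> 2 ^ (3 * K)" using E_le k3 by (rule order_trans)
      then show "\<bar>E\<bar> \<le> int (2 ^ K) ^ vx ''E''" using E_ge by (intro b5) simp
    qed (auto simp: bounds_simps l0_simps E_def)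
    show "\<bar>SS\<bar> \<le> int (2 ^ K) ^ vx ''S''" by (rule b5) (use SS_le rX(4) in simp)
    show "aval ((Var ''n'' \<oplus> Const 1) \<otimes> (Var ''n'' \<oplus> Const 1) \<otimes> (Var ''n'' \<oplus> Const 1)) ?l6 M0 = SS"
      by (simp add: l0_simps SS_def X_def power3_eq_cube)
  qed (auto simp: bounds_simps)
  let ?w1 = "While (Op Less (Var ''P'') (Var ''N2'' \<oplus> Var ''n'' \<oplus> Const 1))
       (Assign ''P'' (Var ''P'' \<oplus> Var ''P'') ;; Assign ''K'' (Var ''K'' \<oplus> Const 1))"
  have w1: "runs ?w1 ?l5 M0 ((K + 1) * 30) (\<lambda>l' M'. l' = ?l6 \<and> M' = M0)"
  proof (rule runs_While[where T = K and I = "\<lambda>k l' M'. l' = ?l5(''P'' := 2 ^ k, ''K'' := int k) \<and> M' = M0" and a = 20])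
    fix k l' M' assume k: "k < K" and I: "l' = ?l5(''P'' := 2 ^ k, ''K'' := int k) \<and> M' = M0"
    have "(2 :: int) ^ Suc k \<le> 2 ^ (3 * K)" using k by (intro power_increasing) auto
    then have Pb: "\<bar>2 ^ k + 2 ^ k\<bar> \<le> int (2 ^ K) ^ vx ''P''" by (intro b5) simp
    have Kb: "\<bar>int (Suc k)\<bar> \<le> int (2 ^ K) ^ vx ''K''"
      by (rule b5') (use k less_exp[of K] in linarith)
    have "int (2 ^ k) < int (2 * N + n + 1)" unfolding of_nat_less_iff by (rule K_props(3)[OF k])
    then have c: "(2 :: int) ^ k < 2 * int N + int n + 1" by simp
    have "runs (Assign ''P'' (Var ''P'' \<oplus> Var ''P'') ;; Assign ''K'' (Var ''K'' \<oplus> Const 1)) l' M' 20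
      (\<lambda>l' M'. l' = ?l5(''P'' := 2 ^ Suc k, ''K'' := int (Suc k)) \<and> M' = M0)"
    proof (rule runs_let[where v = "2 ^ Suc k" and b = 10 and a = 10], goal_cases)
      case 5
      show ?case
        by (rule runs_Assign) (use I Kb in \<open>auto simp: bounds_simps fun_upd_def fun_eq_iff add.commute\<close>)
    qed (use I Pb in \<open>auto simp: bounds_simps\<close>)
    then show "aval (Op Less (Var ''P'') (Var ''N2'' \<oplus> Var ''n'' \<oplus> Const 1)) l' M' \<noteq> 0 \<and>
      runs (Assign ''P'' (Var ''P'' \<oplus> Var ''P'') ;; Assign ''K'' (Var ''K'' \<oplus> Const 1)) l' M' 20
      (\<lambda>l' M'. l' = ?l5(''P'' := 2 ^ Suc k, ''K'' := int (Suc k)) \<and> M' = M0)"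
      using I c by (simp add: l0_simps)
  next
    fix l' M' assume I: "l' = ?l5(''P'' := 2 ^ K, ''K'' := int K) \<and> M' = M0"
    have "int (2 * N + n + 1) \<le> int (2 ^ K)" unfolding of_nat_le_iff by (rule K_props(1))
    then have "2 * int N + int n + 1 \<le> 2 ^ K" by simp
    then show "aval (Op Less (Var ''P'') (Var ''N2'' \<oplus> Var ''n'' \<oplus> Const 1)) l' M' = 0"
      using I by (simp add: l0_simps)
  qed (auto simp: bounds_simps)
  have t5: "runs (?w1 ;; ?tail2) ?l5 M0 (200 + (K + 1) * 60 + ?c) ?Q"
    by (rule runs_Seq[OF w1, where ?a2.0 = "200 + (K + 1) * 30 + ?c"]) (use t6 in auto)
  have "runs main_com l0 M0 (300 + (K + 1) * 60 + ?c) ?Q"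
    unfolding main_com_def
  proof (rule runs_let[where v = "int N" and b = 10 and a = "280 + (K + 1) * 60 + ?c"], goal_cases)
    case 5
    show ?case
    proof (rule runs_let[where v = "int (2 * N)" and b = 10 and a = "260 + (K + 1) * 60 + ?c"], goal_cases)
      case 5
      show ?case
      proof (rule runs_let[where v = "int (2 * m)" and b = 10 and a = "240 + (K + 1) * 60 + ?c"], goal_cases)
        case 5
        show ?case
        proof (rule runs_let[where v = 1 and b = 10 and a = "220 + (K + 1) * 60 + ?c"], goal_cases)
          case 5
          show ?case
            by (rule runs_let[where v = 0 and b = 10 and a = "200 + (K + 1) * 60 + ?c"]) (use t5 in auto)
        qed (use b5[of 1 "''P''"] in auto)
        show "\<bar>int (2 * m)\<bar> \<le> int (2 ^ K) ^ vx ''M2''" by (rule b5'[OF NK(3)])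
      qed (auto simp: bounds_simps l0_simps)
      show "\<bar>int (2 * N)\<bar> \<le> int (2 ^ K) ^ vx ''N2''" by (rule b5'[OF NK(2)])
    qed (auto simp: bounds_simps l0_simps)
    show "\<bar>int N\<bar> \<le> int (2 ^ K) ^ vx ''N''" by (rule b5'[OF NK(1)])
  qed (use S0 in \<open>auto simp: bounds_simps l0_simps\<close>)
  then show ?thesis by (rule runs_mono) (simp_all add: budget_def)
qed

text \<open>The walk preserves \<open>\<bar>S\<^sub>i\<bar> * y0\<close> up to \<epsilon>/4 in units
  of \<open>U\<close>, and \<open>y0\<close> is \<open>p * U\<close> up to the factor 1 -
  \<epsilon>/8 from below. Both losses together remain below \<epsilon>.\<close>

lemma sample_bounds:
  assumes g: "good steps \<kappa> y c" and M: "\<forall>j\<in>{1..n}. M' (''T'', int j) = of_bool (y j = 16 * E)" and i: "i \<in> {1..m}"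
  shows "(1 - \<epsilon>) * p * real (card (S i)) \<le> real (card (S i \<inter> output_set n M'))"
    "real (card (S i \<inter> output_set n M')) \<le> (1 + \<epsilon>) * p * real (card (S i))"
proof -
  have i': "i - 1 < 2 * m" using i by auto
  have "i - 1 < m" using i by auto
  then have "Suc ((i - 1) mod m) = i" using i by simp
  then have D: "D (i - 1) = S i" using D_eq[OF i'] by simp
  have "S i \<inter> output_set n M' = {j \<in> D (i - 1). y j = 16 * E}"
    unfolding output_set_def D using S_sub[OF i] M by auto
  then have out: "card (S i \<inter> output_set n M') = card {j \<in> D (i - 1). y j = 16 * E}" by simp
  define s where "s = real (card (S i))"
  define t where "t = real (card (S i \<inter> output_set n M'))"
  define u where "u = real_of_int Uu"
  have UU: "U = Uu" by (simp add: U_def Uu_def)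
  have u0: "0 < u" using Uu_pos by (simp add: u_def)
  have s0: "0 \<le> s" by (simp add: s_def)
  have fin: "(1 - \<epsilon> / 4) * (s * y0) \<le> u * t" "u * t \<le> (1 + \<epsilon> / 4) * (s * y0)"
    using good_final[OF g i' \<epsilon>_pos \<epsilon>_le] SL_facts(1,2)[OF i'] unfolding UU out s_def t_def u_def D by simp_all
  have y: "real_of_int y0 \<le> p * u" "(1 - \<epsilon> / 8) * (p * u) \<le> y0" using y0_Uu by (simp_all add: u_def)
  have "u * t \<le> (1 + \<epsilon> / 4) * (s * (p * u))"
    by (rule order_trans[OF fin(2)]) (use y(1) s0 \<epsilon>_pos in \<open>intro mult_left_mono, auto\<close>)
  then have "u * t \<le> u * ((1 + \<epsilon> / 4) * p * s)" by (simp add: mult_ac)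
  then have "t \<le> (1 + \<epsilon> / 4) * p * s" using u0 by simp
  also have "\<dots> \<le> (1 + \<epsilon>) * p * s" using \<epsilon>_pos p_ge s0 by (intro mult_right_mono) auto
  finally show "real (card (S i \<inter> output_set n M')) \<le> (1 + \<epsilon>) * p * real (card (S i))" by (simp add: s_def t_def)
  have "(1 - \<epsilon> / 4) * (s * ((1 - \<epsilon> / 8) * (p * u))) \<le> (1 - \<epsilon> / 4) * (s * y0)"
    using y(2) s0 \<epsilon>_le by (intro mult_left_mono) auto
  also have "\<dots> \<le> u * t" by (rule fin(1))
  finally have "u * ((1 - \<epsilon> / 4) * (1 - \<epsilon> / 8) * p * s) \<le> u * t" by (simp add: mult_ac)
  then have "(1 - \<epsilon> / 4) * (1 - \<epsilon> / 8) * p * s \<le> t" using u0 by simp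
  moreover have "(1 - \<epsilon>) * p * s \<le> (1 - \<epsilon> / 4) * (1 - \<epsilon> / 8) * p * s"
  proof (intro mult_right_mono)
    have "0 \<le> \<epsilon> * \<epsilon>" using \<epsilon>_pos by simp
    then show "1 - \<epsilon> \<le> (1 - \<epsilon> / 4) * (1 - \<epsilon> / 8)" using \<epsilon>_pos by (simp add: field_simps)
  qed (use p_ge s0 in auto)
  ultimately show "(1 - \<epsilon>) * p * real (card (S i)) \<le> real (card (S i \<inter> output_set n M'))" by (simp add: s_def t_def)
qed

lemma sampling_exec:
  "\<exists>l' M' R W work depth. exec word sampling_com (input_locals 3 n m p \<epsilon>) (input_memory xss) l' M' R W work depth \<and>
     (\<forall>i\<in>{1..m}. (1 - \<epsilon>) * p * real (card (S i)) \<le> real (card (S i \<inter> output_set n M')) \<and>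
        real (card (S i \<inter> output_set n M')) \<le> (1 + \<epsilon>) * p * real (card (S i))) \<and>
     depth \<le> budget + 2 \<and> work \<le> (budget + 2) * 2 ^ K"
proof -
  have "runs sampling_com l0 M0 (budget + 2)
    (\<lambda>l' M'. \<exists>\<kappa> y c. good steps \<kappa> y c \<and> (\<forall>j\<in>{1..n}. M' (''T'', int j) = of_bool (y j = 16 * E)))"
    unfolding sampling_com_def
    by (rule runs_If[OF _ run_main]) (use m_ge in \<open>auto simp: l0_simps bounds_simps\<close>)
  then obtain l' M' R W work depth \<kappa> y c where e: "exec word sampling_com l0 M0 l' M' R W work depth"
    "work \<le> (budget + 2) * 2 ^ K" "depth \<le> budget + 2"
    "good steps \<kappa> y c" "\<forall>j\<in>{1..n}. M' (''T'', int j) = of_bool (y j = 16 * E)"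
    using TB_start unfolding runs_def by blast
  show ?thesis using e(1-3) sample_bounds[OF e(4,5)] unfolding l0_def M0_def by blast
qed

text \<open>With \<open>Z\<close> bounding \<open>K\<close> and \<open>W\<close> bounding
  1/\<epsilon>, \<open>E\<close> is of order \<open>Z * W\<close>, the number of rounds of order
  \<open>E\<^sup>2 * K\<close>, and a round costs of order \<open>K\<^sup>2\<close>. This gives
  \<open>Z ^ 5 * W\<^sup>2\<close> and hence the exponent \<open>2 * b + 5\<close> of the
  logarithm.\<close>

lemma budget_le:
  assumes e: "1 / \<epsilon> \<le> (2 * Log n) ^ b"
  shows "real (budget + 2) \<le> 10 ^ 14 * (2 * (real a0 + 2)) ^ 5 * 4 ^ b * Log n ^ (2 * b + 5)"
proof -
  define Z where "Z = 2 * (real a0 + 2) * Log n"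
  define W where "W = (2 * Log n) ^ b"
  have K1: "12 \<le> real K" and KZ: "real K \<le> Z" using sampling_input.K_ge[OF sampling_input_axioms] K_le by (simp_all add: Z_def)
  have Z1: "1 \<le> Z" using K1 KZ by linarith
  have W1: "1 \<le> W" unfolding W_def using Log_ge by (intro one_le_power) auto
  have ZW: "1 * 1 \<le> Z * W" using Z1 W1 by (intro mult_mono) auto
  have "720 * real K / \<epsilon> = 720 * (real K * (1 / \<epsilon>))" by simp
  also have "\<dots> \<le> 720 * (Z * W)" using KZ e \<epsilon>_pos Z1 by (intro mult_left_mono mult_mono) (auto simp: W_def)
  finally have E: "real_of_int E \<le> 721 * (Z * W)" using E_facts(2) ZW by linarith
  have E0: "0 \<le> real_of_int E" using E_facts(3) by simp
  have "real steps = real_of_int (int steps)" by simp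
  also have "\<dots> = 19200 * (real_of_int E * real_of_int E * real K)"
    unfolding steps_eq G_eq by simp
  also have "\<dots> \<le> 19200 * (721 * (Z * W) * (721 * (Z * W)) * Z)"
    using E E0 KZ Z1 W1 by (intro mult_left_mono mult_mono) auto
  also have "\<dots> = 9980947200 * (Z ^ 3 * W\<^sup>2)" by (simp add: power2_eq_square power3_eq_cube)
  finally have st: "real steps \<le> 9980947200 * (Z ^ 3 * W\<^sup>2)" .
  have o: "1 * 1 \<le> Z ^ 3 * W\<^sup>2" using Z1 W1 by (intro mult_mono one_le_power) auto
  have s1: "real steps + 1 \<le> 10 ^ 10 * (Z ^ 3 * W\<^sup>2)" using st o by simp
  have k1: "real K + 1 \<le> 2 * Z" using K1 KZ by linarith
  have "Z * 1 \<le> Z * Z" using Z1 by (intro mult_left_mono) auto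
  then have ZZ: "Z \<le> Z\<^sup>2" "1 \<le> Z\<^sup>2" by (simp add: power2_eq_square) (rule one_le_power[OF Z1])
  have "(real K + 1) * (904 + (real K + 1) * 60) \<le> 2 * Z * (904 + 2 * Z * 60)"
    using k1 by (intro mult_mono add_mono) auto
  also have "\<dots> = 1808 * Z + 240 * Z\<^sup>2" by (simp add: power2_eq_square algebra_simps)
  finally have i1: "704 + (real K + 1) * (904 + (real K + 1) * 60) \<le> 2752 * Z\<^sup>2" using ZZ by linarith
  have "(real steps + 1) * (704 + (real K + 1) * (904 + (real K + 1) * 60)) \<le> 10 ^ 10 * (Z ^ 3 * W\<^sup>2) * (2752 * Z\<^sup>2)"
    using s1 i1 by (intro mult_mono) auto
  also have "\<dots> = 10 ^ 10 * 2752 * (Z ^ 5 * W\<^sup>2)"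
    using power_add[of Z 3 2] by simp
  finally have p1: "(real steps + 1) * (704 + (real K + 1) * (904 + (real K + 1) * 60)) \<le> 10 ^ 10 * 2752 * (Z ^ 5 * W\<^sup>2)" .
  have "Z * 1 \<le> Z ^ 5 * W\<^sup>2"
    using Z1 W1 power_increasing[of 1 5 Z] by (intro mult_mono one_le_power) auto
  then have z5: "Z \<le> Z ^ 5 * W\<^sup>2" by simp
  have "real (budget + 2) = 1202 + (real K + 1) * 300 + (real steps + 1) * (704 + (real K + 1) * (904 + (real K + 1) * 60))"
    by (simp add: budget_def algebra_simps)
  also have "\<dots> \<le> 10 ^ 14 * (Z ^ 5 * W\<^sup>2)" using p1 k1 z5 Z1 by simp
  also have "Z ^ 5 = (2 * (real a0 + 2)) ^ 5 * Log n ^ 5" by (simp only: Z_def power_mult_distrib)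
  also have "W\<^sup>2 = 4 ^ b * Log n ^ (2 * b)"
  proof -
    have "W\<^sup>2 = (2 * Log n) ^ (2 * b)" unfolding W_def by (simp only: power_mult[symmetric] mult.commute[of b])
    also have "\<dots> = 2 ^ (2 * b) * Log n ^ (2 * b)" by (rule power_mult_distrib)
    also have "(2 :: real) ^ (2 * b) = 4 ^ b" by (simp add: power_mult)
    finally show ?thesis .
  qed
  finally show ?thesis by (simp add: power_add mult_ac)
qed

end

theorem theorem1:
  fixes mpoly :: "real poly"
  shows "\<exists>C > (0 :: real). \<forall>epoly :: real poly.
    \<exists>(prog :: com) (prec :: nat) (word :: nat) (K :: real) (k :: nat).
    \<forall>(n :: nat) (m :: nat) (S :: nat \<Rightarrow> nat set) (xss :: nat list list)
      (p :: real) (\<epsilon> :: real).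
      n \<ge> 1 \<and>
      (\<forall>i\<in>{1..m}. S i \<subseteq> {1..n}) \<and>
      real m \<le> poly mpoly (real n) \<and>
      0 \<le> p \<and> p \<le> 1 \<and>
      0 < poly epoly (Log n) \<and> 1 / poly epoly (Log n) \<le> \<epsilon> \<and> \<epsilon> \<le> 1 \<and>
      (\<forall>i\<in>{1..m}. p * \<epsilon>\<^sup>2 * real (card (S i)) \<ge> C * Log n) \<and>
      lists_family xss m S
      \<longrightarrow> (\<exists>l' M' R W work depth.
            exec ((int n + 1) ^ word) prog (input_locals prec n m p \<epsilon>) (input_memory xss)
              l' M' R W work depth \<and>
            (\<forall>i\<in>{1..m}.
              (1 - \<epsilon>) * p * real (card (S i)) \<le> real (card (S i \<inter> output_set n M')) \<and>
              real (card (S i \<inter> output_set n M')) \<le> (1 + \<epsilon>) * p * real (card (S i))) \<and>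
            real depth \<le> K * Log n ^ k \<and>
            real work \<le> K * (real (\<Sum>i=1..m. card (S i)) + real n) * Log n ^ k)"
proof -
  obtain a0 where a0: "\<And>x. 1 \<le> x \<Longrightarrow> \<bar>poly mpoly x\<bar> \<le> (x + 1) ^ a0" using poly_le_power[of mpoly] by blast
  show ?thesis
  proof (intro exI[of _ "3200 * (real a0 + 2)"] conjI allI)
    fix epoly :: "real poly"
    obtain b where b: "\<And>x. 1 \<le> x \<Longrightarrow> \<bar>poly epoly x\<bar> \<le> (x + 1) ^ b" using poly_le_power[of epoly] by blast
    define c where "c = 10 ^ 14 * (2 * (real a0 + 2)) ^ 5 * 4 ^ b"
    have c3: "3 \<le> c"
    proof -
      have "3 * 1 * 1 \<le> c" unfolding c_def by (intro mult_mono one_le_power) auto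
      then show ?thesis by simp
    qed
    show "\<exists>(prog :: com) (prec :: nat) (word :: nat) (K :: real) (k :: nat).
      \<forall>(n :: nat) (m :: nat) (S :: nat \<Rightarrow> nat set) (xss :: nat list list) (p :: real) (\<epsilon> :: real).
      n \<ge> 1 \<and>
      (\<forall>i\<in>{1..m}. S i \<subseteq> {1..n}) \<and>
      real m \<le> poly mpoly (real n) \<and>
      0 \<le> p \<and> p \<le> 1 \<and>
      0 < poly epoly (Log n) \<and> 1 / poly epoly (Log n) \<le> \<epsilon> \<and> \<epsilon> \<le> 1 \<and>
      (\<forall>i\<in>{1..m}. p * \<epsilon>\<^sup>2 * real (card (S i)) \<ge> 3200 * (real a0 + 2) * Log n) \<and>
      lists_family xss m S
      \<longrightarrow> (\<exists>l' M' R W work depth.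
            exec ((int n + 1) ^ word) prog (input_locals prec n m p \<epsilon>) (input_memory xss)
              l' M' R W work depth \<and>
            (\<forall>i\<in>{1..m}.
              (1 - \<epsilon>) * p * real (card (S i)) \<le> real (card (S i \<inter> output_set n M')) \<and>
              real (card (S i \<inter> output_set n M')) \<le> (1 + \<epsilon>) * p * real (card (S i))) \<and>
            real depth \<le> K * Log n ^ k \<and>
            real work \<le> K * (real (\<Sum>i=1..m. card (S i)) + real n) * Log n ^ k)"
    \<comment> \<open>Program and precision are the same for all polynomials. The word size depends
      on \<open>mpoly\<close> only; \<open>epoly\<close> enters the constant and the exponent of the
      resource bounds.\<close>
    proof (rule exI[of _ sampling_com], rule exI[of _ 3], rule exI[of _ "140 * (a0 + 2)"], rule exI[of _ "4 * c"],
        rule exI[of _ "2 * b + 5"], intro allI impI, elim conjE)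
      fix n m :: nat and S :: "nat \<Rightarrow> nat set" and xss :: "nat list list" and p \<epsilon> :: real
      assume n: "1 \<le> n" and S: "\<forall>i\<in>{1..m}. S i \<subseteq> {1..n}" and m: "real m \<le> poly mpoly (real n)"
        and p: "0 \<le> p" "p \<le> 1" and e: "0 < poly epoly (Log n)" "1 / poly epoly (Log n) \<le> \<epsilon>" "\<epsilon> \<le> 1"
        and C: "\<forall>i\<in>{1..m}. p * \<epsilon>\<^sup>2 * real (card (S i)) \<ge> 3200 * (real a0 + 2) * Log n"
        and L: "lists_family xss m S"
      let ?goal = "\<exists>l' M' R W work depth.
            exec ((int n + 1) ^ (140 * (a0 + 2))) sampling_com (input_locals 3 n m p \<epsilon>) (input_memory xss)
              l' M' R W work depth \<and>
            (\<forall>i\<in>{1..m}.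
              (1 - \<epsilon>) * p * real (card (S i)) \<le> real (card (S i \<inter> output_set n M')) \<and>
              real (card (S i \<inter> output_set n M')) \<le> (1 + \<epsilon>) * p * real (card (S i))) \<and>
            real depth \<le> 4 * c * Log n ^ (2 * b + 5) \<and>
            real work \<le> 4 * c * (real (\<Sum>i=1..m. card (S i)) + real n) * Log n ^ (2 * b + 5)"
      have lg: "1 \<le> Log n" by (simp add: Log_def)
      have lk: "1 \<le> Log n ^ (2 * b + 5)" using lg by (rule one_le_power)
      show ?goal
      proof (cases "m = 0")
        \<comment> \<open>Only the test of \<open>m\<close> and \<open>Skip\<close> are executed, at
          cost 3, and there is no set to check.\<close>
        case True
        let ?l = "input_locals 3 n m p \<epsilon>" and ?M = "input_memory xss"
        have lm: "?l ''m'' = 0" using True by (simp add: input_locals_def)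
        have "exec ((int n + 1) ^ (140 * (a0 + 2))) sampling_com ?l ?M ?l ?M (reads (Var ''m'') ?l ?M \<union> {}) {}
           (1 + cost (Var ''m'') + 1) (1 + cost (Var ''m'') + 1)"
          unfolding sampling_com_def by (rule exec.If) (simp_all only: lm aval.simps fits.simps simp_thms if_False exec.Skip, simp)
        moreover have "reads (Var ''m'') ?l ?M \<union> {} = {}" "1 + cost (Var ''m'') + 1 = 3" by simp_all
        ultimately have x: "exec ((int n + 1) ^ (140 * (a0 + 2))) sampling_com ?l ?M ?l ?M {} {} 3 3" by (simp only:)
        have "3 * 1 * 1 \<le> 4 * c * (real (\<Sum>i=1..m. card (S i)) + real n) * Log n ^ (2 * b + 5)"
          using c3 n lk True by (intro mult_mono) auto
        moreover have "3 * 1 \<le> 4 * c * Log n ^ (2 * b + 5)" using c3 lk by (intro mult_mono) auto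
        ultimately show ?thesis using x True
          by (intro exI[of _ ?l] exI[of _ ?M] exI[of _ "{}"] exI[of _ "3 :: nat"] conjI) simp_all
      next
        case False
        have pos: "0 < \<epsilon>" using e(1,2) by (meson less_le_trans zero_less_divide_1_iff)
        interpret sampling_input n m a0 S xss p \<epsilon>
        proof
          have "real m \<le> \<bar>poly mpoly (real n)\<bar>" using m by simp
          also have "\<dots> \<le> (real n + 1) ^ a0" by (rule a0) (use n in simp)
          finally show "real m \<le> (real n + 1) ^ a0" .
        qed (use False n S p pos e(3) C L in auto)
        have "1 \<le> \<epsilon> * poly epoly (Log n)" using e(1,2) by (simp add: pos_divide_le_eq)
        then have "1 / \<epsilon> \<le> poly epoly (Log n)" using \<epsilon>_pos by (simp add: pos_divide_le_eq mult.commute)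
        also have "\<dots> \<le> \<bar>poly epoly (Log n)\<bar>" by simp
        also have "\<dots> \<le> (Log n + 1) ^ b" by (rule b[OF lg])
        also have "\<dots> \<le> (2 * Log n) ^ b" using lg by (intro power_mono) auto
        finally have bl: "real (budget + 2) \<le> c * Log n ^ (2 * b + 5)" using budget_le[of b] by (simp add: c_def)
        obtain l' M' R W work depth where x: "exec word sampling_com (input_locals 3 n m p \<epsilon>) (input_memory xss) l' M' R W work depth"
          "\<forall>i\<in>{1..m}. (1 - \<epsilon>) * p * real (card (S i)) \<le> real (card (S i \<inter> output_set n M')) \<and>
            real (card (S i \<inter> output_set n M')) \<le> (1 + \<epsilon>) * p * real (card (S i))"
          "depth \<le> budget + 2" "work \<le> (budget + 2) * 2 ^ K" using sampling_exec by blast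
        have cL: "0 \<le> c * Log n ^ (2 * b + 5)" using c3 lk by simp
        have "real depth \<le> real (budget + 2)" using x(3) by (simp only: of_nat_le_iff)
        then have d: "real depth \<le> 4 * c * Log n ^ (2 * b + 5)" using bl cL by linarith
        \<comment> \<open>Work is the budget times \<open>2 ^ K\<close>; this linear bound is the
          source of the factor 4 in the final constant.\<close>
        have "2 ^ K \<le> 4 * (N + n)" using K_props(2) by simp
        then have "real (2 ^ K) \<le> real (4 * (N + n))" by (simp only: of_nat_le_iff)
        then have PN: "real (2 ^ K) \<le> 4 * (real N + real n)" by simp
        have "real work \<le> real ((budget + 2) * 2 ^ K)" using x(4) by (simp only: of_nat_le_iff)
        also have "\<dots> = real (budget + 2) * real (2 ^ K)" by (simp only: of_nat_mult)
        also have "\<dots> \<le> (c * Log n ^ (2 * b + 5)) * (4 * (real N + real n))"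
          using bl PN cL by (intro mult_mono) auto
        also have "\<dots> = 4 * c * (real (\<Sum>i=1..m. card (S i)) + real n) * Log n ^ (2 * b + 5)"
          by (simp add: N_eq)
        finally have w: "real work \<le> 4 * c * (real (\<Sum>i=1..m. card (S i)) + real n) * Log n ^ (2 * b + 5)" .
        show ?thesis using x(1,2) d w unfolding word_def by blast
      qed
    qed
  qed simp
qed

end
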